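(* Fix $\delta\in(0,1)$. Suppose $n_1\ge N_{\mathrm{unif}}(\Phi,p,\frac\delta{3T})$ and $n_2\ge N_{\mathrm{point}}(\Phi,p,\frac\delta3)$, and assume (A3) and (A4). Then with probability at least $1-\delta$ over the samples, $$\mathbb{E}_{{\bm w}^*_{T+1}\sim\nu}\big[\mathrm{ER}(\hat\phi,\hat{\bm w}_{T+1})\big]\lesssim\sigma^2\left(\frac{\mathcal G(\mathcal F_{\mathcal X}(\Phi))^2+\log\frac1\delta}{n_1T}+\frac{k+\log\frac1\delta}{n_2}\right).$$
   Context: Setting. $\Phi$ is a class of functions $\mathbb{R}^d\to\mathbb{R}^k$ containing a ground truth $\phi^*$, and $p$ is a distribution on $\mathbb{R}^d$ shared by all $T+1$ tasks. Vectors ${\bm w}_t^*\in\mathbb{R}^k$ have norms between two fixed positive absolute constants. A sample of task $t$ is $({\bm x},y)$ with ${\bm x}\sim p$, $y=\langle{\bm w}_t^*,\phi^*({\bm x})\rangle+z$, and $z\sim\mathcal N(0,\sigma^2)$ independent. Source tasks $t\in[T]$ have $n_1$ i.i.d. samples $X_t\in\mathbb{R}^{n_1\times d}$, ${\bm y}_t$. The target has $n_2$ samples $X_{T+1},{\bm y}_{T+1}$. All samples are independent. $\phi(X)$ denotes the matrix whose rows are $\phi$ applied to the rows of $X$, and $W^*=[{\bm w}^*_1,\dots,{\bm w}^*_T]$. Estimators: $$(\hat\phi,\hat{\bm w}_1,\dots,\hat{\bm w}_T)\in\arg\min_{\phi\in\Phi,{\bm w}_t\in\mathbb{R}^k}\frac1{2n_1T}\sum_t\|{\bm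 y}_t-\phi(X_t){\bm w}_t\|^2,$$ $$\hat{\bm w}_{T+1}\in\arg\min_{{\bm w}}\frac1{2n_2}\|{\bm y}_{T+1}-\hat\phi(X_{T+1}){\bm w}\|^2.$$ Excess risk: $\mathrm{ER}(\hat\phi,\hat{\bm w}_{T+1})=\frac12\mathbb{E}_{{\bm x}\sim p}[(\langle\hat{\bm w}_{T+1},\hat\phi({\bm x})\rangle-\langle{\bm w}^*_{T+1},\phi^*({\bm x})\rangle)^2]$. Gaussian width and data-dependent set. - $\mathcal G(\mathcal K)=\mathbb{E}_{{\bm z}\sim\mathcal N(0,I)}\sup_{{\bm v}\in\mathcal K}\langle{\bm v},{\bm z}\rangle$. - $\mathcal F_{\mathcal X}(\Phi)=\{A=[{\bm a}_1,\dots,{\bm a}_T]\in\mathbb{R}^{n_1\times T}:\|A\|_F=1,\exists\phi,\phi'\in\Phi,\ {\bm a}_t\in\mathrm{colspan}([\phi(X_t),\phi'(X_t)])\ \forall t\in[T]\}$. Covariances. $\Sigma_q(\phi,\phi')=\mathbb{E}_{{\bm x}\sim q}[\phi({\bm x})\phi'({\bm x})^\top]$ and $\Lambda_q(\phi,\phi')=\begin{bmatrix}\Sigma_q(\phi,\phi)&\Sigma_q(\phi,\phi')\\\Sigma_q(\phi',\phi)&\Sigma_q(\phi',\phi')\end{bmatrix}$. Concentration assumptions. - $N_{\mathrm{point}}(\Phi,p,\delta)$: for $n\ge N_{\mathrm{point}}$ and any fixed $\phi,\phi'\in\Phi$, the empirical distribution $\hat p$ of $n$ i.i.d. samples of $p$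 satisfies $0.9\Lambda_p(\phi,\phi')\preceq\Lambda_{\hat p}(\phi,\phi')\preceq1.1\Lambda_p(\phi,\phi')$ with probability $\ge1-\delta$. - $N_{\mathrm{unif}}(\Phi,p,\delta)$: for $n\ge N_{\mathrm{unif}}$, with probability $\ge1-\delta$ this sandwich holds simultaneously for all $\phi,\phi'\in\Phi$. Assumptions on the task vectors. - (A3) $\sigma_k^2(W^* )\ge c_0T/k$ for an absolute constant $c_0>0$. - (A4) ${\bm w}^*_{T+1}\sim\nu$ with $\|\mathbb{E}_{{\bm w}\sim\nu}[{\bm w}{\bm w}^\top]\|_2\le C_0/k$ for an absolute constant $C_0$. $\lesssim$ hides a constant depending only on these absolute constants. *)

theory Defs
  imports "HOL-Probability.Probability"
begin

text \<open>Vectors of R^m are represented as functions nat => real, of which only the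
  coordinates below the relevant dimension matter.  Feature maps R^d -> R^k are
  functions vec => vec.\<close>

type_synonym vec = "nat \<Rightarrow> real"
type_synonym feat = "vec \<Rightarrow> vec"

definition ip :: "nat \<Rightarrow> vec \<Rightarrow> vec \<Rightarrow> real" where
  "ip k u v = (\<Sum>j<k. u j * v j)"

definition vnorm :: "nat \<Rightarrow> vec \<Rightarrow> real" where
  "vnorm k u = sqrt (\<Sum>j<k. (u j)\<^sup>2)"

definition cov_pop :: "vec measure \<Rightarrow> feat \<Rightarrow> feat \<Rightarrow> nat \<Rightarrow> nat \<Rightarrow> real" where
  "cov_pop q \<phi> \<psi> i j = (\<integral>x. \<phi> x i * \<psi> x j \<partial>q)"

definition cov_emp :: "(nat \<Rightarrow> vec) \<Rightarrow> nat \<Rightarrow> feat \<Rightarrow> feat \<Rightarrow> nat \<Rightarrow> nat \<Rightarrow> real" where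
  "cov_emp xs n \<phi> \<psi> i j = (\<Sum>l<n. \<phi> (xs l) i * \<psi> (xs l) j) / real n"

definition blockLambda :: "nat \<Rightarrow> (feat \<Rightarrow> feat \<Rightarrow> nat \<Rightarrow> nat \<Rightarrow> real) \<Rightarrow> feat \<Rightarrow> feat \<Rightarrow> nat \<Rightarrow> nat \<Rightarrow> real" where
  "blockLambda k S \<phi> \<psi> i j =
     S (if i < k then \<phi> else \<psi>) (if j < k then \<phi> else \<psi>)
       (if i < k then i else i - k) (if j < k then j else j - k)"

definition loewner_le :: "nat \<Rightarrow> (nat \<Rightarrow> nat \<Rightarrow> real) \<Rightarrow> (nat \<Rightarrow> nat \<Rightarrow> real) \<Rightarrow> bool" where
  "loewner_le m A B \<longleftrightarrow> (\<forall>v::vec. (\<Sum>i<m. \<Sum>j<m. v i * A i j * v j) \<le> (\<Sum>i<m. \<Sum>j<m. v i * B i j * v j))"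

definition sandwich :: "nat \<Rightarrow> vec measure \<Rightarrow> (nat \<Rightarrow> vec) \<Rightarrow> nat \<Rightarrow> feat \<Rightarrow> feat \<Rightarrow> bool" where
  "sandwich k p xs n \<phi> \<psi> \<longleftrightarrow>
     loewner_le (2*k) (\<lambda>i j. 0.9 * blockLambda k (cov_pop p) \<phi> \<psi> i j) (blockLambda k (cov_emp xs n) \<phi> \<psi>) \<and>
     loewner_le (2*k) (blockLambda k (cov_emp xs n) \<phi> \<psi>) (\<lambda>i j. 1.1 * blockLambda k (cov_pop p) \<phi> \<psi> i j)"

abbreviation iid :: "nat \<Rightarrow> vec measure \<Rightarrow> (nat \<Rightarrow> vec) measure" where
  "iid n p \<equiv> PiM {..<n} (\<lambda>_. p)"

text \<open>"n satisfies the pointwise concentration property at level delta", i.e. the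
  defining property of N_point(Phi,p,delta) for sample size n.\<close>

definition point_conc :: "nat \<Rightarrow> feat set \<Rightarrow> vec measure \<Rightarrow> real \<Rightarrow> nat \<Rightarrow> bool" where
  "point_conc k \<Phi> p \<delta> n \<longleftrightarrow>
     (\<forall>\<phi>\<in>\<Phi>. \<forall>\<psi>\<in>\<Phi>. \<exists>A\<in>sets (iid n p). measure (iid n p) A \<ge> 1 - \<delta> \<and>
        (\<forall>xs\<in>A. sandwich k p xs n \<phi> \<psi>))"

definition unif_conc :: "nat \<Rightarrow> feat set \<Rightarrow> vec measure \<Rightarrow> real \<Rightarrow> nat \<Rightarrow> bool" where
  "unif_conc k \<Phi> p \<delta> n \<longleftrightarrow>
     (\<exists>A\<in>sets (iid n p). measure (iid n p) A \<ge> 1 - \<delta> \<and>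
        (\<forall>xs\<in>A. \<forall>\<phi>\<in>\<Phi>. \<forall>\<psi>\<in>\<Phi>. sandwich k p xs n \<phi> \<psi>))"

text \<open>k-th (= smallest) singular value squared of the k x T matrix W = [w_1,...,w_T],
  i.e. the smallest eigenvalue of W W^T (variational definition).\<close>

definition sing_k_sq :: "nat \<Rightarrow> nat \<Rightarrow> (nat \<Rightarrow> vec) \<Rightarrow> real" where
  "sing_k_sq k T W = Inf {(\<Sum>t\<in>{1..T}. (ip k u (W t))\<^sup>2) | u. (\<Sum>j<k. (u j)\<^sup>2) = 1}"

definition spec_norm :: "nat \<Rightarrow> (nat \<Rightarrow> nat \<Rightarrow> real) \<Rightarrow> real" where
  "spec_norm k M = Sup {sqrt (\<Sum>i<k. (\<Sum>j<k. M i j * u j)\<^sup>2) | u. (\<Sum>j<k. (u j)\<^sup>2) = 1}"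

definition second_moment :: "vec measure \<Rightarrow> nat \<Rightarrow> nat \<Rightarrow> real" where
  "second_moment \<nu> i j = (\<integral>w. w i * w j \<partial>\<nu>)"

definition gaussian_width :: "'i set \<Rightarrow> ('i \<Rightarrow> real) set \<Rightarrow> real" where
  "gaussian_width S K =
     (if K = {} then 0 else
      (\<integral>z. Sup ((\<lambda>v. \<Sum>s\<in>S. v s * z s) ` K) \<partial>(PiM S (\<lambda>_. density lborel std_normal_density))))"

text \<open>Sample space: sample (t,i) is a pair (x, z) of an input x ~ p and a noise z ~ N(0,sigma^2);
  source tasks t = 1..T with i < n1, target task T+1 with i < n2; all independent.\<close>

type_synonym sample = "nat \<times> nat \<Rightarrow> vec \<times> real"

definition sample_space :: "vec measure \<Rightarrow> real \<Rightarrow> nat \<Rightarrow> nat \<Rightarrow> nat \<Rightarrow> sample measure" where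
  "sample_space p \<sigma> T n1 n2 =
     PiM ({1..T} \<times> {..<n1} \<union> {Suc T} \<times> {..<n2})
         (\<lambda>_. p \<Otimes>\<^sub>M density lborel (normal_density 0 \<sigma>))"

text \<open>Data-dependent set F_X(Phi), matrices A = [a_1..a_T] in R^{n1 x T} indexed by (t,i).\<close>

definition F_X :: "nat \<Rightarrow> feat set \<Rightarrow> nat \<Rightarrow> nat \<Rightarrow> sample \<Rightarrow> (nat \<times> nat \<Rightarrow> real) set" where
  "F_X k \<Phi> T n1 \<omega> =
     {A. (\<forall>s. s \<notin> {1..T} \<times> {..<n1} \<longrightarrow> A s = 0) \<and>
         (\<Sum>s\<in>{1..T} \<times> {..<n1}. (A s)\<^sup>2) = 1 \<and>
         (\<exists>\<phi>\<in>\<Phi>. \<exists>\<psi>\<in>\<Phi>. \<forall>t\<in>{1..T}. \<exists>c c' :: vec. \<forall>i<n1.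
             A (t, i) = (\<Sum>j<k. c j * \<phi> (fst (\<omega> (t, i))) j + c' j * \<psi> (fst (\<omega> (t, i))) j))}"

definition source_loss :: "nat \<Rightarrow> nat \<Rightarrow> nat \<Rightarrow> feat \<Rightarrow> (nat \<Rightarrow> vec) \<Rightarrow> sample \<Rightarrow> feat \<Rightarrow> (nat \<Rightarrow> vec) \<Rightarrow> real" where
  "source_loss k T n1 \<phi>s Ws \<omega> \<phi> W =
     (\<Sum>t\<in>{1..T}. \<Sum>i<n1.
        (ip k (Ws t) (\<phi>s (fst (\<omega> (t, i)))) + snd (\<omega> (t, i)) - ip k (W t) (\<phi> (fst (\<omega> (t, i)))))\<^sup>2)
     / (2 * real n1 * real T)"

definition target_loss :: "nat \<Rightarrow> nat \<Rightarrow> nat \<Rightarrow> feat \<Rightarrow> vec \<Rightarrow> sample \<Rightarrow> feat \<Rightarrow> vec \<Rightarrow> real" where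
  "target_loss k T n2 \<phi>s wstar \<omega> \<phi> w =
     (\<Sum>i<n2.
        (ip k wstar (\<phi>s (fst (\<omega> (Suc T, i)))) + snd (\<omega> (Suc T, i)) - ip k w (\<phi> (fst (\<omega> (Suc T, i)))))\<^sup>2)
     / (2 * real n2)"

definition excess_risk :: "nat \<Rightarrow> vec measure \<Rightarrow> feat \<Rightarrow> feat \<Rightarrow> vec \<Rightarrow> vec \<Rightarrow> ennreal" where
  "excess_risk k p \<phi>s \<phi>h wh wstar =
     (\<integral>\<^sup>+ x. ennreal ((ip k wh (\<phi>h x) - ip k wstar (\<phi>s x))\<^sup>2 / 2) \<partial>p)"

end

(* Least squares on the source tasks has prediction error at most 2 sigma (width + deviation) in the direction
   of the error vector, because that direction lies in F_X; by the uniform sandwich this bounds the population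
   error of the learned representation on the source tasks.  A target task is the combination W^T (W W^T)^{-1} w of the
   source tasks, which transfers this error with the factor C0 / (c0 T) on average over the target.

   The delicate point is the target stage: the class is arbitrary, minimisers need not be unique or depend
   measurably on the data, and the target sandwich is available only for fixed pairs of features, whereas the
   learned feature depends on the source sample.  The uniform sandwich makes the class separable, so the target
   events are only required for a countable family, evaluated at a measurable sequence of near-minimisers.
   To pass to the limit, almost every noise vector has a unique best fitted vector (nearest points to an
   arbitrary closed set are almost everywhere unique), and the weights of a best fit have full rank
   except when the features degenerate (raising the rank by a rank-one perturbation improves the fit unless the noise
   lies in the Lipschitz image of a porous set).  Hence the near-minimising features converge, up to
   linear reparametrisation, to those of every minimiser. *)

theory Submission
  imports Defs
begin

subsection \<open>Gaussian measures and rotations\<close>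

text \<open>The pointwise sandwich may fail with probability \<delta>/3 for each single pair, so
  even a countable union bound over features is out of reach. The target event is therefore imposed
  at each selected near-minimiser separately and only required infinitely often: a subsequence is
  enough for the limit, and failure at all large indices is no more likely than failure at one
  index.

  Separability rests on the failure probability of the uniform sandwich staying the same for all
  larger sample sizes. This forces a full-measure set \<open>K\<close> on which evaluation at a
  point is bounded by the population norm, so that closeness at finitely many sampled inputs implies
  closeness on all of \<open>K\<close>.

  The additive constant hidden in ln(6/\<delta>) is absorbed because the Gaussian width of a
  nonempty \<open>F_X\<close> is at least 1/3 and k is at least 1; if \<open>F_X\<close> is empty,
  the source error vector vanishes. Assumption (A3) forces k \<le> T, which gives the linear
  relation among T + 1 weight vectors on which the rank argument depends.\<close>

lemma nn_integral_PiM_pair: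
  assumes "prob_space M" "prob_space N" "finite I"
    and "f \<in> borel_measurable (PiM I (\<lambda>_. M \<Otimes>\<^sub>M N))"
  shows "(\<integral>\<^sup>+w. f w \<partial>PiM I (\<lambda>_. M \<Otimes>\<^sub>M N))
       = (\<integral>\<^sup>+x. \<integral>\<^sup>+z. f (\<lambda>i\<in>I. (x i, z i)) \<partial>PiM I (\<lambda>_. N) \<partial>PiM I (\<lambda>_. M))"
  using assms(3,4)
proof (induction I arbitrary: f rule: finite_induct)
  case empty
  show ?case by (simp add: PiM_empty nn_integral_count_space_finite)
next
  case (insert i I)
  interpret M: prob_space M by fact
  interpret N: prob_space N by fact
  interpret MN: pair_prob_space M N ..
  interpret pM: product_sigma_finite "\<lambda>_. M" by standard
  interpret pN: product_sigma_finite "\<lambda>_. N" by standard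
  interpret pMN: product_sigma_finite "\<lambda>_. M \<Otimes>\<^sub>M N" by standard
  interpret PM: prob_space "PiM I (\<lambda>_. M)" by (rule prob_space_PiM) unfold_locales
  interpret PN: prob_space "PiM I (\<lambda>_. N)" by (rule prob_space_PiM) unfold_locales
  interpret F: pair_sigma_finite M "PiM I (\<lambda>_. N)" ..
  note [measurable] = insert.prems
  have zipm[measurable]: "(\<lambda>p. (\<lambda>j\<in>I. (fst p j, snd p j))) \<in> PiM I (\<lambda>_. M) \<Otimes>\<^sub>M PiM I (\<lambda>_. N) \<rightarrow>\<^sub>M PiM I (\<lambda>_. M \<Otimes>\<^sub>M N)"
    by (rule measurable_restrict) measurable
  have zipm'[measurable]: "(\<lambda>p. (\<lambda>j\<in>insert i I. (fst p j, snd p j))) \<in> PiM (insert i I) (\<lambda>_. M) \<Otimes>\<^sub>M PiM (insert i I) (\<lambda>_. N) \<rightarrow>\<^sub>M PiM (insert i I) (\<lambda>_. M \<Otimes>\<^sub>M N)"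
    by (rule measurable_restrict) measurable
  have eq: "(\<lambda>j\<in>insert i I. ((x(i := a)) j, (z(i := b)) j)) = (\<lambda>j\<in>I. (x j, z j))(i := (a, b))" for x z a b
    using insert.hyps by (auto simp: fun_eq_iff)
  have "(\<integral>\<^sup>+w. f w \<partial>PiM (insert i I) (\<lambda>_. M \<Otimes>\<^sub>M N))
      = (\<integral>\<^sup>+w. \<integral>\<^sup>+ab. f (w(i := ab)) \<partial>(M \<Otimes>\<^sub>M N) \<partial>PiM I (\<lambda>_. M \<Otimes>\<^sub>M N))"
    by (rule pMN.product_nn_integral_insert) (use insert in auto)
  also have "\<dots> = (\<integral>\<^sup>+x. \<integral>\<^sup>+z. \<integral>\<^sup>+ab. f ((\<lambda>i\<in>I. (x i, z i))(i := ab)) \<partial>(M \<Otimes>\<^sub>M N) \<partial>PiM I (\<lambda>_. N) \<partial>PiM I (\<lambda>_. M))"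
    by (rule insert.IH) measurable
  also have "\<dots> = (\<integral>\<^sup>+x. \<integral>\<^sup>+z. \<integral>\<^sup>+a. \<integral>\<^sup>+b. f ((\<lambda>i\<in>I. (x i, z i))(i := (a,b))) \<partial>N \<partial>M \<partial>PiM I (\<lambda>_. N) \<partial>PiM I (\<lambda>_. M))"
  proof (intro nn_integral_cong)
    fix x z assume [measurable]: "x \<in> space (PiM I (\<lambda>_. M))" "z \<in> space (PiM I (\<lambda>_. N))"
    have w[measurable]: "(\<lambda>j\<in>I. (x j, z j)) \<in> space (PiM I (\<lambda>_. M \<Otimes>\<^sub>M N))"
      using \<open>x \<in> _\<close> \<open>z \<in> _\<close> by (auto simp: space_PiM space_pair_measure PiE_iff)
    show "(\<integral>\<^sup>+ab. f ((\<lambda>i\<in>I. (x i, z i))(i := ab)) \<partial>(M \<Otimes>\<^sub>M N)) = (\<integral>\<^sup>+a. \<integral>\<^sup>+b. f ((\<lambda>i\<in>I. (x i, z i))(i := (a,b))) \<partial>N \<partial>M)"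
      by (subst N.nn_integral_fst[symmetric]) (auto simp del: restrict_apply)
  qed
  \<comment> \<open>Fubini between the new input \<open>a\<close> and the old noises
    \<open>z\<close>, so that all inputs are integrated outside all noises.\<close>
  also have "\<dots> = (\<integral>\<^sup>+x. \<integral>\<^sup>+a. \<integral>\<^sup>+z. \<integral>\<^sup>+b. f ((\<lambda>i\<in>I. (x i, z i))(i := (a,b))) \<partial>N \<partial>PiM I (\<lambda>_. N) \<partial>M \<partial>PiM I (\<lambda>_. M))"
  proof (intro nn_integral_cong)
    fix x assume [measurable]: "x \<in> space (PiM I (\<lambda>_. M))"
    have [measurable]: "(\<lambda>p. \<lambda>j\<in>I. (x j, p j)) \<in> PiM I (\<lambda>_. N) \<rightarrow>\<^sub>M PiM I (\<lambda>_. M \<Otimes>\<^sub>M N)"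
      by (rule measurable_restrict) (use \<open>x \<in> _\<close> in \<open>auto simp: space_PiM intro!: measurable_Pair measurable_component_singleton measurable_const dest: PiE_mem\<close>)
    show "(\<integral>\<^sup>+z. \<integral>\<^sup>+a. \<integral>\<^sup>+b. f ((\<lambda>i\<in>I. (x i, z i))(i := (a,b))) \<partial>N \<partial>M \<partial>PiM I (\<lambda>_. N)) = (\<integral>\<^sup>+a. \<integral>\<^sup>+z. \<integral>\<^sup>+b. f ((\<lambda>i\<in>I. (x i, z i))(i := (a,b))) \<partial>N \<partial>PiM I (\<lambda>_. N) \<partial>M)"
      by (rule F.Fubini') measurable
  qed
  also have "\<dots> = (\<integral>\<^sup>+x. \<integral>\<^sup>+a. \<integral>\<^sup>+z. \<integral>\<^sup>+b. f (\<lambda>j\<in>insert i I. ((x(i := a)) j, (z(i := b)) j)) \<partial>N \<partial>PiM I (\<lambda>_. N) \<partial>M \<partial>PiM I (\<lambda>_. M))"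
    by (simp only: eq)
  also have "\<dots> = (\<integral>\<^sup>+x. \<integral>\<^sup>+a. \<integral>\<^sup>+z. f (\<lambda>j\<in>insert i I. ((x(i := a)) j, z j)) \<partial>PiM (insert i I) (\<lambda>_. N) \<partial>M \<partial>PiM I (\<lambda>_. M))"
  proof (intro nn_integral_cong)
    fix x a assume [measurable]: "x \<in> space (PiM I (\<lambda>_. M))" "a \<in> space M"
    have [measurable]: "(\<lambda>p. \<lambda>j\<in>insert i I. ((x(i := a)) j, p j)) \<in> PiM (insert i I) (\<lambda>_. N) \<rightarrow>\<^sub>M PiM (insert i I) (\<lambda>_. M \<Otimes>\<^sub>M N)"
      by (rule measurable_restrict) (use \<open>x \<in> _\<close> \<open>a \<in> _\<close> in \<open>auto simp: space_PiM intro!: measurable_Pair measurable_component_singleton measurable_const dest: PiE_mem\<close>)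
    show "(\<integral>\<^sup>+z. \<integral>\<^sup>+b. f (\<lambda>j\<in>insert i I. ((x(i := a)) j, (z(i := b)) j)) \<partial>N \<partial>PiM I (\<lambda>_. N)) = (\<integral>\<^sup>+z. f (\<lambda>j\<in>insert i I. ((x(i := a)) j, z j)) \<partial>PiM (insert i I) (\<lambda>_. N))"
      by (rule pN.product_nn_integral_insert[symmetric, OF insert.hyps]) measurable
  qed
  also have "\<dots> = (\<integral>\<^sup>+x. \<integral>\<^sup>+z. f (\<lambda>j\<in>insert i I. (x j, z j)) \<partial>PiM (insert i I) (\<lambda>_. N) \<partial>PiM (insert i I) (\<lambda>_. M))"
  proof -
    interpret PN': prob_space "PiM (insert i I) (\<lambda>_. N)" by (rule prob_space_PiM) unfold_locales
    show ?thesis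
      by (rule pM.product_nn_integral_insert[symmetric]) (use insert in measurable)
  qed
  finally show ?case .
qed

text \<open>For c \<noteq> 0 the rotation factors into two one-dimensional affine substitutions
  whose Jacobians 1/|c| and |c| cancel, and the joint density depends on x^2 + y^2 only. The first
  substitution divides by c, so c = 0 is reached by composition.\<close>

lemma rotation_pair_normal:
  fixes c d :: real
  assumes cd: "c\<^sup>2 + d\<^sup>2 = 1"
  defines "N \<equiv> density lborel std_normal_density"
  shows "distr (N \<Otimes>\<^sub>M N) (N \<Otimes>\<^sub>M N) (\<lambda>(x, y). (c * x + d * y, c * y - d * x)) = N \<Otimes>\<^sub>M N"
proof -
  have N_dens: "(\<integral>\<^sup>+x. g x \<partial>N) = (\<integral>\<^sup>+x. ennreal (std_normal_density x) * g x \<partial>lborel)"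
    if "g \<in> borel_measurable borel" for g :: "real \<Rightarrow> ennreal"
    using that unfolding N_def by (subst nn_integral_density) auto
  have pN: "prob_space N" unfolding N_def by (rule prob_space_normal_density) simp
  interpret N: prob_space N by fact
  have setsN[measurable_cong]: "sets N = sets borel" by (simp add: N_def)
  have main: "(\<integral>\<^sup>+x. \<integral>\<^sup>+y. g (c * x + d * y, c * y - d * x) \<partial>N \<partial>N) = (\<integral>\<^sup>+x. \<integral>\<^sup>+y. g (x, y) \<partial>N \<partial>N)"
    if [measurable]: "g \<in> borel_measurable (borel \<Otimes>\<^sub>M borel)" and c: "c\<^sup>2 + d\<^sup>2 = 1" "c \<noteq> 0" for g :: "real \<times> real \<Rightarrow> ennreal" and c d
  proof -
    let ?p = "\<lambda>x y. ennreal (std_normal_density x * std_normal_density y)"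
    have rw: "(\<integral>\<^sup>+x. \<integral>\<^sup>+y. h x y \<partial>N \<partial>N) = (\<integral>\<^sup>+x. \<integral>\<^sup>+y. ?p x y * h x y \<partial>lborel \<partial>lborel)"
      if [measurable]: "case_prod h \<in> borel_measurable (borel \<Otimes>\<^sub>M borel)" for h
      by (simp add: N_dens nn_integral_cmult[symmetric] ennreal_mult mult.assoc)
    have prot: "std_normal_density (c * x + d * y) * std_normal_density (c * y - d * x) = std_normal_density x * std_normal_density y" for x y
    proof -
      have "(c * x + d * y)\<^sup>2 + (c * y - d * x)\<^sup>2 = (c\<^sup>2 + d\<^sup>2) * (x\<^sup>2 + y\<^sup>2)" by algebra
      then have "- (c * x + d * y)\<^sup>2 / 2 + - (c * y - d * x)\<^sup>2 / 2 = - x\<^sup>2 / 2 + - y\<^sup>2 / 2" using c by simp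
      then have "exp (- (c * x + d * y)\<^sup>2 / 2) * exp (- (c * y - d * x)\<^sup>2 / 2) = exp (- x\<^sup>2 / 2) * exp (- y\<^sup>2 / 2)"
        by (metis exp_add)
      then show ?thesis by (simp add: std_normal_density_def)
    qed
    define G where "G = (\<lambda>(x, y). ?p x y * g (x, y))"
    have Gm[measurable]: "G \<in> borel_measurable (borel \<Otimes>\<^sub>M borel)" unfolding G_def by measurable
    have "(\<integral>\<^sup>+x. \<integral>\<^sup>+y. g (c * x + d * y, c * y - d * x) \<partial>N \<partial>N)
        = (\<integral>\<^sup>+x. \<integral>\<^sup>+y. ?p x y * g (c * x + d * y, c * y - d * x) \<partial>lborel \<partial>lborel)"
      by (rule rw) measurable
    also have "\<dots> = (\<integral>\<^sup>+x. \<integral>\<^sup>+y. G (c * x + d * y, c * y - d * x) \<partial>lborel \<partial>lborel)"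
      by (simp add: G_def prot)
    also have "\<dots> = (\<integral>\<^sup>+y. \<integral>\<^sup>+x. G (c * x + d * y, c * y - d * x) \<partial>lborel \<partial>lborel)"
      by (rule lborel_pair.Fubini'[symmetric]) measurable
    also have "\<dots> = (\<integral>\<^sup>+y. ennreal \<bar>1 / c\<bar> * (\<integral>\<^sup>+x. G (x, c * y - d * ((x - d * y) / c)) \<partial>lborel) \<partial>lborel)"
    proof (rule nn_integral_cong)
      fix y
      show "(\<integral>\<^sup>+x. G (c * x + d * y, c * y - d * x) \<partial>lborel) = ennreal \<bar>1 / c\<bar> * (\<integral>\<^sup>+x. G (x, c * y - d * ((x - d * y) / c)) \<partial>lborel)"
        using c by (subst nn_integral_real_affine[where c="1/c" and t="- d * y / c"]) (auto simp: field_simps intro!: arg_cong2[where f="(*)"] nn_integral_cong)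
    qed
    also have "\<dots> = (\<integral>\<^sup>+y. (\<integral>\<^sup>+x. ennreal \<bar>1 / c\<bar> * G (x, c * y - d * ((x - d * y) / c)) \<partial>lborel) \<partial>lborel)"
      by (simp add: nn_integral_cmult)
    also have "\<dots> = (\<integral>\<^sup>+x. (\<integral>\<^sup>+y. ennreal \<bar>1 / c\<bar> * G (x, c * y - d * ((x - d * y) / c)) \<partial>lborel) \<partial>lborel)"
      by (rule lborel_pair.Fubini') measurable
    also have "\<dots> = (\<integral>\<^sup>+x. (\<integral>\<^sup>+y. G (x, y) \<partial>lborel) \<partial>lborel)"
    proof (rule nn_integral_cong)
      fix x
      \<comment> \<open>After y is replaced by d x + c y, the second argument becomes y again
        because c^2 + d^2 = 1.\<close>
      have a: "c * (d * x + c * y) - d * ((x - d * (d * x + c * y)) / c) = y" for y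
      proof -
        have "c * (c * (d * x + c * y)) - d * (x - d * (d * x + c * y)) = (c\<^sup>2 + d\<^sup>2) * (d * x + c * y) - d * x"
          by algebra
        also have "\<dots> = c * y" using c by simp
        finally show ?thesis using c by (simp add: field_simps)
      qed
      have "(\<integral>\<^sup>+y. ennreal \<bar>1 / c\<bar> * G (x, c * y - d * ((x - d * y) / c)) \<partial>lborel)
        = ennreal \<bar>c\<bar> * (\<integral>\<^sup>+y. ennreal \<bar>1 / c\<bar> * G (x, y) \<partial>lborel)"
      proof -
        have "(\<integral>\<^sup>+y. ennreal \<bar>1 / c\<bar> * G (x, c * y - d * ((x - d * y) / c)) \<partial>lborel)
          = ennreal \<bar>c\<bar> * (\<integral>\<^sup>+y. ennreal \<bar>1 / c\<bar> * G (x, c * (d * x + c * y) - d * ((x - d * (d * x + c * y)) / c)) \<partial>lborel)"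
          using c(2) by (intro nn_integral_real_affine) measurable
        then show ?thesis by (simp only: a)
      qed
      also have "\<dots> = (ennreal \<bar>c\<bar> * ennreal \<bar>1 / c\<bar>) * (\<integral>\<^sup>+y. G (x, y) \<partial>lborel)"
        by (subst nn_integral_cmult) (auto simp: mult.assoc)
      also have "ennreal \<bar>c\<bar> * ennreal \<bar>1 / c\<bar> = 1"
        using c by (subst ennreal_mult[symmetric]) (auto simp: abs_mult[symmetric])
      finally show "(\<integral>\<^sup>+y. ennreal \<bar>1 / c\<bar> * G (x, c * y - d * ((x - d * y) / c)) \<partial>lborel) = (\<integral>\<^sup>+y. G (x, y) \<partial>lborel)"
        by simp
    qed
    also have "\<dots> = (\<integral>\<^sup>+x. \<integral>\<^sup>+y. g (x, y) \<partial>N \<partial>N)"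
      by (subst rw) (auto simp: G_def)
    finally show ?thesis .
  qed
  have "(\<integral>\<^sup>+x. \<integral>\<^sup>+y. g (c * x + d * y, c * y - d * x) \<partial>N \<partial>N) = (\<integral>\<^sup>+x. \<integral>\<^sup>+y. g (x, y) \<partial>N \<partial>N)"
    if [measurable]: "g \<in> borel_measurable (borel \<Otimes>\<^sub>M borel)" for g :: "real \<times> real \<Rightarrow> ennreal"
  proof (cases "c = 0")
    case False
    then show ?thesis by (rule main[OF that cd])
  next
    case True
    \<comment> \<open>a quarter turn is two rotations by an eighth of a turn\<close>
    define r where "r = 1 / sqrt 2"
    have r: "r\<^sup>2 = 1/2" "r * r = 1/2" by (simp_all add: r_def power_divide)
    have d1: "d\<^sup>2 = 1" using cd True by simp
    have rd: "r\<^sup>2 + (d * r)\<^sup>2 = 1" "r \<noteq> 0" using d1 r by (auto simp: power_mult_distrib)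
    have z1: "(r * (r * x + d * r * y) + d * r * (r * y - d * r * x)) = d * y" for x y
    proof -
      have "(r * (r * x + d * r * y) + d * r * (r * y - d * r * x)) = r\<^sup>2 * (x + 2 * d * y - d\<^sup>2 * x)" by algebra
      then show ?thesis using d1 r by simp
    qed
    have z2: "(r * (r * y - d * r * x) - d * r * (r * x + d * r * y)) = - d * x" for x y
    proof -
      have "(r * (r * y - d * r * x) - d * r * (r * x + d * r * y)) = r\<^sup>2 * (y - 2 * d * x - d\<^sup>2 * y)" by algebra
      then show ?thesis using d1 r by simp
    qed
    have "(\<integral>\<^sup>+x. \<integral>\<^sup>+y. g (x, y) \<partial>N \<partial>N) = (\<integral>\<^sup>+x. \<integral>\<^sup>+y. (\<lambda>(x,y). g (r * x + d * r * y, r * y - d * r * x)) (x, y) \<partial>N \<partial>N)"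
      using main[OF that rd] by simp
    also have "\<dots> = (\<integral>\<^sup>+x. \<integral>\<^sup>+y. (\<lambda>(x,y). g (r * x + d * r * y, r * y - d * r * x)) (r * x + d * r * y, r * y - d * r * x) \<partial>N \<partial>N)"
      by (rule main[OF _ rd, symmetric]) measurable
    also have "\<dots> = (\<integral>\<^sup>+x. \<integral>\<^sup>+y. g (c * x + d * y, c * y - d * x) \<partial>N \<partial>N)"
      by (simp only: prod.case z1 z2) (simp add: True)
    finally show ?thesis by simp
  qed
  note all = this
  show ?thesis
  proof (rule measure_eqI)
    fix A assume "A \<in> sets (distr (N \<Otimes>\<^sub>M N) (N \<Otimes>\<^sub>M N) (\<lambda>(x, y). (c * x + d * y, c * y - d * x)))"
    then have A[measurable]: "A \<in> sets (N \<Otimes>\<^sub>M N)" by simp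
    then have A'[measurable]: "A \<in> sets (borel \<Otimes>\<^sub>M borel)" by (metis sets_pair_measure_cong setsN)
    have "emeasure (distr (N \<Otimes>\<^sub>M N) (N \<Otimes>\<^sub>M N) (\<lambda>(x, y). (c * x + d * y, c * y - d * x))) A
      = (\<integral>\<^sup>+p. indicator A p \<partial>distr (N \<Otimes>\<^sub>M N) (N \<Otimes>\<^sub>M N) (\<lambda>(x, y). (c * x + d * y, c * y - d * x)))" by simp
    also have "\<dots> = (\<integral>\<^sup>+p. indicator A (case p of (x, y) \<Rightarrow> (c * x + d * y, c * y - d * x)) \<partial>(N \<Otimes>\<^sub>M N))"
      by (subst nn_integral_distr) auto
    also have "\<dots> = (\<integral>\<^sup>+x. \<integral>\<^sup>+y. indicator A (c * x + d * y, c * y - d * x) \<partial>N \<partial>N)"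
      by (subst N.nn_integral_fst[symmetric]) auto
    also have "\<dots> = (\<integral>\<^sup>+x. \<integral>\<^sup>+y. indicator A (x, y) \<partial>N \<partial>N)"
      by (rule all) measurable
    also have "\<dots> = (\<integral>\<^sup>+p. indicator A p \<partial>(N \<Otimes>\<^sub>M N))"
      by (subst N.nn_integral_fst) auto
    finally show "emeasure (distr (N \<Otimes>\<^sub>M N) (N \<Otimes>\<^sub>M N) (\<lambda>(x, y). (c * x + d * y, c * y - d * x))) A = emeasure (N \<Otimes>\<^sub>M N) A"
      by simp
  qed simp
qed

section \<open>Inner products over a finite index set and moments of Gaussian linear forms\<close>

definition dot :: "'i set \<Rightarrow> ('i \<Rightarrow> real) \<Rightarrow> ('i \<Rightarrow> real) \<Rightarrow> real" where
  "dot S u v = (\<Sum>s\<in>S. u s * v s)"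

abbreviation gauss :: "'i set \<Rightarrow> ('i \<Rightarrow> real) measure" where
  "gauss S \<equiv> PiM S (\<lambda>_. density lborel std_normal_density)"

lemma prob_space_gauss: "prob_space (gauss S)"
  by (intro prob_space_PiM prob_space_normal_density) simp

lemma dot_restrict[simp]: "dot S u (restrict v S) = dot S u v" "dot S (restrict u S) v = dot S u v"
  unfolding dot_def by (auto intro!: sum.cong)

lemma dot_commute: "dot S u v = dot S v u"
  unfolding dot_def by (simp add: mult.commute)

lemma dot_add_right: "dot S u (\<lambda>s. v s + w s) = dot S u v + dot S u w"
  and dot_diff_right: "dot S u (\<lambda>s. v s - w s) = dot S u v - dot S u w"
  and dot_scale_right: "dot S u (\<lambda>s. a * v s) = a * dot S u v"
  and dot_add_left: "dot S (\<lambda>s. v s + w s) u = dot S v u + dot S w u"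
  and dot_diff_left: "dot S (\<lambda>s. v s - w s) u = dot S v u - dot S w u"
  and dot_scale_left: "dot S (\<lambda>s. a * v s) u = a * dot S v u"
  unfolding dot_def by (simp_all add: algebra_simps sum.distrib sum_subtractf sum_distrib_left)

lemmas dot_linear = dot_add_right dot_diff_right dot_scale_right dot_add_left dot_diff_left dot_scale_left

lemma dot_sum_right: "dot S u (\<lambda>s. \<Sum>j\<in>J. f j s) = (\<Sum>j\<in>J. dot S u (f j))"
  and dot_sum_left: "dot S (\<lambda>s. \<Sum>j\<in>J. f j s) u = (\<Sum>j\<in>J. dot S (f j) u)"
  unfolding dot_def by (simp_all add: sum_distrib_left sum_distrib_right sum.swap[of _ _ S])

lemma dot_self_nonneg[simp]: "0 \<le> dot S u u"
  unfolding dot_def by (auto intro!: sum_nonneg)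

lemma dot_measurable[measurable]:
  assumes "finite S" "\<And>s. s \<in> S \<Longrightarrow> (\<lambda>x. f x s) \<in> borel_measurable M" "\<And>s. s \<in> S \<Longrightarrow> (\<lambda>x. g x s) \<in> borel_measurable M"
  shows "(\<lambda>x. dot S (f x) (g x)) \<in> borel_measurable M"
  unfolding dot_def using assms by auto

lemma gauss_component[measurable (raw)]: "s \<in> S \<Longrightarrow> (\<lambda>z. z s) \<in> borel_measurable (gauss S)"
  using measurable_component_singleton[of s S "\<lambda>_. density lborel std_normal_density"] by simp

lemma dot_Cauchy: "(dot S u v)\<^sup>2 \<le> dot S u u * dot S v v"
  unfolding dot_def using Cauchy_Schwarz_ineq_sum[of u v S] by (simp add: power2_eq_square)

lemma std_normal_mgf:
  "(\<integral>\<^sup>+z. ennreal (exp (b * z)) \<partial>density lborel std_normal_density) = ennreal (exp (b\<^sup>2 / 2))"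
proof -
  have e: "std_normal_density z * exp (b * z) = exp (b\<^sup>2 / 2) * normal_density b 1 z" for z
  proof -
    have "- (z\<^sup>2 / 2) + b * z = b\<^sup>2 / 2 + - ((z - b)\<^sup>2 / 2)" by (simp add: power2_eq_square field_simps)
    then have "exp (- (z\<^sup>2 / 2)) * exp (b * z) = exp (b\<^sup>2 / 2) * exp (- ((z - b)\<^sup>2 / 2))"
      by (metis exp_add)
    then show ?thesis by (simp add: normal_density_def field_simps)
  qed
  interpret prob_space "density lborel (normal_density b 1)" by (rule prob_space_normal_density) simp
  have "(\<integral>\<^sup>+z. ennreal (exp (b * z)) \<partial>density lborel std_normal_density)
     = (\<integral>\<^sup>+z. ennreal (exp (b\<^sup>2 / 2)) * ennreal (normal_density b 1 z) \<partial>lborel)"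
    by (subst nn_integral_density) (auto simp: ennreal_mult[symmetric] e)
  also have "\<dots> = ennreal (exp (b\<^sup>2 / 2)) * emeasure (density lborel (normal_density b 1)) (space (density lborel (normal_density b 1)))"
    by (subst nn_integral_cmult) (auto simp: emeasure_density)
  finally show ?thesis by (simp only: emeasure_space_1 mult_1_right)
qed

lemma gauss_mgf:
  assumes "finite S"
  shows "(\<integral>\<^sup>+z. ennreal (exp (b * dot S v z)) \<partial>gauss S) = ennreal (exp (b\<^sup>2 * dot S v v / 2))"
proof -
  interpret N: prob_space "density lborel std_normal_density" by (rule prob_space_normal_density) simp
  interpret product_sigma_finite "\<lambda>_. density lborel std_normal_density" by standard
  have "(\<integral>\<^sup>+z. ennreal (exp (b * dot S v z)) \<partial>gauss S) = (\<integral>\<^sup>+z. (\<Prod>s\<in>S. ennreal (exp ((b * v s) * z s))) \<partial>gauss S)"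
    by (simp add: dot_def sum_distrib_left exp_sum[OF assms] prod_ennreal mult.assoc)
  also have "\<dots> = (\<Prod>s\<in>S. \<integral>\<^sup>+z. ennreal (exp ((b * v s) * z)) \<partial>density lborel std_normal_density)"
    by (rule product_nn_integral_prod) (use assms in auto)
  also have "\<dots> = (\<Prod>s\<in>S. ennreal (exp ((b * v s)\<^sup>2 / 2)))" by (simp only: std_normal_mgf)
  also have "\<dots> = ennreal (exp (b\<^sup>2 * dot S v v / 2))"
    by (simp add: prod_ennreal exp_sum[OF assms, symmetric] dot_def sum_distrib_left sum_divide_distrib power_mult_distrib power2_eq_square mult.assoc mult.left_commute)
  finally show ?thesis .
qed

text \<open>The planar rotation acts on each pair (x s, y s) separately, so its invariance lifts to
  the product of pairs and, by zipping, to two independent Gaussian vectors. Position and velocity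
  along the circle are thus again independent and standard.\<close>

lemma gauss_rotation:
  fixes c d :: real
  assumes S: "finite S" and cd: "c\<^sup>2 + d\<^sup>2 = 1"
    and G: "case_prod G \<in> borel_measurable (gauss S \<Otimes>\<^sub>M gauss S)"
  shows "(\<integral>\<^sup>+x. \<integral>\<^sup>+y. G (\<lambda>s\<in>S. c * x s + d * y s) (\<lambda>s\<in>S. c * y s - d * x s) \<partial>gauss S \<partial>gauss S)
       = (\<integral>\<^sup>+x. \<integral>\<^sup>+y. G x y \<partial>gauss S \<partial>gauss S)"
proof -
  let ?N = "density lborel (\<lambda>x. ennreal (std_normal_density x))"
  let ?R = "\<lambda>(x, y). (c * x + d * y, c * y - d * x)"
  have pN: "prob_space ?N" by (rule prob_space_normal_density) simp
  interpret N: prob_space ?N by fact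
  interpret NN: pair_prob_space ?N ?N ..
  define f where "f w = G (\<lambda>s\<in>S. fst (w s)) (\<lambda>s\<in>S. snd (w s))" for w :: "'a \<Rightarrow> real \<times> real"
  have c1: "(\<lambda>w. w s) \<in> PiM S (\<lambda>_. ?N \<Otimes>\<^sub>M ?N) \<rightarrow>\<^sub>M ?N \<Otimes>\<^sub>M ?N" if "s \<in> S" for s
    using that by (rule measurable_component_singleton)
  have m1: "(\<lambda>w. ((\<lambda>s\<in>S. fst (w s)), (\<lambda>s\<in>S. snd (w s)))) \<in> PiM S (\<lambda>_. ?N \<Otimes>\<^sub>M ?N) \<rightarrow>\<^sub>M gauss S \<Otimes>\<^sub>M gauss S"
    by (intro measurable_Pair measurable_restrict measurable_compose[OF c1 measurable_fst] measurable_compose[OF c1 measurable_snd])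
  have fm[measurable]: "f \<in> borel_measurable (PiM S (\<lambda>_. ?N \<Otimes>\<^sub>M ?N))"
    using measurable_compose[OF m1 G] by (simp add: f_def[abs_def])
  have Rm: "?R \<in> ?N \<Otimes>\<^sub>M ?N \<rightarrow>\<^sub>M ?N \<Otimes>\<^sub>M ?N" by measurable
  have inv: "distr (PiM S (\<lambda>_. ?N \<Otimes>\<^sub>M ?N)) (PiM S (\<lambda>_. ?N \<Otimes>\<^sub>M ?N)) (compose S ?R) = PiM S (\<lambda>_. ?N \<Otimes>\<^sub>M ?N)"
    using distr_PiM_finite_prob_space'[OF S, of "\<lambda>_. ?N \<Otimes>\<^sub>M ?N" "\<lambda>_. ?N \<Otimes>\<^sub>M ?N" ?R] Rm NN.prob_space_axioms rotation_pair_normal[OF cd]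
    by simp
  have Cm: "compose S ?R \<in> PiM S (\<lambda>_. ?N \<Otimes>\<^sub>M ?N) \<rightarrow>\<^sub>M PiM S (\<lambda>_. ?N \<Otimes>\<^sub>M ?N)"
    unfolding compose_def by (intro measurable_restrict measurable_compose[OF c1 Rm])
  have "(\<integral>\<^sup>+x. \<integral>\<^sup>+y. G x y \<partial>gauss S \<partial>gauss S) = (\<integral>\<^sup>+x. \<integral>\<^sup>+y. f (\<lambda>i\<in>S. (x i, y i)) \<partial>gauss S \<partial>gauss S)"
    unfolding f_def
    by (intro nn_integral_cong arg_cong2[where f=G]) (auto simp: space_PiM PiE_iff extensional_def fun_eq_iff restrict_def)
  also have "\<dots> = (\<integral>\<^sup>+w. f w \<partial>PiM S (\<lambda>_. ?N \<Otimes>\<^sub>M ?N))"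
    by (rule nn_integral_PiM_pair[symmetric]) (use S pN fm in auto)
  also have "\<dots> = (\<integral>\<^sup>+w. f (compose S ?R w) \<partial>PiM S (\<lambda>_. ?N \<Otimes>\<^sub>M ?N))"
    by (subst inv[symmetric], subst nn_integral_distr) (use Cm fm in auto)
  also have "\<dots> = (\<integral>\<^sup>+x. \<integral>\<^sup>+y. f (compose S ?R (\<lambda>i\<in>S. (x i, y i))) \<partial>gauss S \<partial>gauss S)"
    by (rule nn_integral_PiM_pair) (use S pN Cm fm in auto)
  also have "\<dots> = (\<integral>\<^sup>+x. \<integral>\<^sup>+y. G (\<lambda>s\<in>S. c * x s + d * y s) (\<lambda>s\<in>S. c * y s - d * x s) \<partial>gauss S \<partial>gauss S)"
    unfolding f_def
    by (intro nn_integral_cong arg_cong2[where f=G]) (auto simp: compose_def fun_eq_iff)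
  finally show ?thesis by simp
qed

text \<open>Second moments are read off the exponential moments at 1 and -1 through u^2/2 + 2 \<le>
  exp u + exp(-u). The resulting 4 replaces the exact value 1 and only affects constants.\<close>

lemma gauss_square_bound:
  assumes S: "finite S" and v: "dot S v v \<le> 1"
  shows "integrable (gauss S) (\<lambda>z. (dot S v z)\<^sup>2)" "(\<integral>z. (dot S v z)\<^sup>2 \<partial>gauss S) \<le> 4"
    "integrable (gauss S) (\<lambda>z. dot S v z)"
proof -
  interpret prob_space "gauss S" by (rule prob_space_gauss)
  have q: "u\<^sup>2 / 2 + 2 \<le> exp u + exp (- u)" for u :: real
  proof -
    have "1 + \<bar>u\<bar> + \<bar>u\<bar>\<^sup>2 / 2 \<le> exp \<bar>u\<bar>" by (rule exp_lower_Taylor_quadratic) simp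
    moreover have "1 + (- \<bar>u\<bar>) \<le> exp (- \<bar>u\<bar>)" by (rule exp_ge_add_one_self)
    moreover have "exp \<bar>u\<bar> + exp (- \<bar>u\<bar>) = exp u + exp (- u)" by (cases "u \<ge> 0") auto
    ultimately show ?thesis by simp
  qed
  have e1: "(\<integral>\<^sup>+z. ennreal (exp (b * dot S v z)) \<partial>gauss S) \<le> ennreal (exp (1/2))" if "b\<^sup>2 = 1" for b
    unfolding gauss_mgf[OF S] using that v by (intro ennreal_leI) auto
  have "(\<integral>\<^sup>+z. ennreal ((dot S v z)\<^sup>2 / 2 + 2) \<partial>gauss S) \<le> (\<integral>\<^sup>+z. ennreal (exp (1 * dot S v z)) + ennreal (exp ((-1) * dot S v z)) \<partial>gauss S)"
    using q by (intro nn_integral_mono) (auto simp: ennreal_plus[symmetric] simp del: ennreal_plus)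
  also have "\<dots> \<le> ennreal (exp (1/2)) + ennreal (exp (1/2))"
    using S e1[of 1] e1[of "-1"] by (subst nn_integral_add) (auto intro!: add_mono)
  also have "\<dots> = ennreal (2 * exp (1/2))" by (simp add: ennreal_plus[symmetric] del: ennreal_plus)
  finally have b: "(\<integral>\<^sup>+z. ennreal ((dot S v z)\<^sup>2 / 2 + 2) \<partial>gauss S) \<le> ennreal (2 * exp (1/2))" .
  have i2: "integrable (gauss S) (\<lambda>z. (dot S v z)\<^sup>2 / 2 + 2)"
    using S le_less_trans[OF b] by (intro integrableI_nonneg) (auto)
  then have "integrable (gauss S) (\<lambda>z. 2 * ((dot S v z)\<^sup>2 / 2 + 2 - 2))" by (intro Bochner_Integration.integrable_diff integrable_mult_right) auto
  then show i: "integrable (gauss S) (\<lambda>z. (dot S v z)\<^sup>2)" by simp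
  have "(\<integral>z. (dot S v z)\<^sup>2 / 2 + 2 \<partial>gauss S) \<le> 2 * exp (1/2)"
    using b i2 S by (subst (asm) nn_integral_eq_integral) auto
  moreover have "exp (1/2) \<le> (2::real)"
    using exp_bound_half[of "1/2::real"] by simp
  moreover have "(\<integral>z. (dot S v z)\<^sup>2 / 2 + 2 \<partial>gauss S) = (\<integral>z. (dot S v z)\<^sup>2 \<partial>gauss S) / 2 + 2"
    using i by (subst Bochner_Integration.integral_add) (auto simp: prob_space)
  ultimately show "(\<integral>z. (dot S v z)\<^sup>2 \<partial>gauss S) \<le> 4" by linarith
  show "integrable (gauss S) (\<lambda>z. dot S v z)"
    by (rule square_integrable_imp_integrable[OF _ i]) (use S in auto)
qed

text \<open>Since 1 - cos u \<le> |u|, the value exp(-1/2) of the characteristic function gives the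
  lower bound 1 - exp(-1/2) > 1/3. It later keeps the Gaussian width away from zero.\<close>

lemma gauss_abs_lower:
  assumes S: "finite S" and v: "dot S v v = 1"
  shows "1/3 \<le> (\<integral>z. \<bar>dot S v z\<bar> \<partial>gauss S)"
proof -
  interpret prob_space "gauss S" by (rule prob_space_gauss)
  interpret N: prob_space "density lborel std_normal_density" by (rule prob_space_normal_density) simp
  interpret P: product_sigma_finite "\<lambda>_. density lborel std_normal_density" by standard
  have int: "integrable (gauss S) (\<lambda>z. iexp (dot S v z))"
    using S by (intro integrable_const_bound[where B=1]) (auto simp: norm_exp_i_times)
  have "(\<integral>z. iexp (dot S v z) \<partial>gauss S) = (\<integral>z. (\<Prod>s\<in>S. iexp (v s * z s)) \<partial>gauss S)"
    by (simp add: dot_def sum_distrib_left exp_sum[OF S])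
  also have "\<dots> = (\<Prod>s\<in>S. \<integral>z. iexp (v s * z) \<partial>density lborel std_normal_density)"
    by (rule P.product_integral_prod) (use S in \<open>auto intro!: N.integrable_const_bound[where B=1] simp: norm_exp_i_times\<close>)
  also have "\<dots> = (\<Prod>s\<in>S. complex_of_real (exp (- (v s)\<^sup>2 / 2)))"
    using char_std_normal_distribution by (simp add: char_def fun_eq_iff)
  also have "\<dots> = complex_of_real (exp (\<Sum>s\<in>S. - (v s)\<^sup>2 / 2))"
    by (simp add: exp_sum[OF S])
  also have "(\<Sum>s\<in>S. - (v s)\<^sup>2 / 2) = - 1/2"
    using v by (simp add: dot_def sum_negf sum_divide_distrib[symmetric] power2_eq_square)
  finally have "Re (\<integral>z. iexp (dot S v z) \<partial>gauss S) = exp (-1/2)" by simp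
  then have c: "(\<integral>z. cos (dot S v z) \<partial>gauss S) = exp (-1/2)"
    using int by (subst (asm) integral_Re[symmetric]) (auto simp: Re_exp)
  have ci: "integrable (gauss S) (\<lambda>z. cos (dot S v z))"
    using S by (intro integrable_const_bound[where B=1]) auto
  have ai: "integrable (gauss S) (\<lambda>z. \<bar>dot S v z\<bar>)"
    using gauss_square_bound(3)[OF S] v by (intro integrable_abs) auto
  have cb: "1 - cos u \<le> \<bar>u\<bar>" for u :: real
  proof -
    have "1 - cos u = 2 * (sin (u/2))\<^sup>2" using cos_double_sin[of "u/2"] by simp
    also have "\<dots> \<le> 2 * \<bar>sin (u/2)\<bar>"
      using mult_left_le[of "\<bar>sin (u/2)\<bar>" "\<bar>sin (u/2)\<bar>"] by (simp add: power2_eq_square)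
    also have "\<dots> \<le> 2 * \<bar>u/2\<bar>" using abs_sin_x_le_abs_x[of "u/2"] by simp
    finally show ?thesis by simp
  qed
  have "1 - exp (-1/2) = (\<integral>z. 1 - cos (dot S v z) \<partial>gauss S)"
    using ci c by (subst Bochner_Integration.integral_diff) (auto simp: prob_space)
  also have "\<dots> \<le> (\<integral>z. \<bar>dot S v z\<bar> \<partial>gauss S)"
    using ci ai cb by (intro integral_mono) auto
  finally have "1 - exp (-1/2) \<le> (\<integral>z. \<bar>dot S v z\<bar> \<partial>gauss S)" .
  moreover have "exp (-1/2) \<le> (2/3 :: real)"
  proof -
    have "3/2 \<le> exp (1/2 :: real)" using exp_ge_add_one_self[of "1/2::real"] by simp
    then show ?thesis by (simp add: exp_minus field_simps)
  qed
  ultimately show ?thesis by linarith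
qed

subsection \<open>Concentration of Gaussian maxima\<close>

lemma Max_image_attained:
  fixes g :: "nat \<Rightarrow> real"
  assumes "0 < m"
  shows "\<exists>i<m. Max (g ` {..<m}) = g i"
proof -
  have "Max (g ` {..<m}) \<in> g ` {..<m}" using assms by (intro Max_in) auto
  then show ?thesis by auto
qed

text \<open>The functional that is maximal at x is frozen: at the rotated point it bounds f from
  below, so the increment is at most (1 - c) f x plus d times one Gaussian linear form in y.
  Integrating over y first leaves x only in the small drift.\<close>

lemma gauss_increment:
  fixes v :: "nat \<Rightarrow> 'i \<Rightarrow> real"
  assumes S: "finite S" and m: "0 < m" and v: "\<And>i. i < m \<Longrightarrow> dot S (v i) (v i) \<le> 1" and k: "0 \<le> \<kappa>"
  defines "f \<equiv> \<lambda>z. Max ((\<lambda>i. dot S (v i) z) ` {..<m})"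
  shows "(\<integral>\<^sup>+x. \<integral>\<^sup>+y. ennreal (exp (\<kappa> * (f x - f (\<lambda>s\<in>S. c * x s - d * y s)))) \<partial>gauss S \<partial>gauss S)
      \<le> ennreal (exp (\<kappa>\<^sup>2 * d\<^sup>2 / 2)) * (\<integral>\<^sup>+x. ennreal (exp (\<kappa> * (1 - c) * f x)) \<partial>gauss S)"
proof -
  have fm[measurable]: "f \<in> borel_measurable (gauss S)"
    unfolding f_def using S by (intro borel_measurable_Max) auto
  have ge: "dot S (v i) z \<le> f z" if "i < m" for i z
    unfolding f_def using that by (intro Max_ge) auto
  have ex: "\<exists>i<m. f z = dot S (v i) z" for z
    unfolding f_def using m by (rule Max_image_attained)
  have "(\<integral>\<^sup>+y. ennreal (exp (\<kappa> * (f x - f (\<lambda>s\<in>S. c * x s - d * y s)))) \<partial>gauss S)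
      \<le> ennreal (exp (\<kappa>\<^sup>2 * d\<^sup>2 / 2)) * ennreal (exp (\<kappa> * (1 - c) * f x))" for x
  proof -
    obtain i where i: "i < m" "f x = dot S (v i) x" using ex by blast
    have "f x - f (\<lambda>s\<in>S. c * x s - d * y s) \<le> (1 - c) * f x + d * dot S (v i) y" for y
    proof -
      have "f (\<lambda>s\<in>S. c * x s - d * y s) \<ge> dot S (v i) (\<lambda>s\<in>S. c * x s - d * y s)" by (rule ge) fact
      also have "dot S (v i) (\<lambda>s\<in>S. c * x s - d * y s) = c * f x - d * dot S (v i) y"
        by (simp add: dot_linear i)
      finally have "c * f x - d * dot S (v i) y \<le> f (\<lambda>s\<in>S. c * x s - d * y s)" .
      then show ?thesis by (simp add: left_diff_distrib)
    qed
    then have "\<kappa> * (f x - f (\<lambda>s\<in>S. c * x s - d * y s)) \<le> \<kappa> * (1 - c) * f x + (\<kappa> * d) * dot S (v i) y" for y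
      using mult_left_mono[OF _ k] by (fastforce simp: algebra_simps)
    then have "(\<integral>\<^sup>+y. ennreal (exp (\<kappa> * (f x - f (\<lambda>s\<in>S. c * x s - d * y s)))) \<partial>gauss S)
      \<le> (\<integral>\<^sup>+y. ennreal (exp (\<kappa> * (1 - c) * f x)) * ennreal (exp ((\<kappa> * d) * dot S (v i) y)) \<partial>gauss S)"
      by (intro nn_integral_mono) (auto simp: ennreal_mult[symmetric] exp_add[symmetric])
    also have "\<dots> = ennreal (exp (\<kappa> * (1 - c) * f x)) * ennreal (exp ((\<kappa> * d)\<^sup>2 * dot S (v i) (v i) / 2))"
      using S by (subst nn_integral_cmult) (auto simp: gauss_mgf)
    also have "\<dots> \<le> ennreal (exp (\<kappa> * (1 - c) * f x)) * ennreal (exp (\<kappa>\<^sup>2 * d\<^sup>2 / 2))"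
      using mult_left_mono[OF v[OF i(1)], of "(\<kappa> * d)\<^sup>2"]
      by (intro mult_left_mono ennreal_leI) (auto simp: power_mult_distrib)
    finally show ?thesis by (simp add: mult.commute)
  qed
  then have "(\<integral>\<^sup>+x. \<integral>\<^sup>+y. ennreal (exp (\<kappa> * (f x - f (\<lambda>s\<in>S. c * x s - d * y s)))) \<partial>gauss S \<partial>gauss S)
    \<le> (\<integral>\<^sup>+x. ennreal (exp (\<kappa>\<^sup>2 * d\<^sup>2 / 2)) * ennreal (exp (\<kappa> * (1 - c) * f x)) \<partial>gauss S)"
    by (intro nn_integral_mono)
  also have "\<dots> = ennreal (exp (\<kappa>\<^sup>2 * d\<^sup>2 / 2)) * (\<integral>\<^sup>+x. ennreal (exp (\<kappa> * (1 - c) * f x)) \<partial>gauss S)"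
    by (rule nn_integral_cmult) measurable
  finally show ?thesis .
qed

text \<open>By convexity exp(a u) \<le> 1 + a exp u, so m enters only together with the factor a and
  the bound tends to 1 as a does to 0. A direct union bound would keep the full factor m.\<close>

lemma gauss_exp_Max:
  fixes v :: "nat \<Rightarrow> 'i \<Rightarrow> real"
  assumes S: "finite S" and m: "0 < m" and v: "\<And>i. i < m \<Longrightarrow> dot S (v i) (v i) \<le> 1" and a: "0 \<le> a" "a \<le> 1"
  defines "f \<equiv> \<lambda>z. Max ((\<lambda>i. dot S (v i) z) ` {..<m})"
  shows "(\<integral>\<^sup>+x. ennreal (exp (a * f x)) \<partial>gauss S) \<le> ennreal (1 + a * (real m * 2))"
proof -
  interpret prob_space "gauss S" by (rule prob_space_gauss)
  have ex: "\<exists>i<m. f z = dot S (v i) z" for z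
    unfolding f_def using m by (rule Max_image_attained)
  have conv: "exp (a * u) \<le> 1 + a * exp u" for u :: real
  proof -
    have "exp ((1 - a) *\<^sub>R 0 + a *\<^sub>R u) \<le> (1 - a) * exp 0 + a * exp u"
      by (rule convex_onD[OF exp_convex]) (use a in auto)
    then show ?thesis using a by simp
  qed
  have "exp (f z) \<le> (\<Sum>i<m. exp (dot S (v i) z))" for z
    using ex[of z] by (auto intro!: member_le_sum)
  then have "exp (a * f z) \<le> 1 + a * (\<Sum>i<m. exp (dot S (v i) z))" for z
    using order_trans[OF conv[of "f z"]] a by (simp add: mult_left_mono)
  then have "(\<integral>\<^sup>+x. ennreal (exp (a * f x)) \<partial>gauss S)
     \<le> (\<integral>\<^sup>+z. 1 + ennreal a * (\<Sum>i<m. ennreal (exp (1 * dot S (v i) z))) \<partial>gauss S)"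
    using a by (intro nn_integral_mono) (auto simp: ennreal_mult[symmetric] ennreal_1[symmetric] ennreal_plus[symmetric] sum_nonneg simp del: ennreal_1 ennreal_plus)
  also have "\<dots> = 1 + ennreal a * (\<Sum>i<m. ennreal (exp (1\<^sup>2 * dot S (v i) (v i) / 2)))"
    using S by (simp only: gauss_mgf[OF S, symmetric])
       (subst nn_integral_add; simp add: nn_integral_cmult nn_integral_sum emeasure_space_1 del: sum_ennreal)
  also have "\<dots> \<le> 1 + ennreal a * (\<Sum>i<m. ennreal 2)"
  proof (intro add_left_mono mult_left_mono sum_mono ennreal_leI)
    fix i assume "i \<in> {..<m}"
    then have "exp (1\<^sup>2 * dot S (v i) (v i) / 2) \<le> exp (1/2)" using v by auto
    also have "\<dots> \<le> (2::real)" using exp_bound_half[of "1/2::real"] by simp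
    finally show "exp (1\<^sup>2 * dot S (v i) (v i) / 2) \<le> 2" .
  qed simp
  also have "\<dots> = ennreal (1 + a * (real m * 2))"
    using a by (simp add: sum_ennreal ennreal_mult[symmetric] ennreal_1[symmetric] ennreal_plus[symmetric] ennreal_of_nat_eq_real_of_nat del: ennreal_1 ennreal_plus flip: ennreal_numeral)
  finally show ?thesis .
qed

text \<open>Moving from an independent copy \<^term>\<open>x\<close> to \<^term>\<open>y\<close> along a circle in \<^term>\<open>n\<close> small rotations
  (Maurey and Pisier): for a maximum of linear functions each step is controlled by the
  maximising functional at its end point, so no gradient is needed.\<close>

lemma gauss_symmetrised_mgf:
  fixes v :: "nat \<Rightarrow> 'i \<Rightarrow> real"
  assumes S: "finite S" and m: "0 < m" and v: "\<And>i. i < m \<Longrightarrow> dot S (v i) (v i) \<le> 1" and l: "0 \<le> \<beta>"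
  defines "f \<equiv> \<lambda>z. Max ((\<lambda>i. dot S (v i) z) ` {..<m})"
  shows "(\<integral>\<^sup>+x. \<integral>\<^sup>+y. ennreal (exp (\<beta> * (f y - f x))) \<partial>gauss S \<partial>gauss S) \<le> ennreal (exp (\<beta>\<^sup>2 * pi\<^sup>2 / 8))"
proof -
  interpret prob_space "gauss S" by (rule prob_space_gauss)
  let ?I = "\<integral>\<^sup>+x. \<integral>\<^sup>+y. ennreal (exp (\<beta> * (f y - f x))) \<partial>gauss S \<partial>gauss S"
  have fm[measurable]: "f \<in> borel_measurable (gauss S)"
    unfolding f_def using S by (intro borel_measurable_Max) auto
  have fr: "f (restrict z S) = f z" for z unfolding f_def by simp
  have fcong: "f z = f z'" if "\<And>s. s \<in> S \<Longrightarrow> z s = z' s" for z z'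
    using that fr by (metis restrict_ext)
  have bnd: "?I \<le> ennreal (exp (\<beta>\<^sup>2 * pi\<^sup>2 / 8) * (1 + (\<beta> * pi\<^sup>2 / (8 * real n)) * (real m * 2)))"
    if n: "0 < n" "\<beta> * pi\<^sup>2 / (8 * real n) \<le> 1" for n
  proof -
    \<comment> \<open>The quarter turn from x to y is cut into n equal arcs with end points
      \<open>u 0\<close> and \<open>u n\<close>.\<close>
    define h where "h = pi / (2 * real n)"
    define u where "u j x y = (\<lambda>s\<in>S. cos (real j * h) * x s + sin (real j * h) * y s)" for j :: nat and x y :: "'i \<Rightarrow> real"
    have u0: "f (u 0 x y) = f x" for x y by (simp add: u_def fr)
    have un: "f (u n x y) = f y" for x y
    proof -
      have "real n * h = pi / 2" using n by (simp add: h_def)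
      then have "u n x y = (\<lambda>s\<in>S. cos (pi / 2) * x s + sin (pi / 2) * y s)" by (simp only: u_def)
      then show ?thesis by (simp add: fr)
    qed
    have um: "(\<lambda>(x, y). u j x y) \<in> gauss S \<Otimes>\<^sub>M gauss S \<rightarrow>\<^sub>M gauss S" for j
      unfolding u_def case_prod_beta
      by (rule measurable_restrict) (use S in auto)
    have fum[measurable]: "(\<lambda>(x, y). f (u j x y)) \<in> borel_measurable (gauss S \<Otimes>\<^sub>M gauss S)" for j
      using measurable_compose[OF um fm] by (simp add: case_prod_beta)
    \<comment> \<open>Jensen with weights 1/n multiplies the exponent of each increment by n, while
      an increment is of order 1/n, so the two effects balance.\<close>
    define \<kappa> where "\<kappa> = \<beta> * real n"
    have k0: "0 \<le> \<kappa>" using l by (simp add: \<kappa>_def)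
    have jensen: "exp (\<beta> * (f y - f x)) \<le> (\<Sum>j<n. (1 / real n) * exp (\<kappa> * (f (u (Suc j) x y) - f (u j x y))))" for x y
    proof -
      have "exp (\<Sum>j<n. (1 / real n) *\<^sub>R (\<kappa> * (f (u (Suc j) x y) - f (u j x y))))
          \<le> (\<Sum>j<n. (1 / real n) * exp (\<kappa> * (f (u (Suc j) x y) - f (u j x y))))"
        by (rule convex_on_sum[OF _ _ exp_convex]) (use n in auto)
      moreover have "(\<Sum>j<n. (1 / real n) *\<^sub>R (\<kappa> * (f (u (Suc j) x y) - f (u j x y)))) = \<beta> * (\<Sum>j<n. f (u (Suc j) x y) - f (u j x y))"
        using n by (simp add: \<kappa>_def sum_distrib_left)
      moreover have "(\<Sum>j<n. f (u (Suc j) x y) - f (u j x y)) = f y - f x"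
        using sum_lessThan_telescope[of "\<lambda>j. f (u j x y)" n] by (simp only: u0 un)
      ultimately show ?thesis by simp
    qed
    define B where "B = ennreal (exp (\<kappa>\<^sup>2 * (sin h)\<^sup>2 / 2)) * (\<integral>\<^sup>+x. ennreal (exp (\<kappa> * (1 - cos h) * f x)) \<partial>gauss S)"
    have stepj: "(\<integral>\<^sup>+x. \<integral>\<^sup>+y. ennreal (exp (\<kappa> * (f (u (Suc j) x y) - f (u j x y)))) \<partial>gauss S \<partial>gauss S) \<le> B" for j
    proof -
      let ?\<theta> = "real (Suc j) * h"
      define G where "G X Y = ennreal (exp (\<kappa> * (f X - f (\<lambda>s\<in>S. cos h * X s - sin h * Y s))))" for X Y
      have wm: "(\<lambda>(x, y). (\<lambda>s\<in>S. cos h * x s - sin h * y s)) \<in> gauss S \<Otimes>\<^sub>M gauss S \<rightarrow>\<^sub>M gauss S"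
        unfolding case_prod_beta by (rule measurable_restrict) (use S in auto)
      have Gm: "case_prod G \<in> borel_measurable (gauss S \<Otimes>\<^sub>M gauss S)"
      proof -
        have [measurable]: "(\<lambda>p. f (\<lambda>s\<in>S. cos h * fst p s - sin h * snd p s)) \<in> borel_measurable (gauss S \<Otimes>\<^sub>M gauss S)"
          using measurable_compose[OF wm fm] by (simp add: case_prod_beta)
        show ?thesis unfolding G_def case_prod_beta by measurable
      qed
      have trig: "cos (\<theta> - h) * a + sin (\<theta> - h) * b
          = cos h * (cos \<theta> * a + sin \<theta> * b) - sin h * (cos \<theta> * b - sin \<theta> * a)" for \<theta> a b
        by (simp add: cos_diff sin_diff algebra_simps)
      have th: "real j * h = ?\<theta> - h" by (simp add: algebra_simps)
      have "ennreal (exp (\<kappa> * (f (u (Suc j) x y) - f (u j x y))))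
        = G (\<lambda>s\<in>S. cos ?\<theta> * x s + sin ?\<theta> * y s) (\<lambda>s\<in>S. cos ?\<theta> * y s - sin ?\<theta> * x s)" for x y
      proof -
        have "f (u j x y) = f (\<lambda>s\<in>S. cos h * (cos ?\<theta> * x s + sin ?\<theta> * y s) - sin h * (cos ?\<theta> * y s - sin ?\<theta> * x s))"
          unfolding u_def th by (rule fcong) (simp only: restrict_apply' trig)
        also have "\<dots> = f (\<lambda>s\<in>S. cos h * (\<lambda>s\<in>S. cos ?\<theta> * x s + sin ?\<theta> * y s) s - sin h * (\<lambda>s\<in>S. cos ?\<theta> * y s - sin ?\<theta> * x s) s)"
          by (rule fcong) simp
        finally show ?thesis unfolding G_def by (simp only: u_def)
      qed
      then have "(\<integral>\<^sup>+x. \<integral>\<^sup>+y. ennreal (exp (\<kappa> * (f (u (Suc j) x y) - f (u j x y)))) \<partial>gauss S \<partial>gauss S)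
         = (\<integral>\<^sup>+x. \<integral>\<^sup>+y. G x y \<partial>gauss S \<partial>gauss S)"
        using gauss_rotation[OF S _ Gm, of "cos ?\<theta>" "sin ?\<theta>"] by (simp add: sin_cos_squared_add3 power2_eq_square)
      also have "\<dots> \<le> B"
        unfolding G_def B_def f_def by (rule gauss_increment[OF S m v k0])
      finally show ?thesis .
    qed
    have hn: "real n * h = pi / 2" "0 \<le> h" using n by (simp_all add: h_def)
    have c1: "1 - cos h \<le> h\<^sup>2 / 2"
    proof -
      have "1 - cos h = 2 * (sin (h/2))\<^sup>2" using cos_double_sin[of "h/2"] by simp
      also have "(sin (h/2))\<^sup>2 \<le> (h/2)\<^sup>2"
        using power_mono[OF abs_sin_x_le_abs_x[of "h/2"], of 2] by (simp add: power_divide)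
      finally show ?thesis by (simp add: power_divide)
    qed
    have "?I \<le> (\<integral>\<^sup>+x. \<integral>\<^sup>+y. (\<Sum>j<n. ennreal (1 / real n) * ennreal (exp (\<kappa> * (f (u (Suc j) x y) - f (u j x y))))) \<partial>gauss S \<partial>gauss S)"
      using jensen by (intro nn_integral_mono) (auto simp: ennreal_mult[symmetric] intro!: ennreal_leI)
    also have "\<dots> = (\<Sum>j<n. ennreal (1 / real n) * (\<integral>\<^sup>+x. \<integral>\<^sup>+y. ennreal (exp (\<kappa> * (f (u (Suc j) x y) - f (u j x y)))) \<partial>gauss S \<partial>gauss S))"
    proof -
      have "(\<integral>\<^sup>+y. (\<Sum>j<n. ennreal (1 / real n) * ennreal (exp (\<kappa> * (f (u (Suc j) x y) - f (u j x y))))) \<partial>gauss S)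
         = (\<Sum>j<n. ennreal (1 / real n) * (\<integral>\<^sup>+y. ennreal (exp (\<kappa> * (f (u (Suc j) x y) - f (u j x y)))) \<partial>gauss S))"
        if "x \<in> space (gauss S)" for x
      proof -
        have [measurable]: "(\<lambda>y. f (u j x y)) \<in> borel_measurable (gauss S)" for j
          using measurable_Pair2[OF fum that] by simp
        show ?thesis by (subst nn_integral_sum) (auto simp: nn_integral_cmult)
      qed
      then have "(\<integral>\<^sup>+x. \<integral>\<^sup>+y. (\<Sum>j<n. ennreal (1 / real n) * ennreal (exp (\<kappa> * (f (u (Suc j) x y) - f (u j x y))))) \<partial>gauss S \<partial>gauss S)
        = (\<integral>\<^sup>+x. (\<Sum>j<n. ennreal (1 / real n) * (\<integral>\<^sup>+y. ennreal (exp (\<kappa> * (f (u (Suc j) x y) - f (u j x y)))) \<partial>gauss S)) \<partial>gauss S)"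
        by (intro nn_integral_cong) auto
      also have "\<dots> = (\<Sum>j<n. ennreal (1 / real n) * (\<integral>\<^sup>+x. \<integral>\<^sup>+y. ennreal (exp (\<kappa> * (f (u (Suc j) x y) - f (u j x y)))) \<partial>gauss S \<partial>gauss S))"
        by (subst nn_integral_sum) (auto simp: nn_integral_cmult)
      finally show ?thesis .
    qed
    also have "\<dots> \<le> (\<Sum>j<n. ennreal (1 / real n) * B)"
      by (intro sum_mono mult_left_mono stepj) auto
    also have "\<dots> = B"
      using n by (simp add: ennreal_of_nat_eq_real_of_nat mult.assoc[symmetric] ennreal_mult[symmetric])
    also have "B \<le> ennreal (exp (\<beta>\<^sup>2 * pi\<^sup>2 / 8)) * ennreal (1 + (\<beta> * pi\<^sup>2 / (8 * real n)) * (real m * 2))"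
      unfolding B_def
    proof (rule mult_mono)
      have "\<bar>sin h\<bar> \<le> h" using abs_sin_x_le_abs_x[of h] hn by simp
      then have "(sin h)\<^sup>2 \<le> h\<^sup>2" using power_mono[of "\<bar>sin h\<bar>" h 2] by simp
      then have "\<kappa>\<^sup>2 * (sin h)\<^sup>2 \<le> \<kappa>\<^sup>2 * h\<^sup>2" by (rule mult_left_mono) simp
      also have "\<dots> = \<beta>\<^sup>2 * (real n * h)\<^sup>2" by (simp add: \<kappa>_def power_mult_distrib)
      also have "\<dots> = \<beta>\<^sup>2 * pi\<^sup>2 / 4" unfolding hn by (simp add: power_divide)
      finally show "ennreal (exp (\<kappa>\<^sup>2 * (sin h)\<^sup>2 / 2)) \<le> ennreal (exp (\<beta>\<^sup>2 * pi\<^sup>2 / 8))" by (intro ennreal_leI) simp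
      let ?a = "\<kappa> * (1 - cos h)"
      have "?a \<le> \<kappa> * (h\<^sup>2 / 2)" by (intro mult_left_mono c1 k0)
      also have "\<dots> = \<beta> * pi\<^sup>2 / (8 * real n)" using n by (simp add: \<kappa>_def h_def power2_eq_square field_simps)
      finally have a: "?a \<le> \<beta> * pi\<^sup>2 / (8 * real n)" .
      have a0: "0 \<le> ?a" using k0 by (intro mult_nonneg_nonneg) auto
      have "(\<integral>\<^sup>+x. ennreal (exp (?a * f x)) \<partial>gauss S) \<le> ennreal (1 + ?a * (real m * 2))"
        unfolding f_def by (rule gauss_exp_Max[OF S m v a0 order_trans[OF a n(2)]])
      also have "\<dots> \<le> ennreal (1 + (\<beta> * pi\<^sup>2 / (8 * real n)) * (real m * 2))"
        by (intro ennreal_leI add_left_mono mult_right_mono a) auto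
      finally show "(\<integral>\<^sup>+x. ennreal (exp (?a * f x)) \<partial>gauss S) \<le> ennreal (1 + (\<beta> * pi\<^sup>2 / (8 * real n)) * (real m * 2))" .
    qed auto
    also have "\<dots> = ennreal (exp (\<beta>\<^sup>2 * pi\<^sup>2 / 8) * (1 + (\<beta> * pi\<^sup>2 / (8 * real n)) * (real m * 2)))"
      using l by (simp add: ennreal_mult)
    finally show ?thesis .
  qed
  \<comment> \<open>As n grows, the drift coefficient \<kappa> (1 - cos h) is of order 1/n, and with
    it the only term containing m vanishes.\<close>
  have ev: "eventually (\<lambda>n. 0 < n \<and> \<beta> * pi\<^sup>2 / (8 * real n) \<le> 1) sequentially"
  proof (rule eventually_conj)
    have "(\<lambda>n. \<beta> * pi\<^sup>2 / (8 * real n)) \<longlonglongrightarrow> 0" by real_asymp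
    then have "eventually (\<lambda>n. \<beta> * pi\<^sup>2 / (8 * real n) < 1) sequentially" by (rule order_tendstoD) simp
    then show "eventually (\<lambda>n. \<beta> * pi\<^sup>2 / (8 * real n) \<le> 1) sequentially" by eventually_elim simp
  qed (rule eventually_gt_at_top)
  have lim: "(\<lambda>n. ennreal (exp (\<beta>\<^sup>2 * pi\<^sup>2 / 8) * (1 + (\<beta> * pi\<^sup>2 / (8 * real n)) * (real m * 2)))) \<longlonglongrightarrow> ennreal (exp (\<beta>\<^sup>2 * pi\<^sup>2 / 8) * (1 + 0 * (real m * 2)))"
    by (intro tendsto_ennrealI tendsto_intros) real_asymp
  show ?thesis
    using tendsto_lowerbound[OF lim eventually_mono[OF ev bnd]] by simp
qed

text \<open>The independent copy is removed by Jensen: the mean of exp(\<beta> (E f - f x)) is at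
  least 1, so multiplying by it turns the centred exponential moment into the symmetrised
  one.\<close>

lemma gauss_Max_concentration:
  fixes v :: "nat \<Rightarrow> 'i \<Rightarrow> real"
  assumes S: "finite S" and m: "0 < m" and v: "\<And>i. i < m \<Longrightarrow> dot S (v i) (v i) \<le> 1" and t: "0 \<le> t"
  defines "f \<equiv> \<lambda>z. Max ((\<lambda>i. dot S (v i) z) ` {..<m})"
  shows "integrable (gauss S) f"
    and "emeasure (gauss S) {z \<in> space (gauss S). f z \<ge> (\<integral>z. f z \<partial>gauss S) + t} \<le> ennreal (exp (- t\<^sup>2 / 5))"
proof -
  interpret prob_space "gauss S" by (rule prob_space_gauss)
  have fm[measurable]: "f \<in> borel_measurable (gauss S)"
    unfolding f_def using S by (intro borel_measurable_Max) auto
  have ex: "\<exists>i<m. f z = dot S (v i) z" for z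
    unfolding f_def using m by (rule Max_image_attained)
  show fi: "integrable (gauss S) f"
  proof (rule Bochner_Integration.integrable_bound)
    show "integrable (gauss S) (\<lambda>z. \<Sum>i<m. \<bar>dot S (v i) z\<bar>)"
      using gauss_square_bound(3)[OF S v] by auto
    show "AE z in gauss S. norm (f z) \<le> norm (\<Sum>i<m. \<bar>dot S (v i) z\<bar>)"
    proof (rule AE_I2)
      fix z
      obtain i where "i < m" "f z = dot S (v i) z" using ex by blast
      moreover have "\<bar>dot S (v i) z\<bar> \<le> (\<Sum>i<m. \<bar>dot S (v i) z\<bar>)" using \<open>i < m\<close> by (intro member_le_sum) auto
      ultimately show "norm (f z) \<le> norm (\<Sum>i<m. \<bar>dot S (v i) z\<bar>)" by simp
    qed
  qed simp
  let ?E = "\<integral>z. f z \<partial>gauss S"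
  \<comment> \<open>Jensen in the form exp u \<ge> 1 + u; a non-integrable exponential has an
    infinite integral.\<close>
  have one: "1 \<le> (\<integral>\<^sup>+x. ennreal (exp (\<beta> * (?E - f x))) \<partial>gauss S)" for \<beta>
  proof (cases "integrable (gauss S) (\<lambda>x. exp (\<beta> * (?E - f x)))")
    case True
    have "(\<integral>x. 1 + \<beta> * (?E - f x) \<partial>gauss S) = (\<integral>x. 1 + \<beta> * ?E \<partial>gauss S) - (\<integral>x. \<beta> * f x \<partial>gauss S)"
      using fi by (subst Bochner_Integration.integral_diff[symmetric]) (auto simp: algebra_simps)
    also have "\<dots> = 1"
      by (simp add: prob_space)
    finally have "1 = (\<integral>x. 1 + \<beta> * (?E - f x) \<partial>gauss S)" by simp
    also have "\<dots> \<le> (\<integral>x. exp (\<beta> * (?E - f x)) \<partial>gauss S)"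
      using fi True by (intro integral_mono exp_ge_add_one_self) auto
    finally show ?thesis using True by (subst nn_integral_eq_integral) auto
  next
    case False
    then have "(\<integral>\<^sup>+x. ennreal (exp (\<beta> * (?E - f x))) \<partial>gauss S) = \<infinity>"
    proof -
      have "\<not> (\<integral>\<^sup>+x. ennreal (exp (\<beta> * (?E - f x))) \<partial>gauss S) < \<infinity>"
      proof
        assume "(\<integral>\<^sup>+x. ennreal (exp (\<beta> * (?E - f x))) \<partial>gauss S) < \<infinity>"
        then have "integrable (gauss S) (\<lambda>x. exp (\<beta> * (?E - f x)))"
          using fm by (intro integrableI_nonneg) auto
        with False show False by contradiction
      qed
      then show ?thesis by (simp add: not_less top_unique)
    qed
    then show ?thesis by simp
  qed
  \<comment> \<open>Minimises -\<beta> t + 5 \<beta>^2 / 4, the exponent after pi^2 \<le> 10; the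
    minimum is -t^2 / 5.\<close>
  define \<beta> where "\<beta> = 2 * t / 5"
  have l0: "0 \<le> \<beta>" using t by (simp add: \<beta>_def)
  let ?A = "\<integral>\<^sup>+x. ennreal (exp (\<beta> * (?E - f x))) \<partial>gauss S"
  let ?B = "\<integral>\<^sup>+y. ennreal (exp (\<beta> * (f y - ?E))) \<partial>gauss S"
  have pr: "ennreal (exp (\<beta> * (?E - f x))) * ennreal (exp (\<beta> * (f y - ?E))) = ennreal (exp (\<beta> * (f y - f x)))" for x y
    unfolding ennreal_mult[symmetric, OF exp_ge_zero exp_ge_zero] exp_add[symmetric] by (simp only: distrib_left[symmetric]) simp
  have "?B = 1 * ?B" by simp
  also have "\<dots> \<le> ?A * ?B" by (rule mult_right_mono[OF one]) simp
  also have "\<dots> = (\<integral>\<^sup>+x. ennreal (exp (\<beta> * (?E - f x))) * ?B \<partial>gauss S)"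
    by (rule nn_integral_multc[symmetric]) measurable
  also have "\<dots> = (\<integral>\<^sup>+x. \<integral>\<^sup>+y. ennreal (exp (\<beta> * (?E - f x))) * ennreal (exp (\<beta> * (f y - ?E))) \<partial>gauss S \<partial>gauss S)"
    by (intro nn_integral_cong nn_integral_cmult[symmetric]) measurable
  also have "\<dots> = (\<integral>\<^sup>+x. \<integral>\<^sup>+y. ennreal (exp (\<beta> * (f y - f x))) \<partial>gauss S \<partial>gauss S)"
    by (simp only: pr)
  also have "\<dots> \<le> ennreal (exp (\<beta>\<^sup>2 * pi\<^sup>2 / 8))"
    unfolding f_def by (rule gauss_symmetrised_mgf[OF S m v l0])
  finally have mgf: "(\<integral>\<^sup>+y. ennreal (exp (\<beta> * (f y - ?E))) \<partial>gauss S) \<le> ennreal (exp (\<beta>\<^sup>2 * pi\<^sup>2 / 8))" .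
  have "emeasure (gauss S) {z \<in> space (gauss S). f z \<ge> ?E + t}
      \<le> emeasure (gauss S) {z \<in> space (gauss S). 1 \<le> ennreal (exp (- (\<beta> * t))) * ennreal (exp (\<beta> * (f z - ?E)))}"
  proof (intro emeasure_mono subsetI CollectI conjI)
    fix z assume z: "z \<in> {z \<in> space (gauss S). f z \<ge> ?E + t}"
    then have "0 \<le> - (\<beta> * t) + \<beta> * (f z - ?E)"
      using mult_left_mono[of t "f z - ?E" \<beta>] l0 by auto
    then have "1 \<le> exp (- (\<beta> * t)) * exp (\<beta> * (f z - ?E))" by (simp add: exp_add[symmetric])
    then show "1 \<le> ennreal (exp (- (\<beta> * t))) * ennreal (exp (\<beta> * (f z - ?E)))"
      by (simp add: ennreal_mult[symmetric])
  qed auto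
  also have "\<dots> \<le> ennreal (exp (- (\<beta> * t))) * (\<integral>\<^sup>+z. ennreal (exp (\<beta> * (f z - ?E))) * indicator (space (gauss S)) z \<partial>gauss S)"
    using nn_integral_Markov_inequality[of "\<lambda>z. ennreal (exp (\<beta> * (f z - ?E)))" "space (gauss S)" "gauss S" "ennreal (exp (- (\<beta> * t)))"] by simp
  also have "(\<integral>\<^sup>+z. ennreal (exp (\<beta> * (f z - ?E))) * indicator (space (gauss S)) z \<partial>gauss S) = (\<integral>\<^sup>+y. ennreal (exp (\<beta> * (f y - ?E))) \<partial>gauss S)"
    by (intro nn_integral_cong) auto
  also have "ennreal (exp (- (\<beta> * t))) * \<dots> \<le> ennreal (exp (- (\<beta> * t))) * ennreal (exp (\<beta>\<^sup>2 * pi\<^sup>2 / 8))"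
    by (intro mult_left_mono mgf) auto
  also have "\<dots> = ennreal (exp (- (\<beta> * t) + \<beta>\<^sup>2 * pi\<^sup>2 / 8))" by (simp add: ennreal_mult[symmetric] exp_add[symmetric])
  also have "\<dots> \<le> ennreal (exp (- t\<^sup>2 / 5))"
  proof (intro ennreal_leI, simp only: exp_le_cancel_iff)
    have "pi \<le> 3.15" using pi_approx by simp
    then have "pi\<^sup>2 \<le> 3.15\<^sup>2" using pi_gt_zero by (intro power_mono) auto
    then have "pi\<^sup>2 \<le> 10" by (simp add: power2_eq_square)
    then have "\<beta>\<^sup>2 * pi\<^sup>2 \<le> \<beta>\<^sup>2 * 10" by (intro mult_left_mono) auto
    then have "- (\<beta> * t) + \<beta>\<^sup>2 * pi\<^sup>2 / 8 \<le> - (\<beta> * t) + \<beta>\<^sup>2 * 10 / 8" by linarith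
    also have "\<dots> = - t\<^sup>2 / 5" by (simp add: \<beta>_def power2_eq_square field_simps)
    finally show "- (\<beta> * t) + \<beta>\<^sup>2 * pi\<^sup>2 / 8 \<le> - t\<^sup>2 / 5" .
  qed
  finally show "emeasure (gauss S) {z \<in> space (gauss S). f z \<ge> ?E + t} \<le> ennreal (exp (- t\<^sup>2 / 5))" .
qed

subsection \<open>Finite-dimensional linear algebra\<close>

text \<open>Two-term Cauchy-Schwarz without square roots; it adds one orthogonal direction in the
  Gram-Schmidt induction.\<close>

lemma sum_square_combine:
  fixes p q A B P Q :: real
  assumes "p\<^sup>2 \<le> A * P" "q\<^sup>2 \<le> B * Q" "0 \<le> A" "0 \<le> B" "0 \<le> P" "0 \<le> Q"
  shows "(p + q)\<^sup>2 \<le> (A + B) * (P + Q)"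
proof -
  have "(p * q)\<^sup>2 \<le> (A * P) * (B * Q)"
    using assms by (simp only: power_mult_distrib) (intro mult_mono, auto)
  then have "(2 * (p * q))\<^sup>2 \<le> 4 * ((A * P) * (B * Q))" by (simp add: power_mult_distrib)
  also have "\<dots> \<le> (A * Q + B * P)\<^sup>2"
    using zero_le_power2[of "A * Q - B * P"] by (simp add: power2_eq_square algebra_simps)
  finally have "2 * (p * q) \<le> A * Q + B * P"
    by (rule power2_le_imp_le) (use assms in auto)
  then show ?thesis using assms by (simp add: power2_eq_square algebra_simps)
qed

lemma dot_eq_0_if_null:
  assumes "dot S v v = 0"
  shows "dot S u v = 0"
  using dot_Cauchy[of S u v] assms by simp

lemma dot_self_eq_0_iff: "finite S \<Longrightarrow> dot S v v = 0 \<longleftrightarrow> (\<forall>s\<in>S. v s = 0)"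
  unfolding dot_def by (subst sum_nonneg_eq_0_iff) auto

text \<open>The normal equations are solved for possibly dependent vectors: x and the new vector are
  both projected off the old ones by induction, and a single scalar remains.\<close>

lemma orthogonal_projection_exists:
  assumes "finite J"
  shows "\<exists>\<mu>. \<forall>j\<in>J. dot S (\<lambda>s. x s - (\<Sum>l\<in>J. \<mu> l * a l s)) (a j) = 0"
  using assms
proof (induction J arbitrary: x rule: finite_induct)
  case (insert i J)
  obtain \<mu> where \<mu>: "\<And>j. j \<in> J \<Longrightarrow> dot S (\<lambda>s. x s - (\<Sum>l\<in>J. \<mu> l * a l s)) (a j) = 0"
    using insert.IH[of x] by auto
  obtain \<nu> where \<nu>: "\<And>j. j \<in> J \<Longrightarrow> dot S (\<lambda>s. a i s - (\<Sum>l\<in>J. \<nu> l * a l s)) (a j) = 0"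
    using insert.IH[of "a i"] by auto
  define x' where "x' = (\<lambda>s. x s - (\<Sum>l\<in>J. \<mu> l * a l s))"
  define v' where "v' = (\<lambda>s. a i s - (\<Sum>l\<in>J. \<nu> l * a l s))"
  define \<gamma> where "\<gamma> = dot S x' v' / dot S v' v'"
  define \<mu>' where "\<mu>' l = (if l = i then \<gamma> else \<mu> l - \<gamma> * \<nu> l)" for l
  have x'': "(\<lambda>s. x s - (\<Sum>l\<in>insert i J. \<mu>' l * a l s)) = (\<lambda>s. x' s - \<gamma> * v' s)"
  proof
    fix s
    have "(\<Sum>l\<in>insert i J. \<mu>' l * a l s) = \<gamma> * a i s + (\<Sum>l\<in>J. (\<mu> l - \<gamma> * \<nu> l) * a l s)"
      using insert.hyps by (auto simp: \<mu>'_def intro!: sum.cong)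
    then show "x s - (\<Sum>l\<in>insert i J. \<mu>' l * a l s) = x' s - \<gamma> * v' s"
      by (simp add: x'_def v'_def algebra_simps sum_subtractf sum_distrib_left)
  qed
  have o: "dot S (\<lambda>s. x' s - \<gamma> * v' s) (a j) = 0" if "j \<in> J" for j
    using \<mu>[OF that] \<nu>[OF that] unfolding x'_def[symmetric] v'_def[symmetric] by (simp add: dot_linear)
  have ov: "dot S (\<lambda>s. x' s - \<gamma> * v' s) v' = 0"
  proof -
    have "\<gamma> * dot S v' v' = dot S x' v'"
      using dot_eq_0_if_null[of S v' x'] by (cases "dot S v' v' = 0") (simp_all add: \<gamma>_def)
    then show ?thesis by (simp add: dot_linear)
  qed
  have "a i = (\<lambda>s. v' s + (\<Sum>l\<in>J. \<nu> l * a l s))" by (simp add: v'_def)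
  then have "dot S (\<lambda>s. x' s - \<gamma> * v' s) (a i) = dot S (\<lambda>s. x' s - \<gamma> * v' s) (\<lambda>s. v' s + (\<Sum>l\<in>J. \<nu> l * a l s))"
    by (rule arg_cong)
  also have "\<dots> = dot S (\<lambda>s. x' s - \<gamma> * v' s) v' + (\<Sum>l\<in>J. \<nu> l * dot S (\<lambda>s. x' s - \<gamma> * v' s) (a l))"
    by (simp only: dot_add_right dot_sum_right dot_scale_right)
  also have "\<dots> = 0" using ov o by simp
  finally have "\<forall>j\<in>insert i J. dot S (\<lambda>s. x s - (\<Sum>l\<in>insert i J. \<mu>' l * a l s)) (a j) = 0"
    unfolding x'' using o by auto
  then show ?case by blast
qed simp

lemma dot_pythagoras:
  assumes "dot S u v = 0"
  shows "dot S (\<lambda>s. u s + c * v s) (\<lambda>s. u s + c * v s) = dot S u u + c\<^sup>2 * dot S v v"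
  using assms by (simp add: dot_linear dot_commute[of S v u] power2_eq_square)

text \<open>The Gram-Schmidt vectors \<open>e j\<close> depend neither on the coefficients nor on z,
  so one k-term sum bounds all unit combinations at once. Norm at most 1 leaves room for dependent
  \<open>a\<close>, whose \<open>e j\<close> is zero because \<open>1 / sqrt 0 = 0\<close>.\<close>

lemma span_orthonormal_bound:
  fixes k :: nat
  shows "\<exists>e. (\<forall>j<k. dot S (e j) (e j) \<le> 1) \<and>
     (\<forall>c z. (dot S (\<lambda>s. \<Sum>j<k. c j * a j s) z)\<^sup>2
        \<le> dot S (\<lambda>s. \<Sum>j<k. c j * a j s) (\<lambda>s. \<Sum>j<k. c j * a j s) * (\<Sum>j<k. (dot S (e j) z)\<^sup>2))"
proof (induction k)
  case 0
  then show ?case by (simp add: dot_def)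
next
  case (Suc k)
  obtain e where e1: "\<And>j. j < k \<Longrightarrow> dot S (e j) (e j) \<le> 1"
    and e2: "\<And>c z. (dot S (\<lambda>s. \<Sum>j<k. c j * a j s) z)\<^sup>2
        \<le> dot S (\<lambda>s. \<Sum>j<k. c j * a j s) (\<lambda>s. \<Sum>j<k. c j * a j s) * (\<Sum>j<k. (dot S (e j) z)\<^sup>2)"
    using Suc by blast
  obtain \<mu> where \<mu>: "\<And>j. j < k \<Longrightarrow> dot S (\<lambda>s. a k s - (\<Sum>l<k. \<mu> l * a l s)) (a j) = 0"
    using orthogonal_projection_exists[of "{..<k}" S "a k" a] by auto
  define a' where "a' = (\<lambda>s. a k s - (\<Sum>l<k. \<mu> l * a l s))"
  define r where "r = 1 / sqrt (dot S a' a')"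
  define e' where "e' = e(k := \<lambda>s. r * a' s)"
  have ek: "dot S (e' k) z = dot S a' z / sqrt (dot S a' a')" for z
    by (simp add: e'_def dot_scale_left) (simp add: r_def)
  have "dot S (e' k) (e' k) = dot S a' a' / (sqrt (dot S a' a') * sqrt (dot S a' a'))"
    by (simp add: e'_def dot_scale_left dot_scale_right) (simp add: r_def)
  then have "dot S (e' k) (e' k) \<le> 1"
    by (simp add: divide_le_eq_1)
  then have n: "\<forall>j<Suc k. dot S (e' j) (e' j) \<le> 1"
    using e1 by (auto simp: less_Suc_eq e'_def)
  have "(dot S (\<lambda>s. \<Sum>j<Suc k. c j * a j s) z)\<^sup>2
        \<le> dot S (\<lambda>s. \<Sum>j<Suc k. c j * a j s) (\<lambda>s. \<Sum>j<Suc k. c j * a j s) * (\<Sum>j<Suc k. (dot S (e' j) z)\<^sup>2)" for c z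
  proof -
    define w where "w = (\<lambda>s. \<Sum>j<k. (c j + c k * \<mu> j) * a j s)"
    have w: "(\<lambda>s. \<Sum>j<Suc k. c j * a j s) = (\<lambda>s. w s + c k * a' s)"
      by (simp add: w_def a'_def fun_eq_iff algebra_simps sum.distrib sum_distrib_left)
    have "dot S w a' = (\<Sum>j<k. (c j + c k * \<mu> j) * dot S (a j) a')"
      unfolding w_def by (simp add: dot_sum_left dot_scale_left)
    also have "\<dots> = 0"
    proof (rule sum.neutral, rule ballI)
      fix j assume "j \<in> {..<k}"
      then have "dot S (a j) a' = 0" using \<mu>[of j] dot_commute[of S "a j" a'] by (simp add: a'_def)
      then show "(c j + c k * \<mu> j) * dot S (a j) a' = 0" by simp
    qed
    finally have wa: "dot S w a' = 0" .
    have q: "(c k * dot S a' z)\<^sup>2 \<le> ((c k)\<^sup>2 * dot S a' a') * (dot S (e' k) z)\<^sup>2"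
    proof (cases "dot S a' a' = 0")
      case True
      then have "dot S a' z = 0" using dot_eq_0_if_null[of S a' z] dot_commute[of S a' z] by simp
      then show ?thesis by simp
    next
      case False
      then show ?thesis unfolding ek by (simp add: power_mult_distrib power_divide)
    qed
    have "(dot S w z + c k * dot S a' z)\<^sup>2 \<le> (dot S w w + (c k)\<^sup>2 * dot S a' a') * ((\<Sum>j<k. (dot S (e j) z)\<^sup>2) + (dot S (e' k) z)\<^sup>2)"
      using e2[of "\<lambda>j. c j + c k * \<mu> j" z] q unfolding w_def[symmetric]
      by (rule sum_square_combine) (auto intro!: sum_nonneg)
    moreover have "(\<Sum>j<Suc k. (dot S (e' j) z)\<^sup>2) = (\<Sum>j<k. (dot S (e j) z)\<^sup>2) + (dot S (e' k) z)\<^sup>2"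
      by (simp add: e'_def)
    ultimately show ?thesis unfolding w dot_pythagoras[OF wa] by (simp only: dot_linear)
  qed
  with n show ?case by blast
qed

text \<open>The last equation eliminates the unknown \<open>p\<close>, leaving one equation and one
  unknown fewer. It serves for the relation among T + 1 weight vectors and for inverting W
  W^T.\<close>

lemma homogeneous_system_nontrivial:
  fixes c :: "'j \<Rightarrow> nat \<Rightarrow> real"
  assumes "finite J" "k < card J"
  shows "\<exists>u. (\<exists>j\<in>J. u j \<noteq> 0) \<and> (\<forall>i<k. (\<Sum>j\<in>J. u j * c j i) = 0)"
  using assms
proof (induction k arbitrary: J c)
  case 0
  then show ?case by (intro exI[of _ "\<lambda>_. 1"]) (auto simp: card_gt_0_iff)
next
  case (Suc k)
  show ?case
  proof (cases "\<forall>j\<in>J. c j k = 0")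
    case True
    with Suc.IH[of J c] Suc.prems show ?thesis by (auto simp: less_Suc_eq)
  next
    case False
    then obtain p where p: "p \<in> J" "c p k \<noteq> 0" by auto
    define J' where "J' = J - {p}"
    have J': "finite J'" "k < card J'" "J = insert p J'" "p \<notin> J'"
      using Suc.prems p by (auto simp: J'_def)
    obtain u where u: "\<exists>j\<in>J'. u j \<noteq> 0" "\<And>i. i < k \<Longrightarrow> (\<Sum>j\<in>J'. u j * (c j i - c j k / c p k * c p i)) = 0"
      using Suc.IH[OF J'(1,2), of "\<lambda>j i. c j i - c j k / c p k * c p i"] by auto
    define u' where "u' = u(p := - (\<Sum>j\<in>J'. u j * c j k) / c p k)"
    have s: "(\<Sum>j\<in>J. u' j * c j i) = (\<Sum>j\<in>J'. u j * (c j i - c j k / c p k * c p i))" for i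
    proof -
      have "(\<Sum>j\<in>J. u' j * c j i) = u' p * c p i + (\<Sum>j\<in>J'. u j * c j i)"
        using J' by (auto simp: u'_def intro!: sum.cong)
      then show ?thesis
        by (simp add: u'_def algebra_simps sum_subtractf sum_distrib_left sum_divide_distrib)
    qed
    have "(\<Sum>j\<in>J. u' j * c j i) = 0" if "i < Suc k" for i
      using that u(2) p unfolding s by (cases "i = k") auto
    moreover have "\<exists>j\<in>J. u' j \<noteq> 0" using u(1) J'(3,4) by (auto simp: u'_def)
    ultimately show ?thesis by blast
  qed
qed

text \<open>A smallest eigenvalue of the Gram matrix without compactness: the part \<open>g\<close>
  of \<open>a i\<close> orthogonal to the other vectors is nonzero, and pairing a combination with
  \<open>g\<close> isolates its coefficient \<open>u i\<close>.\<close>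

lemma independent_lower_bound:
  assumes S: "finite S" and J: "finite J"
    and ind: "\<And>u. (\<And>s. s \<in> S \<Longrightarrow> (\<Sum>j\<in>J. u j * a j s) = 0) \<Longrightarrow> \<forall>j\<in>J. u j = 0"
  shows "\<exists>\<kappa>>0. \<forall>u. \<kappa> * (\<Sum>j\<in>J. (u j)\<^sup>2) \<le> dot S (\<lambda>s. \<Sum>j\<in>J. u j * a j s) (\<lambda>s. \<Sum>j\<in>J. u j * a j s)"
proof -
  have "\<exists>h>0. \<forall>u. h * (u i)\<^sup>2 \<le> dot S (\<lambda>s. \<Sum>j\<in>J. u j * a j s) (\<lambda>s. \<Sum>j\<in>J. u j * a j s)" if i: "i \<in> J" for i
  proof -
    obtain \<mu> where \<mu>: "\<And>j. j \<in> J - {i} \<Longrightarrow> dot S (\<lambda>s. a i s - (\<Sum>l\<in>J - {i}. \<mu> l * a l s)) (a j) = 0"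
      using orthogonal_projection_exists[of "J - {i}" S "a i" a] J by auto
    define g where "g = (\<lambda>s. a i s - (\<Sum>l\<in>J - {i}. \<mu> l * a l s))"
    have g0: "dot S g g \<noteq> 0"
    proof
      assume "dot S g g = 0"
      then have z: "\<forall>s\<in>S. g s = 0" using dot_self_eq_0_iff[OF S] by blast
      have "\<forall>j\<in>J. (\<lambda>j. if j = i then 1 else - \<mu> j) j = 0"
      proof (rule ind)
        fix s assume "s \<in> S"
        have "(\<Sum>j\<in>J. (if j = i then 1 else - \<mu> j) * a j s) = a i s + (\<Sum>j\<in>J - {i}. (if j = i then 1 else - \<mu> j) * a j s)"
          using sum.remove[OF J i, of "\<lambda>j. (if j = i then 1 else - \<mu> j) * a j s"] by simp
        also have "(\<Sum>j\<in>J - {i}. (if j = i then 1 else - \<mu> j) * a j s) = - (\<Sum>j\<in>J - {i}. \<mu> j * a j s)"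
          by (simp add: sum_negf[symmetric])
        finally show "(\<Sum>j\<in>J. (if j = i then 1 else - \<mu> j) * a j s) = 0" using z \<open>s \<in> S\<close> by (simp add: g_def)
      qed
      with i show False by auto
    qed
    have gp: "0 < dot S g g" using g0 dot_self_nonneg[of S g] by linarith
    have "dot S g g * (u i)\<^sup>2 \<le> dot S (\<lambda>s. \<Sum>j\<in>J. u j * a j s) (\<lambda>s. \<Sum>j\<in>J. u j * a j s)" (is "_ \<le> dot S ?w ?w") for u
    proof -
      have ag: "dot S g (a i) = dot S g g"
      proof -
        have "a i = (\<lambda>s. g s + (\<Sum>l\<in>J - {i}. \<mu> l * a l s))" by (simp add: g_def)
        then have "dot S g (a i) = dot S g (\<lambda>s. g s + (\<Sum>l\<in>J - {i}. \<mu> l * a l s))" by (rule arg_cong)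
        also have "\<dots> = dot S g g + (\<Sum>l\<in>J - {i}. \<mu> l * dot S g (a l))"
          by (simp only: dot_add_right dot_sum_right dot_scale_right)
        finally show ?thesis using \<mu> by (simp add: g_def)
      qed
      have "dot S g ?w = (\<Sum>j\<in>J. u j * dot S g (a j))" by (simp add: dot_sum_right dot_scale_right)
      also have "\<dots> = u i * dot S g (a i) + (\<Sum>j\<in>J - {i}. u j * dot S g (a j))" by (rule sum.remove[OF J i])
      also have "(\<Sum>j\<in>J - {i}. u j * dot S g (a j)) = 0"
        using \<mu> unfolding g_def[symmetric] by (intro sum.neutral) auto
      finally have "dot S g ?w = u i * dot S g g" by (simp only: ag add_0_right)
      then have "(u i * dot S g g)\<^sup>2 \<le> dot S g g * dot S ?w ?w" using dot_Cauchy[of S g ?w] by (simp only:)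
      moreover have "(u i * dot S g g)\<^sup>2 = dot S g g * (dot S g g * (u i)\<^sup>2)" by (simp only: power2_eq_square mult_ac)
      ultimately have "dot S g g * (dot S g g * (u i)\<^sup>2) \<le> dot S g g * dot S ?w ?w" by (simp only:)
      then show ?thesis using gp by (rule mult_left_le_imp_le)
    qed
    then show ?thesis using gp by (intro exI[of _ "dot S g g"] conjI allI)
  qed
  then have "\<forall>i\<in>J. \<exists>h. 0 < h \<and> (\<forall>u. h * (u i)\<^sup>2 \<le> dot S (\<lambda>s. \<Sum>j\<in>J. u j * a j s) (\<lambda>s. \<Sum>j\<in>J. u j * a j s))"
    by blast
  from bchoice[OF this] obtain h where h': "\<forall>i\<in>J. 0 < h i \<and> (\<forall>u. h i * (u i)\<^sup>2 \<le> dot S (\<lambda>s. \<Sum>j\<in>J. u j * a j s) (\<lambda>s. \<Sum>j\<in>J. u j * a j s))"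
    by (rule exE)
  have h: "\<And>i. i \<in> J \<Longrightarrow> 0 < h i"
    "\<And>i u. i \<in> J \<Longrightarrow> h i * (u i)\<^sup>2 \<le> dot S (\<lambda>s. \<Sum>j\<in>J. u j * a j s) (\<lambda>s. \<Sum>j\<in>J. u j * a j s)"
    using h' by blast+
  \<comment> \<open>The summand 1 keeps \<open>H\<close> positive when \<open>J\<close> is
    empty.\<close>
  define H where "H = 1 + (\<Sum>i\<in>J. 1 / h i)"
  have Hp: "0 < H" unfolding H_def using h(1) by (intro add_pos_nonneg sum_nonneg) (auto intro: less_imp_le)
  have fin: "1 / H * (\<Sum>j\<in>J. (u j)\<^sup>2) \<le> d" if d: "\<And>j. j \<in> J \<Longrightarrow> h j * (u j)\<^sup>2 \<le> d" "0 \<le> d" for u d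
  proof -
    have "(\<Sum>j\<in>J. (u j)\<^sup>2) \<le> (\<Sum>j\<in>J. 1 / h j * d)"
    proof (rule sum_mono)
      fix j assume "j \<in> J"
      then show "(u j)\<^sup>2 \<le> 1 / h j * d" using h(1)[of j] d(1)[of j] by (simp add: field_simps)
    qed
    also have "\<dots> \<le> H * d" unfolding H_def sum_distrib_right[symmetric]
      by (intro mult_right_mono) (auto simp: d(2))
    finally show ?thesis using Hp by (simp add: field_simps)
  qed
  have "1 / H * (\<Sum>j\<in>J. (u j)\<^sup>2) \<le> dot S (\<lambda>s. \<Sum>j\<in>J. u j * a j s) (\<lambda>s. \<Sum>j\<in>J. u j * a j s)" for u
    by (rule fin[OF h(2) dot_self_nonneg])
  then show ?thesis using Hp by (intro exI[of _ "1 / H"]) auto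
qed

subsection \<open>Deviation of suprema over subspaces and classes\<close>

abbreviation noise :: "real \<Rightarrow> 'i set \<Rightarrow> ('i \<Rightarrow> real) measure" where
  "noise \<sigma> S \<equiv> PiM S (\<lambda>_. density lborel (normal_density 0 \<sigma>))"

lemma noise_eq_distr_gauss:
  assumes S: "finite S" and \<sigma>: "0 < \<sigma>"
  shows "(\<lambda>z. \<lambda>s\<in>S. \<sigma> * z s) \<in> gauss S \<rightarrow>\<^sub>M noise \<sigma> S"
    and "distr (gauss S) (noise \<sigma> S) (\<lambda>z. \<lambda>s\<in>S. \<sigma> * z s) = noise \<sigma> S"
proof -
  let ?N = "density lborel (\<lambda>x. ennreal (std_normal_density x))"
  let ?N' = "density lborel (\<lambda>x. ennreal (normal_density 0 \<sigma> x))"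
  interpret N: prob_space ?N by (rule prob_space_normal_density) simp
  have "distributed ?N lborel (\<lambda>x. x) std_normal_density"
    unfolding distributed_def by (auto simp: distr_id2)
  then have "distributed ?N lborel (\<lambda>x. 0 + \<sigma> * x) (normal_density (0 + \<sigma> * 0) (\<bar>\<sigma>\<bar> * 1))"
    by (rule N.normal_density_affine) (use \<sigma> in auto)
  then have "distr ?N lborel (\<lambda>x. \<sigma> * x) = ?N'"
    using \<sigma> by (simp add: distributed_def)
  moreover have "distr ?N lborel (\<lambda>x. \<sigma> * x) = distr ?N ?N' (\<lambda>x. \<sigma> * x)"
    by (rule distr_cong) auto
  ultimately have d: "distr ?N ?N' (\<lambda>x. \<sigma> * x) = ?N'" by simp
  have co: "compose S (\<lambda>x. \<sigma> * x) = (\<lambda>z. \<lambda>s\<in>S. \<sigma> * z s)"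
    by (simp add: fun_eq_iff compose_def)
  have "distr (gauss S) (noise \<sigma> S) (compose S (\<lambda>x. \<sigma> * x)) = PiM S (\<lambda>_. distr ?N ?N' (\<lambda>x. \<sigma> * x))"
    by (rule distr_PiM_finite_prob_space'[OF S]) (use \<sigma> in \<open>auto intro!: prob_space_normal_density\<close>)
  then show "distr (gauss S) (noise \<sigma> S) (\<lambda>z. \<lambda>s\<in>S. \<sigma> * z s) = noise \<sigma> S"
    unfolding d co .
  show "(\<lambda>z. \<lambda>s\<in>S. \<sigma> * z s) \<in> gauss S \<rightarrow>\<^sub>M noise \<sigma> S"
    by (rule measurable_restrict) auto
qed

lemma prob_space_noise: "0 < \<sigma> \<Longrightarrow> prob_space (noise \<sigma> S)"
  by (intro prob_space_PiM prob_space_normal_density)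

lemma dot_le_sum_abs:
  assumes S: "finite S" and v: "dot S v v \<le> 1"
  shows "\<bar>dot S v z\<bar> \<le> (\<Sum>s\<in>S. \<bar>z s\<bar>)"
proof -
  have "\<bar>v s\<bar> \<le> 1" if "s \<in> S" for s
  proof -
    have "v s * v s \<le> dot S v v" unfolding dot_def using S that by (intro member_le_sum) auto
    then have "\<bar>v s\<bar>\<^sup>2 \<le> 1\<^sup>2" using v by (simp add: power2_eq_square)
    then show ?thesis by (rule power2_le_imp_le) simp
  qed
  then have "\<bar>v s * z s\<bar> \<le> \<bar>z s\<bar>" if "s \<in> S" for s
    using that mult_right_mono[of "\<bar>v s\<bar>" 1 "\<bar>z s\<bar>"] by (simp add: abs_mult)
  then show ?thesis unfolding dot_def by (intro order_trans[OF sum_abs] sum_mono)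
qed

lemma bdd_above_dot:
  assumes S: "finite S" and v: "\<And>i. dot S (v i) (v i) \<le> 1"
  shows "bdd_above (range (\<lambda>i::nat. dot S (v i) z))"
  using dot_le_sum_abs[OF S v, where z=z] by (intro bdd_aboveI2) (auto simp: abs_le_iff)

text \<open>Monotone limit of finite maxima: their tail bound does not depend on their number, and
  their expectations lie below that of the supremum.\<close>

lemma gauss_Sup_concentration:
  fixes v :: "nat \<Rightarrow> 'i \<Rightarrow> real"
  assumes S: "finite S" and v: "\<And>i. dot S (v i) (v i) \<le> 1" and t: "0 \<le> t"
  defines "f \<equiv> \<lambda>z. SUP i. dot S (v i) z"
  shows "integrable (gauss S) f"
    and "emeasure (gauss S) {z \<in> space (gauss S). \<exists>i. dot S (v i) z > (\<integral>z. f z \<partial>gauss S) + t} \<le> ennreal (exp (- t\<^sup>2 / 5))"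
proof -
  interpret prob_space "gauss S" by (rule prob_space_gauss)
  note bdd = bdd_above_dot[OF S v]
  have fm[measurable]: "f \<in> borel_measurable (gauss S)"
    unfolding f_def using S by (intro borel_measurable_cSUP bdd) auto
  have ge: "dot S (v i) z \<le> f z" for i z unfolding f_def by (intro cSUP_upper bdd) auto
  have zi: "integrable (gauss S) (\<lambda>z. z s)" if "s \<in> S" for s
  proof -
    let ?d = "\<lambda>r. if r = s then 1 else 0 :: real"
    have "dot S ?d z = z s" for z
    proof -
      have "dot S ?d z = (\<Sum>r\<in>S. if r = s then z s else 0)" unfolding dot_def by (intro sum.cong) auto
      then show ?thesis using S that by simp
    qed
    moreover have "dot S ?d ?d = 1"
    proof -
      have "dot S ?d ?d = (\<Sum>r\<in>S. if r = s then 1 else 0)" unfolding dot_def by (intro sum.cong) auto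
      then show ?thesis using S that by simp
    qed
    ultimately show ?thesis using gauss_square_bound(3)[OF S, of ?d] by simp
  qed
  have fb: "\<bar>f z\<bar> \<le> (\<Sum>s\<in>S. \<bar>z s\<bar>)" for z
  proof -
    have "f z \<le> (\<Sum>s\<in>S. \<bar>z s\<bar>)"
      unfolding f_def using dot_le_sum_abs[OF S v, where z=z] by (intro cSUP_least) (auto simp: abs_le_iff)
    moreover have "- (\<Sum>s\<in>S. \<bar>z s\<bar>) \<le> f z"
      using ge[of 0 z] dot_le_sum_abs[OF S v[of 0], of z] by linarith
    ultimately show ?thesis by linarith
  qed
  show fi: "integrable (gauss S) f"
    by (rule Bochner_Integration.integrable_bound[where f="\<lambda>z. \<Sum>s\<in>S. \<bar>z s\<bar>"])
       (use zi fb in \<open>auto intro!: AE_I2 order_trans[OF fb] simp: abs_of_nonneg sum_nonneg\<close>)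
  let ?E = "\<integral>z. f z \<partial>gauss S"
  define fm where "fm m z = Max ((\<lambda>i. dot S (v i) z) ` {..<Suc m})" for m z
  define A where "A m = {z \<in> space (gauss S). fm m z > ?E + t}" for m
  have fmm[measurable]: "fm m \<in> borel_measurable (gauss S)" for m
    unfolding fm_def using S by (intro borel_measurable_Max) auto
  have Am[measurable]: "A m \<in> sets (gauss S)" for m unfolding A_def by measurable
  have le: "fm m z \<le> f z" for m z unfolding fm_def using ge by (intro Max.boundedI) auto
  have "incseq A"
  proof (rule incseq_SucI, rule subsetI)
    fix m z assume "z \<in> A m"
    moreover have "fm m z \<le> fm (Suc m) z" unfolding fm_def by (intro Max_mono) auto
    ultimately show "z \<in> A (Suc m)" by (auto simp: A_def)
  qed
  then have "emeasure (gauss S) (\<Union>m. A m) = (SUP m. emeasure (gauss S) (A m))"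
    using Am by (intro SUP_emeasure_incseq[symmetric]) auto
  also have "\<dots> \<le> ennreal (exp (- t\<^sup>2 / 5))"
  proof (rule SUP_least)
    fix m
    note c = gauss_Max_concentration[where v=v and m="Suc m", OF S zero_less_Suc v t, folded fm_def[abs_def]]
    have "(\<integral>z. fm m z \<partial>gauss S) \<le> ?E"
      using c(1) fi le by (intro integral_mono) (auto simp: fm_def[abs_def])
    then have "emeasure (gauss S) (A m) \<le> emeasure (gauss S) {z \<in> space (gauss S). fm m z \<ge> (\<integral>z. fm m z \<partial>gauss S) + t}"
      by (intro emeasure_mono) (auto simp: A_def)
    also have "\<dots> \<le> ennreal (exp (- t\<^sup>2 / 5))" using c(2) by (simp add: fm_def)
    finally show "emeasure (gauss S) (A m) \<le> ennreal (exp (- t\<^sup>2 / 5))" .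
  qed
  finally have b: "emeasure (gauss S) (\<Union>m. A m) \<le> ennreal (exp (- t\<^sup>2 / 5))" .
  have "{z \<in> space (gauss S). \<exists>i. dot S (v i) z > ?E + t} \<subseteq> (\<Union>m. A m)"
  proof safe
    fix z i assume z: "z \<in> space (gauss S)" "dot S (v i) z > ?E + t"
    have "dot S (v i) z \<le> fm i z" unfolding fm_def by (intro Max_ge) auto
    with z show "z \<in> (\<Union>m. A m)" by (auto simp: A_def intro!: exI[of _ i])
  qed
  then have "emeasure (gauss S) {z \<in> space (gauss S). \<exists>i. dot S (v i) z > ?E + t} \<le> emeasure (gauss S) (\<Union>m. A m)"
    using Am by (intro emeasure_mono) auto
  with b show "emeasure (gauss S) {z \<in> space (gauss S). \<exists>i. dot S (v i) z > ?E + t} \<le> ennreal (exp (- t\<^sup>2 / 5))"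
    by (rule order_trans[rotated])
qed

lemma noise_exceed_sets:
  assumes S: "finite S"
  shows "{z \<in> space (noise \<sigma> S). \<exists>i::nat. dot S (v i) z > c} \<in> sets (noise \<sigma> S)"
proof -
  have [measurable]: "(\<lambda>z. dot S w z) \<in> borel_measurable (noise \<sigma> S)" for w
    using S measurable_component_singleton[of _ S "\<lambda>_. density lborel (normal_density 0 \<sigma>)"]
    by (intro dot_measurable) auto
  show ?thesis by measurable
qed

lemma noise_Sup_deviation:
  fixes v :: "nat \<Rightarrow> 'i \<Rightarrow> real"
  assumes S: "finite S" and v: "\<And>i. dot S (v i) (v i) \<le> 1" and t: "0 \<le> t" and \<sigma>: "0 < \<sigma>"
  shows "emeasure (noise \<sigma> S) {z \<in> space (noise \<sigma> S). \<exists>i. dot S (v i) z > \<sigma> * ((\<integral>z. (SUP i. dot S (v i) z) \<partial>gauss S) + t)}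
     \<le> ennreal (exp (- t\<^sup>2 / 5))"
proof -
  let ?g = "\<lambda>z. \<lambda>s\<in>S. \<sigma> * z s"
  let ?E = "\<integral>z. (SUP i. dot S (v i) z) \<partial>gauss S"
  let ?A = "{z \<in> space (noise \<sigma> S). \<exists>i. dot S (v i) z > \<sigma> * (?E + t)}"
  note m = noise_eq_distr_gauss[OF S \<sigma>]
  have "?A \<in> sets (noise \<sigma> S)" by (rule noise_exceed_sets[OF S])
  then have "emeasure (noise \<sigma> S) ?A = emeasure (gauss S) (?g -` ?A \<inter> space (gauss S))"
    by (subst m(2)[symmetric]) (simp add: emeasure_distr[OF m(1)])
  also have "?g -` ?A \<inter> space (gauss S) = {z \<in> space (gauss S). \<exists>i. dot S (v i) z > ?E + t}"
  proof -
    have "?g z \<in> space (noise \<sigma> S)" if "z \<in> space (gauss S)" for z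
      by (auto simp: space_PiM)
    then show ?thesis using \<sigma> by (auto simp: dot_scale_right)
  qed
  also have "emeasure (gauss S) \<dots> \<le> ennreal (exp (- t\<^sup>2 / 5))"
    by (rule gauss_Sup_concentration(2)[OF S v t])
  finally show ?thesis .
qed

text \<open>Each value is at most the norm of the projection of z on one k-dimensional span.
  Splitting it against sqrt k by the arithmetic-geometric mean leaves a quadratic form to integrate;
  the second moment bound 4 then gives 5/2 sqrt k.\<close>

lemma gauss_Sup_subspace:
  fixes v :: "nat \<Rightarrow> 'i \<Rightarrow> real"
  assumes S: "finite S" and v: "\<And>i. dot S (v i) (v i) \<le> 1" and k: "0 < k"
    and span: "\<And>i. \<exists>c. v i = (\<lambda>s. \<Sum>j<k. c j * a j s)"
  shows "(\<integral>z. (SUP i. dot S (v i) z) \<partial>gauss S) \<le> 3 * sqrt (real k)"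
proof -
  interpret prob_space "gauss S" by (rule prob_space_gauss)
  obtain e where e: "\<And>j. j < k \<Longrightarrow> dot S (e j) (e j) \<le> 1"
    "\<And>c z. (dot S (\<lambda>s. \<Sum>j<k. c j * a j s) z)\<^sup>2
        \<le> dot S (\<lambda>s. \<Sum>j<k. c j * a j s) (\<lambda>s. \<Sum>j<k. c j * a j s) * (\<Sum>j<k. (dot S (e j) z)\<^sup>2)"
    using span_orthonormal_bound[of k S a] by blast
  let ?r = "sqrt (real k)"
  have r: "0 < ?r" "?r * ?r = real k" using k by auto
  have b: "dot S (v i) z \<le> ((\<Sum>j<k. (dot S (e j) z)\<^sup>2) / ?r + ?r) / 2" for i z
  proof -
    obtain c where c: "v i = (\<lambda>s. \<Sum>j<k. c j * a j s)" using span by blast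
    let ?s = "\<Sum>j<k. (dot S (e j) z)\<^sup>2"
    have s0: "0 \<le> ?s" by (intro sum_nonneg) auto
    have "(dot S (v i) z)\<^sup>2 \<le> dot S (v i) (v i) * ?s" using e(2)[of c z] by (simp add: c)
    also have "\<dots> \<le> ?s" using v s0 by (simp add: mult_left_le_one_le)
    also have "\<dots> = (?s / ?r) * ?r" using r by simp
    also have "\<dots> \<le> ((?s / ?r + ?r) / 2)\<^sup>2"
    proof -
      have "x * y \<le> ((x + y) / 2)\<^sup>2" for x y :: real
        using zero_le_power2[of "x - y"] by (simp add: power2_eq_square field_simps)
      then show ?thesis .
    qed
    finally show ?thesis by (rule power2_le_imp_le) (use s0 r in auto)
  qed
  have "(\<integral>z. (SUP i. dot S (v i) z) \<partial>gauss S) \<le> (\<integral>z. ((\<Sum>j<k. (dot S (e j) z)\<^sup>2) / ?r + ?r) / 2 \<partial>gauss S)"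
  proof (rule integral_mono)
    show "integrable (gauss S) (\<lambda>z. SUP i. dot S (v i) z)"
      by (rule gauss_Sup_concentration(1)[where v=v, OF S v order_refl])
    show "integrable (gauss S) (\<lambda>z. ((\<Sum>j<k. (dot S (e j) z)\<^sup>2) / ?r + ?r) / 2)"
      by (intro integrable_divide Bochner_Integration.integrable_add Bochner_Integration.integrable_sum integrable_const gauss_square_bound(1)[OF S e(1)]) auto
    show "(SUP i. dot S (v i) z) \<le> ((\<Sum>j<k. (dot S (e j) z)\<^sup>2) / ?r + ?r) / 2" for z
      by (rule cSUP_least) (simp, rule b)
  qed
  also have "\<dots> = ((\<Sum>j<k. (\<integral>z. (dot S (e j) z)\<^sup>2 \<partial>gauss S)) / ?r + ?r) / 2"
  proof -
    have i: "integrable (gauss S) (\<lambda>z. (\<Sum>j<k. (dot S (e j) z)\<^sup>2) / ?r)"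
      by (intro integrable_divide Bochner_Integration.integrable_sum gauss_square_bound(1)[OF S e(1)]) auto
    have "(\<integral>z. (\<Sum>j<k. (dot S (e j) z)\<^sup>2) / ?r + ?r \<partial>gauss S) = (\<integral>z. (\<Sum>j<k. (dot S (e j) z)\<^sup>2) / ?r \<partial>gauss S) + ?r"
      by (subst Bochner_Integration.integral_add[OF i]) (auto simp: prob_space)
    also have "(\<integral>z. (\<Sum>j<k. (dot S (e j) z)\<^sup>2) / ?r \<partial>gauss S) = (\<Sum>j<k. (\<integral>z. (dot S (e j) z)\<^sup>2 \<partial>gauss S)) / ?r"
      unfolding integral_divide_zero
      by (subst Bochner_Integration.integral_sum) (auto intro!: gauss_square_bound(1)[OF S e(1)])
    finally show ?thesis by simp
  qed
  also have "\<dots> \<le> ((\<Sum>j<k. 4) / ?r + ?r) / 2"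
    using gauss_square_bound(2)[OF S e(1)] r by (intro divide_right_mono add_right_mono sum_mono) auto
  also have "\<dots> = 5 / 2 * ?r" using r by (simp add: field_simps)
  also have "\<dots> \<le> 3 * ?r" using r by simp
  finally show ?thesis .
qed

subsection \<open>Images of porous sets\<close>

lemma noise_box_measure:
  assumes S: "finite S" and \<sigma>: "0 < \<sigma>" and r: "0 \<le> r"
  shows "{z \<in> space (noise \<sigma> S). \<forall>s\<in>S. \<bar>z s - p s\<bar> \<le> r} \<in> sets (noise \<sigma> S)"
    and "emeasure (noise \<sigma> S) {z \<in> space (noise \<sigma> S). \<forall>s\<in>S. \<bar>z s - p s\<bar> \<le> r} \<le> ennreal ((2 * r / \<sigma>) ^ card S)"
proof -
  let ?N = "density lborel (\<lambda>x. ennreal (normal_density 0 \<sigma> x))"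
  interpret N: prob_space ?N by (rule prob_space_normal_density) fact
  interpret P: product_sigma_finite "\<lambda>_. ?N" by standard
  have e: "{z \<in> space (noise \<sigma> S). \<forall>s\<in>S. \<bar>z s - p s\<bar> \<le> r} = (\<Pi>\<^sub>E s\<in>S. {p s - r .. p s + r})"
  proof -
    have b: "\<bar>z s - p s\<bar> \<le> r \<longleftrightarrow> z s \<in> {p s - r .. p s + r}" for z s by auto
    show ?thesis unfolding b by (auto simp: space_PiM PiE_iff extensional_def)
  qed
  show "{z \<in> space (noise \<sigma> S). \<forall>s\<in>S. \<bar>z s - p s\<bar> \<le> r} \<in> sets (noise \<sigma> S)"
    unfolding e by (rule sets_PiM_I_finite) (use S in auto)
  have d: "normal_density 0 \<sigma> x \<le> 1 / \<sigma>" for x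
  proof -
    have "sqrt (2 * pi * \<sigma>\<^sup>2) \<ge> sqrt (\<sigma>\<^sup>2)"
      using pi_ge_two mult_right_mono[of 1 "2 * pi" "\<sigma>\<^sup>2"] by (intro real_sqrt_le_mono) simp
    then have s: "\<sigma> \<le> sqrt (2 * pi * \<sigma>\<^sup>2)" using \<sigma> by simp
    have "1 / sqrt (2 * pi * \<sigma>\<^sup>2) \<le> 1 / \<sigma>"
      by (rule divide_left_mono[OF s]) (use \<sigma> in auto)
    moreover have "exp (- ((x - 0)\<^sup>2 / (2 * \<sigma>\<^sup>2))) \<le> 1" by simp
    ultimately have "1 / sqrt (2 * pi * \<sigma>\<^sup>2) * exp (- ((x - 0)\<^sup>2 / (2 * \<sigma>\<^sup>2))) \<le> 1 / \<sigma> * 1"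
      using \<sigma> by (intro mult_mono) auto
    then show ?thesis unfolding normal_density_def by simp
  qed
  have one: "emeasure ?N {a - r .. a + r} \<le> ennreal (2 * r / \<sigma>)" for a
  proof -
    have "emeasure ?N {a - r .. a + r} = (\<integral>\<^sup>+x. ennreal (normal_density 0 \<sigma> x) * indicator {a - r .. a + r} x \<partial>lborel)"
      by (simp add: emeasure_density)
    also have "\<dots> \<le> (\<integral>\<^sup>+x. ennreal (1 / \<sigma>) * indicator {a - r .. a + r} x \<partial>lborel)"
      using d by (intro nn_integral_mono mult_right_mono ennreal_leI) auto
    also have "\<dots> = ennreal (1 / \<sigma>) * ennreal (2 * r)" using r by (simp add: nn_integral_cmult_indicator)
    also have "\<dots> = ennreal (2 * r / \<sigma>)" using \<sigma> r by (simp add: ennreal_mult[symmetric])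
    finally show ?thesis .
  qed
  have "emeasure (noise \<sigma> S) (\<Pi>\<^sub>E s\<in>S. {p s - r .. p s + r}) = (\<Prod>s\<in>S. emeasure ?N {p s - r .. p s + r})"
    by (rule P.emeasure_PiM) (use S in auto)
  also have "\<dots> \<le> (\<Prod>s\<in>S. ennreal (2 * r / \<sigma>))" by (intro prod_mono_ennreal one)
  also have "\<dots> = ennreal ((2 * r / \<sigma>) ^ card S)" using r \<sigma> by (simp add: ennreal_power)
  finally show "emeasure (noise \<sigma> S) {z \<in> space (noise \<sigma> S). \<forall>s\<in>S. \<bar>z s - p s\<bar> \<le> r} \<le> ennreal ((2 * r / \<sigma>) ^ card S)"
    unfolding e .
qed

text \<open>A cube of side l is divided into subcubes of side l/M. If the middle subcube contains
  some u b, there is a hole of radius l/M around a point z of the cube, and the subcube containing z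
  lies inside that hole. So some subcube is always empty, and at most M^card S - 1 children survive
  in each generation.\<close>

lemma porous_cover:
  fixes u :: "'b \<Rightarrow> 'i \<Rightarrow> real" and n :: nat
  assumes S: "finite S"
    and hole: "\<And>b \<epsilon>. b \<in> B \<Longrightarrow> 0 < \<epsilon> \<Longrightarrow> \<epsilon> < 1 / real (Suc n) \<Longrightarrow>
       \<exists>z. (\<forall>s\<in>S. \<bar>z s - u b s\<bar> \<le> \<epsilon>) \<and> (\<forall>b'\<in>B. \<exists>s\<in>S. \<bar>u b' s - z s\<bar> > \<epsilon> / real (Suc n))"
  defines "M \<equiv> 8 * Suc n"
  assumes l: "0 < l" "l \<le> 1 / real (Suc n)"
  shows "\<exists>C. finite C \<and> card C \<le> (M ^ card S - 1) ^ j \<and>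
     (\<forall>b\<in>B. (\<forall>s\<in>S. q s \<le> u b s \<and> u b s < q s + l) \<longrightarrow> (\<exists>c\<in>C. \<forall>s\<in>S. c s \<le> u b s \<and> u b s < c s + l / real M ^ j))"
  using l
proof (induction j arbitrary: q l)
  case 0
  show ?case by (intro exI[of _ "{q}"]) auto
next
  case (Suc j)
  have M: "0 < real M" "M \<noteq> 0" by (auto simp: M_def)
  define I where "I = (\<Pi>\<^sub>E s\<in>S. {..<M})"
  define qq where "qq i s = q s + l / real M * real (i s)" for i :: "'i \<Rightarrow> nat" and s
  define Q where "Q i = {b \<in> B. \<forall>s\<in>S. qq i s \<le> u b s \<and> u b s < qq i s + l / real M}" for i
  have I: "finite I" "card I = M ^ card S" unfolding I_def using S by (auto intro!: finite_PiE simp: card_PiE)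
  have idx: "\<exists>i\<in>I. \<forall>s\<in>S. qq i s \<le> x s \<and> x s < qq i s + l / real M"
    if x: "\<forall>s\<in>S. q s \<le> x s \<and> x s < q s + l" for x
  proof -
    define i where "i = (\<lambda>s\<in>S. nat \<lfloor>(x s - q s) * real M / l\<rfloor>)"
    have "i s < M \<and> qq i s \<le> x s \<and> x s < qq i s + l / real M" if s: "s \<in> S" for s
    proof -
      let ?y = "(x s - q s) * real M / l"
      have y: "0 \<le> ?y" using x s Suc.prems M by auto
      have "(x s - q s) * real M < l * real M" using x s M by (intro mult_strict_right_mono) (auto simp: algebra_simps)
      then have "?y < real M" using Suc.prems by (simp add: field_simps)
      moreover have i1: "real (i s) \<le> ?y" "?y < real (i s) + 1" using y s by (simp_all add: i_def)
      ultimately have "i s < M" by linarith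
      moreover have "l / real M * real (i s) \<le> l / real M * ?y" "l / real M * ?y < l / real M * (real (i s) + 1)"
        using mult_left_mono[OF i1(1), of "l / real M"] mult_strict_left_mono[OF i1(2), of "l / real M"] Suc.prems M
        by simp_all
      moreover have "l / real M * ?y = x s - q s" using Suc.prems M by simp
      ultimately show ?thesis by (simp add: qq_def algebra_simps)
    qed
    then show ?thesis by (intro bexI[of _ i]) (auto simp: I_def i_def)
  qed
  have free: "\<exists>i\<in>I. Q i = {}"
  proof -
    \<comment> \<open>\<open>4 * Suc n\<close> is half of M: the subcube starts at the midpoint of
      the cube, so a point within l/8 of it stays inside the cube.\<close>
    define i0 where "i0 = (\<lambda>s\<in>S. 4 * Suc n)"
    have i0: "i0 \<in> I" by (auto simp: i0_def I_def M_def)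
    have q0: "qq i0 s = q s + l / 2" if "s \<in> S" for s
      using that by (simp add: qq_def i0_def M_def field_simps)
    show ?thesis
    proof (cases "Q i0 = {}")
      case True with i0 show ?thesis by blast
    next
      case False
      then obtain b where b: "b \<in> B" "\<And>s. s \<in> S \<Longrightarrow> qq i0 s \<le> u b s \<and> u b s < qq i0 s + l / real M"
        by (auto simp: Q_def)
      have lM: "l / real M \<le> l / 8" unfolding M_def using Suc.prems by (intro divide_left_mono) auto
      have "l / 8 < 1 / real (Suc n)" using Suc.prems by linarith
      then obtain z where z: "\<And>s. s \<in> S \<Longrightarrow> \<bar>z s - u b s\<bar> \<le> l / 8"
        "\<And>b'. b' \<in> B \<Longrightarrow> \<exists>s\<in>S. \<bar>u b' s - z s\<bar> > l / 8 / real (Suc n)"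
        using hole[OF b(1), of "l / 8"] Suc.prems by auto
      have "q s \<le> z s \<and> z s < q s + l" if "s \<in> S" for s
        using b(2)[OF that] z(1)[OF that] q0[OF that] lM Suc.prems(1) unfolding abs_le_iff by linarith
      then obtain i where i: "i \<in> I" "\<And>s. s \<in> S \<Longrightarrow> qq i s \<le> z s \<and> z s < qq i s + l / real M"
        using idx[of z] by auto
      have "Q i = {}"
      proof (rule ccontr)
        assume "Q i \<noteq> {}"
        then obtain b' where b': "b' \<in> B" "\<And>s. s \<in> S \<Longrightarrow> qq i s \<le> u b' s \<and> u b' s < qq i s + l / real M"
          by (auto simp: Q_def)
        obtain s where s: "s \<in> S" "\<bar>u b' s - z s\<bar> > l / 8 / real (Suc n)" using z(2)[OF b'(1)] by blast
        have "\<bar>u b' s - z s\<bar> < l / real M" using b'(2)[OF s(1)] i(2)[OF s(1)] by linarith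
        moreover have "l / real M = l / 8 / real (Suc n)" by (simp add: M_def)
        ultimately show False using s(2) by linarith
      qed
      with i show ?thesis by blast
    qed
  qed
  then obtain i1 where i1: "i1 \<in> I" "Q i1 = {}" by blast
  have l': "0 < l / real M" "l / real M \<le> 1 / real (Suc n)"
  proof -
    show "0 < l / real M" using Suc.prems M by simp
    have "l / real M \<le> l / 1" using Suc.prems M by (intro divide_left_mono) auto
    then show "l / real M \<le> 1 / real (Suc n)" using Suc.prems by simp
  qed
  have "\<forall>i. \<exists>C. finite C \<and> card C \<le> (M ^ card S - 1) ^ j \<and>
     (\<forall>b\<in>B. (\<forall>s\<in>S. qq i s \<le> u b s \<and> u b s < qq i s + l / real M) \<longrightarrow> (\<exists>c\<in>C. \<forall>s\<in>S. c s \<le> u b s \<and> u b s < c s + (l / real M) / real M ^ j))"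
    using Suc.IH[OF l'] by blast
  from choice[OF this] obtain C where C: "\<And>i. finite (C i)" "\<And>i. card (C i) \<le> (M ^ card S - 1) ^ j"
     "\<And>i b. b \<in> B \<Longrightarrow> (\<forall>s\<in>S. qq i s \<le> u b s \<and> u b s < qq i s + l / real M) \<Longrightarrow> (\<exists>c\<in>C i. \<forall>s\<in>S. c s \<le> u b s \<and> u b s < c s + (l / real M) / real M ^ j)"
    by blast
  show ?case
  proof (intro exI[of _ "\<Union>i\<in>I - {i1}. C i"] conjI ballI impI)
    show "finite (\<Union>i\<in>I - {i1}. C i)" using I C by auto
    have "card (\<Union>i\<in>I - {i1}. C i) \<le> (\<Sum>i\<in>I - {i1}. card (C i))" using I by (intro card_UN_le) auto
    also have "\<dots> \<le> (\<Sum>i\<in>I - {i1}. (M ^ card S - 1) ^ j)" by (intro sum_mono C)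
    also have "\<dots> = (M ^ card S - 1) ^ Suc j" using I i1 by (simp add: card_Diff_singleton)
    finally show "card (\<Union>i\<in>I - {i1}. C i) \<le> (M ^ card S - 1) ^ Suc j" .
    fix b assume b: "b \<in> B" "\<forall>s\<in>S. q s \<le> u b s \<and> u b s < q s + l"
    obtain i where i: "i \<in> I" "\<forall>s\<in>S. qq i s \<le> u b s \<and> u b s < qq i s + l / real M" using idx[OF b(2)] by blast
    then have "b \<in> Q i" using b by (auto simp: Q_def)
    then have "i \<noteq> i1" using i1 by auto
    moreover obtain c where "c \<in> C i" "\<forall>s\<in>S. c s \<le> u b s \<and> u b s < c s + (l / real M) / real M ^ j"
      using C(3)[OF b(1) i(2)] by blast
    ultimately show "\<exists>c\<in>(\<Union>i\<in>I - {i1}. C i). \<forall>s\<in>S. c s \<le> u b s \<and> u b s < c s + l / real M ^ Suc j"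
      using i(1) by (intro bexI[of _ c]) auto
  qed
qed

text \<open>With K = M^card S, generation j needs at most (K - 1)^j boxes of measure a constant
  times K^-j, because the density is at most 1/\<sigma> and v is L-Lipschitz in u. \<open>B\<close>
  and \<open>v\<close> are arbitrary, so the conclusion is a null superset.\<close>

lemma porous_image_null_cube:
  fixes u v :: "'b \<Rightarrow> 'i \<Rightarrow> real" and n :: nat
  assumes S: "finite S" "S \<noteq> {}" and \<sigma>: "0 < \<sigma>" and L: "0 \<le> L"
    and lip: "\<And>b b' \<delta>. b \<in> B \<Longrightarrow> b' \<in> B \<Longrightarrow> (\<And>s. s \<in> S \<Longrightarrow> \<bar>u b s - u b' s\<bar> \<le> \<delta>) \<Longrightarrow> (\<forall>s\<in>S. \<bar>v b s - v b' s\<bar> \<le> L * \<delta>)"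
    and hole: "\<And>b \<epsilon>. b \<in> B \<Longrightarrow> 0 < \<epsilon> \<Longrightarrow> \<epsilon> < 1 / real (Suc n) \<Longrightarrow>
       \<exists>z. (\<forall>s\<in>S. \<bar>z s - u b s\<bar> \<le> \<epsilon>) \<and> (\<forall>b'\<in>B. \<exists>s\<in>S. \<bar>u b' s - z s\<bar> > \<epsilon> / real (Suc n))"
  defines "l \<equiv> 1 / real (Suc n)"
  shows "\<exists>N\<in>null_sets (noise \<sigma> S). \<forall>b\<in>B. (\<forall>s\<in>S. q s \<le> u b s \<and> u b s < q s + l) \<longrightarrow> restrict (v b) S \<in> N"
proof -
  define M where "M = 8 * Suc n"
  have M: "8 \<le> M" "0 < real M" by (auto simp: M_def)
  have l: "0 < l" "l \<le> 1 / real (Suc n)" by (auto simp: l_def)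
  have "\<forall>j. \<exists>C. finite C \<and> card C \<le> (M ^ card S - 1) ^ j \<and>
     (\<forall>b\<in>B. (\<forall>s\<in>S. q s \<le> u b s \<and> u b s < q s + l) \<longrightarrow> (\<exists>c\<in>C. \<forall>s\<in>S. c s \<le> u b s \<and> u b s < c s + l / real M ^ j))"
    using porous_cover[of S B n u l, OF S(1) hole l] unfolding M_def by blast
  from choice[OF this] obtain C where C: "\<And>j. finite (C j)" "\<And>j. card (C j) \<le> (M ^ card S - 1) ^ j"
    "\<And>j b. b \<in> B \<Longrightarrow> (\<forall>s\<in>S. q s \<le> u b s \<and> u b s < q s + l) \<Longrightarrow> (\<exists>c\<in>C j. \<forall>s\<in>S. c s \<le> u b s \<and> u b s < c s + l / real M ^ j)"
    by blast
  define R where "R j c b \<longleftrightarrow> b \<in> B \<and> (\<forall>s\<in>S. c s \<le> u b s \<and> u b s < c s + l / real M ^ j)" for j c b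
  \<comment> \<open>Boxes are centred at images of representatives, since v is given on the
    parameters \<open>b\<close> and not at corners of cubes.\<close>
  define w where "w j c = (SOME b. R j c b)" for j c
  define box where "box j c = {z \<in> space (noise \<sigma> S). \<forall>s\<in>S. \<bar>z s - v (w j c) s\<bar> \<le> L * (l / real M ^ j)}" for j c
  have r0: "0 \<le> L * (l / real M ^ j)" for j using L l M by simp
  have boxm[measurable]: "box j c \<in> sets (noise \<sigma> S)" for j c
    unfolding box_def by (rule noise_box_measure(1)[OF S(1) \<sigma> r0])
  define N where "N = (\<Inter>j. \<Union>c\<in>C j. box j c)"
  have Nm[measurable]: "N \<in> sets (noise \<sigma> S)"
    unfolding N_def using C(1) by (intro sets.countable_INT sets.finite_UN) auto
  define A where "A = (2 * L * l / \<sigma>) ^ card S"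
  define K where "K = M ^ card S"
  have K: "1 < K" unfolding K_def using M S by (intro one_less_power) (auto simp: card_gt_0_iff)
  have bnd: "emeasure (noise \<sigma> S) N \<le> ennreal (A * (real (K - 1) / real K) ^ j)" for j
  proof -
    have p0: "0 \<le> (2 * (L * (l / real M ^ j)) / \<sigma>) ^ card S"
      using r0[of j] \<sigma> by (intro zero_le_power divide_nonneg_pos) auto
    have "emeasure (noise \<sigma> S) N \<le> emeasure (noise \<sigma> S) (\<Union>c\<in>C j. box j c)"
      using C(1) by (intro emeasure_mono sets.finite_UN) (auto simp: N_def)
    also have "\<dots> \<le> (\<Sum>c\<in>C j. emeasure (noise \<sigma> S) (box j c))"
      using C(1) by (intro emeasure_subadditive_finite) auto
    also have "\<dots> \<le> (\<Sum>c\<in>C j. ennreal ((2 * (L * (l / real M ^ j)) / \<sigma>) ^ card S))"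
      unfolding box_def by (intro sum_mono noise_box_measure(2)[OF S(1) \<sigma> r0])
    also have "\<dots> = ennreal (real (card (C j)) * ((2 * (L * (l / real M ^ j)) / \<sigma>) ^ card S))"
      using p0 by (subst ennreal_mult) (simp_all add: ennreal_of_nat_eq_real_of_nat)
    also have "\<dots> \<le> ennreal (real ((K - 1) ^ j) * ((2 * (L * (l / real M ^ j)) / \<sigma>) ^ card S))"
      using C(2)[of j] by (intro ennreal_leI mult_right_mono p0) (simp add: K_def del: of_nat_power)
    also have "real ((K - 1) ^ j) * ((2 * (L * (l / real M ^ j)) / \<sigma>) ^ card S) = A * (real (K - 1) / real K) ^ j"
    proof -
      have "(2 * (L * (l / real M ^ j)) / \<sigma>) ^ card S = (2 * L * l / \<sigma> / real M ^ j) ^ card S" by (simp add: mult_ac)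
      also have "\<dots> = A / (real M ^ j) ^ card S" by (simp add: A_def power_divide power_mult_distrib)
      also have "(real M ^ j) ^ card S = real K ^ j" by (simp add: K_def power_mult[symmetric] mult.commute)
      finally show ?thesis by (simp add: power_divide)
    qed
    finally show ?thesis .
  qed
  have "(\<lambda>j. A * (real (K - 1) / real K) ^ j) \<longlonglongrightarrow> A * 0"
    by (intro tendsto_intros LIMSEQ_realpow_zero) (use K in auto)
  then have "(\<lambda>j. ennreal (A * (real (K - 1) / real K) ^ j)) \<longlonglongrightarrow> ennreal (A * 0)" by (rule tendsto_ennrealI)
  then have "emeasure (noise \<sigma> S) N \<le> ennreal (A * 0)"
    by (rule LIMSEQ_le_const) (use bnd in auto)
  then have null: "N \<in> null_sets (noise \<sigma> S)" using Nm by (auto simp: null_sets_def)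
  have "restrict (v b) S \<in> N" if b: "b \<in> B" "\<forall>s\<in>S. q s \<le> u b s \<and> u b s < q s + l" for b
  proof -
    have "restrict (v b) S \<in> (\<Union>c\<in>C j. box j c)" for j
    proof -
      obtain c where c: "c \<in> C j" "\<forall>s\<in>S. c s \<le> u b s \<and> u b s < c s + l / real M ^ j" using C(3)[OF b] by blast
      then have "R j c b" using b by (simp add: R_def)
      then have w: "R j c (w j c)" unfolding w_def by (rule someI)
      have "\<bar>u b s - u (w j c) s\<bar> \<le> l / real M ^ j" if "s \<in> S" for s
      proof -
        have "c s \<le> u b s" "u b s < c s + l / real M ^ j" using c(2) that by auto
        moreover have "c s \<le> u (w j c) s" "u (w j c) s < c s + l / real M ^ j" using w that by (auto simp: R_def)
        ultimately show ?thesis by linarith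
      qed
      note d = this
      have wB: "w j c \<in> B" using w by (simp add: R_def)
      have "\<forall>s\<in>S. \<bar>v b s - v (w j c) s\<bar> \<le> L * (l / real M ^ j)"
        by (rule lip[OF b(1) wB d])
      then have "restrict (v b) S \<in> box j c" by (auto simp: box_def space_PiM)
      with c show ?thesis by blast
    qed
    then show ?thesis by (simp add: N_def)
  qed
  with null show ?thesis by blast
qed

text \<open>The hole sizes \<eta> and \<epsilon>0 may vary with b. Countably many strata, on which
  1/(n+1) serves for both, and countably many cubes of that side reduce to the uniform case; a hole
  of \<open>B\<close> is also a hole of every stratum.\<close>

lemma porous_image_null:
  fixes u v :: "'b \<Rightarrow> 'i \<Rightarrow> real"
  assumes S: "finite S" "S \<noteq> {}" and \<sigma>: "0 < \<sigma>" and L: "0 \<le> L"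
    and lip: "\<And>b b' \<delta>. b \<in> B \<Longrightarrow> b' \<in> B \<Longrightarrow> (\<And>s. s \<in> S \<Longrightarrow> \<bar>u b s - u b' s\<bar> \<le> \<delta>) \<Longrightarrow> (\<forall>s\<in>S. \<bar>v b s - v b' s\<bar> \<le> L * \<delta>)"
    and hole: "\<And>b. b \<in> B \<Longrightarrow> \<exists>\<eta>>0. \<exists>\<epsilon>0>0. \<forall>\<epsilon>. 0 < \<epsilon> \<and> \<epsilon> < \<epsilon>0 \<longrightarrow>
       (\<exists>z. (\<forall>s\<in>S. \<bar>z s - u b s\<bar> \<le> \<epsilon>) \<and> (\<forall>b'\<in>B. \<exists>s\<in>S. \<bar>u b' s - z s\<bar> > \<eta> * \<epsilon>))"
  shows "\<exists>N\<in>null_sets (noise \<sigma> S). \<forall>b\<in>B. restrict (v b) S \<in> N"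
proof -
  define B' where "B' n = {b \<in> B. \<forall>\<epsilon>. 0 < \<epsilon> \<and> \<epsilon> < 1 / real (Suc n) \<longrightarrow>
       (\<exists>z. (\<forall>s\<in>S. \<bar>z s - u b s\<bar> \<le> \<epsilon>) \<and> (\<forall>b'\<in>B. \<exists>s\<in>S. \<bar>u b' s - z s\<bar> > \<epsilon> / real (Suc n)))}" for n
  define q where "q n i = (\<lambda>s. real_of_int (i s) / real (Suc n))" for n :: nat and i :: "'i \<Rightarrow> int"
  define I where "I = (\<Pi>\<^sub>E s\<in>S. (UNIV :: int set))"
  have cI: "countable I" unfolding I_def using S(1) by (intro countable_PiE) auto
  have "\<forall>n. \<forall>i. \<exists>N. N \<in> null_sets (noise \<sigma> S) \<and> (\<forall>b\<in>B' n. (\<forall>s\<in>S. q n i s \<le> u b s \<and> u b s < q n i s + 1 / real (Suc n)) \<longrightarrow> restrict (v b) S \<in> N)"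
  proof (intro allI)
    fix n i
    have sub: "B' n \<subseteq> B" by (auto simp: B'_def)
    have "\<exists>N\<in>null_sets (noise \<sigma> S). \<forall>b\<in>B' n. (\<forall>s\<in>S. q n i s \<le> u b s \<and> u b s < q n i s + 1 / real (Suc n)) \<longrightarrow> restrict (v b) S \<in> N"
    proof (rule porous_image_null_cube[OF S \<sigma> L])
      fix b b' \<delta> assume "b \<in> B' n" "b' \<in> B' n" "\<And>s. s \<in> S \<Longrightarrow> \<bar>u b s - u b' s\<bar> \<le> \<delta>"
      then show "\<forall>s\<in>S. \<bar>v b s - v b' s\<bar> \<le> L * \<delta>" using sub by (intro lip) auto
    next
      fix b \<epsilon> assume b: "b \<in> B' n" "0 < \<epsilon>" "\<epsilon> < 1 / real (Suc n)"
      then obtain z where z: "\<forall>s\<in>S. \<bar>z s - u b s\<bar> \<le> \<epsilon>" "\<forall>b'\<in>B. \<exists>s\<in>S. \<bar>u b' s - z s\<bar> > \<epsilon> / real (Suc n)"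
        unfolding B'_def mem_Collect_eq by metis
      have "\<forall>b'\<in>B' n. \<exists>s\<in>S. \<bar>u b' s - z s\<bar> > \<epsilon> / real (Suc n)"
      proof
        fix b' assume "b' \<in> B' n"
        then have "b' \<in> B" using sub by (rule rev_subsetD)
        with z(2) show "\<exists>s\<in>S. \<bar>u b' s - z s\<bar> > \<epsilon> / real (Suc n)" by (rule bspec)
      qed
      with z(1) show "\<exists>z. (\<forall>s\<in>S. \<bar>z s - u b s\<bar> \<le> \<epsilon>) \<and> (\<forall>b'\<in>B' n. \<exists>s\<in>S. \<bar>u b' s - z s\<bar> > \<epsilon> / real (Suc n))"
        by (intro exI[of _ z] conjI)
    qed
    then show "\<exists>N. N \<in> null_sets (noise \<sigma> S) \<and> (\<forall>b\<in>B' n. (\<forall>s\<in>S. q n i s \<le> u b s \<and> u b s < q n i s + 1 / real (Suc n)) \<longrightarrow> restrict (v b) S \<in> N)"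
      by blast
  qed
  then obtain N where N: "\<And>n i. N n i \<in> null_sets (noise \<sigma> S)"
    "\<And>n i b. b \<in> B' n \<Longrightarrow> (\<forall>s\<in>S. q n i s \<le> u b s \<and> u b s < q n i s + 1 / real (Suc n)) \<Longrightarrow> restrict (v b) S \<in> N n i"
    unfolding choice_iff by blast
  have "(\<Union>n. \<Union>i\<in>I. N n i) \<in> null_sets (noise \<sigma> S)"
    by (intro null_sets_UN null_sets_UN'[OF cI] N(1))
  moreover have "restrict (v b) S \<in> (\<Union>n. \<Union>i\<in>I. N n i)" if b: "b \<in> B" for b
  proof -
    obtain \<eta> \<epsilon>0 where h: "0 < \<eta>" "0 < \<epsilon>0" "\<And>\<epsilon>. 0 < \<epsilon> \<Longrightarrow> \<epsilon> < \<epsilon>0 \<Longrightarrow>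
       (\<exists>z. (\<forall>s\<in>S. \<bar>z s - u b s\<bar> \<le> \<epsilon>) \<and> (\<forall>b'\<in>B. \<exists>s\<in>S. \<bar>u b' s - z s\<bar> > \<eta> * \<epsilon>))"
      using hole[OF b] by blast
    obtain n where n: "1 / real (Suc n) < min \<eta> \<epsilon>0"
      using reals_Archimedean[of "min \<eta> \<epsilon>0"] h by (auto simp: inverse_eq_divide)
    have "b \<in> B' n" unfolding B'_def
    proof (intro CollectI conjI allI impI b)
      fix \<epsilon> assume e: "0 < \<epsilon> \<and> \<epsilon> < 1 / real (Suc n)"
      then obtain z where z: "\<forall>s\<in>S. \<bar>z s - u b s\<bar> \<le> \<epsilon>" "\<forall>b'\<in>B. \<exists>s\<in>S. \<bar>u b' s - z s\<bar> > \<eta> * \<epsilon>"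
        using h(3)[of \<epsilon>] n by (metis (no_types, lifting) less_trans min_less_iff_conj)
      have "\<epsilon> / real (Suc n) \<le> \<eta> * \<epsilon>" using n e mult_right_mono[of "1 / real (Suc n)" \<eta> \<epsilon>] by simp
      then have "\<forall>b'\<in>B. \<exists>s\<in>S. \<bar>u b' s - z s\<bar> > \<epsilon> / real (Suc n)"
        using z(2) by (intro ballI) (drule bspec, assumption, erule bexE, rule bexI, erule le_less_trans)
      with z(1) show "\<exists>z. (\<forall>s\<in>S. \<bar>z s - u b s\<bar> \<le> \<epsilon>) \<and> (\<forall>b'\<in>B. \<exists>s\<in>S. \<bar>u b' s - z s\<bar> > \<epsilon> / real (Suc n))"
        by (intro exI[of _ z] conjI)
    qed
    moreover define i where "i = (\<lambda>s\<in>S. \<lfloor>u b s * real (Suc n)\<rfloor>)"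
    have "q n i s \<le> u b s \<and> u b s < q n i s + 1 / real (Suc n)" if "s \<in> S" for s
    proof -
      have "real_of_int (i s) \<le> u b s * real (Suc n)" "u b s * real (Suc n) < real_of_int (i s) + 1"
        using that by (simp_all add: i_def)
      then show ?thesis by (simp add: q_def field_simps)
    qed
    moreover have "i \<in> I" by (auto simp: i_def I_def)
    ultimately show ?thesis using N(2)[of b n i] by blast
  qed
  ultimately show ?thesis by blast
qed

subsection \<open>Non-unique nearest points\<close>

abbreviation sqd :: "'i set \<Rightarrow> ('i \<Rightarrow> real) \<Rightarrow> ('i \<Rightarrow> real) \<Rightarrow> real" where
  "sqd S y m \<equiv> dot S (\<lambda>s. y s - m s) (\<lambda>s. y s - m s)"

definition nearest :: "'i set \<Rightarrow> ('i \<Rightarrow> real) set \<Rightarrow> ('i \<Rightarrow> real) \<Rightarrow> ('i \<Rightarrow> real) \<Rightarrow> bool" where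
  "nearest S M y m \<longleftrightarrow> m \<in> M \<and> (\<forall>q\<in>M. sqd S y m \<le> sqd S y q)"

definition nrm :: "'i set \<Rightarrow> ('i \<Rightarrow> real) \<Rightarrow> real" where
  "nrm S x = sqrt (dot S x x)"

lemma nrm_nonneg[simp]: "0 \<le> nrm S x" by (simp add: nrm_def)

lemma nrm_square: "(nrm S x)\<^sup>2 = dot S x x" by (simp add: nrm_def)

lemma nrm_eq_L2_set: "nrm S x = L2_set x S"
  by (simp add: nrm_def L2_set_def dot_def power2_eq_square)

lemma nrm_triangle: "nrm S (\<lambda>s. x s + y s) \<le> nrm S x + nrm S y"
  unfolding nrm_eq_L2_set by (rule L2_set_triangle_ineq)

lemma nrm_scale: "nrm S (\<lambda>s. c * x s) = \<bar>c\<bar> * nrm S x"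
proof -
  have "dot S (\<lambda>s. c * x s) (\<lambda>s. c * x s) = c\<^sup>2 * dot S x x"
    by (simp add: dot_scale_left dot_scale_right power2_eq_square)
  then show ?thesis unfolding nrm_def by (simp only: real_sqrt_mult real_sqrt_abs)
qed

lemma abs_dot_le_nrm: "\<bar>dot S x y\<bar> \<le> nrm S x * nrm S y"
  using real_sqrt_le_mono[OF dot_Cauchy[of S x y]] by (simp add: nrm_def real_sqrt_mult)

lemma abs_le_nrm: "finite S \<Longrightarrow> s \<in> S \<Longrightarrow> \<bar>x s\<bar> \<le> nrm S x"
  using member_le_L2_set[of S s "\<lambda>s. \<bar>x s\<bar>"] by (simp add: nrm_eq_L2_set L2_set_def)

lemma nrm_bound:
  assumes "finite S" "0 \<le> d" "\<And>s. s \<in> S \<Longrightarrow> \<bar>x s\<bar> \<le> d"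
  shows "nrm S x \<le> real (card S) * d"
proof -
  have "nrm S x \<le> (\<Sum>s\<in>S. \<bar>x s\<bar>)" unfolding nrm_eq_L2_set by (rule L2_set_le_sum_abs)
  also have "\<dots> \<le> (\<Sum>s\<in>S. d)" by (intro sum_mono assms)
  finally show ?thesis by simp
qed

lemma nearest_inner:
  assumes "nearest S M y m" "q \<in> M"
  shows "2 * dot S (\<lambda>s. y s - m s) (\<lambda>s. q s - m s) \<le> dot S (\<lambda>s. q s - m s) (\<lambda>s. q s - m s)"
proof -
  have "sqd S y m \<le> sqd S y q" using assms by (auto simp: nearest_def)
  also have "(\<lambda>s. y s - q s) = (\<lambda>s. (y s - m s) - (q s - m s))" by auto
  then have "sqd S y q = dot S (\<lambda>s. (y s - m s) - (q s - m s)) (\<lambda>s. (y s - m s) - (q s - m s))" by simp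
  also have "\<dots> = sqd S y m - 2 * dot S (\<lambda>s. y s - m s) (\<lambda>s. q s - m s) + dot S (\<lambda>s. q s - m s) (\<lambda>s. q s - m s)"
    by (simp only: dot_diff_left[of S "\<lambda>s. y s - m s"] dot_diff_right[of S _ "\<lambda>s. y s - m s"]) (simp add: dot_commute[of S "\<lambda>s. q s - m s" "\<lambda>s. y s - m s"])
  finally show ?thesis by simp
qed

text \<open>Nearest points are monotone: if m2 is nearest to y2, then <y2 - y, m' - m2> \<le> 0.
  Shifting y by \<epsilon> in coordinate s would have to raise that coordinate of the nearest point
  almost to m' s, whereas in the stratum it stays more than h below. Hence the stratum has a hole
  around the shifted y.\<close>

lemma nonunique_stratum_null:
  fixes a :: "'i \<Rightarrow> real"
  assumes S: "finite S" "S \<noteq> {}" and \<sigma>: "0 < \<sigma>" and s: "s \<in> S" and h: "0 < h" and R: "0 < R"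
  shows "\<exists>N\<in>null_sets (noise \<sigma> S). \<forall>y m m'. nearest S M y m \<and> nearest S M y m' \<and>
     (\<forall>r\<in>S. \<bar>m r\<bar> \<le> R \<and> \<bar>m' r\<bar> \<le> R) \<and> 2 * h \<le> m' s - m s \<and> l \<le> m s \<and> m s < l + h \<longrightarrow> restrict (\<lambda>s. y s - a s) S \<in> N"
proof -
  define B where "B = {(y, m, m'). nearest S M y m \<and> nearest S M y m' \<and>
     (\<forall>r\<in>S. \<bar>m r\<bar> \<le> R \<and> \<bar>m' r\<bar> \<le> R) \<and> 2 * h \<le> m' s - m s \<and> l \<le> m s \<and> m s < l + h}"
  have "\<exists>N\<in>null_sets (noise \<sigma> S). \<forall>b\<in>B. restrict ((\<lambda>(y, m, m'). \<lambda>s. y s - a s) b) S \<in> N"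
  proof (rule porous_image_null[where u="\<lambda>(y, m, m'). y" and L=1, OF S \<sigma>])
    fix b b' \<delta> assume "b \<in> B" "b' \<in> B" "\<And>s. s \<in> S \<Longrightarrow> \<bar>(\<lambda>(y, m, m'). y) b s - (\<lambda>(y, m, m'). y) b' s\<bar> \<le> \<delta>"
    then show "\<forall>s\<in>S. \<bar>(case b of (y, m, m') \<Rightarrow> \<lambda>s. y s - a s) s - (case b' of (y, m, m') \<Rightarrow> \<lambda>s. y s - a s) s\<bar> \<le> 1 * \<delta>"
      by (auto split: prod.splits)
  next
    fix b assume "b \<in> B"
    then obtain y m m' where b: "b = (y, m, m')" and y: "nearest S M y m" "nearest S M y m'"
     "2 * h \<le> m' s - m s" "l \<le> m s" "m s < l + h" and R': "\<And>r. r \<in> S \<Longrightarrow> \<bar>m' r\<bar> \<le> R"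
      by (auto simp: B_def)
    \<comment> \<open>An error of \<eta> \<epsilon> per coordinate contributes at most card S *
      \<eta> \<epsilon> * 2 R = \<epsilon> h / 2, half of the gain \<epsilon> h.\<close>
    define \<eta> where "\<eta> = h / (4 * R * real (card S))"
    have cS: "0 < real (card S)" using S by (simp add: card_gt_0_iff)
    have \<eta>: "0 < \<eta>" using h R cS by (simp add: \<eta>_def)
    show "\<exists>\<eta>>0. \<exists>\<epsilon>0>0. \<forall>\<epsilon>. 0 < \<epsilon> \<and> \<epsilon> < \<epsilon>0 \<longrightarrow>
       (\<exists>z. (\<forall>s\<in>S. \<bar>z s - (\<lambda>(y, m, m'). y) b s\<bar> \<le> \<epsilon>) \<and> (\<forall>b'\<in>B. \<exists>s\<in>S. \<bar>(\<lambda>(y, m, m'). y) b' s - z s\<bar> > \<eta> * \<epsilon>))"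
    proof (rule exI[of _ \<eta>], intro conjI \<eta>, rule exI[of _ 1], intro conjI allI impI)
      fix \<epsilon> :: real assume \<epsilon>: "0 < \<epsilon> \<and> \<epsilon> < 1"
      define z where "z r = y r + (if r = s then \<epsilon> else 0)" for r
      have "\<exists>r\<in>S. \<bar>y2 r - z r\<bar> > \<eta> * \<epsilon>" if b2: "(y2, m2, m2') \<in> B" for y2 m2 m2'
      proof (rule ccontr)
        assume "\<not> (\<exists>r\<in>S. \<bar>y2 r - z r\<bar> > \<eta> * \<epsilon>)"
        then have c: "\<And>r. r \<in> S \<Longrightarrow> \<bar>y2 r - z r\<bar> \<le> \<eta> * \<epsilon>" by force
        from b2 have b2': "nearest S M y2 m2" "m2 s < l + h" "\<And>r. r \<in> S \<Longrightarrow> \<bar>m2 r\<bar> \<le> R" by (auto simp: B_def)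
        have m2: "m2 \<in> M" "m' \<in> M" using b2' y by (auto simp: nearest_def)
        have i1: "2 * dot S (\<lambda>r. y2 r - m2 r) (\<lambda>r. m' r - m2 r) \<le> dot S (\<lambda>r. m' r - m2 r) (\<lambda>r. m' r - m2 r)"
          by (rule nearest_inner[OF b2'(1) m2(2)])
        have i2: "2 * dot S (\<lambda>r. y r - m' r) (\<lambda>r. m2 r - m' r) \<le> dot S (\<lambda>r. m2 r - m' r) (\<lambda>r. m2 r - m' r)"
          by (rule nearest_inner[OF y(2) m2(1)])
        have "dot S (\<lambda>r. y2 r - y r) (\<lambda>r. m' r - m2 r)
          = dot S (\<lambda>r. y2 r - m2 r) (\<lambda>r. m' r - m2 r) + dot S (\<lambda>r. y r - m' r) (\<lambda>r. m2 r - m' r)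
            - (dot S (\<lambda>r. m' r - m2 r) (\<lambda>r. m' r - m2 r) + dot S (\<lambda>r. m2 r - m' r) (\<lambda>r. m2 r - m' r)) / 2"
          unfolding dot_def by (simp add: sum.distrib[symmetric] sum_subtractf[symmetric] sum_divide_distrib algebra_simps add_divide_distrib diff_divide_distrib)
        then have "dot S (\<lambda>r. y2 r - y r) (\<lambda>r. m' r - m2 r) \<le> 0" using i1 i2 by argo
        moreover have "dot S (\<lambda>r. y2 r - y r) (\<lambda>r. m' r - m2 r)
           = dot S (\<lambda>r. y2 r - z r) (\<lambda>r. m' r - m2 r) + \<epsilon> * (m' s - m2 s)"
        proof -
          have "\<epsilon> * (m' s - m2 s) = (\<Sum>r\<in>S. if r = s then \<epsilon> * (m' s - m2 s) else 0)" using S s by simp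
          also have "\<dots> = dot S (\<lambda>r. z r - y r) (\<lambda>r. m' r - m2 r)"
            unfolding dot_def by (intro sum.cong) (auto simp: z_def)
          finally show ?thesis unfolding dot_def by (simp add: sum.distrib[symmetric] algebra_simps)
        qed
        moreover have "\<bar>dot S (\<lambda>r. y2 r - z r) (\<lambda>r. m' r - m2 r)\<bar> \<le> \<epsilon> * (h / 2)"
        proof -
          have "\<bar>dot S (\<lambda>r. y2 r - z r) (\<lambda>r. m' r - m2 r)\<bar> \<le> (\<Sum>r\<in>S. \<eta> * \<epsilon> * (2 * R))"
            unfolding dot_def
          proof (rule order_trans[OF sum_abs], rule sum_mono)
            fix r assume r: "r \<in> S"
            have "\<bar>m' r - m2 r\<bar> \<le> 2 * R" using R'[OF r] b2'(3)[OF r] by linarith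
            then show "\<bar>(y2 r - z r) * (m' r - m2 r)\<bar> \<le> \<eta> * \<epsilon> * (2 * R)"
              unfolding abs_mult using c[OF r] R \<eta> \<epsilon> by (intro mult_mono) auto
          qed
          also have "\<dots> = \<epsilon> * (h / 2)" using R cS by (simp add: \<eta>_def field_simps)
          finally show ?thesis .
        qed
        moreover have "h < m' s - m2 s" using y b2'(2) by linarith
        then have "\<epsilon> * h < \<epsilon> * (m' s - m2 s)" using \<epsilon> by simp
        moreover have "0 < \<epsilon> * h" using \<epsilon> h by simp
        ultimately show False by linarith
      qed
      moreover have "\<forall>r\<in>S. \<bar>z r - y r\<bar> \<le> \<epsilon>" using \<epsilon> by (auto simp: z_def)
      ultimately show "\<exists>z. (\<forall>s\<in>S. \<bar>z s - (\<lambda>(y, m, m'). y) b s\<bar> \<le> \<epsilon>) \<and> (\<forall>b'\<in>B. \<exists>s\<in>S. \<bar>(\<lambda>(y, m, m'). y) b' s - z s\<bar> > \<eta> * \<epsilon>)"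
        by (intro exI[of _ z]) (auto simp: b)
    qed simp
  qed simp
  then obtain N where "N \<in> null_sets (noise \<sigma> S)" "\<forall>b\<in>B. restrict ((\<lambda>(y, m, m'). \<lambda>s. y s - a s) b) S \<in> N" by blast
  then show ?thesis by (intro bexI[of _ N]) (auto simp: B_def)
qed

text \<open>Countably many strata: the coordinate where the two nearest points differ, a lower bound
  for the gap, a bound for their size, and the cell of the smaller coordinate. Exchanging m and m'
  covers both signs.\<close>

lemma nonunique_nearest_null:
  fixes a :: "'i \<Rightarrow> real"
  assumes S: "finite S" "S \<noteq> {}" and \<sigma>: "0 < \<sigma>"
  shows "\<exists>N\<in>null_sets (noise \<sigma> S). \<forall>y m m'. nearest S M y m \<and> nearest S M y m' \<and> (\<exists>s\<in>S. m s \<noteq> m' s)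
     \<longrightarrow> restrict (\<lambda>s. y s - a s) S \<in> N"
proof -
  define P where "P s h R l y m m' \<longleftrightarrow> nearest S M y m \<and> nearest S M y m' \<and>
     (\<forall>r\<in>S. \<bar>m r\<bar> \<le> R \<and> \<bar>m' r\<bar> \<le> R) \<and> 2 * h \<le> m' s - m s \<and> l \<le> m s \<and> m s < l + h" for s h R l y m m'
  define hh where "hh n = 1 / real (Suc n)" for n
  define I where "I = S \<times> (UNIV :: (nat \<times> nat \<times> int) set)"
  have cI: "countable I" unfolding I_def using S by (intro countable_SIGMA) (auto simp: countable_finite)
  have "\<forall>i\<in>I. \<exists>N. N \<in> null_sets (noise \<sigma> S) \<and> (case i of (s, n, R, j) \<Rightarrow>
     \<forall>y m m'. P s (hh n) (real (Suc R)) (hh n * real_of_int j) y m m' \<longrightarrow> restrict (\<lambda>s. y s - a s) S \<in> N)"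
  proof
    fix i assume i: "i \<in> I"
    obtain s n R j where i': "i = (s, n, R, j)" by (cases i)
    have s: "s \<in> S" using i by (simp add: i' I_def)
    have "\<exists>N\<in>null_sets (noise \<sigma> S). \<forall>y m m'. P s (hh n) (real (Suc R)) (hh n * real_of_int j) y m m' \<longrightarrow> restrict (\<lambda>s. y s - a s) S \<in> N"
      unfolding P_def by (rule nonunique_stratum_null[OF S \<sigma> s]) (simp_all add: hh_def)
    then show "\<exists>N. N \<in> null_sets (noise \<sigma> S) \<and> (case i of (s, n, R, j) \<Rightarrow>
     \<forall>y m m'. P s (hh n) (real (Suc R)) (hh n * real_of_int j) y m m' \<longrightarrow> restrict (\<lambda>s. y s - a s) S \<in> N)"
      unfolding i' by auto
  qed
  from bchoice[OF this] obtain N where N': "\<forall>i\<in>I. N i \<in> null_sets (noise \<sigma> S) \<and> (case i of (s, n, R, j) \<Rightarrow>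
     \<forall>y m m'. P s (hh n) (real (Suc R)) (hh n * real_of_int j) y m m' \<longrightarrow> restrict (\<lambda>s. y s - a s) S \<in> N i)"
    by (rule exE)
  have N1: "N i \<in> null_sets (noise \<sigma> S)" if "i \<in> I" for i
    using bspec[OF N' that] by (rule conjunct1)
  have N2: "restrict (\<lambda>s. y s - a s) S \<in> N (s, n, R, j)"
    if "s \<in> S" "P s (hh n) (real (Suc R)) (hh n * real_of_int j) y m m'" for s n R j y m m'
  proof -
    have "(s, n, R, j) \<in> I" using that(1) by (simp add: I_def)
    from bspec[OF N' this] have "\<forall>y m m'. P s (hh n) (real (Suc R)) (hh n * real_of_int j) y m m' \<longrightarrow> restrict (\<lambda>s. y s - a s) S \<in> N (s, n, R, j)"
      unfolding prod.case by (rule conjunct2)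
    with that(2) show ?thesis by (elim allE impE)
  qed
  have main: "restrict (\<lambda>s. y s - a s) S \<in> (\<Union>i\<in>I. N i)"
    if n: "nearest S M y m" "nearest S M y m'" "s \<in> S" "m s < m' s" for y m m' s
  proof -
    obtain n where n1: "hh n < (m' s - m s) / 2"
      using reals_Archimedean[of "(m' s - m s) / 2"] n by (auto simp: inverse_eq_divide hh_def)
    obtain R :: nat where R: "(\<Sum>r\<in>S. \<bar>m r\<bar> + \<bar>m' r\<bar>) \<le> real R" using real_arch_simple by blast
    have R': "\<bar>m r\<bar> \<le> real (Suc R) \<and> \<bar>m' r\<bar> \<le> real (Suc R)" if "r \<in> S" for r
    proof -
      have "\<bar>m r\<bar> + \<bar>m' r\<bar> \<le> (\<Sum>r\<in>S. \<bar>m r\<bar> + \<bar>m' r\<bar>)" using S that by (intro member_le_sum) auto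
      with R show ?thesis by auto
    qed
    define j where "j = \<lfloor>m s / hh n\<rfloor>"
    have h0: "0 < hh n" by (simp add: hh_def)
    have j1: "real_of_int j \<le> m s / hh n" "m s / hh n < real_of_int j + 1" by (simp_all add: j_def)
    have j2: "hh n * real_of_int j \<le> m s" "m s < hh n * real_of_int j + hh n"
      using j1 h0 by (simp_all add: field_simps)
    have "P s (hh n) (real (Suc R)) (hh n * real_of_int j) y m m'"
      unfolding P_def using n n1 R' j2 by auto
    then have "restrict (\<lambda>s. y s - a s) S \<in> N (s, n, R, j)" by (rule N2[OF n(3)])
    moreover have "(s, n, R, j) \<in> I" using n(3) by (simp add: I_def)
    ultimately show ?thesis by blast
  qed
  have "(\<Union>i\<in>I. N i) \<in> null_sets (noise \<sigma> S)" by (intro null_sets_UN'[OF cI] N1)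
  moreover have "restrict (\<lambda>s. y s - a s) S \<in> (\<Union>i\<in>I. N i)"
    if "nearest S M y m" "nearest S M y m'" "s \<in> S" "m s \<noteq> m' s" for y m m' s
    using main[of y m m' s] main[of y m' m s] that by (cases "m s < m' s") auto
  ultimately show ?thesis by (intro bexI[of _ "\<Union>i\<in>I. N i"]) auto
qed

subsection \<open>Almost every response has an unambiguous fit of full rank\<close>

lemma dot_relation_bound:
  fixes T :: "'t set" and e :: "'t \<Rightarrow> 'i \<Rightarrow> real"
  assumes "finite T"
  shows "dot I (\<lambda>i. \<Sum>t\<in>T. c t * e t i) (\<lambda>i. \<Sum>t\<in>T. c t * e t i) \<le> dot T c c * (\<Sum>t\<in>T. dot I (e t) (e t))"
proof -
  have "dot I (\<lambda>i. \<Sum>t\<in>T. c t * e t i) (\<lambda>i. \<Sum>t\<in>T. c t * e t i) = (\<Sum>i\<in>I. (dot T c (\<lambda>t. e t i))\<^sup>2)"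
    unfolding dot_def[of I] by (simp add: dot_def power2_eq_square)
  also have "\<dots> \<le> (\<Sum>i\<in>I. dot T c c * dot T (\<lambda>t. e t i) (\<lambda>t. e t i))"
    by (intro sum_mono dot_Cauchy)
  also have "\<dots> = dot T c c * (\<Sum>t\<in>T. dot I (e t) (e t))"
    unfolding sum_distrib_left[symmetric] dot_def by (subst sum.swap) simp
  finally show ?thesis .
qed

text \<open>Perturbing a tuple \<^term>\<open>f\<close> of rank \<^term>\<open>card J\<close> by the rank-one tuple \<^term>\<open>\<lambda>t i. \<alpha> t * b i\<close>, with
  \<^term>\<open>\<alpha>\<close> a linear relation of \<^term>\<open>f\<close> and \<^term>\<open>b\<close> orthogonal to \<^term>\<open>f\<close>, raises the rank, and this is stable
  under small errors.\<close>

lemma rank_one_perturbation: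
  fixes f f' :: "'t \<Rightarrow> 'i \<Rightarrow> real"
  assumes T: "finite T" and J: "J \<subseteq> T" and \<tau>: "\<tau> \<in> T" "\<tau> \<notin> J"
    and \<alpha>\<tau>: "\<alpha> \<tau> \<noteq> 0" and \<alpha>0: "\<And>t. t \<in> T \<Longrightarrow> t \<notin> insert \<tau> J \<Longrightarrow> \<alpha> t = 0"
    and rel: "\<And>i. i \<in> I \<Longrightarrow> (\<Sum>t\<in>T. \<alpha> t * f t i) = 0"
    and bf: "\<And>t. t \<in> T \<Longrightarrow> dot I b (f t) = 0"
    and \<kappa>: "\<And>u. \<kappa> * (\<Sum>j\<in>J. (u j)\<^sup>2) \<le> dot I (\<lambda>i. \<Sum>j\<in>J. u j * f j i) (\<lambda>i. \<Sum>j\<in>J. u j * f j i)"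
    and ab: "1 \<le> 2 * dot T \<alpha> \<alpha> * dot I b b"
    and \<epsilon>: "0 < \<epsilon>" "\<epsilon>\<^sup>2 \<le> \<kappa>"
    and err: "(\<Sum>t\<in>T. dot I (\<lambda>i. f' t i - f t i - \<epsilon> * \<alpha> t * b i) (\<lambda>i. f' t i - f t i - \<epsilon> * \<alpha> t * b i)) \<le> \<epsilon>\<^sup>2 / 200"
    and dep: "\<And>i. i \<in> I \<Longrightarrow> f' \<tau> i = (\<Sum>j\<in>J. u j * f' j i)"
  shows False
proof -
  have fJ: "finite J" using J T by (rule finite_subset)
  \<comment> \<open>\<open>l\<close> is the relation expressing f' \<tau> through J. Subtracting the
    multiple of \<alpha> that agrees with it at \<tau> leaves l' supported on J, where the lower
    bound \<kappa> applies.\<close>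
  define l where "l t = (if t = \<tau> then 1 else if t \<in> J then - u t else 0)" for t
  define l' where "l' t = l t - (1 / \<alpha> \<tau>) * \<alpha> t" for t
  define e where "e t i = f' t i - f t i - \<epsilon> * \<alpha> t * b i" for t i
  have l'0: "l' t = 0" if "t \<in> T" "t \<notin> J" for t
    using that \<alpha>0[of t] \<alpha>\<tau> \<tau> by (cases "t = \<tau>") (auto simp: l'_def l_def)
  have sJ: "(\<Sum>t\<in>T. l' t * g t) = (\<Sum>t\<in>J. l' t * g t)" for g
    using T J l'0 by (intro sum.mono_neutral_right) auto
  have lrel: "(\<Sum>t\<in>T. l t * f' t i) = 0" if i: "i \<in> I" for i
  proof -
    have "(\<Sum>t\<in>T. l t * f' t i) = (\<Sum>t\<in>insert \<tau> J. l t * f' t i)"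
      using T J \<tau> by (intro sum.mono_neutral_right) (auto simp: l_def)
    also have "\<dots> = f' \<tau> i + (\<Sum>t\<in>J. - u t * f' t i)"
      using fJ \<tau> by (simp add: l_def) (intro sum.cong, auto)
    also have "\<dots> = 0" using dep[OF i] by (simp add: sum_negf)
    finally show ?thesis .
  qed
  define P where "P i = (\<Sum>j\<in>J. l' j * f j i)" for i
  define \<mu> where "\<mu> = dot T l \<alpha>"
  \<comment> \<open>The relation annihilates f', so on f plus the perturbation only errors remain;
    as b is orthogonal to f, the two parts are then bounded separately.\<close>
  have Pe: "P i + (\<epsilon> * \<mu>) * b i = - (\<Sum>t\<in>T. l t * e t i)" if i: "i \<in> I" for i
  proof -
    have "(\<Sum>t\<in>T. l t * f t i) = (\<Sum>t\<in>T. l' t * f t i) + (1 / \<alpha> \<tau>) * (\<Sum>t\<in>T. \<alpha> t * f t i)"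
      by (simp add: l'_def sum_distrib_left sum.distrib[symmetric] algebra_simps)
    also have "\<dots> = P i" using rel[OF i] sJ by (simp add: P_def)
    finally have 1: "(\<Sum>t\<in>T. l t * f t i) = P i" .
    have "(\<Sum>t\<in>T. l t * e t i) = (\<Sum>t\<in>T. l t * f' t i) - (\<Sum>t\<in>T. l t * f t i) - \<epsilon> * \<mu> * b i"
      by (simp add: e_def \<mu>_def dot_def sum_distrib_left sum_distrib_right sum_subtractf[symmetric] algebra_simps)
    then show ?thesis using 1 lrel[OF i] by simp
  qed
  have "dot I P b = (\<Sum>j\<in>J. l' j * dot I (f j) b)" unfolding P_def by (simp add: dot_sum_left dot_scale_left)
  also have "\<dots> = 0"
  proof (intro sum.neutral ballI)
    fix j assume "j \<in> J"
    then have "dot I (f j) b = 0" using bf[of j] J dot_commute[of I b "f j"] by auto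
    then show "l' j * dot I (f j) b = 0" by simp
  qed
  finally have "dot I P P + (\<epsilon> * \<mu>)\<^sup>2 * dot I b b = dot I (\<lambda>i. P i + (\<epsilon> * \<mu>) * b i) (\<lambda>i. P i + (\<epsilon> * \<mu>) * b i)"
    by (rule dot_pythagoras[symmetric])
  also have "\<dots> = dot I (\<lambda>i. \<Sum>t\<in>T. l t * e t i) (\<lambda>i. \<Sum>t\<in>T. l t * e t i)"
    unfolding dot_def by (intro sum.cong) (auto simp: Pe)
  also have "\<dots> \<le> dot T l l * (\<Sum>t\<in>T. dot I (e t) (e t))" by (rule dot_relation_bound[OF T])
  also have "\<dots> \<le> dot T l l * (\<epsilon>\<^sup>2 / 200)" using err by (intro mult_left_mono) (auto simp: e_def[abs_def])
  finally have main: "dot I P P + (\<epsilon> * \<mu>)\<^sup>2 * dot I b b \<le> dot T l l * (\<epsilon>\<^sup>2 / 200)" .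
  have LL: "dot T l' l' = (\<Sum>j\<in>J. (l' j)\<^sup>2)"
    using sJ[of l'] by (simp add: dot_def power2_eq_square)
  have "\<epsilon>\<^sup>2 * dot T l' l' \<le> \<kappa> * dot T l' l'" using \<epsilon> by (intro mult_right_mono) auto
  also have "\<dots> \<le> dot I P P" unfolding LL P_def by (rule \<kappa>)
  also have "\<dots> \<le> dot T l l * (\<epsilon>\<^sup>2 / 200)" using main by (smt (verit) dot_self_nonneg mult_nonneg_nonneg zero_le_power2)
  finally have "\<epsilon>\<^sup>2 * dot T l' l' \<le> \<epsilon>\<^sup>2 * (dot T l l / 200)" by (simp add: mult.commute)
  then have b1: "dot T l' l' \<le> dot T l l / 200" using \<epsilon> by simp
  have "(\<epsilon> * \<mu>)\<^sup>2 * dot I b b \<le> dot T l l * (\<epsilon>\<^sup>2 / 200)" using main by (smt (verit) dot_self_nonneg)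
  then have "\<epsilon>\<^sup>2 * (\<mu>\<^sup>2 * dot I b b) \<le> \<epsilon>\<^sup>2 * (dot T l l / 200)" by (simp add: power_mult_distrib mult_ac)
  then have b2: "\<mu>\<^sup>2 * dot I b b \<le> dot T l l / 200" using \<epsilon> by simp
  have "\<mu>\<^sup>2 \<le> \<mu>\<^sup>2 * (2 * dot T \<alpha> \<alpha> * dot I b b)" using ab by (simp add: mult_left_le_imp_le mult_le_cancel_left1)
  also have "\<dots> = 2 * dot T \<alpha> \<alpha> * (\<mu>\<^sup>2 * dot I b b)" by simp
  also have "\<dots> \<le> 2 * dot T \<alpha> \<alpha> * (dot T l l / 200)" using b2 by (intro mult_left_mono) auto
  finally have b3: "\<mu>\<^sup>2 \<le> dot T \<alpha> \<alpha> * dot T l l / 100" by simp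
  define H where "H = 1 / \<alpha> \<tau>"
  have leq: "l t = H * \<alpha> t + l' t" for t by (simp add: l'_def H_def)
  have nl': "nrm T l' \<le> nrm T l / 10"
  proof (rule power2_le_imp_le)
    show "(nrm T l')\<^sup>2 \<le> (nrm T l / 10)\<^sup>2" using b1 by (simp add: nrm_square power_divide) (use dot_self_nonneg[of T l] in linarith)
  qed simp
  have n\<mu>: "\<bar>\<mu>\<bar> \<le> nrm T \<alpha> * nrm T l / 10"
  proof (rule power2_le_imp_le)
    show "\<bar>\<mu>\<bar>\<^sup>2 \<le> (nrm T \<alpha> * nrm T l / 10)\<^sup>2" using b3 by (simp add: nrm_square power_divide power_mult_distrib)
  qed simp
  have "nrm T (\<lambda>t. H * \<alpha> t) = nrm T (\<lambda>t. l t + (-1) * l' t)" by (simp add: leq)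
  also have "\<dots> \<le> nrm T l + nrm T (\<lambda>t. (-1) * l' t)" by (rule nrm_triangle)
  also have "nrm T (\<lambda>t. (-1) * l' t) = nrm T l'" unfolding nrm_scale by simp
  finally have nH: "\<bar>H\<bar> * nrm T \<alpha> \<le> 1.1 * nrm T l" using nl' by (simp add: nrm_scale)
  \<comment> \<open>In l = H \<alpha> + l' the part l' is small, and so is \<mu> = <l, \<alpha>>.
    Hence |l|^2 \<le> 0.21 |l|^2 and l = 0, against l \<tau> = 1.\<close>
  have "dot T l l = dot T l (\<lambda>t. H * \<alpha> t + l' t)" by (simp only: leq[symmetric])
  also have "\<dots> = H * \<mu> + dot T l l'" by (simp add: dot_add_right dot_scale_right \<mu>_def)
  also have "\<dots> \<le> \<bar>H\<bar> * \<bar>\<mu>\<bar> + nrm T l * nrm T l'"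
    using abs_dot_le_nrm[of T l l'] abs_ge_self[of "H * \<mu>"] by (simp add: abs_mult)
  also have "\<bar>H\<bar> * \<bar>\<mu>\<bar> \<le> \<bar>H\<bar> * (nrm T \<alpha> * nrm T l / 10)" by (intro mult_left_mono n\<mu>) auto
  also have "\<dots> = (\<bar>H\<bar> * nrm T \<alpha>) * (nrm T l / 10)" by simp
  also have "\<dots> \<le> (1.1 * nrm T l) * (nrm T l / 10)" by (intro mult_right_mono nH) auto
  also have "nrm T l * nrm T l' \<le> nrm T l * (nrm T l / 10)" by (intro mult_left_mono nl') auto
  finally have "dot T l l \<le> 0.21 * (nrm T l * nrm T l)" by simp
  also have "nrm T l * nrm T l = dot T l l" using nrm_square[of T l] by (simp add: power2_eq_square)
  finally have "dot T l l = 0" using dot_self_nonneg[of T l] by simp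
  then have "l \<tau> = 0" using dot_self_eq_0_iff[OF T] \<tau> by auto
  then show False by (simp add: l_def)
qed

text \<open>An independent subset of largest cardinality. Using subsets instead of ranks gives
  finitely many strata, on each of which the spanning indices are fixed.\<close>

lemma maximal_independent_subset:
  fixes f :: "'t \<Rightarrow> 'i \<Rightarrow> real"
  assumes T: "finite T"
  shows "\<exists>J\<subseteq>T. (\<forall>u. (\<forall>i\<in>I. (\<Sum>j\<in>J. u j * f j i) = 0) \<longrightarrow> (\<forall>j\<in>J. u j = 0)) \<and>
     (\<forall>t\<in>T. \<exists>u. \<forall>i\<in>I. f t i = (\<Sum>j\<in>J. u j * f j i))"
proof -
  define ind where "ind J \<longleftrightarrow> (\<forall>u. (\<forall>i\<in>I. (\<Sum>j\<in>J. u j * f j i) = 0) \<longrightarrow> (\<forall>j\<in>J. u j = 0))" for J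
  define Q where "Q J \<longleftrightarrow> J \<subseteq> T \<and> ind J" for J
  have Q0: "Q {}" by (simp add: Q_def ind_def)
  have Qb: "\<forall>J. Q J \<longrightarrow> card J < Suc (card T)" using T by (auto simp: Q_def card_mono less_Suc_eq_le)
  from ex_has_greatest_nat[of Q "{}" card "Suc (card T)", OF Q0 Qb] obtain J where J': "Q J \<and> (\<forall>J'. Q J' \<longrightarrow> card J' \<le> card J)"
    by (rule exE)
  have J: "Q J" "\<And>J'. Q J' \<Longrightarrow> card J' \<le> card J" using J' by auto
  have fJ: "finite J" using J(1) T by (auto simp: Q_def intro: finite_subset)
  have "\<exists>u. \<forall>i\<in>I. f t i = (\<Sum>j\<in>J. u j * f j i)" if t: "t \<in> T" for t
  proof (cases "t \<in> J")
    case True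
    have "(\<Sum>j\<in>J. (if j = t then 1 else 0) * f j i) = f t i" for i
    proof -
      have "(\<Sum>j\<in>J. (if j = t then 1 else 0) * f j i) = (\<Sum>j\<in>J. if j = t then f t i else 0)" by (intro sum.cong) auto
      then show ?thesis using fJ True by simp
    qed
    then show ?thesis by (intro exI[of _ "\<lambda>j. if j = t then 1 else 0"]) simp
  next
    case False
    have "\<not> Q (insert t J)"
    proof
      assume "Q (insert t J)"
      from J(2)[OF this] False fJ show False by simp
    qed
    then have "\<not> ind (insert t J)" using J(1) t by (auto simp: Q_def)
    then obtain u where u: "\<And>i. i \<in> I \<Longrightarrow> (\<Sum>j\<in>insert t J. u j * f j i) = 0" "\<exists>j\<in>insert t J. u j \<noteq> 0"
      unfolding ind_def by blast
    have s: "u t * f t i + (\<Sum>j\<in>J. u j * f j i) = 0" if "i \<in> I" for i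
      using u(1)[OF that] fJ False by simp
    have ut: "u t \<noteq> 0"
    proof
      assume z: "u t = 0"
      then have "\<forall>i\<in>I. (\<Sum>j\<in>J. u j * f j i) = 0" using s by auto
      then have "\<forall>j\<in>J. u j = 0" using J(1) by (auto simp: Q_def ind_def)
      with u(2) z show False by auto
    qed
    have "f t i = (\<Sum>j\<in>J. (- u j / u t) * f j i)" if "i \<in> I" for i
    proof -
      define Y where "Y = (\<Sum>j\<in>J. u j * f j i)"
      have "(\<Sum>j\<in>J. (- u j / u t) * f j i) = - Y / u t"
        unfolding Y_def by (simp add: sum_negf[symmetric] sum_divide_distrib)
      also have "\<dots> = f t i" using s[OF that] ut unfolding Y_def[symmetric] by (simp add: field_simps)
      finally show ?thesis by simp
    qed
    then show ?thesis by (intro exI[of _ "\<lambda>j. - u j / u t"] ballI)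
  qed
  note d = this
  have JT: "J \<subseteq> T" and iJ: "ind J" using J(1) by (simp_all add: Q_def)
  show ?thesis
    by (rule exI[of _ J], rule conjI[OF JT], rule conjI[OF iJ[unfolded ind_def]], rule ballI, rule d)
qed

text \<open>A point close to m on the segment from the nearest point m towards y. Many y may share
  one m, but pulled points determine y by a Lipschitz map, and their displacements still control
  those of m.\<close>

definition pull :: "('i \<Rightarrow> real) \<Rightarrow> ('i \<Rightarrow> real) \<Rightarrow> 'i \<Rightarrow> real" where
  "pull y m = (\<lambda>s. m s + (y s - m s) / 1000)"

text \<open>Each of m and m' competes with the other. Each competition costs half of |m' - m|^2,
  against the 1000 |m' - m|^2 from the main part of the pulled points.\<close>

lemma nearest_pull_monotone:
  assumes "nearest S M y m" "nearest S M y' m'"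
  shows "999 * dot S (\<lambda>s. m' s - m s) (\<lambda>s. m' s - m s) \<le> 1000 * dot S (\<lambda>s. pull y' m' s - pull y m s) (\<lambda>s. m' s - m s)"
proof -
  have m: "m \<in> M" "m' \<in> M" using assms by (auto simp: nearest_def)
  note i1 = nearest_inner[OF assms(1) m(2)]
  note i2 = nearest_inner[OF assms(2) m(1)]
  have "1000 * dot S (\<lambda>s. pull y' m' s - pull y m s) (\<lambda>s. m' s - m s)
     = 1000 * dot S (\<lambda>s. m' s - m s) (\<lambda>s. m' s - m s)
       - dot S (\<lambda>s. y s - m s) (\<lambda>s. m' s - m s) - dot S (\<lambda>s. y' s - m' s) (\<lambda>s. m s - m' s)"
    unfolding dot_def pull_def sum_distrib_left sum_subtractf[symmetric]
    by (intro sum.cong refl) (simp add: field_simps)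
  moreover have "dot S (\<lambda>s. m s - m' s) (\<lambda>s. m s - m' s) = dot S (\<lambda>s. m' s - m s) (\<lambda>s. m' s - m s)"
    unfolding dot_def by (intro sum.cong refl) (simp add: algebra_simps)
  ultimately show ?thesis using i1 i2 by linarith
qed

text \<open>With g the change of the pulled point and k that of the nearest point, y' - y = 1000 g -
  999 k, and monotonicity gives 999 |k| \<le> 1000 |g|. The factor card S converts coordinatewise
  bounds into the norm.\<close>

lemma pull_inverse_lipschitz:
  assumes S: "finite S" and n: "nearest S M y m" "nearest S M y' m'"
    and d: "\<And>s. s \<in> S \<Longrightarrow> \<bar>pull y m s - pull y' m' s\<bar> \<le> \<delta>" and s: "s \<in> S"
  shows "\<bar>y s - y' s\<bar> \<le> (2000 * real (card S)) * \<delta>"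
proof -
  define g where "g = (\<lambda>s. pull y' m' s - pull y m s)"
  define k where "k = (\<lambda>s. m' s - m s)"
  have d0: "0 \<le> \<delta>" using d[OF s] by linarith
  have ng: "nrm S g \<le> real (card S) * \<delta>"
    by (rule nrm_bound[OF S d0]) (use d in \<open>auto simp: g_def abs_minus_commute\<close>)
  have "999 * (nrm S k * nrm S k) \<le> 1000 * dot S g k"
    using nearest_pull_monotone[OF n] by (simp add: nrm_square[unfolded power2_eq_square] g_def k_def)
  also have "\<dots> \<le> 1000 * (nrm S g * nrm S k)" using abs_dot_le_nrm[of S g k] by simp
  finally have "999 * nrm S k \<le> 1000 * nrm S g"
    by (cases "nrm S k = 0") (auto simp: mult.assoc[symmetric] mult_le_cancel_right order.strict_iff_order)
  moreover have "y' s - y s = 1000 * g s + (-999) * k s" by (simp add: g_def k_def pull_def field_simps)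
  moreover have "\<bar>g s\<bar> \<le> nrm S g" "\<bar>k s\<bar> \<le> nrm S k" using S s by (auto intro: abs_le_nrm)
  ultimately have "\<bar>y s - y' s\<bar> \<le> 2000 * nrm S g" by linarith
  then show ?thesis using ng by linarith
qed

text \<open>Moving along the line by the projection p of the residual would bring m closer to y
  unless p = 0.\<close>

lemma nearest_orthogonal_line:
  assumes n: "nearest S M y m" and line: "\<And>\<beta>. (\<lambda>s. m s + \<beta> * h s) \<in> M" and h: "dot S h h = 1"
  shows "dot S (\<lambda>s. y s - m s) h = 0"
proof -
  define p where "p = dot S (\<lambda>s. y s - m s) h"
  have "2 * dot S (\<lambda>s. y s - m s) (\<lambda>s. (m s + p * h s) - m s) \<le> dot S (\<lambda>s. (m s + p * h s) - m s) (\<lambda>s. (m s + p * h s) - m s)"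
    by (rule nearest_inner[OF n line])
  moreover have "(\<lambda>s. (m s + p * h s) - m s) = (\<lambda>s. p * h s)" by simp
  ultimately have "2 * (p * p) \<le> p * p" by (simp add: dot_scale_left dot_scale_right h p_def[symmetric])
  then have "p * p = 0" using zero_le_square[of p] by linarith
  then show ?thesis by (simp add: p_def)
qed

text \<open>m' competes with m for y, and m + \<epsilon> h competes with m' for y'. As y - m is
  orthogonal to h, the deviation x = (m' - m) - \<epsilon> h obeys 1999 |x|^2 \<le> |m' - m|^2 +
  2000 <e, x>, which excludes |x| > \<epsilon>/20.\<close>

lemma nearest_follows_line:
  assumes n: "nearest S M y m" "nearest S M y' m'" and line: "\<And>\<beta>. (\<lambda>s. m s + \<beta> * h s) \<in> M" and h: "dot S h h = 1"
    and \<epsilon>: "0 < \<epsilon>" and e: "nrm S (\<lambda>s. pull y' m' s - (pull y m s + \<epsilon> * h s)) \<le> \<epsilon> / 1000"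
  shows "dot S (\<lambda>s. (m' s - m s) - \<epsilon> * h s) (\<lambda>s. (m' s - m s) - \<epsilon> * h s) \<le> \<epsilon>\<^sup>2 / 400"
proof -
  define w where "w = (\<lambda>s. y s - m s)"
  define e where "e = (\<lambda>s. pull y' m' s - (pull y m s + \<epsilon> * h s))"
  define k where "k = (\<lambda>s. m' s - m s)"
  define x where "x = (\<lambda>s. k s - \<epsilon> * h s)"
  have wh: "dot S w h = 0" unfolding w_def by (rule nearest_orthogonal_line[OF n(1) line h])
  have "m' \<in> M" using n by (auto simp: nearest_def)
  from nearest_inner[OF n(1) this] have wk: "2 * dot S w k \<le> dot S k k" by (simp add: w_def k_def)
  have q: "(\<lambda>s. (m s + \<epsilon> * h s) - m' s) = (\<lambda>s. (-1) * x s)" by (simp add: x_def k_def fun_eq_iff)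
  have y': "(\<lambda>s. y' s - m' s) = (\<lambda>s. w s + 1000 * (e s - x s))"
    by (simp add: w_def e_def x_def k_def pull_def fun_eq_iff field_simps)
  have "2 * dot S (\<lambda>s. y' s - m' s) (\<lambda>s. (m s + \<epsilon> * h s) - m' s) \<le> dot S (\<lambda>s. (m s + \<epsilon> * h s) - m' s) (\<lambda>s. (m s + \<epsilon> * h s) - m' s)"
    by (rule nearest_inner[OF n(2) line])
  then have "2 * (- dot S w x - 1000 * dot S e x + 1000 * dot S x x) \<le> dot S x x"
    unfolding q y' dot_scale_left dot_scale_right dot_add_left dot_diff_left by (simp add: algebra_simps)
  moreover have "dot S w x = dot S w k" unfolding x_def by (simp add: dot_diff_right dot_scale_right wh)
  moreover have "1999 * c \<le> f + 2000 * b" if "2 * (- a - 1000 * b + 1000 * c) \<le> c" "a = d" "2 * d \<le> f" for a b c d f :: real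
    using that by argo
  ultimately have 1: "1999 * dot S x x \<le> dot S k k + 2000 * dot S e x" using wk by blast
  define X where "X = nrm S x"
  have xx: "dot S x x = X * X" using nrm_square[of S x] by (simp add: X_def power2_eq_square)
  have h1: "nrm S h = 1" by (simp add: nrm_def h)
  have "nrm S k = nrm S (\<lambda>s. x s + \<epsilon> * h s)" by (simp add: x_def)
  also have "\<dots> \<le> X + nrm S (\<lambda>s. \<epsilon> * h s)" unfolding X_def by (rule nrm_triangle)
  also have "nrm S (\<lambda>s. \<epsilon> * h s) = \<epsilon>" using \<epsilon> h1 by (simp add: nrm_scale)
  finally have nk: "nrm S k \<le> X + \<epsilon>" .
  then have "(nrm S k)\<^sup>2 \<le> (X + \<epsilon>)\<^sup>2" by (intro power_mono) auto
  then have kk: "dot S k k \<le> (X + \<epsilon>) * (X + \<epsilon>)" unfolding nrm_square by (simp only: power2_eq_square)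
  have "dot S e x \<le> nrm S e * X" using abs_dot_le_nrm[of S e x] by (simp add: X_def)
  also have "\<dots> \<le> (\<epsilon> / 1000) * X" using e unfolding e_def[symmetric] by (intro mult_right_mono) (auto simp: X_def)
  finally have ex: "dot S e x \<le> \<epsilon> / 1000 * X" .
  have X0: "0 \<le> X" by (simp add: X_def)
  have le: "X \<le> \<epsilon> / 20"
  proof (rule ccontr)
    assume "\<not> X \<le> \<epsilon> / 20"
    then have c: "\<epsilon> \<le> 20 * X" "0 < X" using \<epsilon> by auto
    have "(X + \<epsilon>) * (X + \<epsilon>) \<le> (21 * X) * (21 * X)" using c \<epsilon> X0 by (intro mult_mono) auto
    moreover have "\<epsilon> * X \<le> 20 * X * X" using c by (intro mult_right_mono) auto
    ultimately have "1999 * (X * X) \<le> 441 * (X * X) + 40 * (X * X)" using 1 kk ex unfolding xx by linarith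
    then show False using mult_pos_pos[OF c(2) c(2)] by linarith
  qed
  have "X\<^sup>2 \<le> (\<epsilon> / 20)\<^sup>2" using le X0 by (rule power_mono)
  then show ?thesis using xx unfolding x_def k_def by (simp add: power2_eq_square)
qed

section \<open>Tuples of fitted functions and deficient fits\<close>

abbreviation evn :: "nat \<Rightarrow> nat \<Rightarrow> (nat \<times> nat \<Rightarrow> real) \<Rightarrow> real" where
  "evn n t h \<equiv> dot {..<n} (\<lambda>i. h (t, i)) (\<lambda>i. h (t, i))"

text \<open>The loss sees the function F t only at the inputs of task t; these values form the
  fitted vector.\<close>

definition diag :: "(nat \<Rightarrow> nat \<times> nat \<Rightarrow> real) \<Rightarrow> nat \<times> nat \<Rightarrow> real" where
  "diag F s = F (fst s) s"

text \<open>Covers both the spare function F 0 and the difference between two fits, so that either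
  can be compared across tasks.\<close>

definition comb :: "nat \<Rightarrow> (nat \<Rightarrow> real) \<Rightarrow> (nat \<Rightarrow> nat \<times> nat \<Rightarrow> real) \<Rightarrow> (nat \<Rightarrow> real) \<Rightarrow> (nat \<Rightarrow> nat \<times> nat \<Rightarrow> real) \<Rightarrow> nat \<times> nat \<Rightarrow> real" where
  "comb T a F b F' s = (\<Sum>r\<le>T. a r * F r s + b r * F' r s)"

text \<open>A tuple \<^term>\<open>F\<close> collects the values, at all source inputs, of one function \<^term>\<open>F 0\<close> and of the fitted functions
  \<^term>\<open>F 1\<close>, ..., \<^term>\<open>F T\<close> of a common feature map; \<^term>\<open>fit_family\<close> records what the uniform sandwich,
  linearity and \<^prop>\<open>k \<le> T\<close> give about such tuples.\<close>

definition fit_family :: "nat \<Rightarrow> nat \<Rightarrow> (nat \<Rightarrow> nat \<times> nat \<Rightarrow> real) set \<Rightarrow> bool" where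
  "fit_family T n \<T> \<longleftrightarrow>
     (\<forall>F\<in>\<T>. \<forall>F'\<in>\<T>. \<forall>a b. \<forall>t\<in>{1..T}. \<forall>t'\<in>{1..T}. evn n t (comb T a F b F') \<le> 2 * evn n t' (comb T a F b F')) \<and>
     (\<forall>F\<in>\<T>. \<forall>\<alpha>. (\<lambda>r s. F r s + \<alpha> r * F 0 s) \<in> \<T>) \<and>
     (\<forall>F\<in>\<T>. \<exists>c. (\<exists>r\<le>T. c r \<noteq> 0) \<and> (\<forall>s\<in>{1..T} \<times> {..<n}. (\<Sum>r\<le>T. c r * F r s) = 0))"

text \<open>F 0 witnesses a function of the common features that the fitted functions miss at the
  inputs of the first task, so the fitted weights have too small a rank.\<close>

definition deficient :: "nat \<Rightarrow> nat \<Rightarrow> (nat \<Rightarrow> nat \<times> nat \<Rightarrow> real) \<Rightarrow> bool" where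
  "deficient T n F \<longleftrightarrow> evn n 1 (F 0) \<noteq> 0 \<and> (\<forall>t\<in>{1..T}. dot {..<n} (\<lambda>i. F 0 (1, i)) (\<lambda>i. F t (1, i)) = 0)"

lemma dot_eq_sum_evn: "dot ({1..T} \<times> {..<n}) h h = (\<Sum>t\<in>{1..T}. evn n t h)"
  unfolding dot_def by (simp add: sum.cartesian_product case_prod_beta)

lemma sum_atMost_delta: "t \<le> T \<Longrightarrow> (\<Sum>r\<le>T. (if r = t then c else 0) * f r) = c * (f t :: real)"
  for t T :: nat
proof -
  assume t: "t \<le> T"
  have "(\<Sum>r\<le>T. (if r = t then c else 0) * f r) = (\<Sum>r\<le>T. if r = t then c * f t else 0)" by (intro sum.cong) auto
  then show ?thesis using t by simp
qed

text \<open>A deficient fit has a spare direction F 0 and a linear relation \<alpha> among its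
  fitted functions. Adding multiples of \<alpha> t * F 0 stays in the family, so a nearest point
  must follow this line when the pulled point does. By the rank-one perturbation such a fit is no
  longer spanned by J and has left the stratum, which therefore has a hole in that
  direction.\<close>

lemma deficient_hole:
  assumes T: "1 \<le> T" "1 \<le> n" and fam: "fit_family T n \<T>"
    and F: "F \<in> \<T>" "deficient T n F" "nearest ({1..T} \<times> {..<n}) (diag ` \<T>) y (diag F)"
    and J: "J \<subseteq> {1..T}" "\<And>u. (\<And>i. i \<in> {..<n} \<Longrightarrow> (\<Sum>j\<in>J. u j * F j (1, i)) = 0) \<Longrightarrow> (\<forall>j\<in>J. u j = 0)"
    and dep: "\<And>t. t \<in> {1..T} \<Longrightarrow> \<exists>u. \<forall>i\<in>{..<n}. F t (1, i) = (\<Sum>j\<in>J. u j * F j (1, i))"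
  defines "S \<equiv> {1..T} \<times> {..<n}"
  shows "\<exists>\<eta>>0. \<exists>\<epsilon>0>0. \<forall>\<epsilon>. 0 < \<epsilon> \<and> \<epsilon> < \<epsilon>0 \<longrightarrow> (\<exists>z. (\<forall>s\<in>S. \<bar>z s - pull y (diag F) s\<bar> \<le> \<epsilon>) \<and>
     (\<forall>y' F'. F' \<in> \<T> \<and> nearest S (diag ` \<T>) y' (diag F') \<and>
        (\<forall>t\<in>{1..T}. \<exists>u. \<forall>i\<in>{..<n}. F' t (1, i) = (\<Sum>j\<in>J. u j * F' j (1, i)))
      \<longrightarrow> (\<exists>s\<in>S. \<bar>pull y' (diag F') s - z s\<bar> > \<eta> * \<epsilon>)))"
proof -
  have "(1, 0) \<in> S" using T by (simp add: S_def)
  then have S: "finite S" "S \<noteq> {}" by (auto simp: S_def)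
  have cS: "0 < real (card S)" using S by (simp add: card_gt_0_iff)
  let ?I = "{..<n}"
  let ?b = "\<lambda>i. F 0 (1::nat, i)"
  have b0: "0 < dot ?I ?b ?b" using F(2) dot_self_nonneg[of ?I ?b] by (auto simp: deficient_def order.strict_iff_order)
  have bF: "dot ?I ?b (\<lambda>i. F t (1, i)) = 0" if "t \<in> {1..T}" for t using F(2) that by (auto simp: deficient_def)
  have fJ: "finite J" using J(1) by (rule finite_subset) simp
  have comp: "evn n t (comb T a G c G') \<le> 2 * evn n t' (comb T a G c G')"
    if "G \<in> \<T>" "G' \<in> \<T>" "t \<in> {1..T}" "t' \<in> {1..T}" for G G' a c t t'
    using fam that unfolding fit_family_def by blast
  have c0: "comb T (\<lambda>r. if r = 0 then 1 else 0) F (\<lambda>r. 0) F s = F 0 s" for s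
    unfolding comb_def by (simp add: sum.delta' if_distrib[of "\<lambda>x. x * _"] cong: if_cong)
  have comp0: "evn n t (F 0) \<le> 2 * evn n t' (F 0)" if "t \<in> {1..T}" "t' \<in> {1..T}" for t t'
    using comp[OF F(1) F(1) that, of "\<lambda>r. if r = 0 then 1 else 0" "\<lambda>r. 0"] by (simp only: c0)
  \<comment> \<open>If J were all of {1..T}, pairing the relation among F 0, ..., F T with F 0 would
    remove its F 0 term by orthogonality, and the rest would contradict independence.\<close>
  have "\<exists>\<tau>\<in>{1..T}. \<tau> \<notin> J"
  proof (rule ccontr)
    assume "\<not> (\<exists>\<tau>\<in>{1..T}. \<tau> \<notin> J)"
    then have JT: "J = {1..T}" using J(1) by auto
    obtain c where c: "\<exists>r\<le>T. c r \<noteq> 0" "\<And>s. s \<in> {1..T} \<times> {..<n} \<Longrightarrow> (\<Sum>r\<le>T. c r * F r s) = 0"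
      using fam F(1) unfolding fit_family_def by blast
    have split: "(\<Sum>r\<le>T. c r * F r s) = c 0 * F 0 s + (\<Sum>r\<in>{1..T}. c r * F r s)" for s
    proof -
      have "{..T} = insert 0 {1..T}" by auto
      then show ?thesis by simp
    qed
    have z: "c 0 * F 0 (1, i) + (\<Sum>r\<in>{1..T}. c r * F r (1, i)) = 0" if "i \<in> ?I" for i
      using c(2)[of "(1, i)"] that T unfolding split by simp
    have "0 = dot ?I ?b (\<lambda>i. c 0 * F 0 (1, i) + (\<Sum>r\<in>{1..T}. c r * F r (1, i)))"
      unfolding dot_def using z by (intro sum.neutral[symmetric]) auto
    also have "\<dots> = c 0 * dot ?I ?b ?b + (\<Sum>r\<in>{1..T}. c r * dot ?I ?b (\<lambda>i. F r (1, i)))"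
      by (simp only: dot_add_right dot_scale_right dot_sum_right)
    also have "\<dots> = c 0 * dot ?I ?b ?b" using bF by simp
    finally have c00: "c 0 = 0" using b0 by simp
    then have "\<forall>j\<in>J. c j = 0" using z by (intro J(2)) (simp add: JT)
    moreover obtain r where "r \<le> T" "c r \<noteq> 0" using c(1) by blast
    ultimately show False using c00 JT by (cases "r = 0") auto
  qed
  then obtain \<tau> where \<tau>: "\<tau> \<in> {1..T}" "\<tau> \<notin> J" by blast
  obtain u where u: "\<And>i. i \<in> ?I \<Longrightarrow> F \<tau> (1, i) = (\<Sum>j\<in>J. u j * F j (1, i))" using dep[OF \<tau>(1)] by blast
  define \<alpha>0 where "\<alpha>0 t = (if t = \<tau> then 1 else if t \<in> J then - u t else 0 :: real)" for t
  define H where "H = nrm S (\<lambda>s. \<alpha>0 (fst s) * F 0 s)"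
  have evs: "evn n t (\<lambda>s. c (fst s) * h s) = (c t)\<^sup>2 * evn n t h" for t c h
    by (simp add: dot_scale_left dot_scale_right power2_eq_square)
  have "0 < H"
  proof -
    have "0 < evn n 1 (F 0)" by (rule b0)
    also have "\<dots> \<le> 2 * evn n \<tau> (F 0)" by (rule comp0) (use T \<tau> in auto)
    finally have "0 < evn n \<tau> (F 0)" by simp
    also have "\<dots> = (\<alpha>0 \<tau>)\<^sup>2 * evn n \<tau> (F 0)" by (simp add: \<alpha>0_def)
    also have "\<dots> \<le> (\<Sum>t\<in>{1..T}. (\<alpha>0 t)\<^sup>2 * evn n t (F 0))"
      using \<tau>(1) by (intro member_le_sum) auto
    also have "\<dots> = dot S (\<lambda>s. \<alpha>0 (fst s) * F 0 s) (\<lambda>s. \<alpha>0 (fst s) * F 0 s)"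
      unfolding S_def dot_eq_sum_evn evs ..
    finally show ?thesis by (simp add: H_def nrm_def)
  qed
  note H = this
  \<comment> \<open>Scaled so that h has unit length over all samples, as the lemma on lines
    requires.\<close>
  define \<alpha> where "\<alpha> t = \<alpha>0 t / H" for t
  define h where "h s = \<alpha> (fst s) * F 0 s" for s
  have hh: "dot S h h = 1"
  proof -
    have "h = (\<lambda>s. (1 / H) * (\<alpha>0 (fst s) * F 0 s))" by (simp add: h_def \<alpha>_def fun_eq_iff)
    then have "dot S h h = (1 / H) * ((1 / H) * dot S (\<lambda>s. \<alpha>0 (fst s) * F 0 s) (\<lambda>s. \<alpha>0 (fst s) * F 0 s))"
      by (simp only: dot_scale_left dot_scale_right)
    also have "dot S (\<lambda>s. \<alpha>0 (fst s) * F 0 s) (\<lambda>s. \<alpha>0 (fst s) * F 0 s) = H * H"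
      unfolding H_def by (simp add: nrm_square[unfolded power2_eq_square])
    finally show ?thesis using H by simp
  qed
  have line: "(\<lambda>s. diag F s + \<beta> * h s) \<in> diag ` \<T>" for \<beta>
  proof -
    have "(\<lambda>r s. F r s + \<alpha>' r * F 0 s) \<in> \<T>" for \<alpha>' using fam F(1) unfolding fit_family_def by blast
    from this[of "\<lambda>r. \<beta> * \<alpha> r"] have "(\<lambda>r s. F r s + (\<beta> * \<alpha> r) * F 0 s) \<in> \<T>" .
    moreover have "(\<lambda>s. diag F s + \<beta> * h s) = diag (\<lambda>r s. F r s + (\<beta> * \<alpha> r) * F 0 s)"
      by (simp add: diag_def h_def fun_eq_iff)
    ultimately show ?thesis by blast
  qed
  have rel: "(\<Sum>t\<in>{1..T}. \<alpha> t * F t (1, i)) = 0" if i: "i \<in> ?I" for i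
  proof -
    have "(\<Sum>t\<in>{1..T}. \<alpha>0 t * F t (1, i)) = (\<Sum>t\<in>insert \<tau> J. \<alpha>0 t * F t (1, i))"
      using J(1) \<tau> by (intro sum.mono_neutral_right) (auto simp: \<alpha>0_def)
    also have "\<dots> = F \<tau> (1, i) + (\<Sum>t\<in>J. - (u t * F t (1, i)))"
      using fJ \<tau> by (simp add: \<alpha>0_def) (intro sum.cong, auto)
    also have "\<dots> = 0" using u[OF i] by (simp add: sum_negf)
    finally have "(\<Sum>t\<in>{1..T}. \<alpha>0 t * F t (1, i)) / H = 0" by simp
    then show ?thesis by (simp add: \<alpha>_def sum_divide_distrib)
  qed
  have "1 = (\<Sum>t\<in>{1..T}. (\<alpha> t)\<^sup>2 * evn n t (F 0))"
    using hh unfolding S_def dot_eq_sum_evn h_def evs by simp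
  also have "\<dots> \<le> (\<Sum>t\<in>{1..T}. (\<alpha> t)\<^sup>2 * (2 * dot ?I ?b ?b))"
    using T by (intro sum_mono mult_left_mono comp0) auto
  also have "\<dots> = 2 * dot {1..T} \<alpha> \<alpha> * dot ?I ?b ?b"
    unfolding dot_def[of "{1..T}"] sum_distrib_right[symmetric] by (simp add: power2_eq_square)
  finally have ab: "1 \<le> 2 * dot {1..T} \<alpha> \<alpha> * dot ?I ?b ?b" .
  obtain \<kappa> where \<kappa>: "0 < \<kappa>" "\<And>u. \<kappa> * (\<Sum>j\<in>J. (u j)\<^sup>2) \<le> dot ?I (\<lambda>i. \<Sum>j\<in>J. u j * F j (1, i)) (\<lambda>i. \<Sum>j\<in>J. u j * F j (1, i))"
    using independent_lower_bound[of ?I J "\<lambda>j i. F j (1, i)", OF finite_lessThan fJ J(2)] by blast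
  \<comment> \<open>By \<open>nrm_bound\<close> a coordinatewise error \<eta> \<epsilon> becomes at
    most \<epsilon>/1000 in norm, the tolerance of \<open>nearest_follows_line\<close>.\<close>
  define \<eta> where "\<eta> = 1 / (1000 * real (card S))"
  have \<eta>: "0 < \<eta>" using cS by (simp add: \<eta>_def)
  have core: "\<exists>s\<in>S. \<bar>pull y' (diag F') s - (pull y (diag F) s + \<epsilon> * h s)\<bar> > \<eta> * \<epsilon>"
    if \<epsilon>: "0 < \<epsilon>" "\<epsilon> < sqrt \<kappa>" and F': "F' \<in> \<T>" "nearest S (diag ` \<T>) y' (diag F')"
      and dep': "\<And>t. t \<in> {1..T} \<Longrightarrow> \<exists>u. \<forall>i\<in>?I. F' t (1, i) = (\<Sum>j\<in>J. u j * F' j (1, i))" for \<epsilon> y' F'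
  proof (rule ccontr)
    assume "\<not> ?thesis"
    then have c: "\<And>s. s \<in> S \<Longrightarrow> \<bar>pull y' (diag F') s - (pull y (diag F) s + \<epsilon> * h s)\<bar> \<le> \<eta> * \<epsilon>" by force
    have "nrm S (\<lambda>s. pull y' (diag F') s - (pull y (diag F) s + \<epsilon> * h s)) \<le> real (card S) * (\<eta> * \<epsilon>)"
      by (rule nrm_bound[OF S(1)]) (use c \<eta> \<epsilon> in auto)
    also have "\<dots> = \<epsilon> / 1000" using cS by (simp add: \<eta>_def)
    finally have e: "nrm S (\<lambda>s. pull y' (diag F') s - (pull y (diag F) s + \<epsilon> * h s)) \<le> \<epsilon> / 1000" .
    define er where "er t s = F' t s - F t s - \<epsilon> * \<alpha> t * F 0 s" for t s
    have "dot S (\<lambda>s. (diag F' s - diag F s) - \<epsilon> * h s) (\<lambda>s. (diag F' s - diag F s) - \<epsilon> * h s) \<le> \<epsilon>\<^sup>2 / 400"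
      by (rule nearest_follows_line[OF F(3)[folded S_def] F'(2) line hh \<epsilon>(1) e])
    also have "(\<lambda>s. (diag F' s - diag F s) - \<epsilon> * h s) = (\<lambda>s. er (fst s) s)"
      by (simp add: er_def diag_def h_def fun_eq_iff)
    finally have ers: "(\<Sum>t\<in>{1..T}. evn n t (er t)) \<le> \<epsilon>\<^sup>2 / 400" unfolding S_def dot_eq_sum_evn by simp
    have erc: "er t = comb T (\<lambda>r. (if r = t then -1 else 0) + (if r = 0 then - (\<epsilon> * \<alpha> t) else 0)) F (\<lambda>r. if r = t then 1 else 0) F'"
      if t: "t \<in> {1..T}" for t
    proof
      fix s
      have t': "t \<le> T" using t by simp
      show "er t s = comb T (\<lambda>r. (if r = t then -1 else 0) + (if r = 0 then - (\<epsilon> * \<alpha> t) else 0)) F (\<lambda>r. if r = t then 1 else 0) F' s"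
        unfolding comb_def sum.distrib distrib_right sum_atMost_delta[OF t'] sum_atMost_delta[OF le0] er_def by simp
    qed
    \<comment> \<open>The nearest-point estimate controls er t at the inputs of task t only. As a
      combination of F and F' it is comparable at the inputs of the first task, where all fitted
      functions can be related to each other.\<close>
    have "(\<Sum>t\<in>{1..T}. evn n 1 (er t)) \<le> (\<Sum>t\<in>{1..T}. 2 * evn n t (er t))"
    proof (rule sum_mono)
      fix t assume t: "t \<in> {1..T}"
      show "evn n 1 (er t) \<le> 2 * evn n t (er t)"
        unfolding erc[OF t] by (rule comp[OF F(1) F'(1)]) (use t T in auto)
    qed
    also have "\<dots> \<le> \<epsilon>\<^sup>2 / 200" using ers by (simp add: sum_distrib_left[symmetric])
    finally have err: "(\<Sum>t\<in>{1..T}. dot ?I (\<lambda>i. F' t (1, i) - F t (1, i) - \<epsilon> * \<alpha> t * F 0 (1, i)) (\<lambda>i. F' t (1, i) - F t (1, i) - \<epsilon> * \<alpha> t * F 0 (1, i))) \<le> \<epsilon>\<^sup>2 / 200"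
      by (simp only: er_def)
    have "\<epsilon>\<^sup>2 \<le> (sqrt \<kappa>)\<^sup>2" using \<epsilon> by (intro power_mono) auto
    then have ek: "\<epsilon>\<^sup>2 \<le> \<kappa>" using \<kappa>(1) by simp
    obtain u' where u': "\<And>i. i \<in> ?I \<Longrightarrow> F' \<tau> (1, i) = (\<Sum>j\<in>J. u' j * F' j (1, i))" using dep'[OF \<tau>(1)] by blast
    show False
    proof (rule rank_one_perturbation[where T="{1..T}" and I="?I" and J=J and \<tau>=\<tau> and \<alpha>=\<alpha> and f="\<lambda>t i. F t (1, i)"
          and f'="\<lambda>t i. F' t (1, i)" and b="?b" and \<kappa>=\<kappa> and \<epsilon>=\<epsilon> and u=u'])
      show "\<alpha> \<tau> \<noteq> 0" using H by (simp add: \<alpha>_def \<alpha>0_def)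
      show "\<alpha> t = 0" if "t \<notin> insert \<tau> J" for t using that by (simp add: \<alpha>_def \<alpha>0_def)
    qed (use J(1) \<tau> rel bF \<kappa>(2) ab \<epsilon>(1) ek err u' in auto)
  qed
  have "\<forall>s\<in>S. \<bar>(pull y (diag F) s + \<epsilon> * h s) - pull y (diag F) s\<bar> \<le> \<epsilon>" if "0 < \<epsilon>" for \<epsilon>
  proof
    fix s assume "s \<in> S"
    then have "\<bar>h s\<bar> \<le> nrm S h" using S(1) by (intro abs_le_nrm)
    also have "\<dots> = 1" by (simp add: nrm_def hh)
    finally show "\<bar>(pull y (diag F) s + \<epsilon> * h s) - pull y (diag F) s\<bar> \<le> \<epsilon>"
      using that mult_left_mono[of "\<bar>h s\<bar>" 1 \<epsilon>] by (simp add: abs_mult)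
  qed
  note near = this
  show ?thesis
  proof (rule exI[of _ \<eta>], rule conjI[OF \<eta>], rule exI[of _ "sqrt \<kappa>"], rule conjI, simp add: \<kappa>(1), intro allI impI)
    fix \<epsilon> assume \<epsilon>: "0 < \<epsilon> \<and> \<epsilon> < sqrt \<kappa>"
    show "\<exists>z. (\<forall>s\<in>S. \<bar>z s - pull y (diag F) s\<bar> \<le> \<epsilon>) \<and>
     (\<forall>y' F'. F' \<in> \<T> \<and> nearest S (diag ` \<T>) y' (diag F') \<and>
        (\<forall>t\<in>{1..T}. \<exists>u. \<forall>i\<in>{..<n}. F' t (1, i) = (\<Sum>j\<in>J. u j * F' j (1, i)))
      \<longrightarrow> (\<exists>s\<in>S. \<bar>pull y' (diag F') s - z s\<bar> > \<eta> * \<epsilon>))"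
    proof (rule exI[of _ "\<lambda>s. pull y (diag F) s + \<epsilon> * h s"], intro conjI allI impI)
      show "\<forall>s\<in>S. \<bar>(pull y (diag F) s + \<epsilon> * h s) - pull y (diag F) s\<bar> \<le> \<epsilon>" using near \<epsilon> by blast
      fix y' F' assume a: "F' \<in> \<T> \<and> nearest S (diag ` \<T>) y' (diag F') \<and>
        (\<forall>t\<in>{1..T}. \<exists>u. \<forall>i\<in>{..<n}. F' t (1, i) = (\<Sum>j\<in>J. u j * F' j (1, i)))"
      show "\<exists>s\<in>S. \<bar>pull y' (diag F') s - (pull y (diag F) s + \<epsilon> * h s)\<bar> > \<eta> * \<epsilon>"
        by (rule core) (use a \<epsilon> in auto)
    qed
  qed
qed

text \<open>The strata are indexed by the spanning subset J. Pulled points form the porous set, and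
  the noise y - a depends on them in a Lipschitz way.\<close>

lemma deficient_null:
  fixes a :: "nat \<times> nat \<Rightarrow> real"
  assumes T: "1 \<le> T" "1 \<le> n" and fam: "fit_family T n \<T>" and \<sigma>: "0 < \<sigma>"
  defines "S \<equiv> {1..T} \<times> {..<n}"
  shows "\<exists>N\<in>null_sets (noise \<sigma> S). \<forall>y F. F \<in> \<T> \<and> deficient T n F \<and> nearest S (diag ` \<T>) y (diag F)
     \<longrightarrow> restrict (\<lambda>s. y s - a s) S \<in> N"
proof -
  have "(1, 0) \<in> S" using T by (simp add: S_def)
  then have S: "finite S" "S \<noteq> {}" by (auto simp: S_def)
  define ind where "ind J F \<longleftrightarrow> (\<forall>u. (\<forall>i\<in>{..<n}. (\<Sum>j\<in>J. u j * F j (1::nat, i)) = 0) \<longrightarrow> (\<forall>j\<in>J. u j = (0::real)))" for J :: "nat set" and F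
  define dep where "dep J F \<longleftrightarrow> (\<forall>t\<in>{1..T}. \<exists>u. \<forall>i\<in>{..<n}. F t (1::nat, i) = (\<Sum>j\<in>J. u j * F j (1, i) :: real))" for J :: "nat set" and F
  define B where "B J = {(y, F). F \<in> \<T> \<and> deficient T n F \<and> nearest S (diag ` \<T>) y (diag F) \<and> ind J F \<and> dep J F}" for J
  have "\<forall>J\<in>Pow {1..T}. \<exists>N. N \<in> null_sets (noise \<sigma> S) \<and> (\<forall>b\<in>B J. restrict ((\<lambda>(y, F) s. y s - a s) b) S \<in> N)"
  proof
    fix J assume J: "J \<in> Pow {1..T}"
    have "\<exists>N\<in>null_sets (noise \<sigma> S). \<forall>b\<in>B J. restrict ((\<lambda>(y, F) s. y s - a s) b) S \<in> N"
    proof (rule porous_image_null[where u="\<lambda>(y, F). pull y (diag F)" and L="2000 * real (card S)", OF S \<sigma>])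
      fix b b' \<delta> assume b: "b \<in> B J" "b' \<in> B J"
        and d: "\<And>s. s \<in> S \<Longrightarrow> \<bar>(case b of (y, F) \<Rightarrow> pull y (diag F)) s - (case b' of (y, F) \<Rightarrow> pull y (diag F)) s\<bar> \<le> \<delta>"
      obtain y F y' F' where bb: "b = (y, F)" "b' = (y', F')" by (cases b, cases b')
      have n: "nearest S (diag ` \<T>) y (diag F)" "nearest S (diag ` \<T>) y' (diag F')"
        using b by (auto simp: B_def bb)
      have "\<bar>y s - y' s\<bar> \<le> (2000 * real (card S)) * \<delta>" if "s \<in> S" for s
        by (rule pull_inverse_lipschitz[OF S(1) n _ that]) (use d in \<open>simp add: bb\<close>)
      then show "\<forall>s\<in>S. \<bar>(case b of (y, F) \<Rightarrow> \<lambda>s. y s - a s) s - (case b' of (y, F) \<Rightarrow> \<lambda>s. y s - a s) s\<bar> \<le> 2000 * real (card S) * \<delta>"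
        by (simp add: bb)
    next
      fix b assume b: "b \<in> B J"
      obtain y F where bb: "b = (y, F)" by (cases b)
      have F: "F \<in> \<T>" "deficient T n F" "nearest S (diag ` \<T>) y (diag F)" and i: "ind J F" "dep J F"
        using b by (auto simp: B_def bb)
      have h: "\<exists>\<eta>>0. \<exists>\<epsilon>0>0. \<forall>\<epsilon>. 0 < \<epsilon> \<and> \<epsilon> < \<epsilon>0 \<longrightarrow> (\<exists>z. (\<forall>s\<in>S. \<bar>z s - pull y (diag F) s\<bar> \<le> \<epsilon>) \<and>
       (\<forall>y' F'. F' \<in> \<T> \<and> nearest S (diag ` \<T>) y' (diag F') \<and> dep J F'
        \<longrightarrow> (\<exists>s\<in>S. \<bar>pull y' (diag F') s - z s\<bar> > \<eta> * \<epsilon>)))"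
        unfolding S_def dep_def
        by (rule deficient_hole[OF T fam F(1,2) F(3)[unfolded S_def]])
           (use J i in \<open>auto simp: ind_def dep_def\<close>)
      then obtain \<eta> \<epsilon>0 where he: "0 < \<eta>" "0 < \<epsilon>0" "\<And>\<epsilon>. 0 < \<epsilon> \<and> \<epsilon> < \<epsilon>0 \<Longrightarrow> (\<exists>z. (\<forall>s\<in>S. \<bar>z s - pull y (diag F) s\<bar> \<le> \<epsilon>) \<and>
       (\<forall>y' F'. F' \<in> \<T> \<and> nearest S (diag ` \<T>) y' (diag F') \<and> dep J F'
        \<longrightarrow> (\<exists>s\<in>S. \<bar>pull y' (diag F') s - z s\<bar> > \<eta> * \<epsilon>)))"
        by blast
      show "\<exists>\<eta>>0. \<exists>\<epsilon>0>0. \<forall>\<epsilon>. 0 < \<epsilon> \<and> \<epsilon> < \<epsilon>0 \<longrightarrow> (\<exists>z. (\<forall>s\<in>S. \<bar>z s - (case b of (y, F) \<Rightarrow> pull y (diag F)) s\<bar> \<le> \<epsilon>) \<and>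
        (\<forall>b'\<in>B J. \<exists>s\<in>S. \<bar>(case b' of (y, F) \<Rightarrow> pull y (diag F)) s - z s\<bar> > \<eta> * \<epsilon>))"
      proof (rule exI[of _ \<eta>], rule conjI[OF he(1)], rule exI[of _ \<epsilon>0], rule conjI[OF he(2)], intro allI impI)
        fix \<epsilon> assume "0 < \<epsilon> \<and> \<epsilon> < \<epsilon>0"
        from he(3)[OF this] obtain z where z: "\<forall>s\<in>S. \<bar>z s - pull y (diag F) s\<bar> \<le> \<epsilon>"
          "\<And>y' F'. F' \<in> \<T> \<and> nearest S (diag ` \<T>) y' (diag F') \<and> dep J F' \<Longrightarrow> (\<exists>s\<in>S. \<bar>pull y' (diag F') s - z s\<bar> > \<eta> * \<epsilon>)"
          by blast
        show "\<exists>z. (\<forall>s\<in>S. \<bar>z s - (case b of (y, F) \<Rightarrow> pull y (diag F)) s\<bar> \<le> \<epsilon>) \<and>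
        (\<forall>b'\<in>B J. \<exists>s\<in>S. \<bar>(case b' of (y, F) \<Rightarrow> pull y (diag F)) s - z s\<bar> > \<eta> * \<epsilon>)"
        proof (rule exI[of _ z], intro conjI ballI)
          show "\<bar>z s - (case b of (y, F) \<Rightarrow> pull y (diag F)) s\<bar> \<le> \<epsilon>" if "s \<in> S" for s using z(1) that by (simp add: bb)
          fix b' assume "b' \<in> B J"
          then obtain y' F' where b': "b' = (y', F')" "F' \<in> \<T> \<and> nearest S (diag ` \<T>) y' (diag F') \<and> dep J F'"
            by (auto simp: B_def)
          show "\<exists>s\<in>S. \<bar>(case b' of (y, F) \<Rightarrow> pull y (diag F)) s - z s\<bar> > \<eta> * \<epsilon>"
            using z(2)[OF b'(2)] by (simp add: b'(1))
        qed
      qed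
    qed simp
    then show "\<exists>N. N \<in> null_sets (noise \<sigma> S) \<and> (\<forall>b\<in>B J. restrict ((\<lambda>(y, F) s. y s - a s) b) S \<in> N)" by blast
  qed
  from bchoice[OF this] obtain N where N: "\<forall>J\<in>Pow {1..T}. N J \<in> null_sets (noise \<sigma> S) \<and> (\<forall>b\<in>B J. restrict ((\<lambda>(y, F) s. y s - a s) b) S \<in> N J)"
    by (rule exE)
  show ?thesis
  proof (intro bexI[of _ "\<Union>J\<in>Pow {1..T}. N J"] allI impI)
    fix y F assume F: "F \<in> \<T> \<and> deficient T n F \<and> nearest S (diag ` \<T>) y (diag F)"
    obtain J where J: "J \<subseteq> {1..T}" "ind J F" "dep J F"
      using maximal_independent_subset[of "{1..T}" "{..<n}" "\<lambda>t i. F t (1, i)"] unfolding ind_def dep_def by blast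
    then have "(y, F) \<in> B J" using F by (simp add: B_def)
    then have "restrict (\<lambda>s. y s - a s) S \<in> N J" using N J(1) by auto
    then show "restrict (\<lambda>s. y s - a s) S \<in> (\<Union>J\<in>Pow {1..T}. N J)" using J(1) by blast
  next
    show "(\<Union>J\<in>Pow {1..T}. N J) \<in> null_sets (noise \<sigma> S)"
      using N by (intro null_sets_UN' countable_finite) auto
  qed
qed

section \<open>Limits of near-minimising tuples\<close>

lemma bounded_family_convergent_subsequence:
  fixes x :: "nat \<Rightarrow> 'k \<Rightarrow> real"
  assumes "finite K" "\<And>m k. k \<in> K \<Longrightarrow> \<bar>x m k\<bar> \<le> B"
  shows "\<exists>f l. strict_mono (f :: nat \<Rightarrow> nat) \<and> (\<forall>k\<in>K. (\<lambda>m. x (f m) k) \<longlonglongrightarrow> l k)"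
  using assms
proof (induction K rule: finite_induct)
  case empty
  show ?case by (intro exI[of _ id] exI[of _ "\<lambda>_. 0"]) (auto simp: strict_mono_id)
next
  case (insert k K)
  have "\<exists>f l. strict_mono (f :: nat \<Rightarrow> nat) \<and> (\<forall>k\<in>K. (\<lambda>m. x (f m) k) \<longlonglongrightarrow> l k)"
    by (rule insert.IH) (use insert.prems in auto)
  then obtain f l where f: "strict_mono (f :: nat \<Rightarrow> nat)" "\<And>k. k \<in> K \<Longrightarrow> (\<lambda>m. x (f m) k) \<longlonglongrightarrow> l k"
    by blast
  have sc: "seq_compact {-B..B}" by (simp add: compact_imp_seq_compact)
  have "\<forall>m. x (f m) k \<in> {-B..B}" using insert.prems[of k] by (auto simp: abs_le_iff minus_le_iff)
  from seq_compactE[OF sc, of "\<lambda>m. x (f m) k", OF this]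
  obtain c g where g: "strict_mono (g :: nat \<Rightarrow> nat)" "((\<lambda>m. x (f m) k) \<circ> g) \<longlonglongrightarrow> c"
    by blast
  have "(\<lambda>m. x ((f \<circ> g) m) j) \<longlonglongrightarrow> (l(k := c)) j" if "j \<in> insert k K" for j
  proof (cases "j = k")
    case True then show ?thesis using g(2) by (simp add: o_def)
  next
    case False
    then have "j \<in> K" using that by simp
    from LIMSEQ_subseq_LIMSEQ[OF f(2)[OF this] g(1)] show ?thesis using False by (simp add: o_def)
  qed
  moreover have "strict_mono (f \<circ> g)" using f(1) g(1) by (rule strict_mono_o)
  ultimately show ?case by blast
qed

lemma tendsto_dot:
  assumes "\<And>s. s \<in> S \<Longrightarrow> (\<lambda>m. u m s) \<longlonglongrightarrow> u' s" "\<And>s. s \<in> S \<Longrightarrow> (\<lambda>m. v m s) \<longlonglongrightarrow> v' s"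
  shows "(\<lambda>m. dot S (u m) (v m)) \<longlonglongrightarrow> dot S u' v'"
  unfolding dot_def by (intro tendsto_sum tendsto_mult assms)

definition tuple_tendsto :: "nat \<Rightarrow> nat \<Rightarrow> (nat \<Rightarrow> nat \<Rightarrow> nat \<times> nat \<Rightarrow> real) \<Rightarrow> (nat \<Rightarrow> nat \<times> nat \<Rightarrow> real) \<Rightarrow> bool" where
  "tuple_tendsto T n G F \<longleftrightarrow> (\<forall>r\<le>T. \<forall>s\<in>{1..T} \<times> {..<n}. (\<lambda>m. G m r s) \<longlonglongrightarrow> F r s)"

text \<open>A limit of near-minimising tuples need not come from a feature map of the class, but the
  properties in \<open>fit_family\<close> pass to it.\<close>

definition tuple_closure :: "nat \<Rightarrow> nat \<Rightarrow> (nat \<Rightarrow> nat \<times> nat \<Rightarrow> real) set \<Rightarrow> (nat \<Rightarrow> nat \<times> nat \<Rightarrow> real) set" where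
  "tuple_closure T n \<T> = {F. \<exists>G. (\<forall>m. G m \<in> \<T>) \<and> tuple_tendsto T n G F}"

lemma tuple_tendsto_dot:
  assumes "tuple_tendsto T n G F" "t \<in> {1..T}" "r \<le> T" "r' \<le> T"
  shows "(\<lambda>m. dot {..<n} (\<lambda>i. G m r (t, i)) (\<lambda>i. G m r' (t, i))) \<longlonglongrightarrow> dot {..<n} (\<lambda>i. F r (t, i)) (\<lambda>i. F r' (t, i))"
  by (rule tendsto_dot) (use assms in \<open>auto simp: tuple_tendsto_def\<close>)

lemma tuple_tendsto_sqd:
  assumes "tuple_tendsto T n G F"
  shows "(\<lambda>m. sqd ({1..T} \<times> {..<n}) y (diag (G m))) \<longlonglongrightarrow> sqd ({1..T} \<times> {..<n}) y (diag F)"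
  by (intro tendsto_dot tendsto_diff tendsto_const) (use assms in \<open>auto simp: tuple_tendsto_def diag_def\<close>)

lemma fit_family_comp:
  assumes "fit_family T n \<T>" "F \<in> \<T>" "t \<in> {1..T}" "t' \<in> {1..T}" "r \<le> T"
  shows "evn n t (F r) \<le> 2 * evn n t' (F r)"
proof -
  have c: "comb T (\<lambda>q. if q = r then 1 else 0) F (\<lambda>_. 0) F = F r"
    using assms(5) by (simp add: comb_def fun_eq_iff sum_atMost_delta)
  have "evn n t (comb T (\<lambda>q. if q = r then 1 else 0) F (\<lambda>_. 0) F) \<le> 2 * evn n t' (comb T (\<lambda>q. if q = r then 1 else 0) F (\<lambda>_. 0) F)"
    using assms unfolding fit_family_def by blast
  then show ?thesis unfolding c .
qed

lemma fit_family_closure: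
  assumes fam: "fit_family T n \<T>"
  shows "fit_family T n (tuple_closure T n \<T>)"
  unfolding fit_family_def
proof (intro conjI ballI allI)
  fix F F' a b t t' assume F: "F \<in> tuple_closure T n \<T>" "F' \<in> tuple_closure T n \<T>" and t: "t \<in> {1..T}" "t' \<in> {1..T}"
  obtain G where G: "\<And>m. G m \<in> \<T>" "tuple_tendsto T n G F" using F(1) by (auto simp: tuple_closure_def)
  obtain G' where G': "\<And>m. G' m \<in> \<T>" "tuple_tendsto T n G' F'" using F(2) by (auto simp: tuple_closure_def)
  have lim: "(\<lambda>m. evn n t (comb T a (G m) b (G' m))) \<longlonglongrightarrow> evn n t (comb T a F b F')" if "t \<in> {1..T}" for t
    unfolding comb_def
    by (intro tendsto_dot tendsto_sum tendsto_add tendsto_mult tendsto_const)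
       (use that G(2) G'(2) in \<open>auto simp: tuple_tendsto_def\<close>)
  have "(\<lambda>m. 2 * evn n t' (comb T a (G m) b (G' m))) \<longlonglongrightarrow> 2 * evn n t' (comb T a F b F')"
    by (intro tendsto_mult tendsto_const lim t)
  from LIMSEQ_le[OF lim[OF t(1)] this] show "evn n t (comb T a F b F') \<le> 2 * evn n t' (comb T a F b F')"
    using fam G(1) G'(1) t unfolding fit_family_def by blast
next
  fix F and \<alpha> :: "nat \<Rightarrow> real" assume F: "F \<in> tuple_closure T n \<T>"
  obtain G where G: "\<And>m. G m \<in> \<T>" "tuple_tendsto T n G F" using F by (auto simp: tuple_closure_def)
  have "(\<lambda>r s. G m r s + \<alpha> r * G m 0 s) \<in> \<T>" for m using fam G(1) unfolding fit_family_def by blast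
  moreover have "tuple_tendsto T n (\<lambda>m r s. G m r s + \<alpha> r * G m 0 s) (\<lambda>r s. F r s + \<alpha> r * F 0 s)"
    unfolding tuple_tendsto_def
    by (intro allI impI ballI tendsto_add tendsto_mult tendsto_const) (use G(2) in \<open>auto simp: tuple_tendsto_def\<close>)
  ultimately show "(\<lambda>r s. F r s + \<alpha> r * F 0 s) \<in> tuple_closure T n \<T>"
    unfolding tuple_closure_def mem_Collect_eq by (intro exI[of _ "\<lambda>m r s. G m r s + \<alpha> r * G m 0 s"] conjI allI)
next
  fix F assume F: "F \<in> tuple_closure T n \<T>"
  obtain G where G: "\<And>m. G m \<in> \<T>" "tuple_tendsto T n G F" using F by (auto simp: tuple_closure_def)
  have "\<forall>m. \<exists>c. (\<Sum>r\<le>T. (c r)\<^sup>2) = 1 \<and> (\<forall>s\<in>{1..T} \<times> {..<n}. (\<Sum>r\<le>T. c r * G m r s) = 0)"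
  proof
    fix m
    obtain c where c: "\<exists>r\<le>T. c r \<noteq> 0" "\<And>s. s \<in> {1..T} \<times> {..<n} \<Longrightarrow> (\<Sum>r\<le>T. c r * G m r s) = 0"
      using fam G(1) unfolding fit_family_def by blast
    \<comment> \<open>Relations are normalised to unit length, since otherwise their limit could be
      zero.\<close>
    define N where "N = (\<Sum>r\<le>T. (c r)\<^sup>2)"
    have "0 < N" unfolding N_def using c(1) by (auto intro!: sum_pos2)
    then have "(\<Sum>r\<le>T. (c r / sqrt N)\<^sup>2) = 1" by (simp add: power_divide sum_divide_distrib[symmetric] N_def[symmetric])
    moreover have "(\<Sum>r\<le>T. (c r / sqrt N) * G m r s) = 0" if "s \<in> {1..T} \<times> {..<n}" for s
      using c(2)[OF that] by (simp add: sum_divide_distrib[symmetric])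
    ultimately show "\<exists>c. (\<Sum>r\<le>T. (c r)\<^sup>2) = 1 \<and> (\<forall>s\<in>{1..T} \<times> {..<n}. (\<Sum>r\<le>T. c r * G m r s) = 0)"
      by (intro exI[of _ "\<lambda>r. c r / sqrt N"]) auto
  qed
  from choice[OF this] obtain c where c: "\<And>m. (\<Sum>r\<le>T. (c m r)\<^sup>2) = 1" "\<And>m s. s \<in> {1..T} \<times> {..<n} \<Longrightarrow> (\<Sum>r\<le>T. c m r * G m r s) = 0"
    by blast
  have "\<bar>c m r\<bar> \<le> 1" if "r \<in> {..T}" for m r
  proof (rule power2_le_imp_le)
    have "(c m r)\<^sup>2 \<le> (\<Sum>r\<le>T. (c m r)\<^sup>2)" using that by (intro member_le_sum) auto
    then show "\<bar>c m r\<bar>\<^sup>2 \<le> 1\<^sup>2" by (simp add: c(1))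
  qed simp
  from bounded_family_convergent_subsequence[where x=c and K="{..T}" and B=1, OF finite_atMost this]
  obtain f l where "strict_mono (f :: nat \<Rightarrow> nat)" "\<forall>r\<in>{..T}. (\<lambda>m. c (f m) r) \<longlonglongrightarrow> l r" by blast
  then have f: "strict_mono f" "\<And>r. r \<le> T \<Longrightarrow> (\<lambda>m. c (f m) r) \<longlonglongrightarrow> l r" by auto
  have "(\<lambda>m. \<Sum>r\<le>T. (c (f m) r)\<^sup>2) \<longlonglongrightarrow> (\<Sum>r\<le>T. (l r)\<^sup>2)" by (intro tendsto_sum tendsto_power f) simp
  then have l1: "(\<Sum>r\<le>T. (l r)\<^sup>2) = 1" by (simp add: c(1) LIMSEQ_const_iff)
  have "\<exists>r\<le>T. l r \<noteq> 0"
  proof (rule ccontr)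
    assume "\<not> ?thesis"
    then have "(\<Sum>r\<le>T. (l r)\<^sup>2) = 0" by (intro sum.neutral) auto
    with l1 show False by simp
  qed
  moreover have "(\<Sum>r\<le>T. l r * F r s) = 0" if s: "s \<in> {1..T} \<times> {..<n}" for s
  proof -
    have G2: "(\<lambda>m. G (f m) r s) \<longlonglongrightarrow> F r s" if "r \<le> T" for r
    proof -
      have "(\<lambda>m. G m r s) \<longlonglongrightarrow> F r s" using G(2) that s unfolding tuple_tendsto_def by blast
      from LIMSEQ_subseq_LIMSEQ[OF this f(1)] show ?thesis by (simp add: o_def)
    qed
    have "(\<lambda>m. \<Sum>r\<le>T. c (f m) r * G (f m) r s) \<longlonglongrightarrow> (\<Sum>r\<le>T. l r * F r s)"
      by (intro tendsto_sum tendsto_mult f G2) auto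
    then show ?thesis by (simp add: c(2)[OF s] LIMSEQ_const_iff)
  qed
  ultimately show "\<exists>c. (\<exists>r\<le>T. c r \<noteq> 0) \<and> (\<forall>s\<in>{1..T} \<times> {..<n}. (\<Sum>r\<le>T. c r * F r s) = 0)" by blast
qed

lemma bounded_tuples_limit:
  assumes G: "\<And>m. G m \<in> \<T>" and b: "\<And>m r s. r \<le> T \<Longrightarrow> s \<in> {1..T} \<times> {..<n} \<Longrightarrow> \<bar>G m r s\<bar> \<le> B"
  shows "\<exists>f F. strict_mono (f :: nat \<Rightarrow> nat) \<and> F \<in> tuple_closure T n \<T> \<and> tuple_tendsto T n (\<lambda>m. G (f m)) F"
proof -
  have "\<exists>f l. strict_mono (f :: nat \<Rightarrow> nat) \<and> (\<forall>k\<in>{..T} \<times> ({1..T} \<times> {..<n}). (\<lambda>m. (\<lambda>(r, s). G (f m) r s) k) \<longlonglongrightarrow> l k)"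
    by (rule bounded_family_convergent_subsequence[where x="\<lambda>m (r, s). G m r s"]) (use b in auto)
  then obtain f l where f: "strict_mono (f :: nat \<Rightarrow> nat)"
    "\<forall>k\<in>{..T} \<times> ({1..T} \<times> {..<n}). (\<lambda>m. (\<lambda>(r, s). G (f m) r s) k) \<longlonglongrightarrow> l k"
    by (elim exE conjE)
  have t: "tuple_tendsto T n (\<lambda>m. G (f m)) (\<lambda>r s. l (r, s))"
    unfolding tuple_tendsto_def
  proof (intro allI impI ballI)
    fix r s assume "r \<le> T" "s \<in> {1..T} \<times> {..<n}"
    then have "(r, s) \<in> {..T} \<times> ({1..T} \<times> {..<n})" by simp
    from bspec[OF f(2) this] show "(\<lambda>m. G (f m) r s) \<longlonglongrightarrow> l (r, s)" by simp
  qed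
  then have "(\<lambda>r s. l (r, s)) \<in> tuple_closure T n \<T>" unfolding tuple_closure_def mem_Collect_eq
    using G by (intro exI[of _ "\<lambda>m. G (f m)"] conjI allI)
  with f(1) t show ?thesis by blast
qed

definition min_loss :: "nat \<Rightarrow> nat \<Rightarrow> (nat \<Rightarrow> nat \<Rightarrow> nat \<times> nat \<Rightarrow> real) \<Rightarrow> (nat \<times> nat \<Rightarrow> real) \<Rightarrow> real" where
  "min_loss T n Fam y = (INF i. sqd ({1..T} \<times> {..<n}) y (diag (Fam i)))"

definition near_min :: "nat \<Rightarrow> nat \<Rightarrow> (nat \<Rightarrow> nat \<Rightarrow> nat \<times> nat \<Rightarrow> real) \<Rightarrow> (nat \<times> nat \<Rightarrow> real) \<Rightarrow> nat \<Rightarrow> nat \<Rightarrow> bool" where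
  "near_min T n Fam y m i \<longleftrightarrow> sqd ({1..T} \<times> {..<n}) y (diag (Fam i)) \<le> min_loss T n Fam y + 1 / real (Suc m)"

text \<open>Written with countable quantifiers over an enumerated family, so that it is a measurable
  condition on the sample. Compactness turns it into two different nearest points of the
  closure.\<close>

definition ambiguous_fit :: "nat \<Rightarrow> nat \<Rightarrow> (nat \<Rightarrow> nat \<Rightarrow> nat \<times> nat \<Rightarrow> real) \<Rightarrow> (nat \<times> nat \<Rightarrow> real) \<Rightarrow> bool" where
  "ambiguous_fit T n Fam y \<longleftrightarrow> (\<exists>s\<in>{1..T} \<times> {..<n}. \<exists>q::nat. \<forall>m. \<exists>i j. near_min T n Fam y m i \<and> near_min T n Fam y m j \<and>
     1 / real (Suc q) \<le> \<bar>diag (Fam i) s - diag (Fam j) s\<bar>)"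

text \<open>Same encoding: squared norms near 1 keep the spare function from vanishing in the limit,
  where it witnesses \<open>deficient\<close>.\<close>

definition deficient_fit :: "nat \<Rightarrow> nat \<Rightarrow> (nat \<Rightarrow> nat \<Rightarrow> nat \<times> nat \<Rightarrow> real) \<Rightarrow> (nat \<times> nat \<Rightarrow> real) \<Rightarrow> bool" where
  "deficient_fit T n Fam y \<longleftrightarrow> (\<forall>m. \<exists>i. near_min T n Fam y m i \<and> \<bar>evn n 1 (Fam i 0) - 1\<bar> \<le> 1 / real (Suc m) \<and>
     (\<forall>t\<in>{1..T}. \<bar>dot {..<n} (\<lambda>i'. Fam i 0 (1, i')) (\<lambda>i'. Fam i t (1, i'))\<bar> \<le> 1 / real (Suc m)))"

definition tuple_dense :: "nat \<Rightarrow> nat \<Rightarrow> (nat \<Rightarrow> nat \<Rightarrow> nat \<times> nat \<Rightarrow> real) \<Rightarrow> (nat \<Rightarrow> nat \<times> nat \<Rightarrow> real) set \<Rightarrow> bool" where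
  "tuple_dense T n Fam \<T> \<longleftrightarrow> (\<forall>F\<in>\<T>. \<exists>i. tuple_tendsto T n (\<lambda>m. Fam (i m)) F)"

lemma min_loss_le: "min_loss T n Fam y \<le> sqd ({1..T} \<times> {..<n}) y (diag (Fam i))"
  unfolding min_loss_def by (intro cINF_lower bdd_belowI2[where m=0]) auto

lemma near_min_ex: "\<exists>i. near_min T n Fam y m i"
proof (rule ccontr)
  assume "\<not> ?thesis"
  then have "min_loss T n Fam y + 1 / real (Suc m) \<le> sqd ({1..T} \<times> {..<n}) y (diag (Fam i))" for i
    by (simp add: near_min_def not_le less_imp_le)
  then have "min_loss T n Fam y + 1 / real (Suc m) \<le> (INF i. sqd ({1..T} \<times> {..<n}) y (diag (Fam i)))"
    by (intro cINF_greatest) auto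
  then show False unfolding min_loss_def[symmetric] by simp
qed

lemma min_loss_le_closure:
  assumes "tuple_dense T n Fam \<T>" "F \<in> tuple_closure T n \<T>"
  shows "min_loss T n Fam y \<le> sqd ({1..T} \<times> {..<n}) y (diag F)"
proof -
  have 1: "min_loss T n Fam y \<le> sqd ({1..T} \<times> {..<n}) y (diag G)" if G: "G \<in> \<T>" for G
  proof -
    obtain i where "tuple_tendsto T n (\<lambda>m. Fam (i m)) G" using assms(1) G by (auto simp: tuple_dense_def)
    from tuple_tendsto_sqd[OF this] show ?thesis
      by (rule LIMSEQ_le_const) (use min_loss_le in blast)
  qed
  obtain G where G: "\<And>m. G m \<in> \<T>" "tuple_tendsto T n G F" using assms(2) by (auto simp: tuple_closure_def)
  from tuple_tendsto_sqd[OF this(2)] show ?thesis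
    by (rule LIMSEQ_le_const) (use 1[OF G(1)] in blast)
qed

lemma nearest_if_limit_near_min:
  assumes dense: "tuple_dense T n Fam \<T>" and F: "F \<in> tuple_closure T n \<T>" "tuple_tendsto T n G F"
    and G: "\<And>m. sqd ({1..T} \<times> {..<n}) y (diag (G m)) \<le> min_loss T n Fam y + 1 / real (Suc m)"
  shows "nearest ({1..T} \<times> {..<n}) (diag ` tuple_closure T n \<T>) y (diag F)"
proof -
  have "(\<lambda>m. min_loss T n Fam y + 1 / real (Suc m)) \<longlonglongrightarrow> min_loss T n Fam y + 0"
    by (intro tendsto_add tendsto_const LIMSEQ_Suc lim_1_over_n)
  from LIMSEQ_le[OF tuple_tendsto_sqd[OF F(2)] this] have "sqd ({1..T} \<times> {..<n}) y (diag F) \<le> min_loss T n Fam y"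
    using G by auto
  then show ?thesis unfolding nearest_def using F(1) min_loss_le_closure[OF dense] by (auto intro: order_trans)
qed

text \<open>The loss bounds each fitted function at the inputs of its own task, and the comparison
  between tasks extends this to all inputs. Values of near-minimisers are thus bounded even when
  their weights are not.\<close>

lemma near_min_tuple_bound:
  assumes fam: "fit_family T n \<T>" and F: "F \<in> \<T>" and l: "sqd ({1..T} \<times> {..<n}) y (diag F) \<le> c"
    and r: "r \<in> {1..T}" and s: "s \<in> {1..T} \<times> {..<n}"
  shows "\<bar>F r s\<bar> \<le> 4 * (dot ({1..T} \<times> {..<n}) y y + c) + 1"
proof -
  let ?S = "{1..T} \<times> {..<n}"
  obtain t i where ti: "s = (t, i)" "t \<in> {1..T}" "i < n" using s by auto
  have "(F r s)\<^sup>2 \<le> evn n t (F r)" unfolding dot_def ti(1) power2_eq_square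
    using ti by (intro member_le_sum) auto
  also have "\<dots> \<le> 2 * evn n r (F r)" by (rule fit_family_comp[OF fam F ti(2) r]) (use r in auto)
  also have "evn n r (F r) = evn n r (diag F)" by (simp add: diag_def)
  also have "\<dots> \<le> (\<Sum>t\<in>{1..T}. evn n t (diag F))" by (rule member_le_sum[OF r]) auto
  also have "\<dots> = dot ?S (diag F) (diag F)" by (simp only: dot_eq_sum_evn)
  also have "\<dots> \<le> 2 * dot ?S y y + 2 * sqd ?S y (diag F)"
    unfolding dot_def sum_distrib_left sum.distrib[symmetric]
  proof (rule sum_mono)
    fix s
    have "0 \<le> (2 * y s - diag F s) * (2 * y s - diag F s)" by simp
    then show "diag F s * diag F s \<le> 2 * (y s * y s) + 2 * ((y s - diag F s) * (y s - diag F s))" by (simp add: algebra_simps)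
  qed
  finally have "(F r s)\<^sup>2 \<le> 4 * (dot ?S y y + c)" using l by simp
  moreover have "\<bar>F r s\<bar> \<le> (F r s)\<^sup>2 + 1"
    using zero_le_power2[of "\<bar>F r s\<bar> - 1"] zero_le_power2[of "F r s"] by (simp add: power2_eq_square algebra_simps abs_if split: if_splits)
  ultimately show ?thesis by linarith
qed

text \<open>Near-minimisers subconverge to nearest points of the closure, so an ambiguous fit
  produces two nearest points and a deficient fit a deficient one; both are null. The inputs are
  held fixed, and with \<open>a\<close> the noiseless signal y - a is the noise.\<close>

lemma bad_fit_null:
  fixes a :: "nat \<times> nat \<Rightarrow> real"
  assumes T: "1 \<le> T" "1 \<le> n" and fam: "fit_family T n \<T>" and \<sigma>: "0 < \<sigma>"
    and Fam: "\<And>i. Fam i \<in> \<T>" and dense: "tuple_dense T n Fam \<T>"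
  defines "S \<equiv> {1..T} \<times> {..<n}"
  shows "\<exists>N\<in>null_sets (noise \<sigma> S). \<forall>y. ambiguous_fit T n Fam y \<or> deficient_fit T n Fam y \<longrightarrow> restrict (\<lambda>s. y s - a s) S \<in> N"
proof -
  let ?C = "tuple_closure T n \<T>"
  have "(1, 0) \<in> S" using T by (simp add: S_def)
  then have S: "finite S" "S \<noteq> {}" by (auto simp: S_def)
  have famC: "fit_family T n ?C" by (rule fit_family_closure[OF fam])
  obtain N1 where N1: "N1 \<in> null_sets (noise \<sigma> S)" "\<And>y m m'. nearest S (diag ` ?C) y m \<Longrightarrow> nearest S (diag ` ?C) y m' \<Longrightarrow> (\<exists>s\<in>S. m s \<noteq> m' s)
     \<Longrightarrow> restrict (\<lambda>s. y s - a s) S \<in> N1"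
    using nonunique_nearest_null[OF S \<sigma>, of "diag ` ?C" a] by blast
  obtain N2 where N2: "N2 \<in> null_sets (noise \<sigma> S)" "\<And>y F. F \<in> ?C \<Longrightarrow> deficient T n F \<Longrightarrow> nearest S (diag ` ?C) y (diag F)
     \<Longrightarrow> restrict (\<lambda>s. y s - a s) S \<in> N2"
    using deficient_null[OF T famC \<sigma>, of a] unfolding S_def by blast
  have lim_near: "\<exists>f F. strict_mono (f :: nat \<Rightarrow> nat) \<and> F \<in> ?C \<and> tuple_tendsto T n (\<lambda>m. G (f m)) F \<and> nearest S (diag ` ?C) y (diag F)"
    if G: "\<And>m. G m \<in> \<T>" "\<And>m. sqd S y (diag (G m)) \<le> min_loss T n Fam y + 1 / real (Suc m)" "\<And>m t. t \<in> {1..T} \<Longrightarrow> evn n t (G m 0) \<le> 4"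
    for G y
  proof -
    define B where "B = max 2 (4 * (dot S y y + (min_loss T n Fam y + 1)) + 1)"
    have "\<bar>G m r s\<bar> \<le> B" if rs: "r \<le> T" "s \<in> {1..T} \<times> {..<n}" for m r s
    proof (cases "r = 0")
      case True
      obtain t i where ti: "s = (t, i)" "t \<in> {1..T}" "i < n" using rs by auto
      have "(G m 0 s)\<^sup>2 \<le> evn n t (G m 0)" unfolding dot_def ti(1) power2_eq_square
        using ti by (intro member_le_sum) auto
      also have "\<dots> \<le> 2\<^sup>2" using G(3)[OF ti(2), of m] by simp
      finally have "\<bar>G m 0 s\<bar> \<le> 2" by (simp add: abs_le_square_iff[of _ 2, simplified])
      then show ?thesis by (simp add: B_def True)
    next
      case False
      have "1 / real (Suc m) \<le> 1" by simp
      then have l: "sqd ({1..T} \<times> {..<n}) y (diag (G m)) \<le> min_loss T n Fam y + 1" using G(2)[of m] unfolding S_def by linarith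
      have "\<bar>G m r s\<bar> \<le> 4 * (dot S y y + (min_loss T n Fam y + 1)) + 1"
        unfolding S_def by (rule near_min_tuple_bound[OF fam G(1) l]) (use False rs in auto)
      then show ?thesis by (simp add: B_def)
    qed
    from bounded_tuples_limit[where G=G and T=T and n=n, OF G(1) this] obtain f F where f: "strict_mono (f :: nat \<Rightarrow> nat)" "F \<in> ?C" "tuple_tendsto T n (\<lambda>m. G (f m)) F"
      by blast
    have "sqd S y (diag (G (f m))) \<le> min_loss T n Fam y + 1 / real (Suc m)" for m
    proof -
      have "m \<le> f m" using f(1) by (rule seq_suble)
      then have "1 / real (Suc (f m)) \<le> 1 / real (Suc m)" by (simp add: frac_le)
      then show ?thesis using G(2)[of "f m"] by linarith
    qed
    then have "nearest S (diag ` ?C) y (diag F)"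
      unfolding S_def by (intro nearest_if_limit_near_min[OF dense f(2,3)])
    with f show ?thesis by blast
  qed
  have amb: "restrict (\<lambda>s. y s - a s) S \<in> N1" if "ambiguous_fit T n Fam y" for y
  proof -
    obtain s q where s: "s \<in> S" and "\<forall>m. \<exists>i j. near_min T n Fam y m i \<and> near_min T n Fam y m j \<and>
     1 / real (Suc q) \<le> \<bar>diag (Fam i) s - diag (Fam j) s\<bar>"
      using \<open>ambiguous_fit T n Fam y\<close> unfolding ambiguous_fit_def S_def by blast
    then have "\<forall>m. \<exists>ij. near_min T n Fam y m (fst ij) \<and> near_min T n Fam y m (snd ij) \<and>
     1 / real (Suc q) \<le> \<bar>diag (Fam (fst ij)) s - diag (Fam (snd ij)) s\<bar>" by force
    from choice[OF this] obtain ij where ij: "\<And>m. near_min T n Fam y m (fst (ij m))" "\<And>m. near_min T n Fam y m (snd (ij m))"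
       "\<And>m. 1 / real (Suc q) \<le> \<bar>diag (Fam (fst (ij m))) s - diag (Fam (snd (ij m))) s\<bar>" by blast
    \<comment> \<open>The loss does not see F 0, which may be unbounded along the sequence. Setting
      it to zero, with coefficient -1 at index 0, restores compactness without changing the
      fits.\<close>
    define Z where "Z F = (\<lambda>r s. F r s + (if r = 0 then -1 else 0) * F 0 s)" for F :: "nat \<Rightarrow> nat \<times> nat \<Rightarrow> real"
    have Zm: "Z F \<in> \<T>" if F: "F \<in> \<T>" for F
    proof -
      have "\<forall>\<alpha>. (\<lambda>r s. F r s + \<alpha> r * F 0 s) \<in> \<T>" using fam F unfolding fit_family_def by blast
      then show ?thesis unfolding Z_def by (rule spec)
    qed
    have Zd: "diag (Z F) r = diag F r" if "r \<in> S" for F r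
      using that by (auto simp: diag_def Z_def S_def)
    have Zs: "sqd S y (diag (Z F)) = sqd S y (diag F)" for F
      unfolding dot_def by (intro sum.cong refl) (simp add: Zd)
    have Z0: "evn n t (Z F 0) \<le> 4" for t F by (simp add: Z_def dot_def)
    obtain f F where f: "strict_mono (f :: nat \<Rightarrow> nat)" "F \<in> ?C" "tuple_tendsto T n (\<lambda>m. Z (Fam (fst (ij (f m))))) F" "nearest S (diag ` ?C) y (diag F)"
      using lim_near[of "\<lambda>m. Z (Fam (fst (ij m)))" y] Zm[OF Fam] ij(1) Z0 unfolding near_min_def S_def[symmetric] Zs by blast
    have "sqd S y (diag (Z (Fam (snd (ij (f m)))))) \<le> min_loss T n Fam y + 1 / real (Suc m)" for m
    proof -
      have "m \<le> f m" using f(1) by (rule seq_suble)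
      then have "1 / real (Suc (f m)) \<le> 1 / real (Suc m)" by (simp add: frac_le)
      then show ?thesis using ij(2)[of "f m"] unfolding near_min_def S_def[symmetric] Zs by linarith
    qed
    then obtain f' F' where f': "strict_mono (f' :: nat \<Rightarrow> nat)" "F' \<in> ?C" "tuple_tendsto T n (\<lambda>m. Z (Fam (snd (ij (f (f' m)))))) F'" "nearest S (diag ` ?C) y (diag F')"
      using lim_near[of "\<lambda>m. Z (Fam (snd (ij (f m))))" y] Zm[OF Fam] Z0 by blast
    have fs: "fst s \<le> T" "s \<in> {1..T} \<times> {..<n}" using s by (auto simp: S_def)
    have "(\<lambda>m. diag (Z (Fam (fst (ij (f (f' m)))))) s) \<longlonglongrightarrow> diag F s"
    proof -
      have "(\<lambda>m. diag (Z (Fam (fst (ij (f m))))) s) \<longlonglongrightarrow> diag F s"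
        using f(3) fs unfolding tuple_tendsto_def diag_def by blast
      from LIMSEQ_subseq_LIMSEQ[OF this f'(1)] show ?thesis by (simp add: o_def)
    qed
    moreover have "(\<lambda>m. diag (Z (Fam (snd (ij (f (f' m)))))) s) \<longlonglongrightarrow> diag F' s"
      using f'(3) fs unfolding tuple_tendsto_def diag_def by blast
    ultimately have "(\<lambda>m. \<bar>diag (Z (Fam (fst (ij (f (f' m)))))) s - diag (Z (Fam (snd (ij (f (f' m)))))) s\<bar>) \<longlonglongrightarrow> \<bar>diag F s - diag F' s\<bar>"
      by (intro tendsto_rabs tendsto_diff)
    then have "1 / real (Suc q) \<le> \<bar>diag F s - diag F' s\<bar>"
      by (rule LIMSEQ_le_const) (use ij(3) Zd[OF s] in auto)
    moreover have "0 < 1 / real (Suc q)" by simp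
    ultimately have "diag F s \<noteq> diag F' s" by auto
    then show ?thesis using N1(2)[OF f(4) f'(4)] s by blast
  qed
  have def: "restrict (\<lambda>s. y s - a s) S \<in> N2" if d: "deficient_fit T n Fam y" for y
  proof -
    from choice[OF d[unfolded deficient_fit_def]] obtain i where i: "\<And>m. near_min T n Fam y m (i m)" "\<And>m. \<bar>evn n 1 (Fam (i m) 0) - 1\<bar> \<le> 1 / real (Suc m)"
     "\<And>m t. t \<in> {1..T} \<Longrightarrow> \<bar>dot {..<n} (\<lambda>i'. Fam (i m) 0 (1, i')) (\<lambda>i'. Fam (i m) t (1, i'))\<bar> \<le> 1 / real (Suc m)"
      by blast
    have e4: "evn n t (Fam (i m) 0) \<le> 4" if "t \<in> {1..T}" for t m
    proof -
      have "1 / real (Suc m) \<le> 1" by simp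
      then have "evn n 1 (Fam (i m) 0) \<le> 2" using i(2)[of m] by linarith
      moreover have "evn n t (Fam (i m) 0) \<le> 2 * evn n 1 (Fam (i m) 0)"
        by (rule fit_family_comp[OF fam Fam that]) (use T in auto)
      ultimately show ?thesis by linarith
    qed
    obtain f F where f: "strict_mono (f :: nat \<Rightarrow> nat)" "F \<in> ?C" "tuple_tendsto T n (\<lambda>m. Fam (i (f m))) F" "nearest S (diag ` ?C) y (diag F)"
      using lim_near[of "\<lambda>m. Fam (i m)" y, OF Fam i(1)[unfolded near_min_def S_def[symmetric]] e4] by blast
    have z: "(\<lambda>m. 1 / real (Suc (f m))) \<longlonglongrightarrow> 0"
      using LIMSEQ_subseq_LIMSEQ[OF LIMSEQ_Suc[OF lim_1_over_n] f(1)] by (simp add: o_def)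
    have t1: "1 \<in> {1..T}" using T by simp
    have "(\<lambda>m. \<bar>evn n 1 (Fam (i (f m)) 0) - 1\<bar>) \<longlonglongrightarrow> \<bar>evn n 1 (F 0) - 1\<bar>"
      by (intro tendsto_rabs tendsto_diff tendsto_const tuple_tendsto_dot[OF f(3) t1]) auto
    from LIMSEQ_le[OF this z] have "\<bar>evn n 1 (F 0) - 1\<bar> \<le> 0" using i(2) by blast
    moreover have "dot {..<n} (\<lambda>i. F 0 (1, i)) (\<lambda>i. F t (1, i)) = 0" if t: "t \<in> {1..T}" for t
    proof -
      have "(\<lambda>m. \<bar>dot {..<n} (\<lambda>i'. Fam (i (f m)) 0 (1, i')) (\<lambda>i'. Fam (i (f m)) t (1, i'))\<bar>) \<longlonglongrightarrow> \<bar>dot {..<n} (\<lambda>i'. F 0 (1, i')) (\<lambda>i'. F t (1, i'))\<bar>"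
        by (intro tendsto_rabs tuple_tendsto_dot[OF f(3) t1]) (use t in auto)
      from LIMSEQ_le[OF this z] have "\<bar>dot {..<n} (\<lambda>i'. F 0 (1, i')) (\<lambda>i'. F t (1, i'))\<bar> \<le> 0" using i(3)[OF t] by blast
      then show ?thesis by simp
    qed
    ultimately have "deficient T n F" by (simp add: deficient_def)
    then show ?thesis using N2(2)[OF f(2) _ f(4)] by blast
  qed
  show ?thesis
    by (rule bexI[of _ "N1 \<union> N2"]) (use amb def N1(1) N2(1) in auto)
qed

subsection \<open>Population and empirical second moments\<close>

definition pop :: "vec measure \<Rightarrow> (vec \<Rightarrow> real) \<Rightarrow> real" where
  "pop p h = (\<integral>x. (h x)\<^sup>2 \<partial>p)"

definition lin2 :: "nat \<Rightarrow> feat \<Rightarrow> feat \<Rightarrow> vec \<Rightarrow> vec \<Rightarrow> vec \<Rightarrow> real" where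
  "lin2 k \<phi> \<psi> c c' x = ip k c (\<phi> x) + ip k c' (\<psi> x)"

definition sqint :: "nat \<Rightarrow> vec measure \<Rightarrow> feat \<Rightarrow> bool" where
  "sqint k p \<phi> \<longleftrightarrow> (\<forall>i<k. (\<lambda>x. \<phi> x i) \<in> borel_measurable p \<and> integrable p (\<lambda>x. (\<phi> x i)\<^sup>2))"

lemma integrable_product_of_squares:
  fixes f g :: "'a \<Rightarrow> real"
  assumes "f \<in> borel_measurable M" "g \<in> borel_measurable M" "integrable M (\<lambda>x. (f x)\<^sup>2)" "integrable M (\<lambda>x. (g x)\<^sup>2)"
  shows "integrable M (\<lambda>x. f x * g x)"
proof (rule Bochner_Integration.integrable_bound[where f="\<lambda>x. (f x)\<^sup>2 + (g x)\<^sup>2"])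
  have "\<bar>a * b\<bar> \<le> a\<^sup>2 + b\<^sup>2" for a b :: real
  proof -
    have "0 \<le> (\<bar>a\<bar> - \<bar>b\<bar>)\<^sup>2" by simp
    then have "2 * \<bar>a * b\<bar> \<le> a\<^sup>2 + b\<^sup>2" by (simp add: power2_eq_square abs_mult algebra_simps)
    then show ?thesis by (smt (verit) abs_ge_zero)
  qed
  then show "AE x in M. norm (f x * g x) \<le> norm ((f x)\<^sup>2 + (g x)\<^sup>2)" by (auto simp: abs_of_nonneg)
qed (use assms in auto)

lemma sum_split_2k: "(\<Sum>i<2*k. f i) = (\<Sum>i<k. f i) + (\<Sum>i<k. f (k + i) :: real)" for k :: nat
proof -
  have "(\<Sum>i<2*k. f i) = (\<Sum>i\<in>{0..<k}. f i) + (\<Sum>i\<in>{k..<2*k}. f i)"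
    by (subst sum.atLeastLessThan_concat) (auto simp: lessThan_atLeast0)
  also have "(\<Sum>i\<in>{k..<2*k}. f i) = (\<Sum>i\<in>{0..<k}. f (i + k))"
    using sum.shift_bounds_nat_ivl[of f 0 k k] by (simp add: mult_2)
  finally show ?thesis by (simp add: lessThan_atLeast0 add.commute)
qed

text \<open>The 2k-dimensional feature vector whose second-moment matrix is
  \<open>blockLambda\<close>.\<close>

definition stackf :: "nat \<Rightarrow> feat \<Rightarrow> feat \<Rightarrow> nat \<Rightarrow> vec \<Rightarrow> real" where
  "stackf k \<phi> \<psi> i x = (if i < k then \<phi> x i else \<psi> x (i - k))"

lemma lin2_eq_stack:
  "lin2 k \<phi> \<psi> c c' x = (\<Sum>i<2*k. (if i < k then c i else c' (i - k)) * stackf k \<phi> \<psi> i x)"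
  unfolding sum_split_2k by (simp add: lin2_def ip_def stackf_def)

lemma stackf_sqint:
  assumes "sqint k p \<phi>" "sqint k p \<psi>" "i < 2 * k"
  shows "stackf k \<phi> \<psi> i \<in> borel_measurable p" "integrable p (\<lambda>x. (stackf k \<phi> \<psi> i x)\<^sup>2)"
  using assms unfolding stackf_def sqint_def by (cases "i < k"; simp)+

lemma lin2_measurable[measurable]:
  assumes "sqint k p \<phi>" "sqint k p \<psi>"
  shows "lin2 k \<phi> \<psi> c c' \<in> borel_measurable p"
  unfolding lin2_eq_stack[abs_def]
  using stackf_sqint(1)[OF assms] by (intro borel_measurable_sum borel_measurable_times) auto

lemma quadratic_form_square:
  "(\<Sum>i<m. \<Sum>j<m. v i * (g i * g j) * v j) = (\<Sum>i<m. v i * g i)\<^sup>2" for m :: nat and v g :: "nat \<Rightarrow> real"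
  by (simp add: power2_eq_square sum_product mult_ac)

lemma lin2_integrable:
  assumes "sqint k p \<phi>" "sqint k p \<psi>"
  shows "integrable p (\<lambda>x. (lin2 k \<phi> \<psi> c c' x)\<^sup>2)"
  unfolding lin2_eq_stack quadratic_form_square[symmetric]
  using stackf_sqint[OF assms]
  by (intro Bochner_Integration.integrable_sum integrable_mult_left integrable_mult_right integrable_product_of_squares) auto

text \<open>The quadratic form of \<open>blockLambda\<close> at the stacked vector (c, c') is the
  second moment of \<open>lin2\<close>, so the Loewner sandwich compares empirical and population L2
  norms on the joint span of two feature maps.\<close>

lemma sandwich_lin2:
  assumes sq: "sqint k p \<phi>" "sqint k p \<psi>" and sw: "sandwich k p xs n \<phi> \<psi>"
  shows "0.9 * pop p (lin2 k \<phi> \<psi> c c') \<le> (\<Sum>l<n. (lin2 k \<phi> \<psi> c c' (xs l))\<^sup>2) / real n"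
    and "(\<Sum>l<n. (lin2 k \<phi> \<psi> c c' (xs l))\<^sup>2) / real n \<le> 1.1 * pop p (lin2 k \<phi> \<psi> c c')"
proof -
  define v where "v i = (if i < k then c i else c' (i - k))" for i
  let ?g = "stackf k \<phi> \<psi>"
  have e: "blockLambda k (cov_emp xs n) \<phi> \<psi> i j = (\<Sum>l<n. ?g i (xs l) * ?g j (xs l)) / real n" for i j
    by (simp add: blockLambda_def cov_emp_def stackf_def)
  have q: "blockLambda k (cov_pop p) \<phi> \<psi> i j = (\<integral>x. ?g i x * ?g j x \<partial>p)" for i j
    by (simp add: blockLambda_def cov_pop_def stackf_def)
  have E: "(\<Sum>i<2*k. \<Sum>j<2*k. v i * blockLambda k (cov_emp xs n) \<phi> \<psi> i j * v j) = (\<Sum>l<n. (lin2 k \<phi> \<psi> c c' (xs l))\<^sup>2) / real n"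
  proof -
    have "(\<Sum>i<2*k. \<Sum>j<2*k. v i * blockLambda k (cov_emp xs n) \<phi> \<psi> i j * v j)
       = (\<Sum>i<2*k. \<Sum>j<2*k. \<Sum>l<n. v i * (?g i (xs l) * ?g j (xs l)) * v j / real n)"
      unfolding e by (simp add: sum_divide_distrib sum_distrib_left sum_distrib_right)
    also have "\<dots> = (\<Sum>i<2*k. \<Sum>l<n. \<Sum>j<2*k. v i * (?g i (xs l) * ?g j (xs l)) * v j / real n)"
      by (intro sum.cong refl sum.swap)
    also have "\<dots> = (\<Sum>l<n. \<Sum>i<2*k. \<Sum>j<2*k. v i * (?g i (xs l) * ?g j (xs l)) * v j / real n)"
      by (rule sum.swap)
    also have "\<dots> = (\<Sum>l<n. (\<Sum>i<2*k. v i * ?g i (xs l))\<^sup>2) / real n"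
      unfolding quadratic_form_square[symmetric] by (simp add: sum_divide_distrib)
    finally show ?thesis unfolding lin2_eq_stack v_def .
  qed
  have P: "(\<Sum>i<2*k. \<Sum>j<2*k. v i * blockLambda k (cov_pop p) \<phi> \<psi> i j * v j) = pop p (lin2 k \<phi> \<psi> c c')"
  proof -
    have i: "integrable p (\<lambda>x. v i * (?g i x * ?g j x) * v j)" if "i < 2*k" "j < 2*k" for i j
      using stackf_sqint[OF sq that(1)] stackf_sqint[OF sq that(2)]
      by (intro integrable_mult_left integrable_mult_right integrable_product_of_squares)
    have "pop p (lin2 k \<phi> \<psi> c c') = (\<integral>x. (\<Sum>i<2*k. \<Sum>j<2*k. v i * (?g i x * ?g j x) * v j) \<partial>p)"
      unfolding pop_def quadratic_form_square lin2_eq_stack v_def ..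
    also have "\<dots> = (\<Sum>i<2*k. \<integral>x. (\<Sum>j<2*k. v i * (?g i x * ?g j x) * v j) \<partial>p)"
      by (rule Bochner_Integration.integral_sum) (intro Bochner_Integration.integrable_sum i, simp_all)
    also have "\<dots> = (\<Sum>i<2*k. \<Sum>j<2*k. \<integral>x. v i * (?g i x * ?g j x) * v j \<partial>p)"
      by (intro sum.cong refl Bochner_Integration.integral_sum i) simp_all
    finally show ?thesis unfolding q by simp
  qed
  have P': "(\<Sum>i<2*k. \<Sum>j<2*k. v i * (a * blockLambda k (cov_pop p) \<phi> \<psi> i j) * v j) = a * pop p (lin2 k \<phi> \<psi> c c')" for a
    unfolding P[symmetric] by (simp add: sum_distrib_left mult_ac)
  have s1: "(\<Sum>i<2*k. \<Sum>j<2*k. v i * (0.9 * blockLambda k (cov_pop p) \<phi> \<psi> i j) * v j) \<le> (\<Sum>i<2*k. \<Sum>j<2*k. v i * blockLambda k (cov_emp xs n) \<phi> \<psi> i j * v j)"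
    and s2: "(\<Sum>i<2*k. \<Sum>j<2*k. v i * blockLambda k (cov_emp xs n) \<phi> \<psi> i j * v j) \<le> (\<Sum>i<2*k. \<Sum>j<2*k. v i * (1.1 * blockLambda k (cov_pop p) \<phi> \<psi> i j) * v j)"
    using sw unfolding sandwich_def loewner_le_def by blast+
  show "0.9 * pop p (lin2 k \<phi> \<psi> c c') \<le> (\<Sum>l<n. (lin2 k \<phi> \<psi> c c' (xs l))\<^sup>2) / real n"
    using s1 unfolding P' E .
  show "(\<Sum>l<n. (lin2 k \<phi> \<psi> c c' (xs l))\<^sup>2) / real n \<le> 1.1 * pop p (lin2 k \<phi> \<psi> c c')"
    using s2 unfolding P' E .
qed

text \<open>The inner measure of an \<^term>\<open>n\<close>-fold power of \<^term>\<open>N\<close> is at most the \<^term>\<open>n\<close>-th power of the inner measure of \<^term>\<open>N\<close>; so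
  lower bounds that do not depend on \<^term>\<open>n\<close> force inner measure one.\<close>

lemma inner_measure_power:
  assumes p: "prob_space p" and \<kappa>: "0 \<le> \<kappa>" and N: "\<And>K. K \<in> sets p \<Longrightarrow> K \<subseteq> N \<Longrightarrow> measure p K \<le> \<kappa>"
  shows "A \<in> sets (iid n p) \<Longrightarrow> (\<And>xs l. xs \<in> A \<Longrightarrow> l < n \<Longrightarrow> xs l \<in> N) \<Longrightarrow> emeasure (iid n p) A \<le> ennreal (\<kappa> ^ n)"
proof (induction n arbitrary: A)
  case 0
  interpret P: prob_space "iid 0 p" by (rule prob_space_PiM) (rule p)
  show ?case using P.emeasure_le_1[of A] by simp
next
  case (Suc n)
  interpret p: prob_space p by fact
  interpret product_sigma_finite "\<lambda>_. p" by standard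
  interpret P: prob_space "iid n p" by (rule prob_space_PiM) (rule p)
  have ins: "{..<Suc n} = insert n {..<n}" by auto
  have A[measurable]: "A \<in> sets (PiM (insert n {..<n}) (\<lambda>_. p))" using Suc.prems(1) unfolding ins .
  define g where "g x = (\<integral>\<^sup>+y. indicator A (x(n := y)) \<partial>p)" for x
  have gm[measurable]: "g \<in> borel_measurable (iid n p)" unfolding g_def by measurable
  have ea: "emeasure (iid (Suc n) p) A = (\<integral>\<^sup>+x. g x \<partial>iid n p)"
  proof -
    have "emeasure (iid (Suc n) p) A = (\<integral>\<^sup>+x. indicator A x \<partial>PiM (insert n {..<n}) (\<lambda>_. p))"
      unfolding ins using A by simp
    also have "\<dots> = (\<integral>\<^sup>+x. g x \<partial>iid n p)" unfolding g_def
      by (rule product_nn_integral_insert) (use A in auto)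
    finally show ?thesis .
  qed
  have gk: "g x \<le> ennreal \<kappa>" and gz: "0 < g x \<Longrightarrow> \<exists>y. x(n := y) \<in> A" if x: "x \<in> space (iid n p)" for x
  proof -
    let ?B = "{y \<in> space p. x(n := y) \<in> A}"
    have xm[measurable]: "(\<lambda>y. x(n := y)) \<in> p \<rightarrow>\<^sub>M PiM (insert n {..<n}) (\<lambda>_. p)"
      using x by (intro measurable_fun_upd[where J="{..<n}"]) auto
    have B[measurable]: "?B \<in> sets p" by measurable
    have gB: "g x = emeasure p ?B"
    proof -
      have "g x = (\<integral>\<^sup>+y. indicator ?B y \<partial>p)" unfolding g_def by (intro nn_integral_cong) (auto split: split_indicator)
      then show ?thesis by simp
    qed
    have "?B \<subseteq> N"
    proof
      fix y assume "y \<in> ?B"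
      then have "x(n := y) \<in> A" by blast
      from Suc.prems(2)[OF this lessI] have "(x(n := y)) n \<in> N" .
      then show "y \<in> N" by simp
    qed
    then show "g x \<le> ennreal \<kappa>" unfolding gB p.emeasure_eq_measure using N[OF B] by (intro ennreal_leI)
    show "\<exists>y. x(n := y) \<in> A" if "0 < g x"
    proof (rule ccontr)
      assume "\<not> ?thesis"
      then have "?B = {}" by auto
      with that show False unfolding gB by (simp only: emeasure_empty less_irrefl)
    qed
  qed
  let ?A' = "{x \<in> space (iid n p). 0 < g x}"
  have A'm: "?A' \<in> sets (iid n p)" by measurable
  have IH: "emeasure (iid n p) ?A' \<le> ennreal (\<kappa> ^ n)"
  proof (rule Suc.IH[OF A'm])
    fix x l assume x: "x \<in> ?A'" "l < n"
    then obtain y where y: "x(n := y) \<in> A" using gz by blast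
    have "(x(n := y)) l \<in> N" by (rule Suc.prems(2)[OF y]) (use x in auto)
    then show "x l \<in> N" using x(2) by simp
  qed
  have "(\<integral>\<^sup>+x. g x \<partial>iid n p) \<le> (\<integral>\<^sup>+x. ennreal \<kappa> * indicator ?A' x \<partial>iid n p)"
    using gk by (intro nn_integral_mono) (auto split: split_indicator simp: not_less)
  also have "\<dots> = ennreal \<kappa> * emeasure (iid n p) ?A'" using A'm by (simp add: nn_integral_cmult_indicator)
  also have "\<dots> \<le> ennreal \<kappa> * ennreal (\<kappa> ^ n)" by (intro mult_left_mono IH) auto
  also have "\<dots> = ennreal (\<kappa> ^ Suc n)" using \<kappa> by (simp add: ennreal_mult)
  finally show ?case unfolding ea .
qed

text \<open>\<open>N\<close> may be non-measurable. The supremum \<kappa> of the measures of its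
  measurable subsets satisfies 1 - \<delta> \<le> \<kappa>^n for all large n, so \<kappa> = 1, and a
  countable union attains it.\<close>

lemma full_measure_kernel:
  assumes p: "prob_space p" and \<delta>: "\<delta> < 1"
    and N: "\<And>n. n1 \<le> n \<Longrightarrow> \<exists>A\<in>sets (iid n p). 1 - \<delta> \<le> measure (iid n p) A \<and> (\<forall>xs\<in>A. \<forall>l<n. xs l \<in> N)"
  shows "\<exists>K\<in>sets p. K \<subseteq> N \<and> measure p K = 1"
proof -
  interpret p: prob_space p by fact
  define V where "V = {measure p K | K. K \<in> sets p \<and> K \<subseteq> N}"
  have V0: "0 \<in> V" unfolding V_def by (auto intro!: exI[of _ "{}"])
  have Vb: "bdd_above V" unfolding V_def by (intro bdd_aboveI[of _ 1]) auto
  define \<kappa> where "\<kappa> = Sup V"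
  have k0: "0 \<le> \<kappa>" unfolding \<kappa>_def by (rule cSup_upper[OF V0 Vb])
  have kN: "measure p K \<le> \<kappa>" if "K \<in> sets p" "K \<subseteq> N" for K
    unfolding \<kappa>_def by (rule cSup_upper[OF _ Vb]) (use that in \<open>auto simp: V_def\<close>)
  have pw: "1 - \<delta> \<le> \<kappa> ^ n" if n: "n1 \<le> n" for n
  proof -
    interpret P: prob_space "iid n p" by (rule prob_space_PiM) (rule p)
    obtain A where A: "A \<in> sets (iid n p)" "1 - \<delta> \<le> measure (iid n p) A" "\<forall>xs\<in>A. \<forall>l<n. xs l \<in> N" using N[OF n] by blast
    have "emeasure (iid n p) A \<le> ennreal (\<kappa> ^ n)" by (rule inner_measure_power[OF p k0 kN A(1)]) (use A(3) in auto)
    then have "measure (iid n p) A \<le> \<kappa> ^ n" using k0 by (simp add: P.emeasure_eq_measure)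
    with A(2) show ?thesis by simp
  qed
  have k1: "1 \<le> \<kappa>"
  proof (rule ccontr)
    assume "\<not> 1 \<le> \<kappa>"
    then have c: "\<kappa> < 1" by simp
    obtain n where n: "\<kappa> ^ n < 1 - \<delta>" using real_arch_pow_inv[OF _ c, of "1 - \<delta>"] \<delta> by auto
    have "\<kappa> ^ (max n n1) \<le> \<kappa> ^ n" using k0 c by (intro power_decreasing) auto
    with pw[of "max n n1"] n show False by simp
  qed
  have "\<exists>K. K \<in> sets p \<and> K \<subseteq> N \<and> 1 - 1 / real (Suc i) < measure p K" for i
  proof -
    have "1 - 1 / real (Suc i) < \<kappa>" using k1 by (simp add: add_pos_nonneg less_le_trans[of _ 1])
    then obtain v where "v \<in> V" "1 - 1 / real (Suc i) < v" unfolding \<kappa>_def using V0 Vb less_cSupE by blast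
    then show ?thesis unfolding V_def by blast
  qed
  then obtain K where K: "\<And>i. K i \<in> sets p" "\<And>i. K i \<subseteq> N" "\<And>i::nat. 1 - 1 / real (Suc i) < measure p (K i)" by metis
  let ?K = "\<Union>i. K i"
  have Km: "?K \<in> sets p" using K(1) by auto
  have "1 - 1 / real (Suc i) \<le> measure p ?K" for i
    using K(3)[of i] p.finite_measure_mono[of "K i" ?K] Km by (meson SUP_upper2 UNIV_I less_imp_le order.trans order_refl)
  then have "1 - 0 \<le> measure p ?K"
    by (intro LIMSEQ_le_const2[OF tendsto_diff[OF tendsto_const LIMSEQ_Suc[OF lim_1_over_n]]]) auto
  then have "measure p ?K = 1" by (intro antisym p.prob_le_1) simp
  with Km K(2) show ?thesis by blast
qed

text \<open>One member is kept for every occupied cell of the grids of mesh 1/(n+1). Finitely many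
  real values describe each member, so only countably many cells occur.\<close>

lemma countable_dense_evaluation:
  fixes e :: "'b \<Rightarrow> 'k \<Rightarrow> real"
  assumes K: "finite K"
  shows "\<exists>D\<subseteq>\<Phi>. countable D \<and> (\<forall>\<phi>\<in>\<Phi>. \<forall>\<eta>>0. \<exists>d\<in>D. \<forall>k\<in>K. \<bar>e d k - e \<phi> k\<bar> < \<eta>)"
proof -
  define cell where "cell n \<phi> = (\<lambda>k\<in>K. \<lfloor>e \<phi> k * real (Suc n)\<rfloor>)" for n \<phi>
  define pick where "pick n a = (SOME \<phi>. \<phi> \<in> \<Phi> \<and> cell n \<phi> = a)" for n a
  have pick: "pick n (cell n \<phi>) \<in> \<Phi> \<and> cell n (pick n (cell n \<phi>)) = cell n \<phi>" if "\<phi> \<in> \<Phi>" for n \<phi>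
    unfolding pick_def by (rule someI[of _ \<phi>]) (use that in auto)
  define D where "D = (\<Union>n. pick n ` cell n ` \<Phi>)"
  have "countable (cell n ` \<Phi>)" for n
    by (rule countable_subset[of _ "\<Pi>\<^sub>E k\<in>K. (UNIV :: int set)"]) (auto simp: cell_def intro!: countable_PiE K)
  then have "countable D" unfolding D_def by auto
  moreover have "D \<subseteq> \<Phi>" using pick by (auto simp: D_def)
  moreover have "\<exists>d\<in>D. \<forall>k\<in>K. \<bar>e d k - e \<phi> k\<bar> < \<eta>" if \<phi>: "\<phi> \<in> \<Phi>" and \<eta>: "0 < \<eta>" for \<phi> \<eta>
  proof -
    obtain n where n: "1 / real (Suc n) < \<eta>" using reals_Archimedean[OF \<eta>] by (auto simp: inverse_eq_divide)
    let ?d = "pick n (cell n \<phi>)"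
    have "\<bar>e ?d k - e \<phi> k\<bar> < \<eta>" if k: "k \<in> K" for k
    proof -
      have "cell n ?d k = cell n \<phi> k" using pick[OF \<phi>] by simp
      then have "\<lfloor>e ?d k * real (Suc n)\<rfloor> = \<lfloor>e \<phi> k * real (Suc n)\<rfloor>" using k by (simp add: cell_def)
      then have "\<bar>e ?d k * real (Suc n) - e \<phi> k * real (Suc n)\<bar> < 1" by linarith
      then have "\<bar>e ?d k - e \<phi> k\<bar> * real (Suc n) < 1" by (simp only: left_diff_distrib[symmetric] abs_mult abs_of_nat)
      then have "\<bar>e ?d k - e \<phi> k\<bar> < 1 / real (Suc n)" by (simp add: field_simps)
      with n show ?thesis by simp
    qed
    moreover have "?d \<in> D" using \<phi> by (auto simp: D_def)
    ultimately show ?thesis by blast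
  qed
  ultimately show ?thesis by blast
qed

subsection \<open>Source tasks\<close>

text \<open>Row \<open>c 0\<close> is a spare function next to the T fitted ones. Every function is
  recorded at the inputs of all tasks, not only of its own.\<close>

definition tup :: "nat \<Rightarrow> feat \<Rightarrow> (nat \<Rightarrow> vec) \<Rightarrow> sample \<Rightarrow> nat \<Rightarrow> nat \<times> nat \<Rightarrow> real" where
  "tup k \<phi> c \<omega> r s = ip k (c r) (\<phi> (fst (\<omega> s)))"

definition clean :: "nat \<Rightarrow> feat \<Rightarrow> (nat \<Rightarrow> vec) \<Rightarrow> sample \<Rightarrow> nat \<times> nat \<Rightarrow> real" where
  "clean k \<phi> c \<omega> s = ip k (c (fst s)) (\<phi> (fst (\<omega> s)))"

definition response :: "nat \<Rightarrow> feat \<Rightarrow> (nat \<Rightarrow> vec) \<Rightarrow> sample \<Rightarrow> nat \<times> nat \<Rightarrow> real" where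
  "response k \<phi> c \<omega> s = clean k \<phi> c \<omega> s + snd (\<omega> s)"

lemma clean_eq_diag: "clean k \<phi> c \<omega> = diag (tup k \<phi> c \<omega>)"
  by (simp add: clean_def diag_def tup_def fun_eq_iff)

lemma ip_add_left: "ip k (\<lambda>j. a j + b j) v = ip k a v + ip k b v"
  and ip_scale_left: "ip k (\<lambda>j. x * a j) v = x * ip k a v"
  and ip_uminus_left: "ip k (\<lambda>j. - a j) v = - ip k a v"
  by (simp_all add: ip_def algebra_simps sum.distrib sum_distrib_left sum_negf)

lemma ip_sum_left: "ip k (\<lambda>j. \<Sum>r\<in>R. f r j) v = (\<Sum>r\<in>R. ip k (f r) v)"
  unfolding ip_def sum_distrib_right by (rule sum.swap)

lemma ip_tendsto:
  assumes "\<And>j. j < k \<Longrightarrow> (\<lambda>m. a m j) \<longlonglongrightarrow> a' j" "\<And>j. j < k \<Longrightarrow> (\<lambda>m. b m j) \<longlonglongrightarrow> b' j"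
  shows "(\<lambda>m. ip k (a m) (b m)) \<longlonglongrightarrow> ip k a' b'"
  unfolding ip_def by (intro tendsto_sum tendsto_mult assms) auto

lemma tendsto_nrm:
  assumes "\<And>s. s \<in> S \<Longrightarrow> (\<lambda>m. u m s) \<longlonglongrightarrow> u' s"
  shows "(\<lambda>m. nrm S (u m)) \<longlonglongrightarrow> nrm S u'"
  unfolding nrm_def by (intro tendsto_real_sqrt tendsto_dot assms)

text \<open>Division by zero sends a null vector to zero, so the result always has norm at most
  1.\<close>

definition normalise :: "'i set \<Rightarrow> ('i \<Rightarrow> real) \<Rightarrow> 'i \<Rightarrow> real" where
  "normalise S u = (\<lambda>s. (1 / nrm S u) * u s)"

lemma dot_normalise: "dot S (normalise S u) z = dot S u z / nrm S u"
  by (simp only: normalise_def dot_scale_left) simp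

lemma normalise_le_1: "dot S (normalise S u) (normalise S u) \<le> 1"
proof -
  have "dot S (normalise S u) (normalise S u) = (1 / nrm S u) * ((1 / nrm S u) * dot S u u)"
    by (simp only: normalise_def dot_scale_left dot_scale_right)
  also have "dot S u u = nrm S u * nrm S u" using nrm_square[of S u] by (simp add: power2_eq_square)
  finally show ?thesis by (cases "nrm S u = 0") simp_all
qed

lemma dot_le_of_normalise:
  assumes "dot S (normalise S u) z \<le> a"
  shows "dot S u z \<le> a * nrm S u"
proof (cases "nrm S u = 0")
  case True
  then have "dot S z u = 0" using dot_eq_0_if_null[of S u z] by (simp add: nrm_def)
  then show ?thesis using True dot_commute[of S z u] by simp
next
  case False
  then have "0 < nrm S u" using nrm_nonneg[of S u] by linarith
  then show ?thesis using assms by (simp add: dot_normalise pos_divide_le_eq)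
qed

lemma dot_le_nrm_limit:
  assumes "\<And>m. dot S (u m) z \<le> a * nrm S (u m)" "\<And>s. s \<in> S \<Longrightarrow> (\<lambda>m. u m s) \<longlonglongrightarrow> u' s"
  shows "dot S u' z \<le> a * nrm S u'"
proof (rule LIMSEQ_le)
  show "(\<lambda>m. dot S (u m) z) \<longlonglongrightarrow> dot S u' z" by (intro tendsto_dot assms(2) tendsto_const)
  show "(\<lambda>m. a * nrm S (u m)) \<longlonglongrightarrow> a * nrm S u'" by (intro tendsto_mult tendsto_const tendsto_nrm assms(2))
qed (use assms(1) in blast)

text \<open>From |e|^2 \<le> |e0|^2 + 2 a (|e| + |e0|) the factor |e| + |e0| cancels. The comparison
  d0 may differ from the truth c: the source stage takes d0 = c, the target stage a combination of
  learned weights.\<close>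

lemma basic_inequality:
  assumes l: "sqd S (\<lambda>s. c s + z s) d \<le> sqd S (\<lambda>s. c s + z s) d0"
    and z: "dot S (\<lambda>s. d s - d0 s) z \<le> a * nrm S (\<lambda>s. d s - d0 s)" and a: "0 \<le> a"
  shows "nrm S (\<lambda>s. d s - c s) \<le> nrm S (\<lambda>s. d0 s - c s) + 2 * a"
proof -
  define e where "e = (\<lambda>s. d s - c s)"
  define e0 where "e0 = (\<lambda>s. d0 s - c s)"
  have de: "(\<lambda>s. d s - d0 s) = (\<lambda>s. e s - e0 s)" by (simp add: e_def e0_def)
  have "sqd S (\<lambda>s. c s + z s) d = dot S e e - 2 * dot S e z + dot S z z"
    unfolding dot_def e_def by (simp add: sum.distrib[symmetric] sum_subtractf[symmetric] sum_distrib_left algebra_simps)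
  moreover have "sqd S (\<lambda>s. c s + z s) d0 = dot S e0 e0 - 2 * dot S e0 z + dot S z z"
    unfolding dot_def e0_def by (simp add: sum.distrib[symmetric] sum_subtractf[symmetric] sum_distrib_left algebra_simps)
  ultimately have "dot S e e \<le> dot S e0 e0 + 2 * dot S (\<lambda>s. e s - e0 s) z" using l by (simp add: dot_diff_left)
  also have "\<dots> \<le> dot S e0 e0 + 2 * (a * nrm S (\<lambda>s. e s - e0 s))" using z unfolding de by simp
  also have "nrm S (\<lambda>s. e s - e0 s) \<le> nrm S e + nrm S e0"
    using nrm_triangle[of S e "\<lambda>s. (-1) * e0 s"] nrm_scale[of S "-1" e0] by simp
  then have "2 * (a * nrm S (\<lambda>s. e s - e0 s)) \<le> 2 * (a * (nrm S e + nrm S e0))" using a by (intro mult_left_mono) auto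
  finally have q: "nrm S e * nrm S e \<le> nrm S e0 * nrm S e0 + 2 * (a * (nrm S e + nrm S e0))"
    using nrm_square[of S e] nrm_square[of S e0] by (simp add: power2_eq_square)
  have "nrm S e \<le> nrm S e0 + 2 * a"
  proof (rule ccontr)
    assume "\<not> ?thesis"
    then have c: "2 * a < nrm S e - nrm S e0" by simp
    moreover have "0 < nrm S e + nrm S e0" using c a nrm_nonneg[of S e0] by linarith
    ultimately have "2 * a * (nrm S e + nrm S e0) < (nrm S e - nrm S e0) * (nrm S e + nrm S e0)" by (rule mult_strict_right_mono)
    then show False using q by (simp add: algebra_simps)
  qed
  then show ?thesis by (simp add: e_def e0_def)
qed

lemma source_loss_eq:
  "source_loss k T n1 \<phi>s Ws \<omega> \<phi> W = sqd ({1..T} \<times> {..<n1}) (response k \<phi>s Ws \<omega>) (clean k \<phi> W \<omega>) / (2 * real n1 * real T)"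
  unfolding source_loss_def dot_def by (simp add: sum.cartesian_product case_prod_beta response_def clean_def power2_eq_square)

lemma target_loss_eq:
  "target_loss k T n2 \<phi>s w \<omega> \<phi> v = sqd ({Suc T} \<times> {..<n2}) (response k \<phi>s (\<lambda>_. w) \<omega>) (clean k \<phi> (\<lambda>_. v) \<omega>) / (2 * real n2)"
proof -
  have e: "(\<Sum>i<n2. f (Suc T, i)) = (\<Sum>s\<in>{Suc T} \<times> {..<n2}. f s)" for f :: "nat \<times> nat \<Rightarrow> real"
    using sum.cartesian_product[of "\<lambda>t i. f (t, i)" "{..<n2}" "{Suc T}"] by (simp add: case_prod_beta)
  then show ?thesis unfolding target_loss_def dot_def e[symmetric] by (simp add: response_def clean_def power2_eq_square)
qed

text \<open>Fixes the choices on which the good event depends: a sandwich event \<open>A1s\<close>,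
  a full-measure set \<open>K\<close> with bounded evaluations, dense sequences of features and
  coefficients, and one pointwise event \<open>A2 j\<close> for each pair of a sequence member and
  the truth.\<close>

locale transfer_setup =
  fixes k T n1 n2 :: nat and \<Phi> :: "feat set" and \<phi>s :: feat and p :: "vec measure" and \<sigma> \<delta> :: real
    and Ws :: "nat \<Rightarrow> vec" and K :: "vec set"
  and \<phi>seq :: "nat \<Rightarrow> feat" and cseq :: "nat \<Rightarrow> nat \<Rightarrow> vec" and A2 :: "nat \<Rightarrow> (nat \<Rightarrow> vec) set"
  fixes A1s :: "(nat \<Rightarrow> vec) set"
  assumes k1: "1 \<le> k" and T1: "1 \<le> T" and n1: "1 \<le> n1" and n2: "1 \<le> n2" and \<sigma>: "0 < \<sigma>" and \<delta>: "0 < \<delta>" "\<delta> < 1"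
    and kT: "k \<le> T" and p: "prob_space p" and \<phi>s: "\<phi>s \<in> \<Phi>" and sq: "\<And>\<phi>. \<phi> \<in> \<Phi> \<Longrightarrow> sqint k p \<phi>"
    and A1: "A1s \<in> sets (iid n1 p)" "1 - \<delta> / (3 * real T) \<le> measure (iid n1 p) A1s"
      "\<And>xs \<phi> \<psi>. xs \<in> A1s \<Longrightarrow> \<phi> \<in> \<Phi> \<Longrightarrow> \<psi> \<in> \<Phi> \<Longrightarrow> sandwich k p xs n1 \<phi> \<psi>"
    and K: "K \<in> sets p" "measure p K = 1"
      "\<And>x. x \<in> K \<Longrightarrow> \<exists>C. \<forall>\<phi>\<in>\<Phi>. \<forall>\<psi>\<in>\<Phi>. \<forall>c c'. (lin2 k \<phi> \<psi> c c' x)\<^sup>2 \<le> C * pop p (lin2 k \<phi> \<psi> c c')"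
    and \<phi>seq: "\<And>i. \<phi>seq i \<in> \<Phi>"
      "\<And>\<phi>. \<phi> \<in> \<Phi> \<Longrightarrow> \<exists>i::nat \<Rightarrow> nat. \<forall>x\<in>K. \<forall>j<k. (\<lambda>m. \<phi>seq (i m) x j) \<longlonglongrightarrow> \<phi> x j"
    and cseq: "\<And>c. \<exists>i::nat \<Rightarrow> nat. \<forall>r\<le>T. \<forall>j<k. (\<lambda>m. cseq (i m) r j) \<longlonglongrightarrow> c r j"
    and A2: "\<And>j. A2 j \<in> sets (iid n2 p)" "\<And>j. 1 - \<delta> / 3 \<le> measure (iid n2 p) (A2 j)"
      "\<And>j xs. xs \<in> A2 j \<Longrightarrow> sandwich k p xs n2 (\<phi>seq j) \<phi>s"
begin

abbreviation "S1 \<equiv> {1..T} \<times> {..<n1}"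
abbreviation "S2 \<equiv> {Suc T} \<times> {..<n2}"

definition goodX :: "sample \<Rightarrow> bool" where
  "goodX \<omega> \<longleftrightarrow> (\<forall>t\<in>{1..T}. (\<lambda>l\<in>{..<n1}. fst (\<omega> (t, l))) \<in> A1s) \<and> (\<forall>s\<in>S1. fst (\<omega> s) \<in> K)"

text \<open>One natural number codes a feature map and T + 1 weight vectors, which permits selection
  by least index.\<close>

definition Fam :: "sample \<Rightarrow> nat \<Rightarrow> nat \<Rightarrow> nat \<times> nat \<Rightarrow> real" where
  "Fam \<omega> i = tup k (\<phi>seq (fst (prod_decode i))) (cseq (snd (prod_decode i))) \<omega>"

definition tuples :: "sample \<Rightarrow> (nat \<Rightarrow> nat \<times> nat \<Rightarrow> real) set" where
  "tuples \<omega> = {tup k \<phi> c \<omega> | \<phi> c. \<phi> \<in> \<Phi>}"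

abbreviation "resp \<equiv> response k \<phi>s Ws"

lemma good_sandwich:
  assumes g: "goodX \<omega>" and t: "t \<in> {1..T}" and \<phi>: "\<phi> \<in> \<Phi>" "\<psi> \<in> \<Phi>"
  shows "0.9 * real n1 * pop p (lin2 k \<phi> \<psi> c c') \<le> (\<Sum>l<n1. (lin2 k \<phi> \<psi> c c' (fst (\<omega> (t, l))))\<^sup>2)"
    and "(\<Sum>l<n1. (lin2 k \<phi> \<psi> c c' (fst (\<omega> (t, l))))\<^sup>2) \<le> 1.1 * real n1 * pop p (lin2 k \<phi> \<psi> c c')"
proof -
  have "(\<lambda>l\<in>{..<n1}. fst (\<omega> (t, l))) \<in> A1s" using g t by (auto simp: goodX_def)
  from sandwich_lin2[OF sq[OF \<phi>(1)] sq[OF \<phi>(2)] A1(3)[OF this \<phi>], of c c']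
  show "0.9 * real n1 * pop p (lin2 k \<phi> \<psi> c c') \<le> (\<Sum>l<n1. (lin2 k \<phi> \<psi> c c' (fst (\<omega> (t, l))))\<^sup>2)"
    and "(\<Sum>l<n1. (lin2 k \<phi> \<psi> c c' (fst (\<omega> (t, l))))\<^sup>2) \<le> 1.1 * real n1 * pop p (lin2 k \<phi> \<psi> c c')"
    using n1 by (simp_all add: field_simps)
qed

lemma pop_nonneg: "0 \<le> pop p h"
  by (simp add: pop_def)

text \<open>Both sums are comparable to n1 times the same population norm; 1.1/0.9 < 2 is the origin
  of the factor 2 in \<open>fit_family\<close>.\<close>

lemma good_compare:
  assumes g: "goodX \<omega>" and t: "t \<in> {1..T}" "t' \<in> {1..T}" and \<phi>: "\<phi> \<in> \<Phi>" "\<psi> \<in> \<Phi>"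
  shows "(\<Sum>l<n1. (lin2 k \<phi> \<psi> c c' (fst (\<omega> (t, l))))\<^sup>2) \<le> 2 * (\<Sum>l<n1. (lin2 k \<phi> \<psi> c c' (fst (\<omega> (t', l))))\<^sup>2)"
proof -
  have "0 \<le> real n1 * pop p (lin2 k \<phi> \<psi> c c')" using pop_nonneg by simp
  then show ?thesis
    using good_sandwich(2)[OF g t(1) \<phi>, of c c'] good_sandwich(1)[OF g t(2) \<phi>, of c c'] by linarith
qed

lemma comb_tup:
  "comb T a (tup k \<phi> c \<omega>) b (tup k \<psi> d \<omega>) s
     = lin2 k \<phi> \<psi> (\<lambda>j. \<Sum>r\<le>T. a r * c r j) (\<lambda>j. \<Sum>r\<le>T. b r * d r j) (fst (\<omega> s))"
  unfolding comb_def tup_def lin2_def ip_sum_left ip_scale_left sum.distrib ..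

lemma fit_family_tuples:
  assumes g: "goodX \<omega>"
  shows "fit_family T n1 (tuples \<omega>)"
  unfolding fit_family_def
proof (intro conjI ballI allI)
  fix F F' a b t t' assume F: "F \<in> tuples \<omega>" "F' \<in> tuples \<omega>" and t: "t \<in> {1..T}" "t' \<in> {1..T}"
  obtain \<phi> c \<psi> d where e: "F = tup k \<phi> c \<omega>" "F' = tup k \<psi> d \<omega>" "\<phi> \<in> \<Phi>" "\<psi> \<in> \<Phi>"
    using F by (auto simp: tuples_def)
  show "evn n1 t (comb T a F b F') \<le> 2 * evn n1 t' (comb T a F b F')"
    using good_compare[OF g t e(3,4)] unfolding e(1,2) comb_tup by (simp add: dot_def power2_eq_square)
next
  fix F and \<alpha> :: "nat \<Rightarrow> real" assume F: "F \<in> tuples \<omega>"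
  obtain \<phi> c where e: "F = tup k \<phi> c \<omega>" "\<phi> \<in> \<Phi>" using F by (auto simp: tuples_def)
  have "(\<lambda>r s. F r s + \<alpha> r * F 0 s) = tup k \<phi> (\<lambda>r j. c r j + \<alpha> r * c 0 j) \<omega>"
    by (simp add: e tup_def fun_eq_iff ip_add_left ip_scale_left)
  then show "(\<lambda>r s. F r s + \<alpha> r * F 0 s) \<in> tuples \<omega>" using e(2) by (auto simp: tuples_def)
next
  fix F assume F: "F \<in> tuples \<omega>"
  obtain \<phi> c where e: "F = tup k \<phi> c \<omega>" "\<phi> \<in> \<Phi>" using F by (auto simp: tuples_def)
  \<comment> \<open>T + 1 weight vectors in dimension k \<le> T satisfy a linear relation.\<close>
  obtain u where u: "\<exists>r\<in>{..T}. u r \<noteq> 0" "\<And>j. j < k \<Longrightarrow> (\<Sum>r\<le>T. u r * c r j) = 0"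
    using homogeneous_system_nontrivial[of "{..T}" k c] kT by auto
  have "(\<Sum>r\<le>T. u r * F r s) = 0" for s
  proof -
    have "(\<Sum>r\<le>T. u r * F r s) = ip k (\<lambda>j. \<Sum>r\<le>T. u r * c r j) (\<phi> (fst (\<omega> s)))"
      by (simp add: e tup_def ip_sum_left ip_scale_left)
    also have "\<dots> = 0" unfolding ip_def using u(2) by simp
    finally show ?thesis .
  qed
  then show "\<exists>u. (\<exists>r\<le>T. u r \<noteq> 0) \<and> (\<forall>s\<in>S1. (\<Sum>r\<le>T. u r * F r s) = 0)" using u(1) by auto
qed

lemma Fam_tuples: "Fam \<omega> i \<in> tuples \<omega>"
  using \<phi>seq(1) by (auto simp: Fam_def tuples_def)

lemma dense_tuples:
  assumes "\<forall>s\<in>S1. fst (\<omega> s) \<in> K" "\<phi> \<in> \<Phi>"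
  shows "\<exists>i. tuple_tendsto T n1 (\<lambda>m. Fam \<omega> (i m)) (tup k \<phi> c \<omega>)"
proof -
  obtain i where i: "\<And>x j. x \<in> K \<Longrightarrow> j < k \<Longrightarrow> (\<lambda>m. \<phi>seq (i m) x j) \<longlonglongrightarrow> \<phi> x j" using \<phi>seq(2)[OF assms(2)] by blast
  obtain i' where i': "\<And>r j. r \<le> T \<Longrightarrow> j < k \<Longrightarrow> (\<lambda>m. cseq (i' m) r j) \<longlonglongrightarrow> c r j" using cseq[of c] by blast
  have "tuple_tendsto T n1 (\<lambda>m. Fam \<omega> (prod_encode (i m, i' m))) (tup k \<phi> c \<omega>)"
    unfolding tuple_tendsto_def Fam_def tup_def prod_encode_inverse fst_conv snd_conv
    using assms(1) by (intro allI impI ballI ip_tendsto i i') auto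
  then show ?thesis by (intro exI[of _ "\<lambda>m. prod_encode (i m, i' m)"])
qed

lemma tuple_dense_tuples:
  assumes "goodX \<omega>"
  shows "tuple_dense T n1 (Fam \<omega>) (tuples \<omega>)"
  unfolding tuple_dense_def tuples_def using dense_tuples[of \<omega>] assms by (auto simp: goodX_def)

text \<open>Enumerates two features and two coefficient tuples. These vectors yield the same
  supremum as \<open>F_X\<close>, but through countably many measurable functions of the
  inputs.\<close>

definition pairvec :: "sample \<Rightarrow> nat \<Rightarrow> nat \<times> nat \<Rightarrow> real" where
  "pairvec \<omega> i s = lin2 k (\<phi>seq (fst (prod_decode (fst (prod_decode i))))) (\<phi>seq (snd (prod_decode (fst (prod_decode i)))))
     (cseq (fst (prod_decode (snd (prod_decode i)))) (fst s)) (cseq (snd (prod_decode (snd (prod_decode i)))) (fst s)) (fst (\<omega> s))"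

text \<open>The homogeneous inequality, with the norm on the right, survives limits; the normalised
  vectors may fail to converge when the limit is zero.\<close>

lemma source_deviation_extends:
  assumes K: "\<forall>s\<in>S1. fst (\<omega> s) \<in> K" and \<phi>: "\<phi> \<in> \<Phi>" "\<psi> \<in> \<Phi>"
    and dev: "\<And>i. dot S1 (normalise S1 (pairvec \<omega> i)) z \<le> a"
  shows "dot S1 (\<lambda>s. lin2 k \<phi> \<psi> (c (fst s)) (c' (fst s)) (fst (\<omega> s))) z \<le> a * nrm S1 (\<lambda>s. lin2 k \<phi> \<psi> (c (fst s)) (c' (fst s)) (fst (\<omega> s)))"
proof -
  obtain i where i: "\<And>x j. x \<in> K \<Longrightarrow> j < k \<Longrightarrow> (\<lambda>m. \<phi>seq (i m) x j) \<longlonglongrightarrow> \<phi> x j" using \<phi>seq(2)[OF \<phi>(1)] by blast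
  obtain j where j: "\<And>x l. x \<in> K \<Longrightarrow> l < k \<Longrightarrow> (\<lambda>m. \<phi>seq (j m) x l) \<longlonglongrightarrow> \<psi> x l" using \<phi>seq(2)[OF \<phi>(2)] by blast
  obtain i' where i': "\<And>r j. r \<le> T \<Longrightarrow> j < k \<Longrightarrow> (\<lambda>m. cseq (i' m) r j) \<longlonglongrightarrow> c r j" using cseq[of c] by blast
  obtain j' where j': "\<And>r j. r \<le> T \<Longrightarrow> j < k \<Longrightarrow> (\<lambda>m. cseq (j' m) r j) \<longlonglongrightarrow> c' r j" using cseq[of c'] by blast
  define q where "q m = prod_encode (prod_encode (i m, j m), prod_encode (i' m, j' m))" for m
  show ?thesis
  proof (rule dot_le_nrm_limit)
    show "dot S1 (pairvec \<omega> (q m)) z \<le> a * nrm S1 (pairvec \<omega> (q m))" for m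
      by (rule dot_le_of_normalise[OF dev])
    fix s assume s: "s \<in> S1"
    then have x: "fst (\<omega> s) \<in> K" "fst s \<le> T" using K by auto
    show "(\<lambda>m. pairvec \<omega> (q m) s) \<longlonglongrightarrow> lin2 k \<phi> \<psi> (c (fst s)) (c' (fst s)) (fst (\<omega> s))"
      unfolding pairvec_def q_def lin2_def prod_encode_inverse fst_conv snd_conv
      by (intro tendsto_add ip_tendsto i j i' j' x)
  qed
qed

lemma F_X_iff:
  "A \<in> F_X k \<Phi> T n1 \<omega> \<longleftrightarrow> (\<forall>s. s \<notin> S1 \<longrightarrow> A s = 0) \<and> dot S1 A A = 1 \<and>
     (\<exists>\<phi>\<in>\<Phi>. \<exists>\<psi>\<in>\<Phi>. \<exists>c c'. \<forall>s\<in>S1. A s = lin2 k \<phi> \<psi> (c (fst s)) (c' (fst s)) (fst (\<omega> s)))"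
proof -
  have e: "(\<forall>t\<in>{1..T}. \<exists>c c' :: vec. \<forall>i<n1. A (t, i) = (\<Sum>j<k. c j * \<phi> (fst (\<omega> (t, i))) j + c' j * \<psi> (fst (\<omega> (t, i))) j))
    \<longleftrightarrow> (\<exists>c c'. \<forall>s\<in>S1. A s = lin2 k \<phi> \<psi> (c (fst s)) (c' (fst s)) (fst (\<omega> s)))" (is "?L \<longleftrightarrow> ?R") for \<phi> \<psi>
  proof
    assume ?L
    then have "\<forall>t\<in>{1..T}. \<exists>cc. \<forall>i<n1. A (t, i) = lin2 k \<phi> \<psi> (fst cc) (snd cc) (fst (\<omega> (t, i)))"
      by (fastforce simp: lin2_def ip_def sum.distrib)
    from bchoice[OF this] obtain cc where "\<forall>t\<in>{1..T}. \<forall>i<n1. A (t, i) = lin2 k \<phi> \<psi> (fst (cc t)) (snd (cc t)) (fst (\<omega> (t, i)))" by (rule exE)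
    then have "\<forall>s\<in>S1. A s = lin2 k \<phi> \<psi> (fst (cc (fst s))) (snd (cc (fst s))) (fst (\<omega> s))" by auto
    then show ?R by (intro exI[of _ "\<lambda>t. fst (cc t)"] exI[of _ "\<lambda>t. snd (cc t)"])
  next
    assume ?R
    then obtain c c' where cc: "\<forall>s\<in>S1. A s = lin2 k \<phi> \<psi> (c (fst s)) (c' (fst s)) (fst (\<omega> s))" by blast
    show ?L
    proof
      fix t assume t: "t \<in> {1..T}"
      show "\<exists>c c' :: vec. \<forall>i<n1. A (t, i) = (\<Sum>j<k. c j * \<phi> (fst (\<omega> (t, i))) j + c' j * \<psi> (fst (\<omega> (t, i))) j)"
      proof (rule exI[of _ "c t"], rule exI[of _ "c' t"], intro allI impI)
        fix i assume "i < n1"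
        then have "(t, i) \<in> S1" using t by simp
        from bspec[OF cc this] show "A (t, i) = (\<Sum>j<k. c t j * \<phi> (fst (\<omega> (t, i))) j + c' t j * \<psi> (fst (\<omega> (t, i))) j)"
          by (simp add: lin2_def ip_def sum.distrib)
      qed
    qed
  qed
  show ?thesis unfolding F_X_def mem_Collect_eq e by (simp add: dot_def power2_eq_square)
qed

lemma normalised_in_F_X:
  assumes \<phi>: "\<phi> \<in> \<Phi>" "\<psi> \<in> \<Phi>" and A: "\<And>s. s \<in> S1 \<Longrightarrow> A s = lin2 k \<phi> \<psi> (c (fst s)) (c' (fst s)) (fst (\<omega> s))" and n: "nrm S1 A \<noteq> 0"
  shows "(\<lambda>s. if s \<in> S1 then normalise S1 A s else 0) \<in> F_X k \<Phi> T n1 \<omega>"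
  unfolding F_X_iff
proof (intro conjI)
  have "dot S1 (\<lambda>s. if s \<in> S1 then normalise S1 A s else 0) (\<lambda>s. if s \<in> S1 then normalise S1 A s else 0) = dot S1 (normalise S1 A) (normalise S1 A)"
    unfolding dot_def by (intro sum.cong) auto
  also have "\<dots> = (1 / nrm S1 A) * ((1 / nrm S1 A) * dot S1 A A)"
    by (simp only: normalise_def dot_scale_left dot_scale_right)
  also have "dot S1 A A = nrm S1 A * nrm S1 A" using nrm_square[of S1 A] by (simp add: power2_eq_square)
  finally show "dot S1 (\<lambda>s. if s \<in> S1 then normalise S1 A s else 0) (\<lambda>s. if s \<in> S1 then normalise S1 A s else 0) = 1" using n by simp
  have ex: "\<exists>c c'. \<forall>s\<in>S1. (if s \<in> S1 then normalise S1 A s else 0) = lin2 k \<phi> \<psi> (c (fst s)) (c' (fst s)) (fst (\<omega> s))"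
  proof (rule exI[of _ "\<lambda>t j. (1 / nrm S1 A) * c t j"], rule exI[of _ "\<lambda>t j. (1 / nrm S1 A) * c' t j"], rule ballI)
    fix s assume s: "s \<in> S1"
    show "(if s \<in> S1 then normalise S1 A s else 0)
        = lin2 k \<phi> \<psi> (\<lambda>j. (1 / nrm S1 A) * c (fst s) j) (\<lambda>j. (1 / nrm S1 A) * c' (fst s) j) (fst (\<omega> s))"
      unfolding if_P[OF s] normalise_def A[OF s] lin2_def ip_scale_left distrib_left ..
  qed
  show "\<exists>\<phi>\<in>\<Phi>. \<exists>\<psi>\<in>\<Phi>. \<exists>c c'. \<forall>s\<in>S1. (if s \<in> S1 then normalise S1 A s else 0) = lin2 k \<phi> \<psi> (c (fst s)) (c' (fst s)) (fst (\<omega> s))"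
    by (rule bexI[OF _ \<phi>(1)], rule bexI[OF _ \<phi>(2)], rule ex)
qed simp

lemma uminus_in_F_X:
  assumes "A \<in> F_X k \<Phi> T n1 \<omega>"
  shows "(\<lambda>s. - A s) \<in> F_X k \<Phi> T n1 \<omega>"
proof -
  from assms obtain \<phi> \<psi> c c' where a: "\<forall>s. s \<notin> S1 \<longrightarrow> A s = 0" "dot S1 A A = 1" "\<phi> \<in> \<Phi>" "\<psi> \<in> \<Phi>"
    "\<forall>s\<in>S1. A s = lin2 k \<phi> \<psi> (c (fst s)) (c' (fst s)) (fst (\<omega> s))" unfolding F_X_iff by blast
  show ?thesis unfolding F_X_iff
  proof (intro conjI)
    have ex: "\<exists>c c'. \<forall>s\<in>S1. - A s = lin2 k \<phi> \<psi> (c (fst s)) (c' (fst s)) (fst (\<omega> s))"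
      by (rule exI[of _ "\<lambda>t j. - c t j"], rule exI[of _ "\<lambda>t j. - c' t j"])
         (use a(5) in \<open>simp add: lin2_def ip_uminus_left\<close>)
    show "\<exists>\<phi>\<in>\<Phi>. \<exists>\<psi>\<in>\<Phi>. \<exists>c c'. \<forall>s\<in>S1. - A s = lin2 k \<phi> \<psi> (c (fst s)) (c' (fst s)) (fst (\<omega> s))"
      by (rule bexI[OF _ a(3)], rule bexI[OF _ a(4)], rule ex)
  qed (use a(1,2) in \<open>auto simp: dot_def\<close>)
qed

abbreviation width :: "sample \<Rightarrow> real" where
  "width \<omega> \<equiv> (\<integral>z. (SUP i. dot S1 (normalise S1 (pairvec \<omega> i)) z) \<partial>gauss S1)"

lemma F_X_bdd: "bdd_above ((\<lambda>v. dot S1 v z) ` F_X k \<Phi> T n1 \<omega>)"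
proof (rule bdd_aboveI2)
  fix v assume "v \<in> F_X k \<Phi> T n1 \<omega>"
  then have "dot S1 v v \<le> 1" by (simp add: F_X_iff)
  from dot_le_sum_abs[OF _ this, of z] show "dot S1 v z \<le> (\<Sum>s\<in>S1. \<bar>z s\<bar>)" by simp
qed

text \<open>One direction passes limits through the homogeneous inequality; in the other every
  nonzero normalised pair, extended by zero, belongs to \<open>F_X\<close>.\<close>

lemma F_X_Sup:
  assumes g: "goodX \<omega>" and ne: "F_X k \<Phi> T n1 \<omega> \<noteq> {}"
  shows "Sup ((\<lambda>v. \<Sum>s\<in>S1. v s * z s) ` F_X k \<Phi> T n1 \<omega>) = (SUP i. dot S1 (normalise S1 (pairvec \<omega> i)) z)"
  unfolding dot_def[symmetric]
proof (rule antisym)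
  let ?U = "SUP i. dot S1 (normalise S1 (pairvec \<omega> i)) z"
  have dev: "dot S1 (normalise S1 (pairvec \<omega> i)) z \<le> ?U" for i
    by (intro cSUP_upper bdd_above_dot normalise_le_1) auto
  show "Sup ((\<lambda>v. dot S1 v z) ` F_X k \<Phi> T n1 \<omega>) \<le> ?U"
  proof (rule cSUP_least[OF ne])
    fix A assume "A \<in> F_X k \<Phi> T n1 \<omega>"
    then obtain \<phi> \<psi> c c' where a: "dot S1 A A = 1" "\<phi> \<in> \<Phi>" "\<psi> \<in> \<Phi>"
      "\<forall>s\<in>S1. A s = lin2 k \<phi> \<psi> (c (fst s)) (c' (fst s)) (fst (\<omega> s))" unfolding F_X_iff by blast
    let ?B = "\<lambda>s. lin2 k \<phi> \<psi> (c (fst s)) (c' (fst s)) (fst (\<omega> s))"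
    have "dot S1 ?B z \<le> ?U * nrm S1 ?B"
      by (rule source_deviation_extends[OF _ a(2,3) dev]) (use g in \<open>simp add: goodX_def\<close>)
    moreover have "dot S1 ?B z = dot S1 A z" unfolding dot_def using a(4) by (intro sum.cong) auto
    moreover have "dot S1 ?B ?B = dot S1 A A" unfolding dot_def using a(4) by (intro sum.cong) auto
    ultimately show "dot S1 A z \<le> ?U" using a(1) by (simp add: nrm_def)
  qed
  show "?U \<le> Sup ((\<lambda>v. dot S1 v z) ` F_X k \<Phi> T n1 \<omega>)" (is "_ \<le> ?V")
  proof (rule cSUP_least)
    fix i
    have up: "dot S1 A z \<le> ?V" if "A \<in> F_X k \<Phi> T n1 \<omega>" for A
      by (rule cSUP_upper[OF that F_X_bdd])
    show "dot S1 (normalise S1 (pairvec \<omega> i)) z \<le> ?V"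
    proof (cases "nrm S1 (pairvec \<omega> i) = 0")
      \<comment> \<open>A null pair contributes 0, which the supremum over the symmetric set
        \<open>F_X\<close> reaches: one of A and -A has nonnegative inner product with z.\<close>
      case True
      obtain A where A: "A \<in> F_X k \<Phi> T n1 \<omega>" using ne by blast
      have "dot S1 (\<lambda>s. - A s) z = - dot S1 A z" by (simp add: dot_def sum_negf)
      then have "0 \<le> ?V" using up[OF A] up[OF uminus_in_F_X[OF A]] by linarith
      then show ?thesis unfolding dot_normalise True by simp
    next
      case False
      have "dot S1 (\<lambda>s. if s \<in> S1 then normalise S1 (pairvec \<omega> i) s else 0) z = dot S1 (normalise S1 (pairvec \<omega> i)) z"
        unfolding dot_def by (intro sum.cong) auto
      moreover have "(\<lambda>s. if s \<in> S1 then normalise S1 (pairvec \<omega> i) s else 0) \<in> F_X k \<Phi> T n1 \<omega>"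
        by (rule normalised_in_F_X[OF \<phi>seq(1) \<phi>seq(1) pairvec_def False])
      ultimately show ?thesis using up by fastforce
    qed
  qed simp
qed

text \<open>A unit vector of \<open>F_X\<close> and its negative bound the supremum below by an
  absolute value, so the squared width can dominate additive constants.\<close>

lemma gaussian_width_eq:
  assumes g: "goodX \<omega>" and ne: "F_X k \<Phi> T n1 \<omega> \<noteq> {}"
  shows "gaussian_width S1 (F_X k \<Phi> T n1 \<omega>) = width \<omega>" and "1/3 \<le> width \<omega>"
proof -
  show "gaussian_width S1 (F_X k \<Phi> T n1 \<omega>) = width \<omega>"
    using ne by (simp only: gaussian_width_def if_False F_X_Sup[OF g ne])
  obtain A where A: "A \<in> F_X k \<Phi> T n1 \<omega>" using ne by blast
  have a1: "dot S1 A A = 1" using A by (simp add: F_X_iff)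
  have "1/3 \<le> (\<integral>z. \<bar>dot S1 A z\<bar> \<partial>gauss S1)" by (rule gauss_abs_lower[OF _ a1]) simp
  also have "\<dots> \<le> width \<omega>"
  proof (rule integral_mono)
    show "integrable (gauss S1) (\<lambda>z. \<bar>dot S1 A z\<bar>)"
      using gauss_square_bound(3)[of S1 A] a1 by (intro integrable_abs) auto
    show "integrable (gauss S1) (\<lambda>z. SUP i. dot S1 (normalise S1 (pairvec \<omega> i)) z)"
      by (rule gauss_Sup_concentration(1)[where v="\<lambda>i. normalise S1 (pairvec \<omega> i)", OF _ normalise_le_1 order_refl]) simp
    fix z
    have up: "dot S1 B z \<le> (SUP i. dot S1 (normalise S1 (pairvec \<omega> i)) z)" if "B \<in> F_X k \<Phi> T n1 \<omega>" for B
      unfolding F_X_Sup[OF g ne, symmetric] unfolding dot_def[symmetric] by (rule cSUP_upper[OF that F_X_bdd])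
    have "dot S1 (\<lambda>s. - A s) z = - dot S1 A z" by (simp add: dot_def sum_negf)
    then show "\<bar>dot S1 A z\<bar> \<le> (SUP i. dot S1 (normalise S1 (pairvec \<omega> i)) z)"
      using up[OF A] up[OF uminus_in_F_X[OF A]] by linarith
  qed
  finally show "1/3 \<le> width \<omega>" .
qed

abbreviation err :: "feat \<Rightarrow> (nat \<Rightarrow> vec) \<Rightarrow> sample \<Rightarrow> nat \<times> nat \<Rightarrow> real" where
  "err \<phi>h Wh \<omega> \<equiv> (\<lambda>s. clean k \<phi>h Wh \<omega> s - clean k \<phi>s Ws \<omega> s)"

lemma err_eq_lin2: "err \<phi>h Wh \<omega> = (\<lambda>s. lin2 k \<phi>h \<phi>s (Wh (fst s)) ((\<lambda>t j. - Ws t j) (fst s)) (fst (\<omega> s)))"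
  by (simp add: clean_def lin2_def ip_uminus_left)

lemma source_error_bound:
  assumes g: "goodX \<omega>" and \<phi>h: "\<phi>h \<in> \<Phi>"
    and opt: "sqd S1 (resp \<omega>) (clean k \<phi>h Wh \<omega>) \<le> sqd S1 (resp \<omega>) (clean k \<phi>s Ws \<omega>)"
    and dev: "\<And>i. dot S1 (normalise S1 (pairvec \<omega> i)) (\<lambda>s. snd (\<omega> s)) \<le> a" and a: "0 \<le> a"
  shows "nrm S1 (err \<phi>h Wh \<omega>) \<le> 2 * a"
proof -
  have "nrm S1 (err \<phi>h Wh \<omega>) \<le> nrm S1 (\<lambda>s. clean k \<phi>s Ws \<omega> s - clean k \<phi>s Ws \<omega> s) + 2 * a"
  proof (rule basic_inequality[where z="\<lambda>s. snd (\<omega> s)", OF _ _ a])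
    show "sqd S1 (\<lambda>s. clean k \<phi>s Ws \<omega> s + snd (\<omega> s)) (clean k \<phi>h Wh \<omega>) \<le> sqd S1 (\<lambda>s. clean k \<phi>s Ws \<omega> s + snd (\<omega> s)) (clean k \<phi>s Ws \<omega>)"
      using opt unfolding response_def .
    show "dot S1 (err \<phi>h Wh \<omega>) (\<lambda>s. snd (\<omega> s)) \<le> a * nrm S1 (err \<phi>h Wh \<omega>)"
      unfolding err_eq_lin2 by (rule source_deviation_extends[OF _ \<phi>h \<phi>s dev]) (use g in \<open>simp add: goodX_def\<close>)
  qed
  then show "nrm S1 (err \<phi>h Wh \<omega>) \<le> 2 * a" by (simp add: nrm_def dot_def)
qed

end

subsection \<open>Passing to the target task\<close>

context transfer_setup
begin

text \<open>The least index makes the selection a measurable function of the source sample, which an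
  arbitrary minimiser is not.\<close>

definition sel :: "sample \<Rightarrow> nat \<Rightarrow> nat" where
  "sel \<omega> m = (LEAST i. near_min T n1 (Fam \<omega>) (resp \<omega>) m i)"

lemma near_min_sel: "near_min T n1 (Fam \<omega>) (resp \<omega>) m (sel \<omega> m)"
  unfolding sel_def using near_min_ex by (rule LeastI_ex)

lemma near_min_mono: "near_min T n Fm y m' i \<Longrightarrow> m \<le> m' \<Longrightarrow> near_min T n Fm y m i"
proof -
  assume a: "near_min T n Fm y m' i" "m \<le> m'"
  then have "1 / real (Suc m') \<le> 1 / real (Suc m)" by (simp add: frac_le)
  with a(1) show "near_min T n Fm y m i" unfolding near_min_def by linarith
qed

definition psel :: "sample \<Rightarrow> nat \<Rightarrow> nat" where
  "psel \<omega> m = fst (prod_decode (sel \<omega> m))"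

definition csel :: "sample \<Rightarrow> nat \<Rightarrow> nat \<Rightarrow> vec" where
  "csel \<omega> m = cseq (snd (prod_decode (sel \<omega> m)))"

lemma Fam_sel: "Fam \<omega> (sel \<omega> m) = tup k (\<phi>seq (psel \<omega> m)) (csel \<omega> m) \<omega>"
  by (simp add: Fam_def psel_def csel_def)

definition source_minimiser :: "sample \<Rightarrow> feat \<Rightarrow> (nat \<Rightarrow> vec) \<Rightarrow> bool" where
  "source_minimiser \<omega> \<phi>h Wh \<longleftrightarrow> \<phi>h \<in> \<Phi> \<and> (\<forall>\<phi>\<in>\<Phi>. \<forall>W. sqd S1 (resp \<omega>) (clean k \<phi>h Wh \<omega>) \<le> sqd S1 (resp \<omega>) (clean k \<phi> W \<omega>))"

text \<open>Links an arbitrary minimiser to the countable family: members converging to its tuple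
  eventually meet every tolerance. The row \<open>c 0\<close> is left free so that a spare function
  can be attached.\<close>

lemma minimiser_approximants:
  assumes g: "goodX \<omega>" and m: "source_minimiser \<omega> \<phi>h Wh" and c: "\<And>t. t \<in> {1..T} \<Longrightarrow> c t = Wh t"
  shows "\<exists>i. tuple_tendsto T n1 (\<lambda>m. Fam \<omega> (i m)) (tup k \<phi>h c \<omega>) \<and> (\<forall>m. eventually (\<lambda>l. near_min T n1 (Fam \<omega>) (resp \<omega>) m (i l)) sequentially)"
proof -
  have \<phi>h: "\<phi>h \<in> \<Phi>" using m by (simp add: source_minimiser_def)
  obtain i where i: "tuple_tendsto T n1 (\<lambda>m. Fam \<omega> (i m)) (tup k \<phi>h c \<omega>)"
    using dense_tuples[of \<omega> \<phi>h c] g \<phi>h by (auto simp: goodX_def)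
  have e: "sqd S1 (resp \<omega>) (diag (tup k \<phi>h c \<omega>)) = sqd S1 (resp \<omega>) (clean k \<phi>h Wh \<omega>)"
    unfolding dot_def by (intro sum.cong refl) (auto simp: diag_def tup_def clean_def c)
  have "sqd S1 (resp \<omega>) (clean k \<phi>h Wh \<omega>) \<le> min_loss T n1 (Fam \<omega>) (resp \<omega>)"
    unfolding min_loss_def
  proof (rule cINF_greatest)
    fix j
    show "sqd S1 (resp \<omega>) (clean k \<phi>h Wh \<omega>) \<le> sqd S1 (resp \<omega>) (diag (Fam \<omega> j))"
      unfolding Fam_def clean_eq_diag[symmetric] using m \<phi>seq(1) unfolding source_minimiser_def by blast
  qed simp
  note le = this
  have "eventually (\<lambda>l. near_min T n1 (Fam \<omega>) (resp \<omega>) m (i l)) sequentially" for m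
  proof -
    have "sqd S1 (resp \<omega>) (diag (tup k \<phi>h c \<omega>)) < min_loss T n1 (Fam \<omega>) (resp \<omega>) + 1 / real (Suc m)"
      unfolding e using le by (smt (verit) divide_pos_pos of_nat_0_less_iff zero_less_Suc)
    from order_tendstoD(2)[OF tuple_tendsto_sqd[OF i] this] show ?thesis
      by eventually_elim (simp add: near_min_def)
  qed
  with i show ?thesis by blast
qed

text \<open>Otherwise selected near-minimisers and approximants of the minimiser would stay apart at
  s for every tolerance, which is an ambiguous fit.\<close>

lemma selected_fits_converge:
  assumes g: "goodX \<omega>" and m: "source_minimiser \<omega> \<phi>h Wh" and na: "\<not> ambiguous_fit T n1 (Fam \<omega>) (resp \<omega>)"
    and s: "s \<in> S1"
  shows "(\<lambda>m. diag (Fam \<omega> (sel \<omega> m)) s) \<longlonglongrightarrow> clean k \<phi>h Wh \<omega> s"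
proof (rule ccontr)
  let ?y = "resp \<omega>"
  assume "\<not> ?thesis"
  then obtain r where r: "0 < r" "\<And>N. \<exists>n\<ge>N. r \<le> \<bar>diag (Fam \<omega> (sel \<omega> n)) s - clean k \<phi>h Wh \<omega> s\<bar>"
    unfolding LIMSEQ_iff by (auto simp: not_less)
  obtain i where i: "tuple_tendsto T n1 (\<lambda>m. Fam \<omega> (i m)) (tup k \<phi>h Wh \<omega>)" "\<And>m. eventually (\<lambda>l. near_min T n1 (Fam \<omega>) ?y m (i l)) sequentially"
    using minimiser_approximants[OF g m refl] by blast
  have lim: "(\<lambda>l. diag (Fam \<omega> (i l)) s) \<longlonglongrightarrow> clean k \<phi>h Wh \<omega> s"
    unfolding clean_eq_diag using i(1) s by (auto simp: tuple_tendsto_def diag_def)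
  obtain q where q: "1 / real (Suc q) < r / 2" using reals_Archimedean[of "r / 2"] r(1) by (auto simp: inverse_eq_divide)
  have "\<exists>i j. near_min T n1 (Fam \<omega>) ?y m i \<and> near_min T n1 (Fam \<omega>) ?y m j \<and> 1 / real (Suc q) \<le> \<bar>diag (Fam \<omega> i) s - diag (Fam \<omega> j) s\<bar>" for m
  proof -
    obtain n where n: "m \<le> n" "r \<le> \<bar>diag (Fam \<omega> (sel \<omega> n)) s - clean k \<phi>h Wh \<omega> s\<bar>" using r(2) by blast
    have "eventually (\<lambda>l. \<bar>diag (Fam \<omega> (i l)) s - clean k \<phi>h Wh \<omega> s\<bar> < r / 2) sequentially"
      using tendstoD[OF lim, of "r / 2"] r(1) by (simp add: dist_real_def)
    from eventually_conj[OF this i(2)[of m]] obtain l where l: "\<bar>diag (Fam \<omega> (i l)) s - clean k \<phi>h Wh \<omega> s\<bar> < r / 2" "near_min T n1 (Fam \<omega>) ?y m (i l)"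
      by (auto simp: eventually_sequentially)
    have "near_min T n1 (Fam \<omega>) ?y m (sel \<omega> n)" by (rule near_min_mono[OF near_min_sel n(1)])
    moreover have "1 / real (Suc q) \<le> \<bar>diag (Fam \<omega> (sel \<omega> n)) s - diag (Fam \<omega> (i l)) s\<bar>" using n(2) l(1) q by linarith
    ultimately show ?thesis using l(2) by blast
  qed
  then have "ambiguous_fit T n1 (Fam \<omega>) ?y" unfolding ambiguous_fit_def using s by blast
  with na show False by contradiction
qed

text \<open>A nonzero function orthogonal to all fits, normalised and placed in row 0, would make
  the approximants of the minimiser witness a deficient fit.\<close>

lemma minimiser_not_deficient:
  assumes g: "goodX \<omega>" and m: "source_minimiser \<omega> \<phi>h Wh" and nd: "\<not> deficient_fit T n1 (Fam \<omega>) (resp \<omega>)"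
    and o: "\<And>t. t \<in> {1..T} \<Longrightarrow> (\<Sum>l<n1. ip k b (\<phi>h (fst (\<omega> (1, l)))) * ip k (Wh t) (\<phi>h (fst (\<omega> (1, l))))) = 0"
  shows "(\<Sum>l<n1. (ip k b (\<phi>h (fst (\<omega> (1, l)))))\<^sup>2) = 0"
proof (rule ccontr)
  let ?y = "resp \<omega>"
  define N where "N = (\<Sum>l<n1. (ip k b (\<phi>h (fst (\<omega> (1, l)))))\<^sup>2)"
  assume "\<not> ?thesis"
  then have N: "0 < N" using sum_nonneg[of "{..<n1}" "\<lambda>l. (ip k b (\<phi>h (fst (\<omega> (1, l)))))\<^sup>2"] by (simp add: N_def order.strict_iff_order)
  define c where "c r = (if r = 0 then (\<lambda>j. (1 / sqrt N) * b j) else Wh r)" for r :: nat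
  define F where "F = tup k \<phi>h c \<omega>"
  obtain i where i: "tuple_tendsto T n1 (\<lambda>m. Fam \<omega> (i m)) F" "\<And>m. eventually (\<lambda>l. near_min T n1 (Fam \<omega>) ?y m (i l)) sequentially"
    using minimiser_approximants[OF g m, of c] unfolding F_def c_def by auto
  have F0: "F 0 (1, l) = (1 / sqrt N) * ip k b (\<phi>h (fst (\<omega> (1, l))))" for l
    by (simp only: F_def tup_def c_def if_True refl ip_scale_left)
  have Ft: "F t (1, l) = ip k (Wh t) (\<phi>h (fst (\<omega> (1, l))))" if "t \<in> {1..T}" for t l
    using that by (simp add: F_def tup_def c_def)
  have t1: "1 \<in> {1..T}" using T1 by simp
  have "evn n1 1 (F 0) = (1 / sqrt N) * ((1 / sqrt N) * N)"
    unfolding F0 dot_scale_left dot_scale_right by (simp add: N_def dot_def power2_eq_square)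
  also have "\<dots> = 1" using N by (simp add: field_simps)
  finally have lim1: "(\<lambda>l. evn n1 1 (Fam \<omega> (i l) 0)) \<longlonglongrightarrow> 1"
    using tuple_tendsto_dot[OF i(1) t1, of 0 0] by simp
  have lim2: "(\<lambda>l. dot {..<n1} (\<lambda>i'. Fam \<omega> (i l) 0 (1, i')) (\<lambda>i'. Fam \<omega> (i l) t (1, i'))) \<longlonglongrightarrow> 0" if t: "t \<in> {1..T}" for t
  proof -
    have "dot {..<n1} (\<lambda>i. F 0 (1, i)) (\<lambda>i. F t (1, i)) = (1 / sqrt N) * (\<Sum>l<n1. ip k b (\<phi>h (fst (\<omega> (1, l)))) * ip k (Wh t) (\<phi>h (fst (\<omega> (1, l)))))"
      unfolding F0 Ft[OF t] dot_scale_left by (simp add: dot_def)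
    then have "dot {..<n1} (\<lambda>i. F 0 (1, i)) (\<lambda>i. F t (1, i)) = 0" using o[OF t] by simp
    then show ?thesis using tuple_tendsto_dot[OF i(1) t1, of 0 t] t by simp
  qed
  have "\<exists>i. near_min T n1 (Fam \<omega>) ?y m i \<and> \<bar>evn n1 1 (Fam \<omega> i 0) - 1\<bar> \<le> 1 / real (Suc m) \<and>
     (\<forall>t\<in>{1..T}. \<bar>dot {..<n1} (\<lambda>i'. Fam \<omega> i 0 (1, i')) (\<lambda>i'. Fam \<omega> i t (1, i'))\<bar> \<le> 1 / real (Suc m))" for m
  proof -
    have r: "0 < 1 / real (Suc m)" by simp
    have e1: "eventually (\<lambda>l. \<bar>evn n1 1 (Fam \<omega> (i l) 0) - 1\<bar> < 1 / real (Suc m)) sequentially"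
      using tendstoD[OF lim1 r] by (simp add: dist_real_def)
    have e2: "eventually (\<lambda>l. \<forall>t\<in>{1..T}. \<bar>dot {..<n1} (\<lambda>i'. Fam \<omega> (i l) 0 (1, i')) (\<lambda>i'. Fam \<omega> (i l) t (1, i'))\<bar> < 1 / real (Suc m)) sequentially"
      using tendstoD[OF lim2 r] by (intro eventually_ball_finite) (simp_all add: dist_real_def)
    from eventually_conj[OF eventually_conj[OF e1 e2] i(2)[of m]] obtain l where
      "\<bar>evn n1 1 (Fam \<omega> (i l) 0) - 1\<bar> < 1 / real (Suc m)"
      "\<forall>t\<in>{1..T}. \<bar>dot {..<n1} (\<lambda>i'. Fam \<omega> (i l) 0 (1, i')) (\<lambda>i'. Fam \<omega> (i l) t (1, i'))\<bar> < 1 / real (Suc m)"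
      "near_min T n1 (Fam \<omega>) ?y m (i l)"
      unfolding eventually_sequentially by blast
    then show ?thesis by (intro exI[of _ "i l"]) (auto intro: less_imp_le)
  qed
  then have "deficient_fit T n1 (Fam \<omega>) ?y" unfolding deficient_fit_def by blast
  with nd show False by contradiction
qed

text \<open>Convergence at the inputs of task t becomes convergence in population norm by the
  sandwich, and then convergence at every point of \<open>K\<close> by the evaluation bound; this
  reaches the inputs of the target.\<close>

lemma selected_features_converge:
  assumes g: "goodX \<omega>" and m: "source_minimiser \<omega> \<phi>h Wh" and na: "\<not> ambiguous_fit T n1 (Fam \<omega>) (resp \<omega>)"
    and t: "t \<in> {1..T}" and x: "x \<in> K"
  shows "(\<lambda>m. ip k (csel \<omega> m t) (\<phi>seq (psel \<omega> m) x)) \<longlonglongrightarrow> ip k (Wh t) (\<phi>h x)"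
proof -
  have \<phi>h: "\<phi>h \<in> \<Phi>" using m by (simp add: source_minimiser_def)
  define h where "h m = lin2 k (\<phi>seq (psel \<omega> m)) \<phi>h (csel \<omega> m t) (\<lambda>j. - Wh t j)" for m
  obtain C where C: "\<And>m. (h m x)\<^sup>2 \<le> C * pop p (h m)" using K(3)[OF x] \<phi>seq(1) \<phi>h unfolding h_def by blast
  have hl: "h m (fst (\<omega> (t, l))) = diag (Fam \<omega> (sel \<omega> m)) (t, l) - clean k \<phi>h Wh \<omega> (t, l)" for m l
    by (simp add: h_def lin2_def ip_uminus_left diag_def Fam_sel tup_def clean_def)
  have "(\<lambda>m. \<Sum>l<n1. (h m (fst (\<omega> (t, l))))\<^sup>2) \<longlonglongrightarrow> (\<Sum>l<n1. (clean k \<phi>h Wh \<omega> (t, l) - clean k \<phi>h Wh \<omega> (t, l))\<^sup>2)"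
    unfolding hl by (intro tendsto_sum tendsto_power tendsto_diff tendsto_const selected_fits_converge[OF g m na]) (use t in auto)
  then have e0: "(\<lambda>m. \<Sum>l<n1. (h m (fst (\<omega> (t, l))))\<^sup>2) \<longlonglongrightarrow> 0" by simp
  have p0: "(\<lambda>m. pop p (h m)) \<longlonglongrightarrow> 0"
  proof (rule tendsto_sandwich[OF _ _ tendsto_const])
    show "(\<lambda>m. (\<Sum>l<n1. (h m (fst (\<omega> (t, l))))\<^sup>2) * 2) \<longlonglongrightarrow> 0" using tendsto_mult_left_zero[OF e0, of 2] by (simp add: mult.commute)
    have "pop p (h m) \<le> (\<Sum>l<n1. (h m (fst (\<omega> (t, l))))\<^sup>2) * 2" for m
    proof -
      have "pop p (h m) \<le> real n1 * pop p (h m)" using n1 pop_nonneg[of "h m"] by (simp add: mult_le_cancel_right1)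
      then show ?thesis using good_sandwich(1)[OF g t \<phi>seq(1) \<phi>h, of "psel \<omega> m" "csel \<omega> m t" "\<lambda>j. - Wh t j"] pop_nonneg[of "h m"]
        unfolding h_def[symmetric] by linarith
    qed
    then show "eventually (\<lambda>m. pop p (h m) \<le> (\<Sum>l<n1. (h m (fst (\<omega> (t, l))))\<^sup>2) * 2) sequentially" by simp
  qed (simp add: pop_nonneg)
  have "(\<lambda>m. (h m x)\<^sup>2) \<longlonglongrightarrow> 0"
  proof (rule tendsto_sandwich[OF _ _ tendsto_const])
    show "(\<lambda>m. C * pop p (h m)) \<longlonglongrightarrow> 0" using tendsto_mult_right_zero[OF p0] .
  qed (use C in simp_all)
  then have "(\<lambda>m. sqrt ((h m x)\<^sup>2)) \<longlonglongrightarrow> sqrt 0" by (rule tendsto_real_sqrt)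
  then have "(\<lambda>m. h m x) \<longlonglongrightarrow> 0" by (simp add: tendsto_rabs_zero_iff)
  then have "(\<lambda>m. h m x + ip k (Wh t) (\<phi>h x)) \<longlonglongrightarrow> 0 + ip k (Wh t) (\<phi>h x)" by (intro tendsto_add tendsto_const)
  then show ?thesis by (simp add: h_def lin2_def ip_uminus_left)
qed

text \<open>A function of the learned features is a combination of the T fitted functions plus a
  part orthogonal to them on the first task, and that part vanishes on \<open>K\<close>. The same
  combination of the selected weights approximates it: spans converge, even if the feature maps do
  not.\<close>

lemma minimiser_span_approximated:
  assumes g: "goodX \<omega>" and m: "source_minimiser \<omega> \<phi>h Wh" and na: "\<not> ambiguous_fit T n1 (Fam \<omega>) (resp \<omega>)"
    and nd: "\<not> deficient_fit T n1 (Fam \<omega>) (resp \<omega>)"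
  shows "\<exists>\<gamma>n. \<forall>x\<in>K. (\<lambda>m. ip k (\<gamma>n m) (\<phi>seq (psel \<omega> m) x)) \<longlonglongrightarrow> ip k \<gamma> (\<phi>h x)"
proof -
  have \<phi>h: "\<phi>h \<in> \<Phi>" using m by (simp add: source_minimiser_def)
  obtain \<mu> where \<mu>': "\<forall>t\<in>{1..T}. dot {..<n1} (\<lambda>l. ip k \<gamma> (\<phi>h (fst (\<omega> (1, l)))) - (\<Sum>r\<in>{1..T}. \<mu> r * ip k (Wh r) (\<phi>h (fst (\<omega> (1, l))))))
     (\<lambda>l. ip k (Wh t) (\<phi>h (fst (\<omega> (1, l))))) = 0"
    using orthogonal_projection_exists[of "{1..T}" "{..<n1}" "\<lambda>l. ip k \<gamma> (\<phi>h (fst (\<omega> (1, l))))" "\<lambda>r l. ip k (Wh r) (\<phi>h (fst (\<omega> (1, l))))"] by blast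
  note \<mu> = bspec[OF \<mu>']
  define b where "b j = \<gamma> j + (\<Sum>r\<in>{1..T}. (- \<mu> r) * Wh r j)" for j
  have b: "ip k b v = ip k \<gamma> v - (\<Sum>r\<in>{1..T}. \<mu> r * ip k (Wh r) v)" for v
    unfolding b_def ip_add_left ip_sum_left ip_scale_left by (simp add: sum_negf)
  have "(\<Sum>l<n1. (ip k b (\<phi>h (fst (\<omega> (1, l)))))\<^sup>2) = 0"
    by (rule minimiser_not_deficient[OF g m nd], drule \<mu>) (simp only: b dot_def)
  moreover have l2: "lin2 k \<phi>h \<phi>h b (\<lambda>_. 0) x = ip k b (\<phi>h x)" for x by (simp add: lin2_def ip_def)
  moreover have "1 \<in> {1..T}" using T1 by simp
  ultimately have "0.9 * real n1 * pop p (lin2 k \<phi>h \<phi>h b (\<lambda>_. 0)) \<le> 0"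
    using good_sandwich(1)[OF g _ \<phi>h \<phi>h, of 1 b "\<lambda>_. 0"] by simp
  then have p0: "pop p (lin2 k \<phi>h \<phi>h b (\<lambda>_. 0)) = 0"
    using n1 pop_nonneg[of "lin2 k \<phi>h \<phi>h b (\<lambda>_. 0)"] by (simp add: mult_le_0_iff)
  have bx: "ip k b (\<phi>h x) = 0" if x: "x \<in> K" for x
  proof -
    obtain C where C: "(lin2 k \<phi>h \<phi>h b (\<lambda>_. 0) x)\<^sup>2 \<le> C * pop p (lin2 k \<phi>h \<phi>h b (\<lambda>_. 0))" using K(3)[OF x] \<phi>h by blast
    then show ?thesis by (simp add: p0 l2)
  qed
  show ?thesis
  proof (intro exI[of _ "\<lambda>m j. \<Sum>r\<in>{1..T}. \<mu> r * csel \<omega> m r j"] ballI)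
    fix x assume x: "x \<in> K"
    have "(\<lambda>m. \<Sum>r\<in>{1..T}. \<mu> r * ip k (csel \<omega> m r) (\<phi>seq (psel \<omega> m) x)) \<longlonglongrightarrow> (\<Sum>r\<in>{1..T}. \<mu> r * ip k (Wh r) (\<phi>h x))"
      by (intro tendsto_sum tendsto_mult tendsto_const selected_features_converge[OF g m na _ x])
    then show "(\<lambda>m. ip k (\<lambda>j. \<Sum>r\<in>{1..T}. \<mu> r * csel \<omega> m r j) (\<phi>seq (psel \<omega> m) x)) \<longlonglongrightarrow> ip k \<gamma> (\<phi>h x)"
      using bx[OF x] by (simp add: ip_sum_left ip_scale_left b)
  qed
qed

text \<open>Row 0 of the dense tuples serves as a dense sequence of single weight vectors.\<close>

definition targetvec :: "nat \<Rightarrow> sample \<Rightarrow> nat \<Rightarrow> nat \<times> nat \<Rightarrow> real" where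
  "targetvec j \<omega> i s = ip k (cseq i 0) (\<phi>seq j (fst (\<omega> s)))"

definition goodT :: "real \<Rightarrow> nat \<Rightarrow> sample \<Rightarrow> bool" where
  "goodT a j \<omega> \<longleftrightarrow> (\<lambda>l\<in>{..<n2}. fst (\<omega> (Suc T, l))) \<in> A2 j \<and> (\<forall>s\<in>S2. fst (\<omega> s) \<in> K) \<and>
     (\<forall>i. dot S2 (normalise S2 (targetvec j \<omega> i)) (\<lambda>s. snd (\<omega> s)) \<le> a)"

lemma target_deviation_extends:
  assumes g: "goodT a j \<omega>"
  shows "dot S2 (\<lambda>s. ip k c (\<phi>seq j (fst (\<omega> s)))) (\<lambda>s. snd (\<omega> s)) \<le> a * nrm S2 (\<lambda>s. ip k c (\<phi>seq j (fst (\<omega> s))))"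
proof -
  obtain i where i: "\<And>r l. r \<le> T \<Longrightarrow> l < k \<Longrightarrow> (\<lambda>m. cseq (i m) r l) \<longlonglongrightarrow> c l" using cseq[of "\<lambda>_. c"] by blast
  show ?thesis
  proof (rule dot_le_nrm_limit)
    show "dot S2 (targetvec j \<omega> (i m)) (\<lambda>s. snd (\<omega> s)) \<le> a * nrm S2 (targetvec j \<omega> (i m))" for m
      by (rule dot_le_of_normalise) (use g in \<open>simp add: goodT_def\<close>)
    show "(\<lambda>m. targetvec j \<omega> (i m) s) \<longlonglongrightarrow> ip k c (\<phi>seq j (fst (\<omega> s)))" for s
      unfolding targetvec_def by (intro ip_tendsto i tendsto_const) auto
  qed
qed

lemma target_sandwich:
  assumes g: "goodT a j \<omega>"
  shows "0.9 * real n2 * pop p (lin2 k (\<phi>seq j) \<phi>s c c') \<le> (\<Sum>l<n2. (lin2 k (\<phi>seq j) \<phi>s c c' (fst (\<omega> (Suc T, l))))\<^sup>2)"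
    and "(\<Sum>l<n2. (lin2 k (\<phi>seq j) \<phi>s c c' (fst (\<omega> (Suc T, l))))\<^sup>2) \<le> 1.1 * real n2 * pop p (lin2 k (\<phi>seq j) \<phi>s c c')"
proof -
  have "(\<lambda>l\<in>{..<n2}. fst (\<omega> (Suc T, l))) \<in> A2 j" using g by (simp add: goodT_def)
  from sandwich_lin2[OF sq[OF \<phi>seq(1)] sq[OF \<phi>s] A2(3)[OF this], of c c']
  show "0.9 * real n2 * pop p (lin2 k (\<phi>seq j) \<phi>s c c') \<le> (\<Sum>l<n2. (lin2 k (\<phi>seq j) \<phi>s c c' (fst (\<omega> (Suc T, l))))\<^sup>2)"
    and "(\<Sum>l<n2. (lin2 k (\<phi>seq j) \<phi>s c c' (fst (\<omega> (Suc T, l))))\<^sup>2) \<le> 1.1 * real n2 * pop p (lin2 k (\<phi>seq j) \<phi>s c c')"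
    using n2 by (simp_all add: field_simps)
qed

text \<open>The target events for the selected near-minimisers pass to the minimiser itself along a subsequence;
  population norms are compared through the inputs of the first source task, which costs only constants.\<close>

lemma minimiser_target_bounds:
  assumes g: "goodX \<omega>" and m: "source_minimiser \<omega> \<phi>h Wh" and na: "\<not> ambiguous_fit T n1 (Fam \<omega>) (resp \<omega>)"
    and nd: "\<not> deficient_fit T n1 (Fam \<omega>) (resp \<omega>)" and inf: "\<exists>\<^sub>\<infinity>m. goodT a (psel \<omega> m) \<omega>2"
  shows "dot S2 (\<lambda>s. ip k \<gamma> (\<phi>h (fst (\<omega>2 s)))) (\<lambda>s. snd (\<omega>2 s)) \<le> a * nrm S2 (\<lambda>s. ip k \<gamma> (\<phi>h (fst (\<omega>2 s))))"
    and "real n2 * pop p (lin2 k \<phi>h \<phi>s \<gamma> w) \<le> 2 * (\<Sum>l<n2. (lin2 k \<phi>h \<phi>s \<gamma> w (fst (\<omega>2 (Suc T, l))))\<^sup>2)"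
    and "(\<Sum>l<n2. (lin2 k \<phi>h \<phi>s \<gamma> w (fst (\<omega>2 (Suc T, l))))\<^sup>2) \<le> 2 * (real n2 * pop p (lin2 k \<phi>h \<phi>s \<gamma> w))"
proof -
  have \<phi>h: "\<phi>h \<in> \<Phi>" using m by (simp add: source_minimiser_def)
  \<comment> \<open>Infinitely many good indices suffice, since all limits below are taken along
    them.\<close>
  obtain f :: "nat \<Rightarrow> nat" where f: "strict_mono f" "\<And>m. goodT a (psel \<omega> (f m)) \<omega>2"
    using infinite_enumerate[of "{m. goodT a (psel \<omega> m) \<omega>2}"] inf unfolding frequently_cofinite by auto
  obtain \<gamma>n where \<gamma>n: "\<And>x. x \<in> K \<Longrightarrow> (\<lambda>m. ip k (\<gamma>n m) (\<phi>seq (psel \<omega> m) x)) \<longlonglongrightarrow> ip k \<gamma> (\<phi>h x)"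
    using minimiser_span_approximated[OF g m na nd] by blast
  have lim: "(\<lambda>m. ip k (\<gamma>n (f m)) (\<phi>seq (psel \<omega> (f m)) x)) \<longlonglongrightarrow> ip k \<gamma> (\<phi>h x)" if "x \<in> K" for x
    using LIMSEQ_subseq_LIMSEQ[OF \<gamma>n[OF that] f(1)] by (simp add: o_def)
  have K2: "fst (\<omega>2 s) \<in> K" if "s \<in> S2" for s using f(2)[of 0] that unfolding goodT_def by blast
  show "dot S2 (\<lambda>s. ip k \<gamma> (\<phi>h (fst (\<omega>2 s)))) (\<lambda>s. snd (\<omega>2 s)) \<le> a * nrm S2 (\<lambda>s. ip k \<gamma> (\<phi>h (fst (\<omega>2 s))))"
    by (rule dot_le_nrm_limit[OF target_deviation_extends[OF f(2)] lim[OF K2]])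
  define h where "h m = lin2 k (\<phi>seq (psel \<omega> (f m))) \<phi>s (\<gamma>n (f m)) w" for m
  define H where "H = lin2 k \<phi>h \<phi>s \<gamma> w"
  have hH: "(\<lambda>m. h m x) \<longlonglongrightarrow> H x" if "x \<in> K" for x
    unfolding h_def H_def lin2_def by (intro tendsto_add tendsto_const lim that)
  define E1 where "E1 u = (\<Sum>l<n1. (u (fst (\<omega> (1, l))))\<^sup>2)" for u :: "vec \<Rightarrow> real"
  define E2 where "E2 u = (\<Sum>l<n2. (u (fst (\<omega>2 (Suc T, l))))\<^sup>2)" for u :: "vec \<Rightarrow> real"
  have t1: "1 \<in> {1..T}" using T1 by simp
  have l1: "(\<lambda>m. E1 (h m)) \<longlonglongrightarrow> E1 H" unfolding E1_def
    by (intro tendsto_sum tendsto_power hH) (use g t1 in \<open>auto simp: goodX_def\<close>)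
  have l2: "(\<lambda>m. E2 (h m)) \<longlonglongrightarrow> E2 H" unfolding E2_def
    by (intro tendsto_sum tendsto_power hH K2) auto
  have s1: "0.9 * real n1 * pop p (h m) \<le> E1 (h m)" "E1 (h m) \<le> 1.1 * real n1 * pop p (h m)" for m
    using good_sandwich[OF g t1 \<phi>seq(1) \<phi>s] unfolding h_def E1_def by blast+
  have s1': "0.9 * real n1 * pop p H \<le> E1 H" "E1 H \<le> 1.1 * real n1 * pop p H"
    using good_sandwich[OF g t1 \<phi>h \<phi>s] unfolding H_def E1_def by blast+
  have s2: "0.9 * real n2 * pop p (h m) \<le> E2 (h m)" "E2 (h m) \<le> 1.1 * real n2 * pop p (h m)" for m
    using target_sandwich[OF f(2)] unfolding h_def E2_def by blast+
  have N: "0 < real n1" "0 < real n2" using n1 n2 by auto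
  \<comment> \<open>Eliminates the population norm P between an upper bound on one sample and a
    lower bound on the other; only empirical sums, which converge, remain.\<close>
  have xfer: "b * e1 * 0.9 \<le> 1.1 * a * e2" if "e1 \<le> 1.1 * a * P" "0.9 * b * P \<le> e2" "0 < a" "0 < b" for a b e1 e2 P :: real
  proof -
    have "b * e1 \<le> b * (1.1 * a * P)" "a * (0.9 * b * P) \<le> a * e2" using that by (intro mult_left_mono; simp)+
    moreover have "b * (1.1 * a * P) = 1.1 * (a * b * P)" "a * (0.9 * b * P) = 0.9 * (a * b * P)" "1.1 * a * e2 = 1.1 * (a * e2)" by simp_all
    ultimately show ?thesis by linarith
  qed
  have a1: "real n2 * E1 (h m) * 0.9 \<le> 1.1 * real n1 * E2 (h m)" for m
    by (rule xfer[OF s1(2) s2(1) N])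
  have a2: "real n1 * E2 (h m) * 0.9 \<le> 1.1 * real n2 * E1 (h m)" for m
    by (rule xfer[OF s2(2) s1(1) N(2) N(1)])
  have b1: "real n2 * E1 H * 0.9 \<le> 1.1 * real n1 * E2 H"
    by (rule LIMSEQ_le[of "\<lambda>m. real n2 * E1 (h m) * 0.9" _ "\<lambda>m. 1.1 * real n1 * E2 (h m)"]) (use a1 in \<open>auto intro!: tendsto_intros l1 l2\<close>)
  have b2: "real n1 * E2 H * 0.9 \<le> 1.1 * real n2 * E1 H"
    by (rule LIMSEQ_le[of "\<lambda>m. real n1 * E2 (h m) * 0.9" _ "\<lambda>m. 1.1 * real n2 * E1 (h m)"]) (use a2 in \<open>auto intro!: tendsto_intros l1 l2\<close>)
  have ab: "81/100 * (a * (b * P)) \<le> 1.1 * (a * e2)" if "0.9 * a * P \<le> e1" "b * e1 * 0.9 \<le> 1.1 * a * e2" "0 < b" for a b e1 e2 P :: real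
  proof -
    have "b * (0.9 * a * P) \<le> b * e1" using that by (intro mult_left_mono) auto
    moreover have "b * (0.9 * a * P) = 0.9 * (a * (b * P))" "1.1 * a * e2 = 1.1 * (a * e2)" by simp_all
    ultimately show ?thesis using that(2) by linarith
  qed
  have "real n1 * (81/100 * (real n2 * pop p H)) \<le> real n1 * (1.1 * E2 H)"
    using ab[OF s1'(1) b1 N(2)] by simp
  then have "81/100 * (real n2 * pop p H) \<le> 1.1 * E2 H" using N by simp
  moreover have "0 \<le> E2 H" by (simp add: E2_def sum_nonneg)
  ultimately show "real n2 * pop p (lin2 k \<phi>h \<phi>s \<gamma> w) \<le> 2 * (\<Sum>l<n2. (lin2 k \<phi>h \<phi>s \<gamma> w (fst (\<omega>2 (Suc T, l))))\<^sup>2)"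
    unfolding H_def[symmetric] E2_def[symmetric] by linarith
  have ab': "0.9 * (a * e2) \<le> 121/100 * (a * (b * P))" if "e1 \<le> 1.1 * a * P" "a * e2 * 0.9 \<le> 1.1 * b * e1" "0 < b" for a b e1 e2 P :: real
  proof -
    have "b * e1 \<le> b * (1.1 * a * P)" using that by (intro mult_left_mono) auto
    moreover have "b * (1.1 * a * P) = 1.1 * (a * (b * P))" "1.1 * b * e1 = 1.1 * (b * e1)" by simp_all
    ultimately show ?thesis using that(2) by linarith
  qed
  have "real n1 * (0.9 * E2 H) \<le> real n1 * (121/100 * (real n2 * pop p H))"
    using ab'[OF s1'(2) b2 N(2)] by simp
  then have "0.9 * E2 H \<le> 121/100 * (real n2 * pop p H)" using N by simp
  moreover have "0 \<le> real n2 * pop p H" using pop_nonneg by simp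
  ultimately show "(\<Sum>l<n2. (lin2 k \<phi>h \<phi>s \<gamma> w (fst (\<omega>2 (Suc T, l))))\<^sup>2) \<le> 2 * (real n2 * pop p (lin2 k \<phi>h \<phi>s \<gamma> w))"
    unfolding H_def[symmetric] E2_def[symmetric] by linarith
qed

end

subsection \<open>The good event\<close>

text \<open>Conditioning on the inputs: a bound on the noise for each fixed x bounds the joint event
  by Fubini.\<close>

lemma emeasure_zip_le:
  assumes "prob_space M" "prob_space N" "finite S" and E: "E \<in> sets (PiM S (\<lambda>_. M \<Otimes>\<^sub>M N))"
    and c: "\<And>x. x \<in> space (PiM S (\<lambda>_. M)) \<Longrightarrow> emeasure (PiM S (\<lambda>_. N)) {z \<in> space (PiM S (\<lambda>_. N)). (\<lambda>s\<in>S. (x s, z s)) \<in> E} \<le> c"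
  shows "emeasure (PiM S (\<lambda>_. M \<Otimes>\<^sub>M N)) E \<le> c"
proof -
  interpret PM: prob_space "PiM S (\<lambda>_. M)" by (rule prob_space_PiM) (rule assms)
  have "emeasure (PiM S (\<lambda>_. M \<Otimes>\<^sub>M N)) E = (\<integral>\<^sup>+w. indicator E w \<partial>PiM S (\<lambda>_. M \<Otimes>\<^sub>M N))" using E by simp
  also have "\<dots> = (\<integral>\<^sup>+x. \<integral>\<^sup>+z. indicator E (\<lambda>s\<in>S. (x s, z s)) \<partial>PiM S (\<lambda>_. N) \<partial>PiM S (\<lambda>_. M))"
    by (rule nn_integral_PiM_pair) (use assms in auto)
  also have "\<dots> \<le> (\<integral>\<^sup>+x. c \<partial>PiM S (\<lambda>_. M))"
  proof (rule nn_integral_mono)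
    fix x assume x: "x \<in> space (PiM S (\<lambda>_. M))"
    let ?B = "{z \<in> space (PiM S (\<lambda>_. N)). (\<lambda>s\<in>S. (x s, z s)) \<in> E}"
    have "(\<lambda>z. \<lambda>s\<in>S. (x s, z s)) \<in> PiM S (\<lambda>_. N) \<rightarrow>\<^sub>M PiM S (\<lambda>_. M \<Otimes>\<^sub>M N)"
      by (rule measurable_restrict) (use x in \<open>auto simp: space_PiM intro!: measurable_Pair measurable_component_singleton measurable_const dest: PiE_mem\<close>)
    from measurable_sets[OF this E] have "?B \<in> sets (PiM S (\<lambda>_. N))" by (simp add: vimage_def Int_def conj_commute)
    then have "emeasure (PiM S (\<lambda>_. N)) ?B = (\<integral>\<^sup>+z. indicator ?B z \<partial>PiM S (\<lambda>_. N))" by simp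
    also have "\<dots> = (\<integral>\<^sup>+z. indicator E (\<lambda>s\<in>S. (x s, z s)) \<partial>PiM S (\<lambda>_. N))"
      by (intro nn_integral_cong) (auto split: split_indicator)
    finally show "(\<integral>\<^sup>+z. indicator E (\<lambda>s\<in>S. (x s, z s)) \<partial>PiM S (\<lambda>_. N)) \<le> c" using c[OF x] by simp
  qed
  also have "\<dots> = c" by (simp add: PM.emeasure_space_1)
  finally show ?thesis .
qed

context transfer_setup
begin

section \<open>Measurability of selections, bad fits and the width\<close>

abbreviation "smp \<equiv> p \<Otimes>\<^sub>M density lborel (normal_density 0 \<sigma>)"
abbreviation "samples S \<equiv> PiM S (\<lambda>_. smp)"

lemma prob_noise1: "prob_space (density lborel (normal_density 0 \<sigma>))"
  using \<sigma> by (rule prob_space_normal_density)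

lemma prob_smp: "prob_space smp"
proof -
  interpret p: prob_space p by (rule p)
  interpret N: prob_space "density lborel (normal_density 0 \<sigma>)" by (rule prob_noise1)
  interpret pair_prob_space p "density lborel (normal_density 0 \<sigma>)" ..
  show ?thesis by unfold_locales
qed

lemma comp_measurable: "s \<in> S \<Longrightarrow> (\<lambda>\<omega>. \<omega> s) \<in> samples S \<rightarrow>\<^sub>M smp"
  by (rule measurable_component_singleton)

lemma fst_measurable: "s \<in> S \<Longrightarrow> (\<lambda>\<omega>. fst (\<omega> s)) \<in> samples S \<rightarrow>\<^sub>M p"
  using measurable_compose[OF comp_measurable measurable_fst] .

lemma snd_measurable: "s \<in> S \<Longrightarrow> (\<lambda>\<omega>. snd (\<omega> s)) \<in> borel_measurable (samples S)"
  using measurable_compose[OF comp_measurable measurable_snd] by simp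

lemma ip_measurable:
  assumes "s \<in> S" "\<phi> \<in> \<Phi>"
  shows "(\<lambda>\<omega>. ip k c (\<phi> (fst (\<omega> s)))) \<in> borel_measurable (samples S)"
  unfolding ip_def
proof (intro borel_measurable_sum borel_measurable_times borel_measurable_const)
  fix j assume "j \<in> {..<k}"
  then have "(\<lambda>x. \<phi> x j) \<in> borel_measurable p" using sq[OF assms(2)] by (simp add: sqint_def)
  from measurable_compose[OF fst_measurable[OF assms(1)] this] show "(\<lambda>\<omega>. \<phi> (fst (\<omega> s)) j) \<in> borel_measurable (samples S)" .
qed

lemma pairvec_measurable: "s \<in> S \<Longrightarrow> (\<lambda>\<omega>. pairvec \<omega> i s) \<in> borel_measurable (samples S)"
  unfolding pairvec_def lin2_def by (intro borel_measurable_add ip_measurable \<phi>seq)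

lemma targetvec_measurable: "s \<in> S \<Longrightarrow> (\<lambda>\<omega>. targetvec j \<omega> i s) \<in> borel_measurable (samples S)"
  unfolding targetvec_def by (intro ip_measurable \<phi>seq)

lemma Fam_measurable: "s \<in> S \<Longrightarrow> (\<lambda>\<omega>. Fam \<omega> i r s) \<in> borel_measurable (samples S)"
  unfolding Fam_def tup_def by (intro ip_measurable \<phi>seq)

lemma resp_measurable: "s \<in> S \<Longrightarrow> (\<lambda>\<omega>. resp \<omega> s) \<in> borel_measurable (samples S)"
  unfolding response_def clean_def by (intro borel_measurable_add ip_measurable \<phi>s snd_measurable)

lemma normalise_measurable:
  assumes "finite R" "\<And>s. s \<in> R \<Longrightarrow> (\<lambda>\<omega>. u \<omega> s) \<in> borel_measurable M" "s \<in> R"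
  shows "(\<lambda>\<omega>. normalise R (u \<omega>) s) \<in> borel_measurable M"
proof -
  have [measurable]: "(\<lambda>\<omega>. dot R (u \<omega>) (u \<omega>)) \<in> borel_measurable M"
    by (rule dot_measurable[OF assms(1,2,2)])
  note [measurable] = assms(2)[OF assms(3)]
  show ?thesis unfolding normalise_def nrm_def by measurable
qed

lemma loss_measurable: "(\<lambda>\<omega>. sqd S1 (resp \<omega>) (diag (Fam \<omega> i))) \<in> borel_measurable (samples S1)"
  unfolding diag_def by (intro dot_measurable borel_measurable_diff resp_measurable Fam_measurable) auto

lemma min_loss_measurable: "(\<lambda>\<omega>. min_loss T n1 (Fam \<omega>) (resp \<omega>)) \<in> borel_measurable (samples S1)"
  unfolding min_loss_def by (intro borel_measurable_cINF loss_measurable bdd_belowI2[where m=0]) auto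

lemma near_min_measurable: "Measurable.pred (samples S1) (\<lambda>\<omega>. near_min T n1 (Fam \<omega>) (resp \<omega>) m i)"
  unfolding near_min_def
  by (intro borel_measurable_le[unfolded pred_def[symmetric]] borel_measurable_add borel_measurable_const loss_measurable min_loss_measurable)

lemma psel_measurable: "Measurable.pred (samples S1) (\<lambda>\<omega>. psel \<omega> m = j)"
proof -
  have "Measurable.pred (samples S1) (\<lambda>\<omega>. sel \<omega> m = i)" for i
  proof -
    have e: "(sel \<omega> m = i) \<longleftrightarrow> near_min T n1 (Fam \<omega>) (resp \<omega>) m i \<and> (\<forall>i'. i' < i \<longrightarrow> \<not> near_min T n1 (Fam \<omega>) (resp \<omega>) m i')" for \<omega>
      unfolding sel_def by (metis (mono_tags, lifting) LeastI_ex near_min_ex not_less_Least linorder_neqE_nat)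
    show ?thesis unfolding e
      by (intro pred_intros_logic pred_intros_countable near_min_measurable measurable_const) auto
  qed
  moreover have "(psel \<omega> m = j) \<longleftrightarrow> (\<exists>i. sel \<omega> m = i \<and> fst (prod_decode i) = j)" for \<omega>
    by (auto simp: psel_def)
  ultimately show ?thesis by (simp only:) (intro pred_intros_logic pred_intros_countable measurable_const, auto)
qed

lemma ambiguous_measurable: "Measurable.pred (samples S1) (\<lambda>\<omega>. ambiguous_fit T n1 (Fam \<omega>) (resp \<omega>))"
  unfolding ambiguous_fit_def diag_def
  by (intro pred_intros_countable_bounded pred_intros_countable pred_intros_logic near_min_measurable
      borel_measurable_le[unfolded pred_def[symmetric]] borel_measurable_const borel_measurable_abs borel_measurable_diff Fam_measurable) auto

lemma deficient_measurable: "Measurable.pred (samples S1) (\<lambda>\<omega>. deficient_fit T n1 (Fam \<omega>) (resp \<omega>))"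
  unfolding deficient_fit_def
  by (intro pred_intros_countable_bounded pred_intros_countable pred_intros_logic near_min_measurable
      borel_measurable_le[unfolded pred_def[symmetric]] borel_measurable_const borel_measurable_abs borel_measurable_diff dot_measurable Fam_measurable)
     (use T1 in auto)

lemma source_dev_measurable: "(\<lambda>\<omega>. dot S1 (normalise S1 (pairvec \<omega> i)) (\<lambda>s. snd (\<omega> s))) \<in> borel_measurable (samples S1)"
  by (intro dot_measurable normalise_measurable pairvec_measurable snd_measurable) auto

lemma width_measurable: "(\<lambda>\<omega>. width \<omega>) \<in> borel_measurable (samples S1)"
proof -
  interpret G: prob_space "gauss S1" by (rule prob_space_gauss)
  have "(\<lambda>x. SUP i. dot S1 (normalise S1 (pairvec (fst x) i)) (snd x)) \<in> borel_measurable (samples S1 \<Otimes>\<^sub>M gauss S1)"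
  proof (intro borel_measurable_cSUP dot_measurable)
    fix i s assume s: "s \<in> S1"
    show "(\<lambda>x. normalise S1 (pairvec (fst x) i) s) \<in> borel_measurable (samples S1 \<Otimes>\<^sub>M gauss S1)"
      by (intro normalise_measurable measurable_compose[OF measurable_fst pairvec_measurable] s) auto
    show "(\<lambda>x. snd x s) \<in> borel_measurable (samples S1 \<Otimes>\<^sub>M gauss S1)"
      by (rule measurable_compose[OF measurable_snd gauss_component[OF s]])
  next
    fix x show "bdd_above (range (\<lambda>i. dot S1 (normalise S1 (pairvec (fst x) i)) (snd x)))"
      by (intro bdd_above_dot normalise_le_1) auto
  qed auto
  then show ?thesis by (intro G.borel_measurable_lebesgue_integral) (simp add: case_prod_beta)
qed

section \<open>Probabilities of the events on inputs and noise\<close>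

lemma inputs_event:
  assumes S: "finite S" and f: "inj_on f {..<n}" "f \<in> {..<n} \<rightarrow> S" and A: "A \<in> sets (iid n p)"
  shows "{\<omega> \<in> space (samples S). (\<lambda>l\<in>{..<n}. fst (\<omega> (f l))) \<notin> A} \<in> sets (samples S)"
    and "emeasure (samples S) {\<omega> \<in> space (samples S). (\<lambda>l\<in>{..<n}. fst (\<omega> (f l))) \<notin> A} \<le> ennreal (1 - measure (iid n p) A)"
proof -
  interpret I: prob_space "iid n p" by (rule prob_space_PiM) (rule p)
  have m: "(\<lambda>\<omega>. \<lambda>l\<in>{..<n}. fst (\<omega> (f l))) \<in> samples S \<rightarrow>\<^sub>M iid n p"
    by (rule measurable_restrict, rule fst_measurable) (use f in auto)
  have "(\<lambda>\<omega>. \<lambda>l\<in>{..<n}. fst (\<omega> (f l))) -` (space (iid n p) - A) \<inter> space (samples S) = {\<omega> \<in> space (samples S). (\<lambda>l\<in>{..<n}. fst (\<omega> (f l))) \<notin> A}"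
    using measurable_space[OF m] by auto
  with measurable_sets[OF m sets.compl_sets[OF A]] show s: "{\<omega> \<in> space (samples S). (\<lambda>l\<in>{..<n}. fst (\<omega> (f l))) \<notin> A} \<in> sets (samples S)" by simp
  let ?E = "{\<omega> \<in> space (samples S). (\<lambda>l\<in>{..<n}. fst (\<omega> (f l))) \<notin> A}"
  let ?g = "\<lambda>x. \<lambda>l\<in>{..<n}. x (f l)"
  have gm: "?g \<in> PiM S (\<lambda>_. p) \<rightarrow>\<^sub>M iid n p"
    by (rule measurable_restrict, rule measurable_component_singleton) (use f in auto)
  have gd: "distr (PiM S (\<lambda>_. p)) (iid n p) ?g = iid n p"
    by (rule distr_PiM_reindex[where M="\<lambda>_. p", OF p f])
  let ?B = "?g -` (space (iid n p) - A) \<inter> space (PiM S (\<lambda>_. p))"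
  have Bm: "?B \<in> sets (PiM S (\<lambda>_. p))" by (rule measurable_sets[OF gm sets.compl_sets[OF A]])
  have "emeasure (samples S) ?E = (\<integral>\<^sup>+w. indicator ?E w \<partial>samples S)" using s by simp
  also have "\<dots> = (\<integral>\<^sup>+x. \<integral>\<^sup>+z. indicator ?E (\<lambda>i\<in>S. (x i, z i)) \<partial>noise \<sigma> S \<partial>PiM S (\<lambda>_. p))"
    by (rule nn_integral_PiM_pair[OF p prob_noise1 S]) (use s in simp)
  also have "\<dots> \<le> (\<integral>\<^sup>+x. \<integral>\<^sup>+z. indicator ?B x \<partial>noise \<sigma> S \<partial>PiM S (\<lambda>_. p))"
  proof (intro nn_integral_mono)
    fix x and z :: "'a \<Rightarrow> real" assume x: "x \<in> space (PiM S (\<lambda>_. p))"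
    have "(\<lambda>l\<in>{..<n}. fst ((\<lambda>i\<in>S. (x i, z i)) (f l))) = ?g x" using f by (auto simp: fun_eq_iff)
    then show "indicator ?E (\<lambda>i\<in>S. (x i, z i)) \<le> (indicator ?B x :: ennreal)"
      using x measurable_space[OF gm x] by (auto split: split_indicator)
  qed
  also have "\<dots> = (\<integral>\<^sup>+x. indicator ?B x \<partial>PiM S (\<lambda>_. p))"
    using prob_space.emeasure_space_1[OF prob_space_noise[OF \<sigma>, of S]] by simp
  also have "\<dots> = emeasure (PiM S (\<lambda>_. p)) ?B" using Bm by simp
  also have "\<dots> = emeasure (distr (PiM S (\<lambda>_. p)) (iid n p) ?g) (space (iid n p) - A)"
    by (rule emeasure_distr[OF gm sets.compl_sets[OF A], symmetric])
  also have "\<dots> = ennreal (1 - measure (iid n p) A)" unfolding gd using A by (simp add: I.emeasure_eq_measure I.prob_compl)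
  finally show "emeasure (samples S) ?E \<le> ennreal (1 - measure (iid n p) A)" .
qed

lemma kernel_event:
  assumes S: "finite S" and s: "s \<in> S"
  shows "{\<omega> \<in> space (samples S). fst (\<omega> s) \<notin> K} \<in> null_sets (samples S)"
proof -
  interpret p: prob_space p by (rule p)
  have m: "(\<lambda>\<omega>. fst (\<omega> s)) \<in> samples S \<rightarrow>\<^sub>M p" by (rule fst_measurable[OF s])
  have "(\<lambda>\<omega>. fst (\<omega> s)) -` (space p - K) \<inter> space (samples S) = {\<omega> \<in> space (samples S). fst (\<omega> s) \<notin> K}"
    using measurable_space[OF m] by auto
  with measurable_sets[OF m sets.compl_sets[OF K(1)]] have sE: "{\<omega> \<in> space (samples S). fst (\<omega> s) \<notin> K} \<in> sets (samples S)" by simp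
  let ?A = "{xs \<in> space (iid 1 p). xs 0 \<in> K}"
  have m0: "(\<lambda>xs. xs 0) \<in> iid 1 p \<rightarrow>\<^sub>M p" by (rule measurable_component_singleton) simp
  have Am: "?A \<in> sets (iid 1 p)" using measurable_sets[OF m0 K(1)] by (simp add: vimage_def Int_def conj_commute)
  have d: "distr (iid 1 p) p (\<lambda>xs. xs 0) = p"
    using distr_PiM_component[of "{..<1::nat}" "\<lambda>_. p" 0] p by simp
  have "measure (iid 1 p) ?A = measure (distr (iid 1 p) p (\<lambda>xs. xs 0)) K"
    by (subst measure_distr[OF m0 K(1)]) (auto intro!: arg_cong[where f="measure _"])
  then have A1': "measure (iid 1 p) ?A = 1" unfolding d using K(2) by simp
  have sub: "{\<omega> \<in> space (samples S). fst (\<omega> s) \<notin> K} \<subseteq> {\<omega> \<in> space (samples S). (\<lambda>l\<in>{..<1}. fst (\<omega> ((\<lambda>_. s) l))) \<notin> ?A}" by auto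
  have "emeasure (samples S) {\<omega> \<in> space (samples S). fst (\<omega> s) \<notin> K} \<le> emeasure (samples S) {\<omega> \<in> space (samples S). (\<lambda>l\<in>{..<1}. fst (\<omega> ((\<lambda>_. s) l))) \<notin> ?A}"
    by (rule emeasure_mono[OF sub inputs_event(1)[OF S _ _ Am]]) (use s in \<open>auto simp: inj_on_def\<close>)
  also have "\<dots> \<le> ennreal (1 - measure (iid 1 p) ?A)"
    by (rule inputs_event(2)[OF S _ _ Am]) (use s in \<open>auto simp: inj_on_def\<close>)
  finally show ?thesis using sE unfolding A1' by (simp add: null_sets_def)
qed

text \<open>Makes the tail exp(-t^2/5) equal to \<delta>/6, which with \<delta>/3 for the sandwich
  uses half of \<delta> in each stage.\<close>

definition dev :: real where
  "dev = sqrt (5 * ln (6 / \<delta>))"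

lemma dev_nonneg: "0 \<le> dev" and dev_sq: "dev\<^sup>2 = 5 * ln (6 / \<delta>)" and exp_dev: "exp (- dev\<^sup>2 / 5) = \<delta> / 6"
proof -
  have "0 \<le> ln (6 / \<delta>)" using \<delta> by simp
  then show "0 \<le> dev" and d: "dev\<^sup>2 = 5 * ln (6 / \<delta>)" by (simp_all add: dev_def)
  have "exp (- dev\<^sup>2 / 5) = inverse (exp (ln (6 / \<delta>)))" unfolding d by (simp add: exp_minus)
  also have "\<dots> = \<delta> / 6" using \<delta> by simp
  finally show "exp (- dev\<^sup>2 / 5) = \<delta> / 6" .
qed

lemma input_dependence:
  assumes "\<And>s. fst (\<omega> s) = fst (\<omega>' s)"
  shows "pairvec \<omega> = pairvec \<omega>'" "targetvec j \<omega> = targetvec j \<omega>'" "Fam \<omega> = Fam \<omega>'" "goodX \<omega> = goodX \<omega>'"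
    "clean k \<phi>s Ws \<omega> = clean k \<phi>s Ws \<omega>'" "tuples \<omega> = tuples \<omega>'"
proof -
  have t: "tup k \<phi> c \<omega> = tup k \<phi> c \<omega>'" for \<phi> c by (simp add: tup_def fun_eq_iff assms)
  show "pairvec \<omega> = pairvec \<omega>'" by (simp add: pairvec_def fun_eq_iff assms)
  show "targetvec j \<omega> = targetvec j \<omega>'" by (simp add: targetvec_def fun_eq_iff assms)
  show "Fam \<omega> = Fam \<omega>'" by (simp add: Fam_def fun_eq_iff t)
  show "goodX \<omega> = goodX \<omega>'" by (simp add: goodX_def assms)
  show "clean k \<phi>s Ws \<omega> = clean k \<phi>s Ws \<omega>'" by (simp add: clean_def fun_eq_iff assms)
  show "tuples \<omega> = tuples \<omega>'" by (simp add: tuples_def t)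
qed

text \<open>A sample with the given inputs and zero noise, at which input-dependent quantities are
  evaluated without reference to z. Off S its input copies the default of \<open>restrict\<close>,
  so that it agrees with zipped samples everywhere.\<close>

definition inputs_of :: "(nat \<times> nat) set \<Rightarrow> (nat \<times> nat \<Rightarrow> vec) \<Rightarrow> sample" where
  "inputs_of S x s = (if s \<in> S then x s else fst (undefined :: vec \<times> real), 0)"

lemma fst_zip:
  fixes z :: "nat \<times> nat \<Rightarrow> real"
  shows "fst ((\<lambda>s\<in>S. (x s, z s)) s) = fst (inputs_of S x s)"
  by (simp add: inputs_of_def)

lemma dot_snd_zip: "dot S v (\<lambda>s. snd ((\<lambda>s\<in>S. (x s, z s)) s)) = dot S v z"
  unfolding dot_def by (intro sum.cong) auto

definition source_ok :: "sample \<Rightarrow> bool" where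
  "source_ok \<omega> \<longleftrightarrow> goodX \<omega> \<and> \<not> ambiguous_fit T n1 (Fam \<omega>) (resp \<omega>) \<and> \<not> deficient_fit T n1 (Fam \<omega>) (resp \<omega>) \<and>
     (\<forall>i. dot S1 (normalise S1 (pairvec \<omega> i)) (\<lambda>s. snd (\<omega> s)) \<le> \<sigma> * (width \<omega> + dev))"

text \<open>T sandwich events at \<delta>/(3T) cost \<delta>/3, the noise deviation costs
  \<delta>/6, and bad fits cost nothing. The last two are bounded conditionally on the
  inputs.\<close>

lemma source_event:
  "\<exists>E\<in>sets (samples S1). emeasure (samples S1) (space (samples S1) - E) \<le> ennreal (\<delta> / 2) \<and> (\<forall>\<omega>\<in>E. source_ok \<omega>)"
proof -
  let ?M = "samples S1"
  define Xb where "Xb t = {\<omega> \<in> space ?M. (\<lambda>l\<in>{..<n1}. fst (\<omega> (t, l))) \<notin> A1s}" for t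
  define Kb where "Kb s = {\<omega> \<in> space ?M. fst (\<omega> s) \<notin> K}" for s
  define G where "G = space ?M - (\<Union>t\<in>{1..T}. Xb t) - (\<Union>s\<in>S1. Kb s)"
  define Nb where "Nb = {\<omega> \<in> space ?M. \<exists>i. \<not> dot S1 (normalise S1 (pairvec \<omega> i)) (\<lambda>s. snd (\<omega> s)) \<le> \<sigma> * (width \<omega> + dev)}"
  \<comment> \<open>Bad fits are null only for inputs whose tuples form a fit family; intersecting
    with \<open>G\<close> makes the conditional measure zero for every x.\<close>
  define Fb where "Fb = G \<inter> {\<omega> \<in> space ?M. ambiguous_fit T n1 (Fam \<omega>) (resp \<omega>) \<or> deficient_fit T n1 (Fam \<omega>) (resp \<omega>)}"
  have Xm: "Xb t \<in> sets ?M" and Xe: "emeasure ?M (Xb t) \<le> ennreal (\<delta> / (3 * real T))" if t: "t \<in> {1..T}" for t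
  proof -
    have i: "inj_on (\<lambda>l. (t, l)) {..<n1}" "(\<lambda>l. (t, l)) \<in> {..<n1} \<rightarrow> S1" using t by (auto simp: inj_on_def)
    show "Xb t \<in> sets ?M" unfolding Xb_def by (rule inputs_event(1)[OF _ i A1(1)]) simp
    have "emeasure ?M (Xb t) \<le> ennreal (1 - measure (iid n1 p) A1s)" unfolding Xb_def by (rule inputs_event(2)[OF _ i A1(1)]) simp
    also have "\<dots> \<le> ennreal (\<delta> / (3 * real T))" using A1(2) by (intro ennreal_leI) linarith
    finally show "emeasure ?M (Xb t) \<le> ennreal (\<delta> / (3 * real T))" .
  qed
  have Kn: "Kb s \<in> null_sets ?M" if "s \<in> S1" for s unfolding Kb_def by (rule kernel_event[OF _ that]) simp
  have Km: "Kb s \<in> sets ?M" if "s \<in> S1" for s using Kn[OF that] by auto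
  have Gm: "G \<in> sets ?M" unfolding G_def by (intro sets.Diff sets.top sets.finite_UN Xm Km) auto
  have Gg: "goodX \<omega>" if "\<omega> \<in> G" for \<omega> using that by (auto simp: G_def goodX_def Xb_def Kb_def)
  have Nm: "Nb \<in> sets ?M" unfolding Nb_def
    by (intro predE pred_intros_countable pred_intros_logic borel_measurable_le[unfolded pred_def[symmetric]] source_dev_measurable
        borel_measurable_times borel_measurable_add borel_measurable_const width_measurable)
  have Fm: "Fb \<in> sets ?M" unfolding Fb_def
    by (intro sets.Int Gm predE pred_intros_logic ambiguous_measurable deficient_measurable)
  have Ne: "emeasure ?M Nb \<le> ennreal (\<delta> / 6)"
  proof (rule emeasure_zip_le[OF p prob_noise1 _ Nm])
    fix x assume x: "x \<in> space (PiM S1 (\<lambda>_. p))"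
    let ?w = "inputs_of S1 x"
    have eqs: "pairvec (\<lambda>s\<in>S1. (x s, z s)) = pairvec ?w" for z :: "nat \<times> nat \<Rightarrow> real" by (rule input_dependence(1)[OF fst_zip])
    have "{z \<in> space (noise \<sigma> S1). (\<lambda>s\<in>S1. (x s, z s)) \<in> Nb}
       \<subseteq> {z \<in> space (noise \<sigma> S1). \<exists>i. dot S1 (normalise S1 (pairvec ?w i)) z > \<sigma> * ((\<integral>z. (SUP i. dot S1 (normalise S1 (pairvec ?w i)) z) \<partial>gauss S1) + dev)}"
    proof safe
      fix z assume z: "z \<in> space (noise \<sigma> S1)" "(\<lambda>s\<in>S1. (x s, z s)) \<in> Nb"
      then obtain i where "\<not> dot S1 (normalise S1 (pairvec (\<lambda>s\<in>S1. (x s, z s)) i)) (\<lambda>s. snd ((\<lambda>s\<in>S1. (x s, z s)) s))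
          \<le> \<sigma> * (width (\<lambda>s\<in>S1. (x s, z s)) + dev)" unfolding Nb_def by blast
      then have "\<sigma> * ((\<integral>z. (SUP i. dot S1 (normalise S1 (pairvec ?w i)) z) \<partial>gauss S1) + dev) < dot S1 (normalise S1 (pairvec ?w i)) z"
        unfolding eqs dot_snd_zip not_le .
      then show "\<exists>i. dot S1 (normalise S1 (pairvec ?w i)) z > \<sigma> * ((\<integral>z. (SUP i. dot S1 (normalise S1 (pairvec ?w i)) z) \<partial>gauss S1) + dev)"
        by (intro exI[of _ i])
    qed
    then have "emeasure (noise \<sigma> S1) {z \<in> space (noise \<sigma> S1). (\<lambda>s\<in>S1. (x s, z s)) \<in> Nb}
       \<le> emeasure (noise \<sigma> S1) {z \<in> space (noise \<sigma> S1). \<exists>i. dot S1 (normalise S1 (pairvec ?w i)) z > \<sigma> * ((\<integral>z. (SUP i. dot S1 (normalise S1 (pairvec ?w i)) z) \<partial>gauss S1) + dev)}"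
      by (rule emeasure_mono[OF _ noise_exceed_sets]) simp
    also have "\<dots> \<le> ennreal (exp (- dev\<^sup>2 / 5))"
      by (rule noise_Sup_deviation[OF _ normalise_le_1 dev_nonneg \<sigma>]) simp
    finally show "emeasure (noise \<sigma> S1) {z \<in> space (noise \<sigma> S1). (\<lambda>s\<in>S1. (x s, z s)) \<in> Nb} \<le> ennreal (\<delta> / 6)" unfolding exp_dev .
  qed simp
  have Fe: "emeasure ?M Fb \<le> 0"
  proof (rule emeasure_zip_le[OF p prob_noise1 _ Fm])
    fix x assume x: "x \<in> space (PiM S1 (\<lambda>_. p))"
    let ?w = "inputs_of S1 x"
    let ?B = "{z \<in> space (noise \<sigma> S1). (\<lambda>s\<in>S1. (x s, z s)) \<in> Fb}"
    note eqs = input_dependence[of "\<lambda>s\<in>S1. (x s, z s)" "inputs_of S1 x" for z :: "nat \<times> nat \<Rightarrow> real", OF fst_zip]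
    show "emeasure (noise \<sigma> S1) ?B \<le> 0"
    proof (cases "goodX ?w")
      case False
      then have "?B = {}" using Gg eqs(4) unfolding Fb_def by blast
      then show ?thesis by (simp only: emeasure_empty)
    next
      case True
      obtain N where N: "N \<in> null_sets (noise \<sigma> S1)"
        "\<And>y. ambiguous_fit T n1 (Fam ?w) y \<or> deficient_fit T n1 (Fam ?w) y \<Longrightarrow> restrict (\<lambda>s. y s - clean k \<phi>s Ws ?w s) S1 \<in> N"
        using bad_fit_null[where Fam="Fam ?w" and a="clean k \<phi>s Ws ?w", OF T1 n1 fit_family_tuples[OF True] \<sigma> Fam_tuples tuple_dense_tuples[OF True]] by blast
      have "?B \<subseteq> N"
      proof
        fix z assume "z \<in> ?B"
        then have z: "z \<in> space (noise \<sigma> S1)" and "(\<lambda>s\<in>S1. (x s, z s)) \<in> Fb" by auto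
        from this(2) have "ambiguous_fit T n1 (Fam (\<lambda>s\<in>S1. (x s, z s))) (resp (\<lambda>s\<in>S1. (x s, z s))) \<or> deficient_fit T n1 (Fam (\<lambda>s\<in>S1. (x s, z s))) (resp (\<lambda>s\<in>S1. (x s, z s)))"
          unfolding Fb_def by blast
        then have "ambiguous_fit T n1 (Fam ?w) (resp (\<lambda>s\<in>S1. (x s, z s))) \<or> deficient_fit T n1 (Fam ?w) (resp (\<lambda>s\<in>S1. (x s, z s)))"
          unfolding eqs(3) .
        from N(2)[OF this] have "restrict (\<lambda>s. resp (\<lambda>s\<in>S1. (x s, z s)) s - clean k \<phi>s Ws ?w s) S1 \<in> N" .
        \<comment> \<open>Subtracting the noiseless signal from the response returns the noise; off
          S1 both sides are undefined.\<close>
        moreover have "restrict (\<lambda>s. resp (\<lambda>s\<in>S1. (x s, z s)) s - clean k \<phi>s Ws ?w s) S1 = z"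
        proof
          fix s
          show "restrict (\<lambda>s. resp (\<lambda>s\<in>S1. (x s, z s)) s - clean k \<phi>s Ws ?w s) S1 s = z s"
          proof (cases "s \<in> S1")
            case True
            then show ?thesis unfolding response_def eqs(5) by simp
          next
            case False
            then have "z s = undefined" using z unfolding space_PiM by (intro PiE_arb)
            then show ?thesis unfolding restrict_def using False by simp
          qed
        qed
        ultimately show "z \<in> N" by simp
      qed
      then have "emeasure (noise \<sigma> S1) ?B \<le> emeasure (noise \<sigma> S1) N" using N(1) by (intro emeasure_mono) auto
      also have "\<dots> = 0" using N(1) by auto
      finally show ?thesis .
    qed
  qed simp
  let ?E = "G - Nb - Fb"
  show ?thesis
  proof (intro bexI[of _ ?E] conjI ballI)
    show "?E \<in> sets ?M" by (intro sets.Diff Gm Nm Fm)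
    fix \<omega> assume w: "\<omega> \<in> ?E"
    then have "\<omega> \<in> space ?M" unfolding G_def by blast
    then show "source_ok \<omega>" using w Gg unfolding source_ok_def Nb_def Fb_def by blast
  next
    have Xum: "(\<Union>t\<in>{1..T}. Xb t) \<in> sets ?M" by (intro sets.finite_UN Xm) auto
    have Kun: "(\<Union>s\<in>S1. Kb s) \<in> null_sets ?M" by (intro null_sets_UN' countable_finite Kn) auto
    have "emeasure ?M (\<Union>t\<in>{1..T}. Xb t) \<le> (\<Sum>t\<in>{1..T}. emeasure ?M (Xb t))"
      by (intro emeasure_subadditive_finite) (use Xm in auto)
    also have "\<dots> \<le> (\<Sum>t\<in>{1..T}. ennreal (\<delta> / (3 * real T)))" by (intro sum_mono Xe)
    also have "\<dots> = ennreal (\<Sum>t\<in>{1..T}. \<delta> / (3 * real T))" using \<delta> by (intro sum_ennreal) auto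
    also have "(\<Sum>t\<in>{1..T}. \<delta> / (3 * real T)) = \<delta> / 3" using T1 by simp
    finally have Xue: "emeasure ?M (\<Union>t\<in>{1..T}. Xb t) \<le> ennreal (\<delta> / 3)" .
    have "space ?M - ?E \<subseteq> (((\<Union>t\<in>{1..T}. Xb t) \<union> (\<Union>s\<in>S1. Kb s)) \<union> Nb) \<union> Fb" unfolding G_def by blast
    then have "emeasure ?M (space ?M - ?E) \<le> emeasure ?M ((((\<Union>t\<in>{1..T}. Xb t) \<union> (\<Union>s\<in>S1. Kb s)) \<union> Nb) \<union> Fb)"
      by (rule emeasure_mono) (use Xum Kun Nm Fm in \<open>auto intro!: sets.Un simp del: UN_simps\<close>)
    also have "\<dots> \<le> emeasure ?M (((\<Union>t\<in>{1..T}. Xb t) \<union> (\<Union>s\<in>S1. Kb s)) \<union> Nb) + emeasure ?M Fb"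
      by (rule emeasure_subadditive) (use Xum null_setsD2[OF Kun] Nm Fm in blast)+
    also have "\<dots> \<le> (emeasure ?M ((\<Union>t\<in>{1..T}. Xb t) \<union> (\<Union>s\<in>S1. Kb s)) + emeasure ?M Nb) + 0"
      by (intro add_mono Fe emeasure_subadditive) (use Xum null_setsD2[OF Kun] Nm in blast)+
    also have "emeasure ?M ((\<Union>t\<in>{1..T}. Xb t) \<union> (\<Union>s\<in>S1. Kb s)) = emeasure ?M (\<Union>t\<in>{1..T}. Xb t)"
      by (rule emeasure_Un_null_set[OF Xum Kun])
    also have "(emeasure ?M (\<Union>t\<in>{1..T}. Xb t) + emeasure ?M Nb) + 0 \<le> ennreal (\<delta> / 3) + ennreal (\<delta> / 6)"
      using add_mono[OF Xue Ne] by simp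
    also have "\<dots> = ennreal (\<delta> / 2)" using \<delta> by (simp add: ennreal_plus[symmetric] del: ennreal_plus)
    finally show "emeasure ?M (space ?M - ?E) \<le> ennreal (\<delta> / 2)" .
  qed
qed

abbreviation target_dev :: real where
  "target_dev \<equiv> \<sigma> * (3 * sqrt (real k) + dev)"

text \<open>For a fixed index j the feature is fixed and the pointwise sandwich applies. Its values
  at the target inputs lie in a k-dimensional span, whence 3 sqrt k.\<close>

lemma target_event:
  "\<exists>H\<in>sets (samples S2). emeasure (samples S2) (space (samples S2) - H) \<le> ennreal (\<delta> / 2) \<and> (\<forall>\<omega>\<in>H. goodT target_dev j \<omega>)"
proof -
  let ?M = "samples S2"
  define Xb where "Xb = {\<omega> \<in> space ?M. (\<lambda>l\<in>{..<n2}. fst (\<omega> (Suc T, l))) \<notin> A2 j}"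
  define Kb where "Kb s = {\<omega> \<in> space ?M. fst (\<omega> s) \<notin> K}" for s
  define Nb where "Nb = {\<omega> \<in> space ?M. \<exists>i. \<not> dot S2 (normalise S2 (targetvec j \<omega> i)) (\<lambda>s. snd (\<omega> s)) \<le> target_dev}"
  have i: "inj_on (\<lambda>l. (Suc T, l)) {..<n2}" "(\<lambda>l. (Suc T, l)) \<in> {..<n2} \<rightarrow> S2" by (auto simp: inj_on_def)
  have Xm: "Xb \<in> sets ?M" unfolding Xb_def by (rule inputs_event(1)[OF _ i A2(1)]) simp
  have "emeasure ?M Xb \<le> ennreal (1 - measure (iid n2 p) (A2 j))" unfolding Xb_def by (rule inputs_event(2)[OF _ i A2(1)]) simp
  also have "\<dots> \<le> ennreal (\<delta> / 3)" using A2(2)[of j] by (intro ennreal_leI) linarith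
  finally have Xe: "emeasure ?M Xb \<le> ennreal (\<delta> / 3)" .
  have Kn: "Kb s \<in> null_sets ?M" if "s \<in> S2" for s unfolding Kb_def by (rule kernel_event[OF _ that]) simp
  have Kun: "(\<Union>s\<in>S2. Kb s) \<in> null_sets ?M" by (intro null_sets_UN' countable_finite Kn) auto
  have Nm: "Nb \<in> sets ?M" unfolding Nb_def
    by (intro predE pred_intros_countable pred_intros_logic borel_measurable_le[unfolded pred_def[symmetric]] dot_measurable normalise_measurable
        targetvec_measurable snd_measurable borel_measurable_const) auto
  have Ne: "emeasure ?M Nb \<le> ennreal (\<delta> / 6)"
  proof (rule emeasure_zip_le[OF p prob_noise1 _ Nm])
    fix x assume x: "x \<in> space (PiM S2 (\<lambda>_. p))"
    let ?w = "inputs_of S2 x"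
    let ?v = "\<lambda>i. normalise S2 (targetvec j ?w i)"
    have eqs: "targetvec j (\<lambda>s\<in>S2. (x s, z s)) = targetvec j ?w" for z :: "nat \<times> nat \<Rightarrow> real" by (rule input_dependence(2)[OF fst_zip])
    have wid: "(\<integral>z. (SUP i. dot S2 (?v i) z) \<partial>gauss S2) \<le> 3 * sqrt (real k)"
    proof (rule gauss_Sup_subspace[OF _ normalise_le_1])
      fix i
      have "?v i = (\<lambda>s. \<Sum>l<k. ((1 / nrm S2 (targetvec j ?w i)) * cseq i 0 l) * \<phi>seq j (fst (?w s)) l)"
        unfolding normalise_def targetvec_def ip_def by (simp only: sum_distrib_left mult.assoc)
      then show "\<exists>c. ?v i = (\<lambda>s. \<Sum>l<k. c l * \<phi>seq j (fst (?w s)) l)"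
        by (intro exI[of _ "\<lambda>l. (1 / nrm S2 (targetvec j ?w i)) * cseq i 0 l"])
    qed (use k1 in auto)
    have "{z \<in> space (noise \<sigma> S2). (\<lambda>s\<in>S2. (x s, z s)) \<in> Nb}
       \<subseteq> {z \<in> space (noise \<sigma> S2). \<exists>i. dot S2 (?v i) z > \<sigma> * ((\<integral>z. (SUP i. dot S2 (?v i) z) \<partial>gauss S2) + dev)}"
    proof safe
      fix z assume z: "z \<in> space (noise \<sigma> S2)" "(\<lambda>s\<in>S2. (x s, z s)) \<in> Nb"
      then obtain i where "\<not> dot S2 (normalise S2 (targetvec j (\<lambda>s\<in>S2. (x s, z s)) i)) (\<lambda>s. snd ((\<lambda>s\<in>S2. (x s, z s)) s)) \<le> target_dev"
        unfolding Nb_def by blast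
      then have "target_dev < dot S2 (?v i) z" unfolding eqs dot_snd_zip not_le .
      moreover have "\<sigma> * ((\<integral>z. (SUP i. dot S2 (?v i) z) \<partial>gauss S2) + dev) \<le> target_dev" using wid \<sigma> by (intro mult_left_mono) auto
      ultimately show "\<exists>i. dot S2 (?v i) z > \<sigma> * ((\<integral>z. (SUP i. dot S2 (?v i) z) \<partial>gauss S2) + dev)" by (intro exI[of _ i]) linarith
    qed
    then have "emeasure (noise \<sigma> S2) {z \<in> space (noise \<sigma> S2). (\<lambda>s\<in>S2. (x s, z s)) \<in> Nb}
       \<le> emeasure (noise \<sigma> S2) {z \<in> space (noise \<sigma> S2). \<exists>i. dot S2 (?v i) z > \<sigma> * ((\<integral>z. (SUP i. dot S2 (?v i) z) \<partial>gauss S2) + dev)}"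
      by (rule emeasure_mono[OF _ noise_exceed_sets]) simp
    also have "\<dots> \<le> ennreal (exp (- dev\<^sup>2 / 5))"
      by (rule noise_Sup_deviation[OF _ normalise_le_1 dev_nonneg \<sigma>]) simp
    finally show "emeasure (noise \<sigma> S2) {z \<in> space (noise \<sigma> S2). (\<lambda>s\<in>S2. (x s, z s)) \<in> Nb} \<le> ennreal (\<delta> / 6)" unfolding exp_dev .
  qed simp
  let ?H = "space ?M - (Xb \<union> (\<Union>s\<in>S2. Kb s) \<union> Nb)"
  have um: "Xb \<union> (\<Union>s\<in>S2. Kb s) \<union> Nb \<in> sets ?M" using Xm null_setsD2[OF Kun] Nm by blast
  show ?thesis
  proof (intro bexI[of _ ?H] conjI ballI)
    show "?H \<in> sets ?M" by (rule sets.compl_sets[OF um])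
    show "goodT target_dev j \<omega>" if "\<omega> \<in> ?H" for \<omega>
      using that unfolding goodT_def Xb_def Kb_def Nb_def by blast
    have "space ?M - ?H \<subseteq> Xb \<union> (\<Union>s\<in>S2. Kb s) \<union> Nb" by blast
    then have "emeasure ?M (space ?M - ?H) \<le> emeasure ?M (Xb \<union> (\<Union>s\<in>S2. Kb s) \<union> Nb)" by (rule emeasure_mono[OF _ um])
    also have "\<dots> \<le> emeasure ?M (Xb \<union> (\<Union>s\<in>S2. Kb s)) + emeasure ?M Nb"
      by (rule emeasure_subadditive) (use Xm null_setsD2[OF Kun] Nm in blast)+
    also have "emeasure ?M (Xb \<union> (\<Union>s\<in>S2. Kb s)) = emeasure ?M Xb" by (rule emeasure_Un_null_set[OF Xm Kun])
    also have "emeasure ?M Xb + emeasure ?M Nb \<le> ennreal (\<delta> / 3) + ennreal (\<delta> / 6)" by (rule add_mono[OF Xe Ne])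
    also have "\<dots> = ennreal (\<delta> / 2)" using \<delta> by (simp add: ennreal_plus[symmetric] del: ennreal_plus)
    finally show "emeasure ?M (space ?M - ?H) \<le> ennreal (\<delta> / 2)" .
  qed
qed

text \<open>By independence the selected index can be frozen: given the source sample, its target
  event fails with probability at most \<delta>/2. Failure for all large m is an increasing union of
  sets, each inside a single failure event, and keeps the bound \<delta>/2.\<close>

lemma good_event:
  "\<exists>A\<in>sets (sample_space p \<sigma> T n1 n2). 1 - \<delta> \<le> measure (sample_space p \<sigma> T n1 n2) A \<and>
     (\<forall>\<omega>\<in>A. source_ok (restrict \<omega> S1) \<and> (\<exists>\<^sub>\<infinity>m. goodT target_dev (psel (restrict \<omega> S1) m) (restrict \<omega> S2)))"
proof -
  let ?O = "samples (S1 \<union> S2)"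
  have O: "sample_space p \<sigma> T n1 n2 = ?O" by (simp add: sample_space_def)
  interpret smp: prob_space smp by (rule prob_smp)
  interpret product_sigma_finite "\<lambda>_. smp" by standard
  interpret PO: prob_space ?O by (rule prob_space_PiM) (rule prob_smp)
  interpret P1: prob_space "samples S1" by (rule prob_space_PiM) (rule prob_smp)
  have disj: "S1 \<inter> S2 = {}" by auto
  obtain E where E: "E \<in> sets (samples S1)" "emeasure (samples S1) (space (samples S1) - E) \<le> ennreal (\<delta> / 2)" "\<And>\<omega>. \<omega> \<in> E \<Longrightarrow> source_ok \<omega>"
    using source_event by blast
  have "\<forall>j. \<exists>H. H \<in> sets (samples S2) \<and> emeasure (samples S2) (space (samples S2) - H) \<le> ennreal (\<delta> / 2) \<and> (\<forall>\<omega>\<in>H. goodT target_dev j \<omega>)"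
    using target_event by blast
  from choice[OF this] obtain H where H: "\<And>j. H j \<in> sets (samples S2)" "\<And>j. emeasure (samples S2) (space (samples S2) - H j) \<le> ennreal (\<delta> / 2)"
    "\<And>j \<omega>. \<omega> \<in> H j \<Longrightarrow> goodT target_dev j \<omega>" by blast
  have r1: "(\<lambda>\<omega>. restrict \<omega> S1) \<in> ?O \<rightarrow>\<^sub>M samples S1" by (rule measurable_restrict_subset) auto
  have r2: "(\<lambda>\<omega>. restrict \<omega> S2) \<in> ?O \<rightarrow>\<^sub>M samples S2" by (rule measurable_restrict_subset) auto
  \<comment> \<open>\<open>psel\<close> takes countably many values, so each failure event is a
    countable union of rectangles.\<close>
  define Q where "Q m j = {\<omega> \<in> space (samples S1). psel \<omega> m = j}" for m j
  have Qm: "Q m j \<in> sets (samples S1)" for m j unfolding Q_def by (rule predE[OF psel_measurable])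
  define C where "C m = {\<omega> \<in> space ?O. restrict \<omega> S2 \<notin> H (psel (restrict \<omega> S1) m)}" for m
  define D where "D = {\<omega> \<in> space ?O. restrict \<omega> S1 \<notin> E}"
  have Cm: "C m \<in> sets ?O" for m
  proof -
    have "C m = (\<Union>j. ((\<lambda>\<omega>. restrict \<omega> S1) -` Q m j \<inter> space ?O) \<inter> ((\<lambda>\<omega>. restrict \<omega> S2) -` (space (samples S2) - H j) \<inter> space ?O))"
      using measurable_space[OF r1] measurable_space[OF r2] by (auto simp: C_def Q_def)
    also have "\<dots> \<in> sets ?O"
    proof (rule sets.countable_UN, rule image_subsetI)
      fix j
      show "((\<lambda>\<omega>. restrict \<omega> S1) -` Q m j \<inter> space ?O) \<inter> ((\<lambda>\<omega>. restrict \<omega> S2) -` (space (samples S2) - H j) \<inter> space ?O) \<in> sets ?O"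
        by (rule sets.Int[OF measurable_sets[OF r1 Qm] measurable_sets[OF r2 sets.compl_sets[OF H(1)]]])
    qed
    finally show ?thesis .
  qed
  have Dm: "D \<in> sets ?O" and De: "emeasure ?O D \<le> ennreal (\<delta> / 2)"
  proof -
    have e: "D = (\<lambda>\<omega>. restrict \<omega> S1) -` (space (samples S1) - E) \<inter> space ?O"
      using measurable_space[OF r1] by (auto simp: D_def)
    show "D \<in> sets ?O" unfolding e by (rule measurable_sets[OF r1 sets.compl_sets[OF E(1)]])
    have "emeasure ?O D = emeasure (distr ?O (samples S1) (\<lambda>\<omega>. restrict \<omega> S1)) (space (samples S1) - E)"
      unfolding e by (rule emeasure_distr[OF r1 sets.compl_sets[OF E(1)], symmetric])
    also have "distr ?O (samples S1) (\<lambda>\<omega>. restrict \<omega> S1) = samples S1"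
      using distr_PiM_reindex[of "S1 \<union> S2" "\<lambda>_. smp" id S1] prob_smp by (simp add: inj_on_def restrict_def id_def)
    finally show "emeasure ?O D \<le> ennreal (\<delta> / 2)" using E(2) by simp
  qed
  have Ce: "emeasure ?O (C m) \<le> ennreal (\<delta> / 2)" for m
  proof -
    have "emeasure ?O (C m) = (\<integral>\<^sup>+\<omega>. indicator (C m) \<omega> \<partial>?O)" using Cm by simp
    also have "\<dots> = (\<integral>\<^sup>+x. \<integral>\<^sup>+y. indicator (C m) (merge S1 S2 (x, y)) \<partial>samples S2 \<partial>samples S1)"
      by (rule product_nn_integral_fold[OF disj]) (use Cm in auto)
    also have "\<dots> \<le> (\<integral>\<^sup>+x. ennreal (\<delta> / 2) \<partial>samples S1)"
    proof (rule nn_integral_mono)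
      fix x assume x: "x \<in> space (samples S1)"
      have "(\<integral>\<^sup>+y. indicator (C m) (merge S1 S2 (x, y)) \<partial>samples S2) \<le> (\<integral>\<^sup>+y. indicator (space (samples S2) - H (psel x m)) y \<partial>samples S2)"
      proof (rule nn_integral_mono)
        fix y assume y: "y \<in> space (samples S2)"
        have "restrict x S1 = x" "restrict y S2 = y" using x y by (auto simp: space_PiM PiE_iff extensional_restrict)
        moreover have "restrict (merge S1 S2 (x, y)) S1 = restrict x S1" "restrict (merge S1 S2 (x, y)) S2 = restrict y S2"
          by (rule restrict_merge[OF disj])+
        ultimately have "merge S1 S2 (x, y) \<in> C m \<Longrightarrow> y \<notin> H (psel x m)" unfolding C_def by (simp only: mem_Collect_eq not_False_eq_True simp_thms)
        then show "indicator (C m) (merge S1 S2 (x, y)) \<le> (indicator (space (samples S2) - H (psel x m)) y :: ennreal)"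
          using y by (auto split: split_indicator)
      qed
      also have "\<dots> = emeasure (samples S2) (space (samples S2) - H (psel x m))" using H(1) by simp
      also have "\<dots> \<le> ennreal (\<delta> / 2)" by (rule H(2))
      finally show "(\<integral>\<^sup>+y. indicator (C m) (merge S1 S2 (x, y)) \<partial>samples S2) \<le> ennreal (\<delta> / 2)" .
    qed
    also have "\<dots> = ennreal (\<delta> / 2)" by (simp only: nn_integral_const P1.emeasure_space_1 mult_1_right)
    finally show ?thesis .
  qed
  \<comment> \<open>Failure at every m \<ge> N, contained in the one event
    \<open>C N\<close>.\<close>
  define R where "R N = (\<Inter>m\<in>{N..}. C m)" for N :: nat
  have Rm: "R N \<in> sets ?O" for N unfolding R_def using Cm by (intro sets.countable_INT') auto
  have "incseq R" unfolding R_def by (intro monoI INF_superset_mono) auto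
  then have "emeasure ?O (\<Union>N. R N) = (SUP N. emeasure ?O (R N))" using Rm by (intro SUP_emeasure_incseq[symmetric]) auto
  also have "\<dots> \<le> ennreal (\<delta> / 2)"
  proof (rule SUP_least)
    fix N
    have "emeasure ?O (R N) \<le> emeasure ?O (C N)" unfolding R_def by (intro emeasure_mono Cm) auto
    then show "emeasure ?O (R N) \<le> ennreal (\<delta> / 2)" using Ce order_trans by blast
  qed
  finally have Re: "emeasure ?O (\<Union>N. R N) \<le> ennreal (\<delta> / 2)" .
  have Rum: "(\<Union>N. R N) \<in> sets ?O" using Rm by auto
  let ?A = "space ?O - (D \<union> (\<Union>N. R N))"
  show ?thesis unfolding O
  proof (intro bexI[of _ ?A] conjI ballI)
    show Am: "?A \<in> sets ?O" using Dm Rum by auto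
    have "emeasure ?O (D \<union> (\<Union>N. R N)) \<le> emeasure ?O D + emeasure ?O (\<Union>N. R N)" by (rule emeasure_subadditive[OF Dm Rum])
    also have "\<dots> \<le> ennreal (\<delta> / 2) + ennreal (\<delta> / 2)" by (rule add_mono[OF De Re])
    also have "\<dots> = ennreal \<delta>" using \<delta> by (simp add: ennreal_plus[symmetric] del: ennreal_plus)
    finally have "measure ?O (D \<union> (\<Union>N. R N)) \<le> \<delta>" unfolding PO.emeasure_eq_measure using \<delta> by (simp only: ennreal_le_iff less_imp_le)
    then show "1 - \<delta> \<le> measure ?O ?A" unfolding PO.prob_compl[OF sets.Un[OF Dm Rum]] by linarith
    fix \<omega> assume w: "\<omega> \<in> ?A"
    then show "source_ok (restrict \<omega> S1)" by (intro E(3)) (auto simp: D_def)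
    show "\<exists>\<^sub>\<infinity>m. goodT target_dev (psel (restrict \<omega> S1) m) (restrict \<omega> S2)"
      unfolding INFM_nat_le
    proof
      fix N
      have "\<omega> \<notin> R N" using w by blast
      then obtain m where "N \<le> m" "\<omega> \<notin> C m" unfolding R_def by auto
      then show "\<exists>m\<ge>N. goodT target_dev (psel (restrict \<omega> S1) m) (restrict \<omega> S2)" using w H(3) unfolding C_def by blast
    qed
  qed
qed

end

subsection \<open>Averaging over the target task\<close>

lemma sing_k_sq_lower:
  "sing_k_sq k T W * (\<Sum>j<k. (u j)\<^sup>2) \<le> (\<Sum>t\<in>{1..T}. (ip k u (W t))\<^sup>2)"
proof (cases "(\<Sum>j<k. (u j)\<^sup>2) = 0")
  case True
  then show ?thesis by (simp only: True mult_zero_right) (intro sum_nonneg; simp)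
next
  case False
  define q where "q = (\<Sum>j<k. (u j)\<^sup>2)"
  define v where "v = (\<lambda>j. (1 / sqrt q) * u j)"
  have q: "0 < q" using False unfolding q_def by (simp add: less_le sum_nonneg)
  have v: "(\<Sum>j<k. (v j)\<^sup>2) = 1" unfolding v_def power_mult_distrib sum_distrib_left[symmetric] q_def[symmetric]
    using q by (simp add: power_divide)
  have "sing_k_sq k T W \<le> (\<Sum>t\<in>{1..T}. (ip k v (W t))\<^sup>2)" unfolding sing_k_sq_def
  proof (rule cInf_lower)
    show "bdd_below {(\<Sum>t\<in>{1..T}. (ip k u (W t))\<^sup>2) |u. (\<Sum>j<k. (u j)\<^sup>2) = 1}"
      by (intro bdd_belowI[of _ 0]) (auto intro: sum_nonneg)
    show "(\<Sum>t\<in>{1..T}. (ip k v (W t))\<^sup>2) \<in> {(\<Sum>t\<in>{1..T}. (ip k u (W t))\<^sup>2) |u. (\<Sum>j<k. (u j)\<^sup>2) = 1}" using v by blast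
  qed
  also have "\<dots> = (1 / q) * (\<Sum>t\<in>{1..T}. (ip k u (W t))\<^sup>2)"
    unfolding v_def ip_scale_left power_mult_distrib sum_distrib_left[symmetric] using q by (simp only: power_one_over real_sqrt_pow2 less_imp_le)
  finally show ?thesis using q by (simp only: q_def[symmetric]) (simp add: field_simps)
qed

text \<open>If k exceeded T, a nonzero direction would be orthogonal to all task vectors, and the
  smallest eigenvalue of W W^T could not be positive.\<close>

lemma dim_le_tasks:
  assumes "0 < sing_k_sq k T W"
  shows "k \<le> T"
proof (rule ccontr)
  assume "\<not> k \<le> T"
  then obtain u :: "nat \<Rightarrow> real" where u: "\<exists>j<k. u j \<noteq> 0" "\<And>i. i < T \<Longrightarrow> (\<Sum>j<k. u j * W (Suc i) j) = 0"
    using homogeneous_system_nontrivial[of "{..<k}" T "\<lambda>j i. W (Suc i) j"] by auto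
  have z: "ip k u (W t) = 0" if "t \<in> {1..T}" for t
    using u(2)[of "t - 1"] that by (cases t) (simp_all add: ip_def)
  obtain j where "j < k" "u j \<noteq> 0" using u(1) by blast
  then have "0 < (\<Sum>j<k. (u j)\<^sup>2)" by (intro sum_pos2[of _ j]) auto
  then have "0 < sing_k_sq k T W * (\<Sum>j<k. (u j)\<^sup>2)" using assms by simp
  also have "\<dots> \<le> (\<Sum>t\<in>{1..T}. (ip k u (W t))\<^sup>2)" by (rule sing_k_sq_lower)
  also have "\<dots> = 0" by (intro sum.neutral ballI) (simp add: z)
  finally show False by simp
qed

lemma sum_Cauchy_Schwarz: "(\<Sum>i\<in>I. f i * g i)\<^sup>2 \<le> (\<Sum>i\<in>I. (f i)\<^sup>2) * (\<Sum>i\<in>I. (g i)\<^sup>2)" for f g :: "'i \<Rightarrow> real"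
  by (rule Cauchy_Schwarz_ineq_sum)

text \<open>The right inverse of the task matrix \<open>W\<close> is \<open>W\<^sup>T (W W\<^sup>T)\<^sup>-\<^sup>1\<close>.\<close>

lemma right_inverse_bound:
  fixes W :: "nat \<Rightarrow> vec"
  assumes R: "finite R" and \<mu>: "0 < \<mu>" and low: "\<And>u. \<mu> * (\<Sum>j<k. (u j)\<^sup>2) \<le> (\<Sum>t\<in>R. (ip k u (W t))\<^sup>2)"
  shows "\<exists>g. (\<forall>w. \<forall>i<k. (\<Sum>t\<in>R. ip k w (g t) * W t i) = w i) \<and>
     (\<forall>\<Delta>. \<mu> * (\<Sum>l<k. (\<Sum>t\<in>R. \<Delta> t * g t l)\<^sup>2) \<le> (\<Sum>t\<in>R. (\<Delta> t)\<^sup>2))"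
proof -
  have energy: "(\<Sum>i<k. u i * (\<Sum>t\<in>R. r t * W t i)) = (\<Sum>t\<in>R. r t * ip k u (W t))" for u r
    unfolding ip_def sum_distrib_left by (subst sum.swap) (simp add: mult_ac)
  have "\<exists>u. \<forall>i<k. (\<Sum>t\<in>R. ip k u (W t) * W t i) = (if i = l then 1 else 0)" if l: "l < k" for l
  proof -
    \<comment> \<open>The k columns of W W^T and the unit vector e_l are k + 1 vectors in dimension
      k. Definiteness forces a nonzero coefficient at e_l in their relation, which then solves the
      equation for e_l.\<close>
    define c where "c j i = (if j < k then (\<Sum>t\<in>R. W t j * W t i) else if i = l then 1 else 0)" for j i
    obtain u :: "nat \<Rightarrow> real" where u: "\<exists>j\<le>k. u j \<noteq> 0" "\<And>i. i < k \<Longrightarrow> (\<Sum>j\<le>k. u j * c j i) = 0"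
      using homogeneous_system_nontrivial[of "{..k}" k c] by auto
    have e: "(\<Sum>t\<in>R. ip k u (W t) * W t i) = - u k * (if i = l then 1 else 0)" if "i < k" for i
    proof -
      have "(\<Sum>j<k. u j * c j i) = (\<Sum>j<k. \<Sum>t\<in>R. u j * W t j * W t i)"
        by (simp add: c_def sum_distrib_left mult_ac)
      also have "\<dots> = (\<Sum>t\<in>R. ip k u (W t) * W t i)" by (subst sum.swap) (simp add: ip_def sum_distrib_right)
      finally show ?thesis using u(2)[OF that] by (simp add: lessThan_Suc_atMost[symmetric] c_def split: if_splits)
    qed
    have "u k \<noteq> 0"
    proof
      assume 0: "u k = 0"
      have "(\<Sum>i<k. u i * (\<Sum>t\<in>R. ip k u (W t) * W t i)) = 0"
        by (intro sum.neutral ballI) (simp add: e 0)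
      then have "(\<Sum>t\<in>R. (ip k u (W t))\<^sup>2) = 0" unfolding energy by (simp add: power2_eq_square)
      then have "\<mu> * (\<Sum>j<k. (u j)\<^sup>2) \<le> 0" using low[of u] by simp
      then have "(\<Sum>j<k. (u j)\<^sup>2) \<le> 0" using \<mu> by (simp add: mult_le_0_iff)
      then have "(\<Sum>j<k. (u j)\<^sup>2) = 0" by (intro antisym sum_nonneg) auto
      then have "\<forall>j<k. u j = 0" by (simp add: sum_nonneg_eq_0_iff)
      then show False using u(1) 0 by (metis le_neq_implies_less)
    qed
    then have "\<forall>i<k. (\<Sum>t\<in>R. ip k (\<lambda>j. (- 1 / u k) * u j) (W t) * W t i) = (if i = l then 1 else 0)"
      unfolding ip_scale_left mult.assoc sum_distrib_left[symmetric] using e by simp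
    then show ?thesis by blast
  qed
  then obtain U where U: "\<And>l i. l < k \<Longrightarrow> i < k \<Longrightarrow> (\<Sum>t\<in>R. ip k (U l) (W t) * W t i) = (if i = l then 1 else 0)" by metis
  define g where "g t l = ip k (U l) (W t)" for t l
  define uu where "uu w j = (\<Sum>l<k. w l * U l j)" for w :: vec and j
  have \<rho>: "ip k w (g t) = ip k (uu w) (W t)" for w t
    unfolding uu_def ip_sum_left ip_scale_left by (simp add: ip_def[of k w] g_def)
  have inv: "(\<Sum>t\<in>R. ip k w (g t) * W t i) = w i" if "i < k" for w i
  proof -
    have "(\<Sum>t\<in>R. ip k w (g t) * W t i) = (\<Sum>l<k. w l * (\<Sum>t\<in>R. g t l * W t i))"
      unfolding ip_def sum_distrib_right sum_distrib_left by (subst sum.swap) (simp add: mult_ac)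
    also have "\<dots> = (\<Sum>l<k. w l * (if i = l then 1 else 0))" using U that by (simp add: g_def)
    also have "\<dots> = (\<Sum>l<k. if i = l then w l else 0)" by (intro sum.cong) auto
    also have "\<dots> = w i" using that by simp
    finally show ?thesis .
  qed
  \<comment> \<open>With uu the solution of W W^T uu = w, |W^T uu|^2 = <uu, w>; Cauchy-Schwarz and
    the eigenvalue bound give the operator norm.\<close>
  have \<rho>_bound: "\<mu> * (\<Sum>t\<in>R. (ip k w (g t))\<^sup>2) \<le> (\<Sum>l<k. (w l)\<^sup>2)" for w
  proof -
    define q where "q = (\<Sum>t\<in>R. (ip k w (g t))\<^sup>2)"
    have "q = (\<Sum>t\<in>R. ip k w (g t) * ip k (uu w) (W t))" by (simp add: q_def \<rho> power2_eq_square)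
    also have "\<dots> = (\<Sum>i<k. uu w i * w i)" unfolding energy[symmetric] using inv by simp
    finally have "q\<^sup>2 \<le> (\<Sum>i<k. (uu w i)\<^sup>2) * (\<Sum>i<k. (w i)\<^sup>2)" using sum_Cauchy_Schwarz[of "uu w" w "{..<k}"] by simp
    then have "\<mu> * q\<^sup>2 \<le> \<mu> * ((\<Sum>i<k. (uu w i)\<^sup>2) * (\<Sum>i<k. (w i)\<^sup>2))" using \<mu> by (intro mult_left_mono) auto
    also have "\<dots> = (\<mu> * (\<Sum>i<k. (uu w i)\<^sup>2)) * (\<Sum>i<k. (w i)\<^sup>2)" by (simp only: mult.assoc)
    also have "\<mu> * (\<Sum>i<k. (uu w i)\<^sup>2) \<le> q" using low[of "uu w"] by (simp add: q_def \<rho>)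
    then have "(\<mu> * (\<Sum>i<k. (uu w i)\<^sup>2)) * (\<Sum>i<k. (w i)\<^sup>2) \<le> q * (\<Sum>i<k. (w i)\<^sup>2)" by (intro mult_right_mono sum_nonneg) auto
    finally have "q * (\<mu> * q) \<le> q * (\<Sum>i<k. (w i)\<^sup>2)" by (simp add: power2_eq_square mult_ac)
    moreover have "0 \<le> q" unfolding q_def by (intro sum_nonneg) auto
    ultimately have "\<mu> * q \<le> (\<Sum>i<k. (w i)\<^sup>2)" by (cases "q = 0") (auto simp: sum_nonneg)
    then show ?thesis by (simp only: q_def)
  qed
  \<comment> \<open>The same norm bound for the transposed operator, by duality with G.\<close>
  have "\<mu> * (\<Sum>l<k. (\<Sum>t\<in>R. \<Delta> t * g t l)\<^sup>2) \<le> (\<Sum>t\<in>R. (\<Delta> t)\<^sup>2)" for \<Delta>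
  proof -
    define G where "G l = (\<Sum>t\<in>R. \<Delta> t * g t l)" for l
    define q where "q = (\<Sum>l<k. (G l)\<^sup>2)"
    have "q = (\<Sum>l<k. \<Sum>t\<in>R. \<Delta> t * (G l * g t l))" unfolding q_def power2_eq_square
      by (subst (2) G_def) (simp add: sum_distrib_left mult_ac)
    also have "\<dots> = (\<Sum>t\<in>R. \<Delta> t * ip k G (g t))" unfolding ip_def sum_distrib_left by (rule sum.swap)
    finally have "q\<^sup>2 \<le> (\<Sum>t\<in>R. (\<Delta> t)\<^sup>2) * (\<Sum>t\<in>R. (ip k G (g t))\<^sup>2)" using sum_Cauchy_Schwarz[of \<Delta> "\<lambda>t. ip k G (g t)" R] by simp
    then have "\<mu> * q\<^sup>2 \<le> \<mu> * ((\<Sum>t\<in>R. (\<Delta> t)\<^sup>2) * (\<Sum>t\<in>R. (ip k G (g t))\<^sup>2))" using \<mu> by (intro mult_left_mono) auto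
    also have "\<dots> = (\<Sum>t\<in>R. (\<Delta> t)\<^sup>2) * (\<mu> * (\<Sum>t\<in>R. (ip k G (g t))\<^sup>2))" by (simp only: mult.left_commute)
    also have "\<dots> \<le> (\<Sum>t\<in>R. (\<Delta> t)\<^sup>2) * q" unfolding q_def by (intro mult_left_mono \<rho>_bound sum_nonneg) auto
    finally have "q * (\<mu> * q) \<le> q * (\<Sum>t\<in>R. (\<Delta> t)\<^sup>2)" by (simp add: power2_eq_square mult_ac)
    moreover have "0 \<le> q" unfolding q_def by (intro sum_nonneg) auto
    ultimately have "\<mu> * q \<le> (\<Sum>t\<in>R. (\<Delta> t)\<^sup>2)" by (cases "q = 0") (auto simp: sum_nonneg)
    then show ?thesis by (simp only: q_def G_def)
  qed
  then show ?thesis using inv by blast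
qed

text \<open>At the normalised vector v, Cauchy-Schwarz passes from the norm of M v to the quadratic
  form. The Frobenius norm bounds the set whose supremum is taken.\<close>

lemma spec_norm_quadratic_form:
  assumes b: "spec_norm k M \<le> b"
  shows "(\<Sum>i<k. \<Sum>j<k. G i * M i j * G j) \<le> b * (\<Sum>i<k. (G i)\<^sup>2)"
proof (cases "(\<Sum>i<k. (G i)\<^sup>2) = 0")
  case True
  then have "\<forall>i<k. G i = 0" by (simp add: sum_nonneg_eq_0_iff)
  then show ?thesis by simp
next
  case False
  define q where "q = (\<Sum>j<k. (G j)\<^sup>2)"
  define v where "v = (\<lambda>j. (1 / sqrt q) * G j)"
  have q: "0 < q" using False unfolding q_def by (simp add: less_le sum_nonneg)
  have v: "(\<Sum>j<k. (v j)\<^sup>2) = 1" unfolding v_def power_mult_distrib sum_distrib_left[symmetric] q_def[symmetric]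
    using q by (simp add: power_divide)
  let ?X = "{sqrt (\<Sum>i<k. (\<Sum>j<k. M i j * u j)\<^sup>2) | u. (\<Sum>j<k. (u j)\<^sup>2) = 1}"
  have "sqrt (\<Sum>i<k. (\<Sum>j<k. M i j * v j)\<^sup>2) \<le> Sup ?X"
  proof (rule cSup_upper)
    show "sqrt (\<Sum>i<k. (\<Sum>j<k. M i j * v j)\<^sup>2) \<in> ?X" using v by blast
    show "bdd_above ?X"
    proof (rule bdd_aboveI)
      fix x assume "x \<in> ?X"
      then obtain u where u: "(\<Sum>j<k. (u j)\<^sup>2) = 1" and x: "x = sqrt (\<Sum>i<k. (\<Sum>j<k. M i j * u j)\<^sup>2)" by blast
      have "(\<Sum>j<k. M i j * u j)\<^sup>2 \<le> (\<Sum>j<k. (M i j)\<^sup>2)" for i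
        using sum_Cauchy_Schwarz[of "M i" u "{..<k}"] unfolding u by simp
      then show "x \<le> sqrt (\<Sum>i<k. \<Sum>j<k. (M i j)\<^sup>2)" unfolding x by (intro real_sqrt_le_mono sum_mono)
    qed
  qed
  then have nb: "sqrt (\<Sum>i<k. (\<Sum>j<k. M i j * v j)\<^sup>2) \<le> b" using b unfolding spec_norm_def by linarith
  have "(\<Sum>i<k. v i * (\<Sum>j<k. M i j * v j))\<^sup>2 \<le> (\<Sum>i<k. (\<Sum>j<k. M i j * v j)\<^sup>2)"
    using sum_Cauchy_Schwarz[of v "\<lambda>i. \<Sum>j<k. M i j * v j" "{..<k}"] unfolding v by simp
  then have "(\<Sum>i<k. v i * (\<Sum>j<k. M i j * v j)) \<le> b" using nb real_le_rsqrt order_trans by blast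
  then have "q * (\<Sum>i<k. v i * (\<Sum>j<k. M i j * v j)) \<le> b * q" using q by (simp add: mult.commute)
  moreover have "q * (v i * (\<Sum>j<k. M i j * v j)) = (\<Sum>j<k. G i * M i j * G j)" for i
  proof -
    have "q * (v i * (\<Sum>j<k. M i j * v j)) = (q * (1 / sqrt q) * (1 / sqrt q)) * (\<Sum>j<k. G i * M i j * G j)"
      unfolding v_def sum_distrib_left by (intro sum.cong refl) (simp only: mult_ac)
    also have "q * (1 / sqrt q) * (1 / sqrt q) = 1" using q by simp
    finally show ?thesis by simp
  qed
  ultimately show ?thesis unfolding sum_distrib_left[of q] q_def[symmetric] by simp
qed

lemma integral_double_sum:
  fixes f :: "nat \<Rightarrow> nat \<Rightarrow> 'a \<Rightarrow> real"
  assumes "\<And>i j. i < k \<Longrightarrow> j < k \<Longrightarrow> integrable M (f i j)"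
  shows "(\<integral>x. (\<Sum>i<k. \<Sum>j<k. f i j x) \<partial>M) = (\<Sum>i<k. \<Sum>j<k. \<integral>x. f i j x \<partial>M)"
proof -
  have "(\<integral>x. (\<Sum>i<k. \<Sum>j<k. f i j x) \<partial>M) = (\<Sum>i<k. \<integral>x. (\<Sum>j<k. f i j x) \<partial>M)"
    using assms by (intro Bochner_Integration.integral_sum Bochner_Integration.integrable_sum) auto
  also have "\<dots> = (\<Sum>i<k. \<Sum>j<k. \<integral>x. f i j x \<partial>M)"
    using assms by (intro sum.cong refl Bochner_Integration.integral_sum) auto
  finally show ?thesis .
qed

text \<open>The transferred error at x is <w, G x> with G linear in the source errors, so its
  average over \<nu> involves only the second moment, whose norm b multiplies |G x|^2; the right
  inverse costs 1/\<mu>. For b = C0/k and \<mu> = c0 T/k the dimension cancels.\<close>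

lemma average_transfer:
  fixes \<Delta> :: "nat \<Rightarrow> vec \<Rightarrow> real"
  assumes R: "finite R" and \<mu>: "0 < \<mu>" and low: "\<And>u. \<mu> * (\<Sum>j<k. (u j)\<^sup>2) \<le> (\<Sum>t\<in>R. (ip k u (W t))\<^sup>2)"
    and b: "0 \<le> b" "spec_norm k (second_moment \<nu>) \<le> b"
    and w: "\<And>i j. i < k \<Longrightarrow> j < k \<Longrightarrow> integrable \<nu> (\<lambda>w. w i * w j)"
    and \<Delta>: "\<And>t. t \<in> R \<Longrightarrow> \<Delta> t \<in> borel_measurable p" "\<And>t. t \<in> R \<Longrightarrow> integrable p (\<lambda>x. (\<Delta> t x)\<^sup>2)"
  shows "\<exists>\<rho>. (\<forall>w. \<forall>i<k. (\<Sum>t\<in>R. \<rho> w t * W t i) = w i) \<and> integrable \<nu> (\<lambda>w. pop p (\<lambda>x. \<Sum>t\<in>R. \<rho> w t * \<Delta> t x)) \<and>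
     (\<integral>w. pop p (\<lambda>x. \<Sum>t\<in>R. \<rho> w t * \<Delta> t x) \<partial>\<nu>) \<le> b / \<mu> * (\<Sum>t\<in>R. pop p (\<Delta> t))"
proof -
  obtain g where g: "\<And>w i. i < k \<Longrightarrow> (\<Sum>t\<in>R. ip k w (g t) * W t i) = w i"
    "\<And>\<Delta>. \<mu> * (\<Sum>l<k. (\<Sum>t\<in>R. \<Delta> t * g t l)\<^sup>2) \<le> (\<Sum>t\<in>R. (\<Delta> t)\<^sup>2)"
    using right_inverse_bound[OF R \<mu> low] by blast
  define G where "G l x = (\<Sum>t\<in>R. \<Delta> t x * g t l)" for l x
  have Gm: "G l \<in> borel_measurable p" for l unfolding G_def[abs_def] using \<Delta>(1) by (intro borel_measurable_sum borel_measurable_times) auto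
  have Gsq: "\<mu> * (\<Sum>l<k. (G l x)\<^sup>2) \<le> (\<Sum>t\<in>R. (\<Delta> t x)\<^sup>2)" for x unfolding G_def by (rule g(2))
  have \<Delta>i: "integrable p (\<lambda>x. \<Sum>t\<in>R. (\<Delta> t x)\<^sup>2)" using \<Delta>(2) by (rule Bochner_Integration.integrable_sum)
  have Gi: "integrable p (\<lambda>x. (G l x)\<^sup>2)" if "l < k" for l
  proof (rule Bochner_Integration.integrable_bound[where f="\<lambda>x. 1 / \<mu> * (\<Sum>t\<in>R. (\<Delta> t x)\<^sup>2)"])
    have "norm ((G l x)\<^sup>2) \<le> norm (1 / \<mu> * (\<Sum>t\<in>R. (\<Delta> t x)\<^sup>2))" for x
    proof -
      have "(G l x)\<^sup>2 \<le> (\<Sum>l<k. (G l x)\<^sup>2)" using that by (intro member_le_sum) auto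
      then have "\<mu> * (G l x)\<^sup>2 \<le> \<mu> * (\<Sum>l<k. (G l x)\<^sup>2)" using \<mu> by (intro mult_left_mono) auto
      from order_trans[OF this Gsq] have "(G l x)\<^sup>2 \<le> 1 / \<mu> * (\<Sum>t\<in>R. (\<Delta> t x)\<^sup>2)" using \<mu> by (simp add: field_simps)
      then show ?thesis using \<mu> by (simp add: sum_nonneg)
    qed
    then show "AE x in p. norm ((G l x)\<^sup>2) \<le> norm (1 / \<mu> * (\<Sum>t\<in>R. (\<Delta> t x)\<^sup>2))" by simp
  qed (use Gm \<Delta>i in auto)
  have GGi: "integrable p (\<lambda>x. G i x * G j x)" if "i < k" "j < k" for i j
    using Gm Gi that by (intro integrable_product_of_squares) auto
  define M where "M i j = (\<integral>x. G i x * G j x \<partial>p)" for i j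
  have pe: "pop p (\<lambda>x. \<Sum>t\<in>R. ip k w (g t) * \<Delta> t x) = (\<Sum>i<k. \<Sum>j<k. w i * w j * M i j)" for w
  proof -
    have e: "(\<Sum>t\<in>R. ip k w (g t) * \<Delta> t x) = (\<Sum>i<k. w i * G i x)" for x
      unfolding ip_def G_def sum_distrib_right sum_distrib_left by (subst sum.swap) (simp add: mult_ac)
    have "pop p (\<lambda>x. \<Sum>t\<in>R. ip k w (g t) * \<Delta> t x) = (\<integral>x. (\<Sum>i<k. \<Sum>j<k. w i * (G i x * G j x) * w j) \<partial>p)"
      unfolding pop_def e quadratic_form_square ..
    also have "\<dots> = (\<Sum>i<k. \<Sum>j<k. \<integral>x. w i * (G i x * G j x) * w j \<partial>p)"
      using GGi by (intro integral_double_sum integrable_mult_left integrable_mult_right)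
    also have "\<dots> = (\<Sum>i<k. \<Sum>j<k. w i * w j * M i j)" unfolding M_def by (intro sum.cong refl) (simp add: mult_ac)
    finally show ?thesis .
  qed
  have "(\<integral>w. pop p (\<lambda>x. \<Sum>t\<in>R. ip k w (g t) * \<Delta> t x) \<partial>\<nu>) = (\<Sum>i<k. \<Sum>j<k. second_moment \<nu> i j * M i j)"
    unfolding pe second_moment_def using w by (subst integral_double_sum) (auto intro: integrable_mult_left)
  also have "\<dots> = (\<integral>x. (\<Sum>i<k. \<Sum>j<k. G i x * second_moment \<nu> i j * G j x) \<partial>p)"
  proof -
    have "(\<integral>x. (\<Sum>i<k. \<Sum>j<k. second_moment \<nu> i j * (G i x * G j x)) \<partial>p) = (\<Sum>i<k. \<Sum>j<k. second_moment \<nu> i j * M i j)"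
      unfolding M_def using GGi by (subst integral_double_sum) (auto intro: integrable_mult_right)
    then show ?thesis by (simp add: mult_ac)
  qed
  also have "\<dots> \<le> (\<integral>x. b / \<mu> * (\<Sum>t\<in>R. (\<Delta> t x)\<^sup>2) \<partial>p)"
  proof (rule integral_mono)
    show "integrable p (\<lambda>x. \<Sum>i<k. \<Sum>j<k. G i x * second_moment \<nu> i j * G j x)"
    proof -
      have "integrable p (\<lambda>x. \<Sum>i<k. \<Sum>j<k. second_moment \<nu> i j * (G i x * G j x))"
        using GGi by (intro Bochner_Integration.integrable_sum integrable_mult_right) auto
      then show ?thesis by (simp add: mult_ac)
    qed
    show "integrable p (\<lambda>x. b / \<mu> * (\<Sum>t\<in>R. (\<Delta> t x)\<^sup>2))" using \<Delta>i by (rule integrable_mult_right)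
    fix x
    have "(\<Sum>i<k. \<Sum>j<k. G i x * second_moment \<nu> i j * G j x) \<le> b * (\<Sum>i<k. (G i x)\<^sup>2)" by (rule spec_norm_quadratic_form[OF b(2)])
    also have "\<dots> \<le> b * (1 / \<mu> * (\<Sum>t\<in>R. (\<Delta> t x)\<^sup>2))" using Gsq[of x] \<mu> b(1) by (intro mult_left_mono) (auto simp: field_simps)
    finally show "(\<Sum>i<k. \<Sum>j<k. G i x * second_moment \<nu> i j * G j x) \<le> b / \<mu> * (\<Sum>t\<in>R. (\<Delta> t x)\<^sup>2)" by simp
  qed
  also have "\<dots> = b / \<mu> * (\<Sum>t\<in>R. pop p (\<Delta> t))"
  proof -
    have "(\<integral>x. (\<Sum>t\<in>R. (\<Delta> t x)\<^sup>2) \<partial>p) = (\<Sum>t\<in>R. pop p (\<Delta> t))" unfolding pop_def by (rule Bochner_Integration.integral_sum[OF \<Delta>(2)])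
    then show ?thesis by (simp only: integral_mult_right_zero)
  qed
  finally have 1: "(\<integral>w. pop p (\<lambda>x. \<Sum>t\<in>R. ip k w (g t) * \<Delta> t x) \<partial>\<nu>) \<le> b / \<mu> * (\<Sum>t\<in>R. pop p (\<Delta> t))" .
  have "integrable \<nu> (\<lambda>w. pop p (\<lambda>x. \<Sum>t\<in>R. ip k w (g t) * \<Delta> t x))"
    unfolding pe using w by (intro Bochner_Integration.integrable_sum integrable_mult_left) auto
  with 1 show ?thesis using g(1) by (intro exI[of _ "\<lambda>w t. ip k w (g t)"] conjI allI impI) auto
qed

lemma F_X_cong:
  assumes "\<And>s. s \<in> {1..T} \<times> {..<n1} \<Longrightarrow> \<omega> s = \<omega>' s"
  shows "F_X k \<Phi> T n1 \<omega> = F_X k \<Phi> T n1 \<omega>'"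
proof -
  have "\<omega> (t, i) = \<omega>' (t, i)" if "Suc 0 \<le> t" "t \<le> T" "i < n1" for t i using assms that by simp
  then show ?thesis unfolding F_X_def by simp
qed

lemma loss_cong:
  assumes "\<And>s. s \<in> S \<Longrightarrow> \<omega> s = \<omega>' s"
  shows "sqd S (response k \<phi> c \<omega>) (clean k \<psi> c' \<omega>) = sqd S (response k \<phi> c \<omega>') (clean k \<psi> c' \<omega>')"
  unfolding dot_def by (intro sum.cong refl) (simp add: response_def clean_def assms)

section \<open>Risk of the target estimator\<close>

context transfer_setup
begin

lemma source_population_error:
  assumes g: "goodX \<omega>" and \<phi>h: "\<phi>h \<in> \<Phi>"
  shows "0.9 * real n1 * (\<Sum>t\<in>{1..T}. pop p (lin2 k \<phi>h \<phi>s (Wh t) (\<lambda>j. - Ws t j))) \<le> (nrm S1 (err \<phi>h Wh \<omega>))\<^sup>2"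
proof -
  have "0.9 * real n1 * (\<Sum>t\<in>{1..T}. pop p (lin2 k \<phi>h \<phi>s (Wh t) (\<lambda>j. - Ws t j)))
      = (\<Sum>t\<in>{1..T}. 0.9 * real n1 * pop p (lin2 k \<phi>h \<phi>s (Wh t) (\<lambda>j. - Ws t j)))" by (rule sum_distrib_left)
  also have "\<dots> \<le> (\<Sum>t\<in>{1..T}. \<Sum>l<n1. (lin2 k \<phi>h \<phi>s (Wh t) (\<lambda>j. - Ws t j) (fst (\<omega> (t, l))))\<^sup>2)"
    by (intro sum_mono good_sandwich(1)[OF g _ \<phi>h \<phi>s])
  also have "\<dots> = (nrm S1 (err \<phi>h Wh \<omega>))\<^sup>2"
    unfolding nrm_square err_eq_lin2 dot_def by (simp only: sum.cartesian_product case_prod_unfold power2_eq_square fst_conv prod.collapse)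
  finally show ?thesis .
qed

text \<open>The comparison u is free. Squaring the basic inequality costs 2, and passing between
  empirical and population norms costs 2 each way: 8 = 2 * 2 * 2 and 16 = 2 * 8.\<close>

lemma target_oracle_inequality:
  assumes g: "goodX \<omega>" and m: "source_minimiser \<omega> \<phi>h Wh" and na: "\<not> ambiguous_fit T n1 (Fam \<omega>) (resp \<omega>)"
    and nd: "\<not> deficient_fit T n1 (Fam \<omega>) (resp \<omega>)" and inf: "\<exists>\<^sub>\<infinity>m. goodT a (psel \<omega> m) \<omega>2" and a: "0 \<le> a"
    and ls: "sqd S2 (response k \<phi>s (\<lambda>_. w) \<omega>2) (clean k \<phi>h (\<lambda>_. v) \<omega>2) \<le> sqd S2 (response k \<phi>s (\<lambda>_. w) \<omega>2) (clean k \<phi>h (\<lambda>_. u) \<omega>2)"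
  shows "pop p (lin2 k \<phi>h \<phi>s v (\<lambda>j. - w j)) \<le> 8 * pop p (lin2 k \<phi>h \<phi>s u (\<lambda>j. - w j)) + 16 * a\<^sup>2 / real n2"
proof -
  note bounds = minimiser_target_bounds[OF g m na nd inf]
  let ?e = "\<lambda>v s. clean k \<phi>h (\<lambda>_. v) \<omega>2 s - clean k \<phi>s (\<lambda>_. w) \<omega>2 s"
  have ee: "(\<Sum>l<n2. (lin2 k \<phi>h \<phi>s v (\<lambda>j. - w j) (fst (\<omega>2 (Suc T, l))))\<^sup>2) = (nrm S2 (?e v))\<^sup>2" for v
  proof -
    have "(nrm S2 (?e v))\<^sup>2 = (\<Sum>s\<in>{Suc T} \<times> {..<n2}. (lin2 k \<phi>h \<phi>s v (\<lambda>j. - w j) (fst (\<omega>2 s)))\<^sup>2)"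
      unfolding nrm_square dot_def by (simp add: clean_def lin2_def ip_uminus_left power2_eq_square)
    also have "\<dots> = (\<Sum>l<n2. (lin2 k \<phi>h \<phi>s v (\<lambda>j. - w j) (fst (\<omega>2 (Suc T, l))))\<^sup>2)"
      using sum.cartesian_product[of "\<lambda>t i. (lin2 k \<phi>h \<phi>s v (\<lambda>j. - w j) (fst (\<omega>2 (t, i))))\<^sup>2" "{..<n2}" "{Suc T}"] by (simp add: case_prod_beta)
    finally show ?thesis ..
  qed
  have "nrm S2 (?e v) \<le> nrm S2 (?e u) + 2 * a"
  proof (rule basic_inequality[where z="\<lambda>s. snd (\<omega>2 s)", OF _ _ a])
    show "sqd S2 (\<lambda>s. clean k \<phi>s (\<lambda>_. w) \<omega>2 s + snd (\<omega>2 s)) (clean k \<phi>h (\<lambda>_. v) \<omega>2)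
        \<le> sqd S2 (\<lambda>s. clean k \<phi>s (\<lambda>_. w) \<omega>2 s + snd (\<omega>2 s)) (clean k \<phi>h (\<lambda>_. u) \<omega>2)"
      using ls unfolding response_def .
    have "(\<lambda>s. clean k \<phi>h (\<lambda>_. v) \<omega>2 s - clean k \<phi>h (\<lambda>_. u) \<omega>2 s) = (\<lambda>s. ip k (\<lambda>j. v j - u j) (\<phi>h (fst (\<omega>2 s))))"
      by (simp add: clean_def ip_def fun_eq_iff sum_subtractf left_diff_distrib)
    then show "dot S2 (\<lambda>s. clean k \<phi>h (\<lambda>_. v) \<omega>2 s - clean k \<phi>h (\<lambda>_. u) \<omega>2 s) (\<lambda>s. snd (\<omega>2 s))
        \<le> a * nrm S2 (\<lambda>s. clean k \<phi>h (\<lambda>_. v) \<omega>2 s - clean k \<phi>h (\<lambda>_. u) \<omega>2 s)"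
      using bounds(1) by (simp only:)
  qed
  then have "(nrm S2 (?e v))\<^sup>2 \<le> (nrm S2 (?e u) + 2 * a)\<^sup>2" by (intro power_mono nrm_nonneg)
  also have "\<dots> \<le> 2 * (nrm S2 (?e u))\<^sup>2 + 8 * a\<^sup>2"
    using zero_le_power2[of "nrm S2 (?e u) - 2 * a"] unfolding power2_sum power2_diff power_mult_distrib by simp
  finally have "real n2 * pop p (lin2 k \<phi>h \<phi>s v (\<lambda>j. - w j)) \<le> real n2 * (8 * pop p (lin2 k \<phi>h \<phi>s u (\<lambda>j. - w j))) + 16 * a\<^sup>2"
    using bounds(2)[of v "\<lambda>j. - w j"] bounds(3)[of u "\<lambda>j. - w j"] unfolding ee by linarith
  then show ?thesis using n2 by (simp add: field_simps)
qed

lemma excess_risk_eq: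
  assumes "\<phi>h \<in> \<Phi>"
  shows "excess_risk k p \<phi>s \<phi>h v w = ennreal (pop p (lin2 k \<phi>h \<phi>s v (\<lambda>j. - w j)) / 2)"
proof -
  have "excess_risk k p \<phi>s \<phi>h v w = (\<integral>\<^sup>+ x. ennreal ((lin2 k \<phi>h \<phi>s v (\<lambda>j. - w j) x)\<^sup>2 / 2) \<partial>p)"
    by (simp add: excess_risk_def lin2_def ip_uminus_left)
  also have "\<dots> = ennreal (\<integral>x. (lin2 k \<phi>h \<phi>s v (\<lambda>j. - w j) x)\<^sup>2 / 2 \<partial>p)"
    using lin2_integrable[OF sq[OF assms] sq[OF \<phi>s]] by (intro nn_integral_eq_integral) auto
  finally show ?thesis by (simp add: pop_def)
qed

text \<open>The risk is bounded for every single w before integrating, so an arbitrary dependence of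
  \<open>wh\<close> on w is covered.\<close>

lemma average_excess_risk:
  assumes \<nu>: "prob_space \<nu>" and w: "\<And>i j. i < k \<Longrightarrow> j < k \<Longrightarrow> integrable \<nu> (\<lambda>w. w i * w j)"
    and \<mu>: "0 < \<mu>" "\<mu> \<le> sing_k_sq k T Ws" and b: "0 \<le> b" "spec_norm k (second_moment \<nu>) \<le> b"
    and g: "goodX \<omega>" and m: "source_minimiser \<omega> \<phi>h Wh" and na: "\<not> ambiguous_fit T n1 (Fam \<omega>) (resp \<omega>)"
    and nd: "\<not> deficient_fit T n1 (Fam \<omega>) (resp \<omega>)" and inf: "\<exists>\<^sub>\<infinity>m. goodT a (psel \<omega> m) \<omega>2" and a: "0 \<le> a"
    and ls: "\<And>w u. sqd S2 (response k \<phi>s (\<lambda>_. w) \<omega>2) (clean k \<phi>h (\<lambda>_. wh w) \<omega>2) \<le> sqd S2 (response k \<phi>s (\<lambda>_. w) \<omega>2) (clean k \<phi>h (\<lambda>_. u) \<omega>2)"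
  shows "(\<integral>\<^sup>+ w. excess_risk k p \<phi>s \<phi>h (wh w) w \<partial>\<nu>) \<le> ennreal (4 * (b / \<mu> * ((nrm S1 (err \<phi>h Wh \<omega>))\<^sup>2 / (0.9 * real n1))) + 8 * a\<^sup>2 / real n2)"
proof -
  interpret \<nu>: prob_space \<nu> by fact
  have \<phi>h: "\<phi>h \<in> \<Phi>" using m by (simp add: source_minimiser_def)
  define \<Delta> where "\<Delta> t = lin2 k \<phi>h \<phi>s (Wh t) (\<lambda>j. - Ws t j)" for t
  have low: "\<mu> * (\<Sum>j<k. (u j)\<^sup>2) \<le> (\<Sum>t\<in>{1..T}. (ip k u (Ws t))\<^sup>2)" for u
    using mult_right_mono[OF \<mu>(2), of "\<Sum>j<k. (u j)\<^sup>2"] sing_k_sq_lower[where k=k and T=T and W=Ws and u=u] by (simp add: sum_nonneg)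
  have "\<exists>\<rho>. (\<forall>w. \<forall>i<k. (\<Sum>t\<in>{1..T}. \<rho> w t * Ws t i) = w i) \<and> integrable \<nu> (\<lambda>w. pop p (\<lambda>x. \<Sum>t\<in>{1..T}. \<rho> w t * \<Delta> t x)) \<and>
     (\<integral>w. pop p (\<lambda>x. \<Sum>t\<in>{1..T}. \<rho> w t * \<Delta> t x) \<partial>\<nu>) \<le> b / \<mu> * (\<Sum>t\<in>{1..T}. pop p (\<Delta> t))"
    by (rule average_transfer[OF _ \<mu>(1) low b w])
       (use lin2_measurable[OF sq[OF \<phi>h] sq[OF \<phi>s]] lin2_integrable[OF sq[OF \<phi>h] sq[OF \<phi>s]] in \<open>simp_all add: \<Delta>_def\<close>)
  then obtain \<rho> where \<rho>: "\<And>w i. i < k \<Longrightarrow> (\<Sum>t\<in>{1..T}. \<rho> w t * Ws t i) = w i"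
    and Qi: "integrable \<nu> (\<lambda>w. pop p (\<lambda>x. \<Sum>t\<in>{1..T}. \<rho> w t * \<Delta> t x))"
    and Qb: "(\<integral>w. pop p (\<lambda>x. \<Sum>t\<in>{1..T}. \<rho> w t * \<Delta> t x) \<partial>\<nu>) \<le> b / \<mu> * (\<Sum>t\<in>{1..T}. pop p (\<Delta> t))" by blast
  define Q where "Q w = pop p (\<lambda>x. \<Sum>t\<in>{1..T}. \<rho> w t * \<Delta> t x)" for w
  have Qint: "integrable \<nu> Q" using Qi unfolding Q_def[abs_def] .
  have Q0: "0 \<le> Q w" for w unfolding Q_def by (rule pop_nonneg)
  have er: "excess_risk k p \<phi>s \<phi>h (wh w) w \<le> ennreal (4 * Q w + 8 * a\<^sup>2 / real n2)" for w
  proof -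
    \<comment> \<open>The combination that writes w through the true task vectors is applied to the
      learned weights; its error is the same combination of the source errors.\<close>
    define u where "u = (\<lambda>j. \<Sum>t\<in>{1..T}. \<rho> w t * Wh t j)"
    have "lin2 k \<phi>h \<phi>s u (\<lambda>j. - w j) = (\<lambda>x. \<Sum>t\<in>{1..T}. \<rho> w t * \<Delta> t x)"
    proof
      fix x
      have "ip k w (\<phi>s x) = ip k (\<lambda>j. \<Sum>t\<in>{1..T}. \<rho> w t * Ws t j) (\<phi>s x)" unfolding ip_def using \<rho> by simp
      then show "lin2 k \<phi>h \<phi>s u (\<lambda>j. - w j) x = (\<Sum>t\<in>{1..T}. \<rho> w t * \<Delta> t x)"
        unfolding lin2_def \<Delta>_def u_def ip_uminus_left by (simp add: ip_sum_left ip_scale_left sum_subtractf right_diff_distrib)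
    qed
    then have "pop p (lin2 k \<phi>h \<phi>s (wh w) (\<lambda>j. - w j)) \<le> 8 * Q w + 16 * a\<^sup>2 / real n2"
      using target_oracle_inequality[OF g m na nd inf a ls, of w u] by (simp only: Q_def)
    then have "pop p (lin2 k \<phi>h \<phi>s (wh w) (\<lambda>j. - w j)) / 2 \<le> 4 * Q w + 8 * a\<^sup>2 / real n2" by simp
    then show ?thesis unfolding excess_risk_eq[OF \<phi>h] by (rule ennreal_leI)
  qed
  have Qi': "integrable \<nu> (\<lambda>w. 4 * Q w + 8 * a\<^sup>2 / real n2)" using Qint by simp
  have "(\<integral>\<^sup>+ w. excess_risk k p \<phi>s \<phi>h (wh w) w \<partial>\<nu>) \<le> (\<integral>\<^sup>+ w. ennreal (4 * Q w + 8 * a\<^sup>2 / real n2) \<partial>\<nu>)"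
    by (rule nn_integral_mono[OF er])
  also have "\<dots> = ennreal (\<integral>w. 4 * Q w + 8 * a\<^sup>2 / real n2 \<partial>\<nu>)" using Q0 by (intro nn_integral_eq_integral[OF Qi']) simp
  also have "(\<integral>w. 4 * Q w + 8 * a\<^sup>2 / real n2 \<partial>\<nu>) = 4 * (\<integral>w. Q w \<partial>\<nu>) + 8 * a\<^sup>2 / real n2"
    using Qint by (simp add: \<nu>.prob_space)
  also have "ennreal \<dots> \<le> ennreal (4 * (b / \<mu> * ((nrm S1 (err \<phi>h Wh \<omega>))\<^sup>2 / (0.9 * real n1))) + 8 * a\<^sup>2 / real n2)"
  proof (rule ennreal_leI)
    have "(\<Sum>t\<in>{1..T}. pop p (\<Delta> t)) \<le> (nrm S1 (err \<phi>h Wh \<omega>))\<^sup>2 / (0.9 * real n1)"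
      using source_population_error[OF g \<phi>h, of Wh] n1 unfolding \<Delta>_def by (simp add: field_simps)
    then have "b / \<mu> * (\<Sum>t\<in>{1..T}. pop p (\<Delta> t)) \<le> b / \<mu> * ((nrm S1 (err \<phi>h Wh \<omega>))\<^sup>2 / (0.9 * real n1))"
      using b(1) \<mu>(1) by (intro mult_left_mono) auto
    then show "4 * (\<integral>w. Q w \<partial>\<nu>) + 8 * a\<^sup>2 / real n2 \<le> 4 * (b / \<mu> * ((nrm S1 (err \<phi>h Wh \<omega>))\<^sup>2 / (0.9 * real n1))) + 8 * a\<^sup>2 / real n2"
      using Qb unfolding Q_def by linarith
  qed
  finally show ?thesis .
qed

text \<open>With ln 6 \<le> 5, dev^2 is at most 25 + 5 L. Doubled, the 25 is absorbed by k \<ge> 1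
  on the target side (68 = 18 + 50) and by G^2 \<ge> 1/9 on the source side (452 = 2 + 9 *
  50).\<close>

lemma deviation_numerics:
  defines "L \<equiv> ln (1 / \<delta>)"
  shows "0 \<le> L" "dev\<^sup>2 \<le> 25 + 5 * L" "target_dev\<^sup>2 \<le> 68 * \<sigma>\<^sup>2 * (real k + L)"
    "1/3 \<le> G \<Longrightarrow> (2 * (\<sigma> * (G + dev)))\<^sup>2 \<le> 1808 * \<sigma>\<^sup>2 * (G\<^sup>2 + L)"
proof -
  show L: "0 \<le> L" using \<delta> by (simp add: L_def)
  have "ln (6 / \<delta>) = ln 6 + L" using \<delta> by (simp add: L_def ln_div)
  moreover have "ln 6 \<le> (5::real)" using ln_le_minus_one[of "6::real"] by simp
  ultimately show d: "dev\<^sup>2 \<le> 25 + 5 * L" unfolding dev_sq by simp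
  have "target_dev\<^sup>2 = \<sigma>\<^sup>2 * (3 * sqrt (real k) + dev)\<^sup>2" by (simp add: power_mult_distrib)
  also have "(3 * sqrt (real k) + dev)\<^sup>2 \<le> 2 * (3 * sqrt (real k))\<^sup>2 + 2 * dev\<^sup>2"
    using zero_le_power2[of "3 * sqrt (real k) - dev"] unfolding power2_sum power2_diff by simp
  also have "\<dots> = 18 * real k + 2 * dev\<^sup>2" by (simp add: power_mult_distrib)
  also have "\<dots> \<le> 68 * (real k + L)" using d L k1 by simp
  finally show "target_dev\<^sup>2 \<le> 68 * \<sigma>\<^sup>2 * (real k + L)" using \<sigma> by (simp add: algebra_simps)
  assume G: "1/3 \<le> G"
  have "1/3 * (1/3) \<le> G * G" using G by (intro mult_mono) auto
  moreover have "(G + dev)\<^sup>2 \<le> 2 * G\<^sup>2 + 2 * dev\<^sup>2"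
    using zero_le_power2[of "G - dev"] unfolding power2_sum power2_diff by simp
  ultimately have "(G + dev)\<^sup>2 \<le> 452 * (G\<^sup>2 + L)" using d L by (simp add: power2_eq_square)
  then have "(4 * \<sigma>\<^sup>2) * (G + dev)\<^sup>2 \<le> (4 * \<sigma>\<^sup>2) * (452 * (G\<^sup>2 + L))" by (intro mult_left_mono) auto
  moreover have "(2 * (\<sigma> * (G + dev)))\<^sup>2 = (4 * \<sigma>\<^sup>2) * (G + dev)\<^sup>2" by (simp add: power_mult_distrib)
  moreover have "(4 * \<sigma>\<^sup>2) * (452 * (G\<^sup>2 + L)) = 1808 * \<sigma>\<^sup>2 * (G\<^sup>2 + L)" by (simp add: algebra_simps)
  ultimately show "(2 * (\<sigma> * (G + dev)))\<^sup>2 \<le> 1808 * \<sigma>\<^sup>2 * (G\<^sup>2 + L)" by (simp only:)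
qed

lemma transfer_risk_bound:
  assumes \<nu>: "prob_space \<nu>" and w: "\<And>i j. i < k \<Longrightarrow> j < k \<Longrightarrow> integrable \<nu> (\<lambda>w. w i * w j)"
    and c0: "0 < c0" and C0: "0 < C0" and sing: "c0 * real T / real k \<le> sing_k_sq k T Ws"
    and spec: "spec_norm k (second_moment \<nu>) \<le> C0 / real k"
    and ok: "source_ok (restrict \<omega> S1)" and inf: "\<exists>\<^sub>\<infinity>m. goodT target_dev (psel (restrict \<omega> S1) m) (restrict \<omega> S2)"
    and \<phi>h: "\<phi>h \<in> \<Phi>" and opt: "\<And>\<phi> W. \<phi> \<in> \<Phi> \<Longrightarrow> source_loss k T n1 \<phi>s Ws \<omega> \<phi>h Wh \<le> source_loss k T n1 \<phi>s Ws \<omega> \<phi> W"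
    and ls: "\<And>wstar w. target_loss k T n2 \<phi>s wstar \<omega> \<phi>h (wh wstar) \<le> target_loss k T n2 \<phi>s wstar \<omega> \<phi>h w"
  shows "(\<integral>\<^sup>+ wstar. excess_risk k p \<phi>s \<phi>h (wh wstar) wstar \<partial>\<nu>)
    \<le> ennreal ((8100 * (C0 / c0) + 544) * \<sigma>\<^sup>2 *
         (((gaussian_width S1 (F_X k \<Phi> T n1 \<omega>))\<^sup>2 + ln (1 / \<delta>)) / (real n1 * real T) + (real k + ln (1 / \<delta>)) / real n2))"
proof -
  let ?\<omega>1 = "restrict \<omega> S1" and ?\<omega>2 = "restrict \<omega> S2"
  let ?G = "gaussian_width S1 (F_X k \<Phi> T n1 \<omega>)" and ?L = "ln (1 / \<delta>)"
  let ?D = "nrm S1 (err \<phi>h Wh ?\<omega>1)"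
  have g: "goodX ?\<omega>1" and na: "\<not> ambiguous_fit T n1 (Fam ?\<omega>1) (resp ?\<omega>1)" and nd: "\<not> deficient_fit T n1 (Fam ?\<omega>1) (resp ?\<omega>1)"
    and dv: "\<And>i. dot S1 (normalise S1 (pairvec ?\<omega>1 i)) (\<lambda>s. snd (?\<omega>1 s)) \<le> \<sigma> * (width ?\<omega>1 + dev)"
    using ok unfolding source_ok_def by blast+
  have l1: "sqd S1 (response k \<phi>s Ws ?\<omega>1) (clean k \<psi> c ?\<omega>1) = sqd S1 (response k \<phi>s Ws \<omega>) (clean k \<psi> c \<omega>)" for \<psi> c
    by (rule loss_cong) (rule restrict_apply')
  have l2: "sqd S2 (response k \<phi>s a ?\<omega>2) (clean k \<psi> c ?\<omega>2) = sqd S2 (response k \<phi>s a \<omega>) (clean k \<psi> c \<omega>)" for \<psi> c a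
    by (rule loss_cong) (rule restrict_apply')
  have m: "source_minimiser ?\<omega>1 \<phi>h Wh"
    unfolding source_minimiser_def l1
  proof (intro conjI ballI allI \<phi>h)
    fix \<phi> W assume "\<phi> \<in> \<Phi>"
    from opt[OF this, of W] show "sqd S1 (response k \<phi>s Ws \<omega>) (clean k \<phi>h Wh \<omega>) \<le> sqd S1 (response k \<phi>s Ws \<omega>) (clean k \<phi> W \<omega>)"
      unfolding source_loss_eq using n1 T1 by (simp add: divide_le_cancel)
  qed
  have ls': "sqd S2 (response k \<phi>s (\<lambda>_. v) ?\<omega>2) (clean k \<phi>h (\<lambda>_. wh v) ?\<omega>2) \<le> sqd S2 (response k \<phi>s (\<lambda>_. v) ?\<omega>2) (clean k \<phi>h (\<lambda>_. u) ?\<omega>2)" for v u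
    using ls[of v u] n2 unfolding l2 target_loss_eq by (simp add: divide_le_cancel)
  have F: "F_X k \<Phi> T n1 ?\<omega>1 = F_X k \<Phi> T n1 \<omega>" by (rule F_X_cong) (rule restrict_apply')
  have L: "0 \<le> ?L" by (rule deviation_numerics(1))
  have a: "0 \<le> \<sigma> * (width ?\<omega>1 + dev)" if "F_X k \<Phi> T n1 \<omega> \<noteq> {}"
    using gaussian_width_eq(2)[OF g] that dev_nonneg \<sigma> unfolding F by simp
  have t0: "0 \<le> target_dev" using dev_nonneg \<sigma> by simp
  have opt1: "sqd S1 (resp ?\<omega>1) (clean k \<phi>h Wh ?\<omega>1) \<le> sqd S1 (resp ?\<omega>1) (clean k \<phi>s Ws ?\<omega>1)"
    using m \<phi>s unfolding source_minimiser_def by blast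
  have D: "?D\<^sup>2 \<le> 1808 * \<sigma>\<^sup>2 * (?G\<^sup>2 + ?L)"
  proof (cases "F_X k \<Phi> T n1 \<omega> = {}")
    \<comment> \<open>An empty set has width 0 by convention; a nonzero error vector would have its
      normalisation in \<open>F_X\<close>, so the error is zero.\<close>
    case True
    have "?D = 0"
    proof (rule ccontr)
      assume "?D \<noteq> 0"
      from normalised_in_F_X[OF \<phi>h \<phi>s fun_cong[OF err_eq_lin2] this] True F show False by blast
    qed
    then show ?thesis using L by simp
  next
    case False
    note wd = gaussian_width_eq[OF g, unfolded F, OF False]
    have "?D \<le> 2 * (\<sigma> * (width ?\<omega>1 + dev))" by (rule source_error_bound[OF g \<phi>h opt1 dv a[OF False]])
    then have "?D\<^sup>2 \<le> (2 * (\<sigma> * (width ?\<omega>1 + dev)))\<^sup>2" by (intro power_mono nrm_nonneg)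
    also have "\<dots> \<le> 1808 * \<sigma>\<^sup>2 * ((width ?\<omega>1)\<^sup>2 + ?L)" by (rule deviation_numerics(4)[OF wd(2)])
    finally show ?thesis unfolding wd(1) .
  qed
  have k0: "0 < real k" and T0: "0 < real T" and n0: "0 < real n1" "0 < real n2" using k1 T1 n1 n2 by auto
  have "(\<integral>\<^sup>+ wstar. excess_risk k p \<phi>s \<phi>h (wh wstar) wstar \<partial>\<nu>)
      \<le> ennreal (4 * (C0 / real k / (c0 * real T / real k) * (?D\<^sup>2 / (0.9 * real n1))) + 8 * target_dev\<^sup>2 / real n2)"
    by (rule average_excess_risk[OF \<nu> w _ sing _ spec g m na nd inf t0 ls']) (use c0 C0 k0 T0 in auto)
  \<comment> \<open>The factors k cancel in the first term; 4/0.9 = 40/9, 40/9 * 1808 < 8100, and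
    544 = 8 * 68.\<close>
  also have "\<dots> \<le> ennreal ((8100 * (C0 / c0) + 544) * \<sigma>\<^sup>2 * ((?G\<^sup>2 + ?L) / (real n1 * real T) + (real k + ?L) / real n2))"
  proof (rule ennreal_leI)
    define X where "X = \<sigma>\<^sup>2 * ((?G\<^sup>2 + ?L) / (real n1 * real T))"
    define Y where "Y = \<sigma>\<^sup>2 * ((real k + ?L) / real n2)"
    have XY: "0 \<le> X" "0 \<le> Y" using L by (simp_all add: X_def Y_def)
    have r: "0 \<le> C0 / c0" using c0 C0 by simp
    have "4 * (C0 / real k / (c0 * real T / real k) * (?D\<^sup>2 / (0.9 * real n1))) = (40 / 9) * (C0 / c0) * (?D\<^sup>2 / (real n1 * real T))"
      using k0 T0 n0 c0 by (simp add: field_simps)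
    also have "\<dots> \<le> (40 / 9) * (C0 / c0) * (1808 * \<sigma>\<^sup>2 * (?G\<^sup>2 + ?L) / (real n1 * real T))"
      using D r n0 T0 by (intro mult_left_mono divide_right_mono) auto
    also have "\<dots> = (40 / 9 * 1808) * ((C0 / c0) * X)" by (simp add: X_def)
    also have "\<dots> \<le> 8100 * ((C0 / c0) * X)" using r XY by (intro mult_right_mono mult_nonneg_nonneg) auto
    finally have s: "4 * (C0 / real k / (c0 * real T / real k) * (?D\<^sup>2 / (0.9 * real n1))) \<le> 8100 * (C0 / c0) * X" by simp
    have "8 * target_dev\<^sup>2 / real n2 \<le> 8 * (68 * \<sigma>\<^sup>2 * (real k + ?L)) / real n2"
      using deviation_numerics(3) n0 by (intro divide_right_mono mult_left_mono) auto
    also have "\<dots> = 544 * Y" by (simp add: Y_def)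
    finally have "4 * (C0 / real k / (c0 * real T / real k) * (?D\<^sup>2 / (0.9 * real n1))) + 8 * target_dev\<^sup>2 / real n2
        \<le> 8100 * (C0 / c0) * X + 544 * Y" using s by linarith
    also have "\<dots> \<le> (8100 * (C0 / c0) + 544) * X + (8100 * (C0 / c0) + 544) * Y"
      using mult_nonneg_nonneg[OF r XY(2)] XY by (simp only: distrib_right mult.assoc)
    also have "\<dots> = (8100 * (C0 / c0) + 544) * \<sigma>\<^sup>2 * ((?G\<^sup>2 + ?L) / (real n1 * real T) + (real k + ?L) / real n2)"
      unfolding X_def Y_def by (simp only: distrib_left mult.assoc)
    finally show "4 * (C0 / real k / (c0 * real T / real k) * (?D\<^sup>2 / (0.9 * real n1))) + 8 * target_dev\<^sup>2 / real n2
       \<le> (8100 * (C0 / c0) + 544) * \<sigma>\<^sup>2 * ((?G\<^sup>2 + ?L) / (real n1 * real T) + (real k + ?L) / real n2)" .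
  qed
  finally show ?thesis .
qed

end

text \<open>A single summand is at most the empirical sum, hence at most 1.1 n times the population
  norm, so all points of a uniformly good sample have bounded evaluations. Such samples keep
  probability at least 1 - \<delta> for arbitrarily large n.\<close>

lemma full_measure_evaluation_bound:
  assumes p: "prob_space p" and sq: "\<And>\<phi>. \<phi> \<in> \<Phi> \<Longrightarrow> sqint k p \<phi>" and \<delta>: "\<delta> < 1" and n1: "1 \<le> n1"
    and unif: "\<And>n. n1 \<le> n \<Longrightarrow> unif_conc k \<Phi> p \<delta> n"
  shows "\<exists>K\<in>sets p. measure p K = 1 \<and>
     (\<forall>x\<in>K. \<exists>C. \<forall>\<phi>\<in>\<Phi>. \<forall>\<psi>\<in>\<Phi>. \<forall>c c'. (lin2 k \<phi> \<psi> c c' x)\<^sup>2 \<le> C * pop p (lin2 k \<phi> \<psi> c c'))"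
proof -
  define N where "N = {x. \<exists>C. \<forall>\<phi>\<in>\<Phi>. \<forall>\<psi>\<in>\<Phi>. \<forall>c c'. (lin2 k \<phi> \<psi> c c' x)\<^sup>2 \<le> C * pop p (lin2 k \<phi> \<psi> c c')}"
  have "\<exists>K\<in>sets p. K \<subseteq> N \<and> measure p K = 1"
  proof (rule full_measure_kernel[OF p \<delta>])
    fix n assume n: "n1 \<le> n"
    from unif[OF n] obtain A where A: "A \<in> sets (iid n p)" "1 - \<delta> \<le> measure (iid n p) A"
      and sw: "\<forall>xs\<in>A. \<forall>\<phi>\<in>\<Phi>. \<forall>\<psi>\<in>\<Phi>. sandwich k p xs n \<phi> \<psi>"
      unfolding unif_conc_def by (elim bexE conjE)
    have "xs l \<in> N" if xs: "xs \<in> A" and l: "l < n" for xs l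
      unfolding N_def
    proof (intro CollectI exI[of _ "1.1 * real n"] ballI allI)
      fix \<phi> \<psi> c c' assume \<phi>: "\<phi> \<in> \<Phi>" "\<psi> \<in> \<Phi>"
      have n0: "0 < real n" using n n1 by simp
      have "(lin2 k \<phi> \<psi> c c' (xs l))\<^sup>2 \<le> (\<Sum>l<n. (lin2 k \<phi> \<psi> c c' (xs l))\<^sup>2)"
        using l by (intro member_le_sum) auto
      also have "\<dots> \<le> 1.1 * pop p (lin2 k \<phi> \<psi> c c') * real n"
        using sandwich_lin2(2)[OF sq[OF \<phi>(1)] sq[OF \<phi>(2)] bspec[OF bspec[OF bspec[OF sw xs] \<phi>(1)] \<phi>(2)], of c c'] by (simp only: pos_divide_le_eq[OF n0])
      finally show "(lin2 k \<phi> \<psi> c c' (xs l))\<^sup>2 \<le> 1.1 * real n * pop p (lin2 k \<phi> \<psi> c c')" by (simp only: mult_ac)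
    qed
    then show "\<exists>A\<in>sets (iid n p). 1 - \<delta> \<le> measure (iid n p) A \<and> (\<forall>xs\<in>A. \<forall>l<n. xs l \<in> N)" using A(1,2) by blast
  qed
  then show ?thesis unfolding N_def by blast
qed

lemma countable_dense_sequence:
  fixes e :: "'b \<Rightarrow> 'k \<Rightarrow> real"
  assumes K: "finite K" and ne: "\<Phi> \<noteq> {}"
  shows "\<exists>f :: nat \<Rightarrow> 'b. range f \<subseteq> \<Phi> \<and> (\<forall>\<phi>\<in>\<Phi>. \<exists>i. \<forall>m. \<forall>k\<in>K. \<bar>e (f (i m)) k - e \<phi> k\<bar> < 1 / real (Suc m))"
proof -
  obtain D where D: "D \<subseteq> \<Phi>" "countable D" "\<And>\<phi> \<eta>. \<phi> \<in> \<Phi> \<Longrightarrow> 0 < \<eta> \<Longrightarrow> \<exists>d\<in>D. \<forall>k\<in>K. \<bar>e d k - e \<phi> k\<bar> < \<eta>"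
    using countable_dense_evaluation[OF K, of \<Phi> e] by blast
  obtain \<phi>0 where "\<phi>0 \<in> \<Phi>" using ne by blast
  then have Dne: "D \<noteq> {}" using D(3)[of \<phi>0 1] by auto
  have "\<exists>i. \<forall>m. \<forall>k\<in>K. \<bar>e (from_nat_into D (i m)) k - e \<phi> k\<bar> < 1 / real (Suc m)" if \<phi>: "\<phi> \<in> \<Phi>" for \<phi>
  proof (rule choice, rule allI)
    fix m
    obtain d where d: "d \<in> D" "\<forall>k\<in>K. \<bar>e d k - e \<phi> k\<bar> < 1 / real (Suc m)" using D(3)[OF \<phi>, of "1 / real (Suc m)"] by auto
    then obtain i where "from_nat_into D i = d" using from_nat_into_surj[OF D(2)] by blast
    then show "\<exists>i. \<forall>k\<in>K. \<bar>e (from_nat_into D i) k - e \<phi> k\<bar> < 1 / real (Suc m)" using d(2) by blast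
  qed
  moreover have "range (from_nat_into D) \<subseteq> \<Phi>" using range_from_nat_into_subset[OF Dne] D(1) by blast
  ultimately show ?thesis by blast
qed

lemma coefficients_dense_sequence:
  "\<exists>cseq :: nat \<Rightarrow> nat \<Rightarrow> vec. \<forall>c. \<exists>i::nat \<Rightarrow> nat. \<forall>r\<le>T. \<forall>j<k. (\<lambda>m. cseq (i m) r j) \<longlonglongrightarrow> c r j"
proof -
  have "finite ({..T} \<times> {..<k})" by simp
  from countable_dense_sequence[OF this UNIV_not_empty, of "\<lambda>c s. c (fst s) (snd s)"]
  obtain f :: "nat \<Rightarrow> nat \<Rightarrow> vec" where f: "\<forall>c\<in>UNIV. \<exists>i. \<forall>m. \<forall>s\<in>{..T} \<times> {..<k}. \<bar>f (i m) (fst s) (snd s) - c (fst s) (snd s)\<bar> < 1 / real (Suc m)"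
    by (elim exE conjE)
  show ?thesis
  proof (intro exI[of _ f] allI)
    fix c :: "nat \<Rightarrow> vec"
    obtain i where i: "\<And>m s. s \<in> {..T} \<times> {..<k} \<Longrightarrow> \<bar>f (i m) (fst s) (snd s) - c (fst s) (snd s)\<bar> < 1 / real (Suc m)" using bspec[OF f UNIV_I, of c] by blast
    show "\<exists>i::nat \<Rightarrow> nat. \<forall>r\<le>T. \<forall>j<k. (\<lambda>m. f (i m) r j) \<longlonglongrightarrow> c r j"
    proof (intro exI[of _ i] allI impI)
      fix r j assume "r \<le> T" "j < k"
      then have "\<bar>f (i m) r j - c r j\<bar> < 1 / real (Suc m)" for m using i[of "(r, j)" m] by simp
      then have "\<forall>m. norm (f (i m) r j - c r j) \<le> 1 / real (Suc m)" by (simp add: less_imp_le)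
      from Lim_null_comparison[OF always_eventually[OF this] LIMSEQ_Suc[OF lim_1_over_n]] show "(\<lambda>m. f (i m) r j) \<longlonglongrightarrow> c r j"
        by (rule Lim_null[THEN iffD2])
    qed
  qed
qed

text \<open>Density is arranged at the finitely many inputs of one good sample; the lower half of
  the sandwich and the evaluation bound carry it to all of \<open>K\<close>.\<close>

lemma features_dense_sequence:
  assumes ne: "\<Phi> \<noteq> {}" and sq: "\<And>\<phi>. \<phi> \<in> \<Phi> \<Longrightarrow> sqint k p \<phi>" and n: "1 \<le> n"
    and sw: "\<And>\<phi> \<psi>. \<phi> \<in> \<Phi> \<Longrightarrow> \<psi> \<in> \<Phi> \<Longrightarrow> sandwich k p xs n \<phi> \<psi>"
    and K: "\<And>x. x \<in> K \<Longrightarrow> \<exists>C. \<forall>\<phi>\<in>\<Phi>. \<forall>\<psi>\<in>\<Phi>. \<forall>c c'. (lin2 k \<phi> \<psi> c c' x)\<^sup>2 \<le> C * pop p (lin2 k \<phi> \<psi> c c')"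
  shows "\<exists>\<phi>seq. range \<phi>seq \<subseteq> \<Phi> \<and> (\<forall>\<phi>\<in>\<Phi>. \<exists>i::nat \<Rightarrow> nat. \<forall>x\<in>K. \<forall>j<k. (\<lambda>m. \<phi>seq (i m) x j) \<longlonglongrightarrow> \<phi> x j)"
proof -
  have "finite ({..<n} \<times> {..<k})" by simp
  from countable_dense_sequence[OF this ne, of "\<lambda>\<phi> s. \<phi> (xs (fst s)) (snd s)"]
  obtain f :: "nat \<Rightarrow> feat" where f: "range f \<subseteq> \<Phi>"
    "\<forall>\<phi>\<in>\<Phi>. \<exists>i. \<forall>m. \<forall>s\<in>{..<n} \<times> {..<k}. \<bar>f (i m) (xs (fst s)) (snd s) - \<phi> (xs (fst s)) (snd s)\<bar> < 1 / real (Suc m)"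
    by (elim exE conjE)
  show ?thesis
  proof (intro exI[of _ f] conjI f(1) ballI)
    fix \<phi> assume \<phi>: "\<phi> \<in> \<Phi>"
    obtain i where i: "\<And>m s. s \<in> {..<n} \<times> {..<k} \<Longrightarrow> \<bar>f (i m) (xs (fst s)) (snd s) - \<phi> (xs (fst s)) (snd s)\<bar> < 1 / real (Suc m)"
      using bspec[OF f(2) \<phi>] by blast
    have fi: "f (i m) \<in> \<Phi>" for m using f(1) by auto
    have "(\<lambda>m. f (i m) x j) \<longlonglongrightarrow> \<phi> x j" if x: "x \<in> K" and j: "j < k" for x j
    proof -
      define u where "u = (\<lambda>l. if l = j then 1 else 0 :: real)"
      have u: "ip k u v = v j" for v
      proof -
        have "ip k u v = (\<Sum>l<k. if l = j then v l else 0)" unfolding ip_def u_def by (intro sum.cong) auto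
        then show ?thesis using j by simp
      qed
      have l2: "lin2 k (f (i m)) \<phi> u (\<lambda>l. - u l) y = f (i m) y j - \<phi> y j" for m y
        by (simp add: lin2_def ip_uminus_left u)
      obtain C where C: "\<And>\<phi> \<psi> c c'. \<phi> \<in> \<Phi> \<Longrightarrow> \<psi> \<in> \<Phi> \<Longrightarrow> (lin2 k \<phi> \<psi> c c' x)\<^sup>2 \<le> C * pop p (lin2 k \<phi> \<psi> c c')" using K[OF x] by blast
      have b: "(f (i m) x j - \<phi> x j)\<^sup>2 \<le> \<bar>C\<bar> * (10 / 9 * (1 / real (Suc m)))" for m
      proof -
        have "(\<Sum>l<n. (f (i m) (xs l) j - \<phi> (xs l) j)\<^sup>2) \<le> (\<Sum>l<n. 1 / real (Suc m))"
        proof (intro sum_mono)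
          fix l assume "l \<in> {..<n}"
          then have d: "\<bar>f (i m) (xs l) j - \<phi> (xs l) j\<bar> < 1 / real (Suc m)" using i[of "(l, j)" m] j by simp
          have "1 / real (Suc m) \<le> 1" by simp
          then have "\<bar>f (i m) (xs l) j - \<phi> (xs l) j\<bar> * \<bar>f (i m) (xs l) j - \<phi> (xs l) j\<bar> \<le> 1 / real (Suc m) * 1"
            by (intro mult_mono less_imp_le[OF d] order_trans[OF less_imp_le[OF d]]) auto
          then show "(f (i m) (xs l) j - \<phi> (xs l) j)\<^sup>2 \<le> 1 / real (Suc m)" by (simp add: power2_eq_square)
        qed
        then have "(\<Sum>l<n. (lin2 k (f (i m)) \<phi> u (\<lambda>l. - u l) (xs l))\<^sup>2) \<le> 1 / real (Suc m) * real n" unfolding l2 by simp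
        then have "(\<Sum>l<n. (lin2 k (f (i m)) \<phi> u (\<lambda>l. - u l) (xs l))\<^sup>2) / real n \<le> 1 / real (Suc m)"
          using n by (subst pos_divide_le_eq) auto
        moreover have "0.9 * pop p (lin2 k (f (i m)) \<phi> u (\<lambda>l. - u l)) \<le> (\<Sum>l<n. (lin2 k (f (i m)) \<phi> u (\<lambda>l. - u l) (xs l))\<^sup>2) / real n"
          by (rule sandwich_lin2(1)[OF sq[OF fi] sq[OF \<phi>] sw[OF fi \<phi>]])
        ultimately have "0.9 * pop p (lin2 k (f (i m)) \<phi> u (\<lambda>l. - u l)) \<le> 1 / real (Suc m)" by (rule order_trans[rotated])
        then have "9 * pop p (lin2 k (f (i m)) \<phi> u (\<lambda>l. - u l)) \<le> 10 * (1 / real (Suc m))" by simp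
        then have "pop p (lin2 k (f (i m)) \<phi> u (\<lambda>l. - u l)) \<le> 10 / 9 * (1 / real (Suc m))" by linarith
        then have "\<bar>C\<bar> * pop p (lin2 k (f (i m)) \<phi> u (\<lambda>l. - u l)) \<le> \<bar>C\<bar> * (10 / 9 * (1 / real (Suc m)))" by (intro mult_left_mono) auto
        moreover have "C * pop p (lin2 k (f (i m)) \<phi> u (\<lambda>l. - u l)) \<le> \<bar>C\<bar> * pop p (lin2 k (f (i m)) \<phi> u (\<lambda>l. - u l))"
          by (intro mult_right_mono) (auto simp: pop_def)
        ultimately show ?thesis using C[OF fi \<phi>, of m u "\<lambda>l. - u l"] unfolding l2 by linarith
      qed
      have "(\<lambda>m. \<bar>C\<bar> * (10 / 9 * (1 / real (Suc m)))) \<longlonglongrightarrow> \<bar>C\<bar> * (10 / 9 * 0)"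
        by (intro tendsto_mult tendsto_const LIMSEQ_Suc[OF lim_1_over_n])
      then have "(\<lambda>m. \<bar>C\<bar> * (10 / 9 * (1 / real (Suc m)))) \<longlonglongrightarrow> 0" by (simp only: mult_zero_right)
      moreover have "\<forall>m. norm ((f (i m) x j - \<phi> x j)\<^sup>2) \<le> \<bar>C\<bar> * (10 / 9 * (1 / real (Suc m)))" using b by simp
      ultimately have "(\<lambda>m. (f (i m) x j - \<phi> x j)\<^sup>2) \<longlonglongrightarrow> 0" by (rule Lim_null_comparison[OF always_eventually, rotated])
      from tendsto_real_sqrt[OF this] have "(\<lambda>m. \<bar>f (i m) x j - \<phi> x j\<bar>) \<longlonglongrightarrow> 0" by simp
      then have "(\<lambda>m. f (i m) x j - \<phi> x j) \<longlonglongrightarrow> 0" by (rule tendsto_rabs_zero_cancel)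
      then show ?thesis by (rule Lim_null[THEN iffD2])
    qed
    then show "\<exists>i::nat \<Rightarrow> nat. \<forall>x\<in>K. \<forall>j<k. (\<lambda>m. f (i m) x j) \<longlonglongrightarrow> \<phi> x j" by blast
  qed
qed

lemma transfer_setup_exists:
  assumes a: "1 \<le> k" "1 \<le> T" "1 \<le> n1" "1 \<le> n2" "0 < \<sigma>" "0 < \<delta>" "\<delta> < 1" "k \<le> T" and p: "prob_space p" and \<phi>s: "\<phi>s \<in> \<Phi>"
    and sq: "\<And>\<phi>. \<phi> \<in> \<Phi> \<Longrightarrow> sqint k p \<phi>"
    and unif: "\<And>n. n1 \<le> n \<Longrightarrow> unif_conc k \<Phi> p (\<delta> / (3 * real T)) n" and point: "point_conc k \<Phi> p (\<delta> / 3) n2"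
  shows "\<exists>K \<phi>seq cseq A2 A1s. transfer_setup k T n1 n2 \<Phi> \<phi>s p \<sigma> \<delta> K \<phi>seq cseq A2 A1s"
proof -
  have "\<delta> / (3 * real T) \<le> \<delta> / 1" using a by (intro divide_left_mono) auto
  then have d1: "\<delta> / (3 * real T) < 1" using a by simp
  from unif[OF order_refl] obtain A1s where A1: "A1s \<in> sets (iid n1 p)" "1 - \<delta> / (3 * real T) \<le> measure (iid n1 p) A1s"
    and sw: "\<forall>xs\<in>A1s. \<forall>\<phi>\<in>\<Phi>. \<forall>\<psi>\<in>\<Phi>. sandwich k p xs n1 \<phi> \<psi>"
    unfolding unif_conc_def by (elim bexE conjE)
  have A1': "sandwich k p xs n1 \<phi> \<psi>" if "xs \<in> A1s" "\<phi> \<in> \<Phi>" "\<psi> \<in> \<Phi>" for xs \<phi> \<psi>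
    by (rule bspec[OF bspec[OF bspec[OF sw that(1)] that(2)] that(3)])
  \<comment> \<open>A failure probability below 1 supplies the one good sample on which the dense
    feature sequence is built.\<close>
  have "A1s \<noteq> {}" using A1(2) d1 by auto
  then obtain xs where xs: "xs \<in> A1s" by blast
  obtain K where K: "K \<in> sets p" "measure p K = 1"
      "\<And>x. x \<in> K \<Longrightarrow> \<exists>C. \<forall>\<phi>\<in>\<Phi>. \<forall>\<psi>\<in>\<Phi>. \<forall>c c'. (lin2 k \<phi> \<psi> c c' x)\<^sup>2 \<le> C * pop p (lin2 k \<phi> \<psi> c c')"
    using full_measure_evaluation_bound[OF p sq d1 a(3) unif] by blast
  have ne: "\<Phi> \<noteq> {}" using \<phi>s by blast
  have "\<exists>\<phi>seq. range \<phi>seq \<subseteq> \<Phi> \<and> (\<forall>\<phi>\<in>\<Phi>. \<exists>i::nat \<Rightarrow> nat. \<forall>x\<in>K. \<forall>j<k. (\<lambda>m. \<phi>seq (i m) x j) \<longlonglongrightarrow> \<phi> x j)"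
    by (rule features_dense_sequence[OF ne sq a(3) A1'[OF xs] K(3)])
  then obtain \<phi>seq where \<phi>seq: "range \<phi>seq \<subseteq> \<Phi>" "\<forall>\<phi>\<in>\<Phi>. \<exists>i::nat \<Rightarrow> nat. \<forall>x\<in>K. \<forall>j<k. (\<lambda>m. \<phi>seq (i m) x j) \<longlonglongrightarrow> \<phi> x j"
    by (elim exE conjE)
  obtain cseq :: "nat \<Rightarrow> nat \<Rightarrow> vec" where cseq: "\<And>c. \<exists>i::nat \<Rightarrow> nat. \<forall>r\<le>T. \<forall>j<k. (\<lambda>m. cseq (i m) r j) \<longlonglongrightarrow> c r j"
    using coefficients_dense_sequence by blast
  have s: "\<phi>seq j \<in> \<Phi>" for j using \<phi>seq(1) by blast
  have "\<forall>j. \<exists>A. A \<in> sets (iid n2 p) \<and> 1 - \<delta> / 3 \<le> measure (iid n2 p) A \<and> (\<forall>xs\<in>A. sandwich k p xs n2 (\<phi>seq j) \<phi>s)"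
    using point s \<phi>s unfolding point_conc_def by blast
  from choice[OF this] obtain A2 where A2: "\<And>j. A2 j \<in> sets (iid n2 p)" "\<And>j. 1 - \<delta> / 3 \<le> measure (iid n2 p) (A2 j)"
      "\<And>j xs. xs \<in> A2 j \<Longrightarrow> sandwich k p xs n2 (\<phi>seq j) \<phi>s" by blast
  have "transfer_setup k T n1 n2 \<Phi> \<phi>s p \<sigma> \<delta> K \<phi>seq cseq A2 A1s"
    by (rule transfer_setup.intro) (fact a p \<phi>s sq A1 A1' K s bspec[OF \<phi>seq(2)] cseq A2)+
  then show ?thesis by blast
qed

lemma integrable_coordinate_products:
  assumes \<nu>: "prob_space \<nu>" and m: "\<And>i. i < k \<Longrightarrow> (\<lambda>w. w i) \<in> borel_measurable \<nu>" and b: "AE w in \<nu>. vnorm k w \<le> chi"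
    and i: "i < k" "j < k"
  shows "integrable \<nu> (\<lambda>w. w i * w j :: real)"
proof -
  interpret \<nu>: prob_space \<nu> by fact
  have c: "\<bar>w l\<bar> \<le> vnorm k w" if "l < k" for l w
  proof -
    have "(w l)\<^sup>2 \<le> (\<Sum>j<k. (w j)\<^sup>2)" using that by (intro member_le_sum) auto
    then show ?thesis unfolding vnorm_def by (metis real_sqrt_abs real_sqrt_le_mono)
  qed
  show ?thesis
  proof (rule \<nu>.integrable_const_bound[where B="chi * chi"])
    show "AE w in \<nu>. norm (w i * w j) \<le> chi * chi"
      using b
    proof eventually_elim
      case (elim w)
      have "\<bar>w i\<bar> * \<bar>w j\<bar> \<le> vnorm k w * vnorm k w" by (intro mult_mono c i) (auto simp: vnorm_def sum_nonneg)
      also have "\<dots> \<le> chi * chi" using elim by (intro mult_mono) (auto simp: vnorm_def sum_nonneg intro: order_trans[rotated])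
      finally show ?case by (simp add: abs_mult)
    qed
  qed (use m i in auto)
qed

theorem mainTheorem12:
  fixes clo chi c0 C0 :: real
  assumes "0 < clo" and "clo \<le> chi" and "0 < c0" and "0 < C0"
  shows "\<exists>C>0. \<forall>(d::nat) (k::nat) (T::nat) (n1::nat) (n2::nat) (\<Phi>::feat set) (\<phi>s::feat)
            (p::vec measure) (\<sigma>::real) (Ws::nat \<Rightarrow> vec) (\<nu>::vec measure) (\<delta>::real).
     0 < \<delta> \<and> \<delta> < 1 \<and> 1 \<le> k \<and> 1 \<le> T \<and> 1 \<le> n1 \<and> 1 \<le> n2 \<and> 0 < \<sigma> \<and>
     prob_space p \<and> (AE x in p. \<forall>i\<ge>d. x i = 0) \<and>
     \<phi>s \<in> \<Phi> \<and>
     (\<forall>\<phi>\<in>\<Phi>. \<forall>i<k. (\<lambda>x. \<phi> x i) \<in> borel_measurable p \<and> integrable p (\<lambda>x. (\<phi> x i)\<^sup>2)) \<and>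
     (\<forall>t\<in>{1..T}. clo \<le> vnorm k (Ws t) \<and> vnorm k (Ws t) \<le> chi) \<and>
     prob_space \<nu> \<and> (\<forall>i<k. (\<lambda>w. w i) \<in> borel_measurable \<nu>) \<and>
     (AE w in \<nu>. clo \<le> vnorm k w \<and> vnorm k w \<le> chi) \<and>
     sing_k_sq k T Ws \<ge> c0 * real T / real k \<and>
     spec_norm k (second_moment \<nu>) \<le> C0 / real k \<and>
     (\<forall>n\<ge>n1. unif_conc k \<Phi> p (\<delta> / (3 * real T)) n) \<and>
     (\<forall>n\<ge>n2. point_conc k \<Phi> p (\<delta> / 3) n)
     \<longrightarrow>
     (\<exists>A\<in>sets (sample_space p \<sigma> T n1 n2).
        measure (sample_space p \<sigma> T n1 n2) A \<ge> 1 - \<delta> \<and>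
        (\<forall>\<omega>\<in>A. \<forall>(\<phi>h::feat) (Wh::nat \<Rightarrow> vec).
           \<phi>h \<in> \<Phi> \<and>
           (\<forall>\<phi>\<in>\<Phi>. \<forall>W. source_loss k T n1 \<phi>s Ws \<omega> \<phi>h Wh \<le> source_loss k T n1 \<phi>s Ws \<omega> \<phi> W)
           \<longrightarrow>
           (\<forall>wh::vec \<Rightarrow> vec.
              (\<forall>wstar w. target_loss k T n2 \<phi>s wstar \<omega> \<phi>h (wh wstar)
                           \<le> target_loss k T n2 \<phi>s wstar \<omega> \<phi>h w)
              \<longrightarrow>
              (\<integral>\<^sup>+ wstar. excess_risk k p \<phi>s \<phi>h (wh wstar) wstar \<partial>\<nu>)
                \<le> ennreal (C * \<sigma>\<^sup>2 *
                     (((gaussian_width ({1..T} \<times> {..<n1}) (F_X k \<Phi> T n1 \<omega>))\<^sup>2 + ln (1 / \<delta>))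
                        / (real n1 * real T)
                      + (real k + ln (1 / \<delta>)) / real n2)))))"
\<comment> \<open>8100 C0/c0 is the price of transferring the source error, 544 that of the target
  regression.\<close>
proof (rule exI[of _ "8100 * (C0 / c0) + 544"], rule conjI, goal_cases)
  case 1
  show ?case using assms by (intro add_nonneg_pos) auto
next
  case 2
  show ?case
  proof (intro allI impI, elim conjE, goal_cases)
    case (1 d k T n1 n2 \<Phi> \<phi>s p \<sigma> Ws \<nu> \<delta>)
    note h = this
    \<comment> \<open>(A3) makes the smallest singular value positive, hence k \<le> T.\<close>
    have k0: "0 < c0 * real T / real k" using h assms by simp
    then have sk: "0 < sing_k_sq k T Ws" using h by linarith
    have sq: "sqint k p \<phi>" if "\<phi> \<in> \<Phi>" for \<phi> using h that unfolding sqint_def by blast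
    have ex: "\<exists>K \<phi>seq cseq A2 A1s. transfer_setup k T n1 n2 \<Phi> \<phi>s p \<sigma> \<delta> K \<phi>seq cseq A2 A1s"
      by (rule transfer_setup_exists) (use h sq dim_le_tasks[OF sk] in auto)
    then obtain K \<phi>seq cseq A2 A1s where "transfer_setup k T n1 n2 \<Phi> \<phi>s p \<sigma> \<delta> K \<phi>seq cseq A2 A1s" by blast
    then interpret transfer_setup k T n1 n2 \<Phi> \<phi>s p \<sigma> \<delta> Ws K \<phi>seq cseq A2 A1s .
    have "AE w in \<nu>. vnorm k w \<le> chi" using h(15) by eventually_elim simp
    then have w: "integrable \<nu> (\<lambda>w. w i * w j)" if "i < k" "j < k" for i j
      using h(13,14) that by (intro integrable_coordinate_products) auto
    obtain A where A: "A \<in> sets (sample_space p \<sigma> T n1 n2)" "1 - \<delta> \<le> measure (sample_space p \<sigma> T n1 n2) A"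
      "\<And>\<omega>. \<omega> \<in> A \<Longrightarrow> source_ok (restrict \<omega> S1)"
      "\<And>\<omega>. \<omega> \<in> A \<Longrightarrow> \<exists>\<^sub>\<infinity>m. goodT target_dev (psel (restrict \<omega> S1) m) (restrict \<omega> S2)"
      using good_event by blast
    show ?case
    proof (intro bexI[OF _ A(1)] conjI A(2) ballI allI impI, elim conjE)
      fix \<omega> \<phi>h Wh and wh :: "vec \<Rightarrow> vec"
      assume o: "\<omega> \<in> A" and opt: "\<phi>h \<in> \<Phi>" "\<forall>\<phi>\<in>\<Phi>. \<forall>W. source_loss k T n1 \<phi>s Ws \<omega> \<phi>h Wh \<le> source_loss k T n1 \<phi>s Ws \<omega> \<phi> W"
        and ls: "\<forall>wstar w. target_loss k T n2 \<phi>s wstar \<omega> \<phi>h (wh wstar) \<le> target_loss k T n2 \<phi>s wstar \<omega> \<phi>h w"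
      show "(\<integral>\<^sup>+ wstar. excess_risk k p \<phi>s \<phi>h (wh wstar) wstar \<partial>\<nu>)
          \<le> ennreal ((8100 * (C0 / c0) + 544) * \<sigma>\<^sup>2 *
               (((gaussian_width S1 (F_X k \<Phi> T n1 \<omega>))\<^sup>2 + ln (1 / \<delta>)) / (real n1 * real T) + (real k + ln (1 / \<delta>)) / real n2))"
        by (rule transfer_risk_bound[OF h(13) w assms(3,4) h(16,17) A(3)[OF o] A(4)[OF o] opt(1)])
           (use opt(2) ls in blast)+
    qed
  qed
qed

end
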